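(* Let $C_1>0$ be a fixed absolute constant. Then there exist constants $K\ge 1$ and $p\ge 0$ (depending on nothing except $C_1$) such that the following holds for all dimensions $d\ge 2$ and accuracies $\varepsilon\in(0,1/2]$ with $$c_1=(K\Lambda^p)^{-1},\qquad C_2=C_3=K\Lambda^p,\qquad \Lambda=2+\log^+\log^+ d+\log^+\log^+\varepsilon^{-1},$$ where $\log^+s=\log\max(s,1)$. Let $\alpha_0>0$ and let $\nu$ be a probability measure on $\mathbb R^d$ such that $\max\bigl(\nu(D_{\alpha_0}^c),\gamma(D_{\alpha_0}^c)\bigr)\le \varepsilon/8$. Let $k_{\max}\in\mathbb N$ and let $h>0$ satisfy $h(2^{k_{\max}}-1)>C_1$, $$h\ \le\ \bar h\ =\ c_1\min\bigl(\alpha_0^{-1/2},\ d^{-1/4}(\log d)^{-1/2}(\log\varepsilon^{-1})^{-3/4}\bigr)(\log d)^{-1/2},$$ and $$\{h(2^n-1):n\in\mathbb N\}\cap\bigl((0,\delta)\cup(\pi-\delta,\pi+\delta]\bigr)=\emptyset\quad\text{with}\quad \delta=C_2\max\bigl(d^{-1}\alpha_0,\ d^{-1/2}\log d\,(\log\varepsilon^{-1})^{3/2}\bigr).$$ Then the total variation mixing time of the No-U-Turn Sampler with target $\gamma$, step size $h$ and maximal number of doublings $k_{\max}$, started from $\nu$, satisfies $$\inf\bigl\{n\in\mathbb N:\ \mathsf{TV}(\nu\pi_{\mathrm{NUTS}}^n,\gamma)\le\varepsilon\bigr\}\ \le\ C_3\,\log d\,\log\varepsilon^{-1}.$$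
   Context: $\mathbb N=\{0,1,2,\dots\}$. $\gamma$ is the canonical (standard) Gaussian measure on $\mathbb R^d$. $D_\alpha=\{x\in\mathbb R^d: ||x|^2-d|\le\alpha\}$ with $|\cdot|$ the Euclidean norm. $\mathsf{TV}(\nu,\eta)=\inf\mathbb P[X\ne Y]$ over all couplings $(X,Y)$ of $\nu,\eta$. Leapfrog. For target $\gamma$ the Hamiltonian is $H(x,v)=\tfrac12|x|^2+\tfrac12|v|^2$ on $\mathbb R^{2d}$. One leapfrog step of size $h$ is $\Phi_h(x,v)=(x',v')$ with $x'=(1-h^2/2)x+hv$, $v'=v-\tfrac h2(x+x')$; $\Phi_h^L$ for $L\in\mathbb Z$ is the $L$-th iterate (negative $L$: iterates of the inverse map). $\Pi(x,v)=x$. Index orbits and U-turns. An index orbit is a set $I\subset\mathbb Z$ of consecutive integers with $|I|\in\{2^n:n\in\mathbb N\}$. Given $(x,v)$, the index orbit $I$ has the U-turn property if $v_+\cdot(x_+-x_-)<0$ or $v_-\cdot(x_+-x_-)<0$, where $(x_+,v_+)=\Phi_h^{\max I}(x,v)$ and $(x_-,v_-)=\Phi_h^{\min I}(x,v)$. An index orbit $I$ of length $2^k$ has the sub-U-turn property if at least one of the index orbits obtained by iteratively halving $I$, namely $I_{j,m}=\{i\in I:\min I+m2^{-j}|I|\le i<\min I+(m+1)2^{-j}|I|\}$, $0\le j\le k$, $0\le m\le 2^j-1$, has the U-turn property. Orbit selection. Given $(x,v)$ and $k_{\max}$, start with $I_0=\{0\}$. Given the current orbit $I_j$, draw $I'$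 uniformly from $\{I_j-|I_j|,\,I_j+|I_j|\}$ (translates of $I_j$). If $I'$ has the sub-U-turn property, stop and select $I_j$. Otherwise set $I_{j+1}=I_j\cup I'$; if $I_{j+1}$ has the U-turn property or $|I_{j+1}|=2^{k_{\max}}$, stop and select $I_{j+1}$; else repeat with $I_{j+1}$. The law of the selected orbit is denoted $\mathcal O(x,v)$. NUTS kernel. $X\sim\pi_{\mathrm{NUTS}}(x,\cdot)$ is generated by: draw $v\sim\gamma$; draw $I\sim\mathcal O(x,v)$; draw $L\in I$ with $\mathbb P(L=i)\propto e^{-(H\circ\Phi_h^i-H)(x,v)}$, $i\in I$; output $X=\Pi(\Phi_h^L(x,v))$. *)

theory Defs
  imports "HOL-Probability.Probability"
begin

text \<open>
  The constants of the mixing time bound are uniform in the dimension \<open>d\<close>, so \<open>d\<close> has to be a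
  term and cannot be a type. A point of Euclidean \<open>d\<close>-space is an extensional function on
  \<open>{..<d}\<close> (i.e. \<open>undefined\<close> outside of \<open>{..<d}\<close>), with the product Borel \<open>\<sigma>\<close>-algebra.
\<close>

definition Rd :: "nat \<Rightarrow> (nat \<Rightarrow> real) measure" where
  "Rd d = (\<Pi>\<^sub>M i\<in>{..<d}. (borel :: real measure))"

definition dot :: "nat \<Rightarrow> (nat \<Rightarrow> real) \<Rightarrow> (nat \<Rightarrow> real) \<Rightarrow> real" where
  "dot d x y = (\<Sum>i<d. x i * y i)"

definition enorm :: "nat \<Rightarrow> (nat \<Rightarrow> real) \<Rightarrow> real" where
  "enorm d x = L2_set x {..<d}"

definition gauss :: "nat \<Rightarrow> (nat \<Rightarrow> real) measure" where
  "gauss d = (\<Pi>\<^sub>M i\<in>{..<d}. std_normal_distribution)"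

definition shell :: "nat \<Rightarrow> real \<Rightarrow> (nat \<Rightarrow> real) set" where
  "shell d \<alpha> = {x \<in> space (Rd d). \<bar>(enorm d x)\<^sup>2 - real d\<bar> \<le> \<alpha>}"

definition couplings :: "'a measure \<Rightarrow> 'a measure \<Rightarrow> ('a \<times> 'a) measure set" where
  "couplings M N = {P. prob_space P \<and> sets P = sets (M \<Otimes>\<^sub>M N) \<and> distr P M fst = M \<and> distr P N snd = N}"

definition TV :: "'a measure \<Rightarrow> 'a measure \<Rightarrow> real" where
  "TV M N = (INF P\<in>couplings M N. measure P {z \<in> space P. fst z \<noteq> snd z})"

type_synonym phase_point = "(nat \<Rightarrow> real) \<times> (nat \<Rightarrow> real)"

definition phase_space :: "nat \<Rightarrow> phase_point set" where
  "phase_space d = space (Rd d) \<times> space (Rd d)"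

fun hamiltonian :: "nat \<Rightarrow> phase_point \<Rightarrow> real" where
  "hamiltonian d (x, v) = (enorm d x)\<^sup>2 / 2 + (enorm d v)\<^sup>2 / 2"

fun leapfrog :: "nat \<Rightarrow> real \<Rightarrow> phase_point \<Rightarrow> phase_point" where
  "leapfrog d h (x, v) =
    (let x' = (\<lambda>i\<in>{..<d}. (1 - h\<^sup>2 / 2) * x i + h * v i);
         v' = (\<lambda>i\<in>{..<d}. v i - h / 2 * (x i + x' i))
     in (x', v'))"

definition leapfrog_iter :: "nat \<Rightarrow> real \<Rightarrow> int \<Rightarrow> phase_point \<Rightarrow> phase_point" where
  "leapfrog_iter d h L =
    (if 0 \<le> L then leapfrog d h ^^ nat L
     else inv_into (phase_space d) (leapfrog d h) ^^ nat (- L))"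

text \<open>
  The predicates below are meant for index orbits, i.e. nonempty sets of consecutive integers
  whose cardinality is a power of two. Orbit selection only ever produces such sets.
\<close>

definition uturn :: "nat \<Rightarrow> real \<Rightarrow> phase_point \<Rightarrow> int set \<Rightarrow> bool" where
  "uturn d h z I =
    (let (xp, vp) = leapfrog_iter d h (Max I) z;
         (xm, vm) = leapfrog_iter d h (Min I) z
     in dot d vp (\<lambda>i. xp i - xm i) < 0 \<or> dot d vm (\<lambda>i. xp i - xm i) < 0)"

text \<open>The division is exact, as \<open>card I\<close> is a power of two and at least \<open>2 ^ j\<close> where this is used.\<close>

definition sub_orbit :: "int set \<Rightarrow> nat \<Rightarrow> nat \<Rightarrow> int set" where
  "sub_orbit I j m =
    {i \<in> I. Min I + int (m * (card I div 2 ^ j)) \<le> i \<and> i < Min I + int ((m + 1) * (card I div 2 ^ j))}"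

definition sub_uturn :: "nat \<Rightarrow> real \<Rightarrow> phase_point \<Rightarrow> int set \<Rightarrow> bool" where
  "sub_uturn d h z I =
    (\<exists>k. card I = 2 ^ k \<and> (\<exists>j\<le>k. \<exists>m\<le>2 ^ j - 1. uturn d h z (sub_orbit I j m)))"

text \<open>
  The first argument of \<open>select_orbit\<close> bounds the number of doublings, which makes the recursion
  terminate. Starting from \<open>{0}\<close> with bound \<open>kmax \<ge> 1\<close>, the cardinality test stops the procedure
  no later than at the \<open>kmax\<close>-th doubling, so that the equation for \<open>0\<close> is never reached.
\<close>

fun select_orbit :: "nat \<Rightarrow> nat \<Rightarrow> real \<Rightarrow> nat \<Rightarrow> phase_point \<Rightarrow> int set \<Rightarrow> int set pmf" where
  "select_orbit 0 d h kmax z I = return_pmf I"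
| "select_orbit (Suc r) d h kmax z I =
    bind_pmf (pmf_of_set {(\<lambda>i. i - int (card I)) ` I, (\<lambda>i. i + int (card I)) ` I}) (\<lambda>I'.
      if sub_uturn d h z I' then return_pmf I
      else if uturn d h z (I \<union> I') \<or> card (I \<union> I') = 2 ^ kmax then return_pmf (I \<union> I')
      else select_orbit r d h kmax z (I \<union> I'))"

definition orbit_law :: "nat \<Rightarrow> real \<Rightarrow> nat \<Rightarrow> phase_point \<Rightarrow> int set pmf" where
  "orbit_law d h kmax z = select_orbit kmax d h kmax z {0}"

definition index_weight :: "nat \<Rightarrow> real \<Rightarrow> phase_point \<Rightarrow> int \<Rightarrow> real" where
  "index_weight d h z i = exp (- (hamiltonian d (leapfrog_iter d h i z) - hamiltonian d z))"

definition index_law :: "nat \<Rightarrow> real \<Rightarrow> phase_point \<Rightarrow> int set \<Rightarrow> int pmf" where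
  "index_law d h z I =
    embed_pmf (\<lambda>i. if i \<in> I then index_weight d h z i / (\<Sum>j\<in>I. index_weight d h z j) else 0)"

definition nuts_kernel :: "nat \<Rightarrow> real \<Rightarrow> nat \<Rightarrow> (nat \<Rightarrow> real) \<Rightarrow> (nat \<Rightarrow> real) measure" where
  "nuts_kernel d h kmax x =
    gauss d \<bind> (\<lambda>v.
      distr (measure_pmf (bind_pmf (orbit_law d h kmax (x, v)) (index_law d h (x, v)))) (Rd d)
        (\<lambda>L. fst (leapfrog_iter d h L (x, v))))"

definition nuts_law :: "nat \<Rightarrow> real \<Rightarrow> nat \<Rightarrow> (nat \<Rightarrow> real) measure \<Rightarrow> nat \<Rightarrow> (nat \<Rightarrow> real) measure" where
  "nuts_law d h kmax \<nu> n = ((\<lambda>\<mu>. \<mu> \<bind> nuts_kernel d h kmax) ^^ n) \<nu>"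

text \<open>Extended naturals, so that the infimum of the empty set is \<open>\<infinity>\<close> (on \<open>nat\<close> it would be \<open>0\<close>).\<close>

definition nuts_mixing_time ::
    "nat \<Rightarrow> real \<Rightarrow> nat \<Rightarrow> (nat \<Rightarrow> real) measure \<Rightarrow> real \<Rightarrow> enat" where
  "nuts_mixing_time d h kmax \<nu> \<epsilon> = Inf (enat ` {n. TV (nuts_law d h kmax \<nu> n) (gauss d) \<le> \<epsilon>})"

definition logp :: "real \<Rightarrow> real" where
  "logp s = ln (max s 1)"

definition Lam :: "nat \<Rightarrow> real \<Rightarrow> real" where
  "Lam d \<epsilon> = 2 + logp (logp (real d)) + logp (logp (1 / \<epsilon>))"

definition step_bound :: "real \<Rightarrow> nat \<Rightarrow> real \<Rightarrow> real \<Rightarrow> real" where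
  "step_bound c1 d \<epsilon> \<alpha>0 =
    c1 * min (\<alpha>0 powr (-1/2))
             (real d powr (-1/4) * ln (real d) powr (-1/2) * ln (1 / \<epsilon>) powr (-3/4))
       * ln (real d) powr (-1/2)"

definition gap :: "real \<Rightarrow> nat \<Rightarrow> real \<Rightarrow> real \<Rightarrow> real" where
  "gap C2 d \<epsilon> \<alpha>0 =
    C2 * max (\<alpha>0 / real d) (real d powr (-1/2) * ln (real d) * ln (1 / \<epsilon>) powr (3/2))"

end

theory Submission
  imports Defs
begin

text \<open>
  For a Gaussian target a leapfrog step is, up to a rescaling of the velocity by a factor
  \<open>beta h\<close> close to one, a rotation of phase space by an angle \<open>theta h\<close> close to \<open>h\<close>. A NUTS
  step from \<open>x\<close> therefore ends in \<open>cos a * x + sin a / beta h * v\<close>, where \<open>a\<close> is a multiple of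
  \<open>theta h\<close> chosen by orbit selection. In high dimension \<open>|x|\<^sup>2\<close> and \<open>|v|\<^sup>2\<close> are close to \<open>d\<close> and
  \<open>x\<close> and \<open>v\<close> are nearly orthogonal. Whether an index orbit of length \<open>2 ^ j\<close> makes a U-turn
  then only depends on the sign of \<open>sin\<close> of its arc \<open>(2 ^ j - 1) * theta h\<close>, except for arcs
  close to a multiple of \<open>pi\<close>, where fluctuations decide (\<open>Ut_sign\<close>, \<open>quiet_no_uturn\<close>,
  \<open>turns_uturn\<close>). Energy errors are small, so the index is nearly uniform on the selected orbit.

  Mixing rests on two mechanisms. The first is contraction. A selected orbit has an arc bounded
  below, hence the mean of \<open>sin\<^sup>2 a\<close> over its indices is bounded below (\<open>mean_sin_sq\<close>). A step
  multiplies the deviation of \<open>|x|\<^sup>2\<close> from \<open>d\<close> by \<open>cos\<^sup>2 a\<close>, so this deviation decreases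
  geometrically to order \<open>sqrt d\<close> (\<open>lyapunov\<close>). A step also commutes with reflections
  (\<open>Pop_reflect\<close>), so two chains started at points of equal norm can be kept mirror images of
  each other, and their distance is multiplied by \<open>|cos a|\<close>; it decreases to order one
  (\<open>recenter\<close>).

  The second mechanism is overlap (\<open>one_shot\<close>). Two chains at distance of order one can be
  merged in a single step by shifting the velocity of one of them by a vector of length of order
  one, at a cost that the Cameron--Martin formula bounds. This requires that both chains select
  the same orbit. If an arc is so close to an odd multiple of \<open>pi\<close> that fluctuations decide, the
  velocities of both chains are in addition pushed along the position, which forces a U-turn
  (\<open>trigger\<close>). That these two situations are exhaustive is an elementary but delicate fact about
  the doubling of angles, and it is where the gap hypothesis is used (\<open>escape\<close>).

  The chains contract from distance of order \<open>sqrt d\<close> to order one in \<open>O (ln d)\<close> steps and then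
  merge with probability bounded below (\<open>epoch\<close>), and \<open>O (ln (1 / \<epsilon>))\<close> repetitions reach the
  accuracy \<open>\<epsilon>\<close> (\<open>epochs\<close>). Couplings of chains are never constructed. Instead, the oscillation of
  the iterated kernel, applied to a function with values between zero and one, is estimated over
  a shell that shrinks by a deterministic amount in each step, outside an event of small
  probability (\<open>exit_bound\<close>). Since the Gaussian measure is invariant (\<open>gauss_invariant\<close>), this
  bounds the difference of the two measures on every measurable set, and the maximal coupling
  (\<open>TV_le\<close>) turns the bound into one for the total variation distance.
\<close>

section \<open>Vectors and the Gaussian measure\<close>

definition lin :: "nat \<Rightarrow> real \<Rightarrow> real \<Rightarrow> (nat \<Rightarrow> real) \<Rightarrow> (nat \<Rightarrow> real) \<Rightarrow> nat \<Rightarrow> real" where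
  "lin d a b x y = (\<lambda>i\<in>{..<d}. a * x i + b * y i)"

text \<open>
  The reflection in the hyperplane orthogonal to \<open>e\<close> if \<open>e\<close> is a unit
  vector, and the identity if \<open>e = 0\<close>.
\<close>

definition reflect :: "nat \<Rightarrow> (nat \<Rightarrow> real) \<Rightarrow> (nat \<Rightarrow> real) \<Rightarrow> nat \<Rightarrow> real" where
  "reflect d e x = lin d 1 (- 2 * dot d x e) x e"

lemma dot_commute: "dot d x y = dot d y x"
  by (simp add: dot_def mult.commute)

lemma dot_lin_left: "dot d (lin d a b x y) z = a * dot d x z + b * dot d y z"
  by (simp add: dot_def lin_def sum_distrib_left sum.distrib algebra_simps)

lemma dot_lin_right: "dot d z (lin d a b x y) = a * dot d z x + b * dot d z y"
  by (simp add: dot_def lin_def sum_distrib_left sum.distrib algebra_simps)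

lemma dot_self_nonneg [simp]: "dot d x x \<ge> 0"
  by (simp add: dot_def sum_nonneg)

lemma enorm_sq: "(enorm d x)\<^sup>2 = dot d x x"
  by (simp add: enorm_def L2_set_def dot_def power2_eq_square sum_nonneg)

lemma enorm_nonneg [simp]: "enorm d x \<ge> 0"
  by (simp add: enorm_def)

lemma dot_Cauchy_Schwarz: "\<bar>dot d x y\<bar> \<le> enorm d x * enorm d y"
proof -
  have "\<bar>dot d x y\<bar> \<le> (\<Sum>i<d. \<bar>x i\<bar> * \<bar>y i\<bar>)"
    unfolding dot_def by (rule order_trans[OF sum_abs]) (simp add: abs_mult)
  also have "\<dots> \<le> enorm d x * enorm d y"
    unfolding enorm_def by (rule L2_set_mult_ineq)
  finally show ?thesis .
qed

lemma enorm_eq_sqrt: "enorm d x = sqrt (dot d x x)"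
  by (simp add: enorm_sq [symmetric])

lemma lin_in_space [simp]: "lin d a b x y \<in> space (Rd d)"
  by (simp add: lin_def Rd_def space_PiM)

lemma reflect_in_space [simp]: "reflect d e x \<in> space (Rd d)"
  by (simp add: reflect_def)

lemma lin_nth: "i < d \<Longrightarrow> lin d a b x y i = a * x i + b * y i"
  by (simp add: lin_def)

lemma space_Rd_eqI: "x \<in> space (Rd d) \<Longrightarrow> y \<in> space (Rd d) \<Longrightarrow> (\<And>i. i < d \<Longrightarrow> x i = y i) \<Longrightarrow> x = y"
  by (auto simp: Rd_def space_PiM intro!: PiE_ext[where k="{..<d}" and s="\<lambda>_. UNIV"])

lemma sets_gauss [measurable_cong, simp]: "sets (gauss d) = sets (Rd d)"
  unfolding gauss_def Rd_def by (intro sets_PiM_cong) auto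

lemma space_gauss [simp]: "space (gauss d) = space (Rd d)"
  by (rule sets_eq_imp_space_eq) simp

lemma prob_space_gauss: "prob_space (gauss d)"
  unfolding gauss_def by (intro prob_space_PiM prob_space_normal_density) auto

lemma measurable_coord:
  assumes "f \<in> measurable M (Rd d)" "i < d"
  shows "(\<lambda>w. f w i) \<in> borel_measurable M"
  using measurable_compose[OF assms(1), of "\<lambda>x. x i" borel] measurable_component_singleton[of i "{..<d}" "\<lambda>_. borel"] assms(2)
  by (auto simp: Rd_def)

lemma measurable_dot [measurable (raw)]:
  assumes "f \<in> measurable M (Rd d)" "g \<in> measurable M (Rd d)"
  shows "(\<lambda>w. dot d (f w) (g w)) \<in> borel_measurable M"
  unfolding dot_def by (intro borel_measurable_sum borel_measurable_times measurable_coord[OF assms(1)] measurable_coord[OF assms(2)]) auto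

lemma measurable_enorm [measurable (raw)]:
  assumes [measurable]: "f \<in> measurable M (Rd d)"
  shows "(\<lambda>w. enorm d (f w)) \<in> borel_measurable M"
  unfolding enorm_eq_sqrt by measurable

lemma measurable_lin [measurable (raw)]:
  assumes "a \<in> borel_measurable M" "b \<in> borel_measurable M"
    "f \<in> measurable M (Rd d)" "g \<in> measurable M (Rd d)"
  shows "(\<lambda>w. lin d (a w) (b w) (f w) (g w)) \<in> measurable M (Rd d)"
  unfolding Rd_def lin_def
  by (intro measurable_restrict borel_measurable_add borel_measurable_times assms(1,2)
      measurable_coord[OF assms(3)] measurable_coord[OF assms(4)]) auto

lemma measurable_reflect [measurable (raw)]:
  assumes [measurable]: "f \<in> measurable M (Rd d)" "g \<in> measurable M (Rd d)"
  shows "(\<lambda>w. reflect d (g w) (f w)) \<in> measurable M (Rd d)"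
  unfolding reflect_def by measurable

section \<open>Cameron--Martin\<close>

text \<open>
  The density of the shifted normal law against the normal law, integrated against
  \<open>f\<close>. The exponent is written for the unshifted variable because that is the form
  in which the transition operator meets it.
\<close>

lemma cameron_martin_real:
  assumes [measurable]: "f \<in> borel_measurable borel"
  shows "(\<integral>\<^sup>+x. f (x + u) * ennreal (exp (- (x * u) - u\<^sup>2 / 2)) \<partial>std_normal_distribution) = (\<integral>\<^sup>+x. f x \<partial>std_normal_distribution)"
proof -
  have d: "std_normal_density x * exp (- (x * u) - u\<^sup>2 / 2) = std_normal_density (x + u)" for x
    by (simp add: std_normal_density_def mult_exp_exp field_simps power2_eq_square)
  have "(\<integral>\<^sup>+x. f (x + u) * ennreal (exp (- (x * u) - u\<^sup>2 / 2)) \<partial>std_normal_distribution)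
      = (\<integral>\<^sup>+x. ennreal (std_normal_density x) * (f (x + u) * ennreal (exp (- (x * u) - u\<^sup>2 / 2))) \<partial>lborel)"
    by (subst nn_integral_density) auto
  also have "\<dots> = (\<integral>\<^sup>+x. ennreal (std_normal_density (x + u)) * f (x + u) \<partial>lborel)"
    by (intro nn_integral_cong) (simp add: d[symmetric] ennreal_mult mult_ac)
  also have "\<dots> = (\<integral>\<^sup>+x. ennreal (std_normal_density x) * f x \<partial>lborel)"
    by (subst nn_integral_real_affine[where c=1 and t=u and f="\<lambda>x. ennreal (std_normal_density x) * f x"]) (auto simp: add.commute)
  also have "\<dots> = (\<integral>\<^sup>+x. f x \<partial>std_normal_distribution)"
    by (subst nn_integral_density) auto
  finally show ?thesis .
qed

interpretation gauss_prod: product_sigma_finite "\<lambda>_::nat. std_normal_distribution"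
  by (intro product_sigma_finite.intro prob_space_imp_sigma_finite prob_space_normal_density) auto

lemma sets_std_normal [simp]: "sets std_normal_distribution = sets borel" by simp

lemma prod_indicator_PiE:
  fixes d :: nat and x :: "nat \<Rightarrow> real" and A :: "nat \<Rightarrow> real set"
  assumes "x \<in> extensional {..<d}"
  shows "(\<Prod>i<d. indicator (A i) (x i) :: ennreal) = indicator (Pi\<^sub>E {..<d} A) x"
proof (cases "x \<in> Pi\<^sub>E {..<d} A")
  case True
  then have "\<And>i. i \<in> {..<d} \<Longrightarrow> indicator (A i) (x i) = (1::ennreal)" by (simp add: PiE_iff)
  then have "(\<Prod>i<d. indicator (A i) (x i) :: ennreal) = 1" by (rule prod.neutral[OF ballI])
  then show ?thesis using True by simp
next
  case False
  then obtain i where i: "i < d" "x i \<notin> A i" using assms by (auto simp: PiE_iff)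
  then have "\<exists>i\<in>{..<d}. indicator (A i) (x i) = (0::ennreal)" by (intro bexI[of _ i]) auto
  then have "(\<Prod>i<d. indicator (A i) (x i) :: ennreal) = 0" by (intro prod_zero) auto
  then show ?thesis using False by simp
qed

text \<open>
  Both sides define a measure when \<open>F\<close> runs over indicators, and a finite measure
  on the product space is determined by its values on boxes. On a box the integral factors into
  the one-dimensional identities.
\<close>

lemma cameron_martin:
  assumes F [measurable]: "F \<in> borel_measurable (Rd d)"
  shows "(\<integral>\<^sup>+v. F (lin d 1 1 v u) * ennreal (exp (- dot d v u - dot d u u / 2)) \<partial>gauss d) = (\<integral>\<^sup>+v. F v \<partial>gauss d)"
proof -
  define u' where "u' = (\<lambda>i\<in>{..<d}. u i)"
  have u': "u' \<in> space (Rd d)" by (simp add: u'_def Rd_def space_PiM)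
  have luu: "lin d 1 1 v u = lin d 1 1 v u'" "dot d v u = dot d v u'" "dot d u u' = dot d u' u'" for v
    by (auto simp: lin_def dot_def u'_def intro!: restrict_ext)
  define M where "M = distr (density (gauss d) (\<lambda>v. ennreal (exp (- dot d v u' - dot d u' u' / 2)))) (Rd d) (\<lambda>v. lin d 1 1 v u')"
  have m1: "(\<lambda>v. lin d 1 1 v u') \<in> measurable (gauss d) (Rd d)" using u' by measurable
  have m2: "(\<lambda>v. ennreal (exp (- dot d v u' - dot d u' u' / 2))) \<in> borel_measurable (gauss d)" using u' by measurable
  have "M = gauss d"
    unfolding gauss_def
  proof (rule gauss_prod.PiM_eqI)
    show "finite {..<d}" by simp
    show "sets M = sets (\<Pi>\<^sub>M i\<in>{..<d}. std_normal_distribution)"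
      using sets_gauss[of d] by (simp add: M_def gauss_def)
    fix A assume A: "\<And>i. i \<in> {..<d} \<Longrightarrow> A i \<in> sets std_normal_distribution"
    have PA: "Pi\<^sub>E {..<d} A \<in> sets (Rd d)"
      unfolding Rd_def using A by (intro sets_PiM_I_finite) auto
    have "emeasure M (Pi\<^sub>E {..<d} A) = emeasure (density (gauss d) (\<lambda>v. ennreal (exp (- dot d v u' - dot d u' u' / 2)))) ((\<lambda>v. lin d 1 1 v u') -` (Pi\<^sub>E {..<d} A) \<inter> space (gauss d))"
      unfolding M_def by (subst emeasure_distr) (use m1 PA in \<open>simp_all cong: measurable_cong_sets\<close>)
    also have "\<dots> = (\<integral>\<^sup>+v. ennreal (exp (- dot d v u' - dot d u' u' / 2)) * indicator ((\<lambda>v. lin d 1 1 v u') -` (Pi\<^sub>E {..<d} A) \<inter> space (gauss d)) v \<partial>gauss d)"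
      by (rule emeasure_density[OF m2 measurable_sets[OF m1 PA]])
    also have "\<dots> = (\<integral>\<^sup>+v. (\<Prod>i<d. ennreal (exp (- (v i * u i) - (u i)\<^sup>2 / 2)) * indicator (A i) (v i + u i)) \<partial>gauss d)"
    proof (intro nn_integral_cong)
      fix v assume v: "v \<in> space (gauss d)"
      have "(\<Prod>i<d. ennreal (exp (- (v i * u i) - (u i)\<^sup>2 / 2))) = ennreal (\<Prod>i<d. exp (- (v i * u i) - (u i)\<^sup>2 / 2))"
        by (rule prod_ennreal) auto
      also have "(\<Prod>i<d. exp (- (v i * u i) - (u i)\<^sup>2 / 2)) = exp (- dot d v u' - dot d u' u' / 2)"
        by (simp add: exp_sum[symmetric] dot_def u'_def sum_subtractf sum_negf sum_divide_distrib power2_eq_square)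
      finally have 1: "(\<Prod>i<d. ennreal (exp (- (v i * u i) - (u i)\<^sup>2 / 2))) = ennreal (exp (- dot d v u' - dot d u' u' / 2))" .
      have "(\<Prod>i<d. indicator (A i) (v i + u i) :: ennreal) = (\<Prod>i<d. indicator (A i) (lin d 1 1 v u' i))"
        by (intro prod.cong) (auto simp: lin_def u'_def)
      also have "\<dots> = indicator (Pi\<^sub>E {..<d} A) (lin d 1 1 v u')"
        by (rule prod_indicator_PiE) (simp add: lin_def extensional_def)
      finally have 2: "(\<Prod>i<d. indicator (A i) (v i + u i) :: ennreal) = indicator ((\<lambda>v. lin d 1 1 v u') -` (Pi\<^sub>E {..<d} A) \<inter> space (gauss d)) v"
        using v by (simp add: indicator_def)
      show "ennreal (exp (- dot d v u' - dot d u' u' / 2)) * indicator ((\<lambda>v. lin d 1 1 v u') -` (Pi\<^sub>E {..<d} A) \<inter> space (gauss d)) v = (\<Prod>i<d. ennreal (exp (- (v i * u i) - (u i)\<^sup>2 / 2)) * indicator (A i) (v i + u i))"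
        unfolding prod.distrib 1 2 ..
    qed
    also have "\<dots> = (\<Prod>i<d. \<integral>\<^sup>+x. ennreal (exp (- (x * u i) - (u i)\<^sup>2 / 2)) * indicator (A i) (x + u i) \<partial>std_normal_distribution)"
      unfolding gauss_def
    proof (rule gauss_prod.product_nn_integral_prod)
      fix i assume "i \<in> {..<d}"
      then have [measurable]: "A i \<in> sets borel" using A by auto
      show "(\<lambda>x. ennreal (exp (- (x * u i) - (u i)\<^sup>2 / 2)) * indicator (A i) (x + u i)) \<in> borel_measurable std_normal_distribution"
        by measurable
    qed simp
    also have "\<dots> = (\<Prod>i<d. emeasure std_normal_distribution (A i))"
    proof (intro prod.cong refl)
      fix i assume "i \<in> {..<d}"
      then have [measurable]: "A i \<in> sets borel" using A by auto
      show "(\<integral>\<^sup>+x. ennreal (exp (- (x * u i) - (u i)\<^sup>2 / 2)) * indicator (A i) (x + u i) \<partial>std_normal_distribution) = emeasure std_normal_distribution (A i)"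
        using cameron_martin_real[of "indicator (A i)" "u i"] by (simp add: mult.commute)
    qed
    finally show "emeasure M (Pi\<^sub>E {..<d} A) = (\<Prod>i\<in>{..<d}. emeasure std_normal_distribution (A i))" .
  qed
  then have "(\<integral>\<^sup>+v. F v \<partial>gauss d) = (\<integral>\<^sup>+v. F v \<partial>M)" by simp
  also have "\<dots> = (\<integral>\<^sup>+v. F (lin d 1 1 v u') \<partial>density (gauss d) (\<lambda>v. ennreal (exp (- dot d v u' - dot d u' u' / 2))))"
    unfolding M_def by (subst nn_integral_distr) (use m1 in \<open>simp_all cong: measurable_cong_sets\<close>)
  also have "\<dots> = (\<integral>\<^sup>+v. ennreal (exp (- dot d v u' - dot d u' u' / 2)) * F (lin d 1 1 v u') \<partial>gauss d)"
    by (rule nn_integral_density[OF m2 measurable_compose[OF m1 F]])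
  finally show ?thesis unfolding luu by (simp only: mult.commute)
qed

section \<open>Moment generating functions and tails\<close>

lemma nn_integral_gauss_exp_dot:
  "(\<integral>\<^sup>+v. ennreal (exp (dot d v u)) \<partial>gauss d) = ennreal (exp (dot d u u / 2))"
proof -
  define u' where "u' = lin d (-1) 0 u u"
  have u': "u' \<in> space (Rd d)" by (simp add: u'_def)
  have 1: "dot d v u' = - dot d v u" "dot d u' u' = dot d u u" for v
    by (simp_all add: u'_def dot_lin_right dot_lin_left)
  have "(\<integral>\<^sup>+v. ennreal (exp (dot d v u)) \<partial>gauss d)
     = (\<integral>\<^sup>+v. ennreal (exp (dot d u u / 2)) * (1 * ennreal (exp (- dot d v u' - dot d u' u' / 2))) \<partial>gauss d)"
    by (intro nn_integral_cong) (simp add: 1(1) ennreal_mult[symmetric] mult_exp_exp 1(2)[unfolded 1(1)])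
  also have "\<dots> = ennreal (exp (dot d u u / 2)) * (\<integral>\<^sup>+v. 1 * ennreal (exp (- dot d v u' - dot d u' u' / 2)) \<partial>gauss d)"
    by (intro nn_integral_cmult) (use u' in measurable)
  also have "(\<integral>\<^sup>+v. 1 * ennreal (exp (- dot d v u' - dot d u' u' / 2)) \<partial>gauss d) = (\<integral>\<^sup>+v. 1 \<partial>gauss d)"
    using cameron_martin[of "\<lambda>_. 1" d u'] by simp
  also have "\<dots> = 1"
    using prob_space.emeasure_space_1[OF prob_space_gauss[of d]] by simp
  finally show ?thesis by simp
qed

text \<open>
  The left side is \<open>exp (- s) / sqrt (1 - 2 * s)\<close>, whose logarithm is of second
  order in \<open>s\<close>. The chi-square variable \<open>dot d v v - d\<close> therefore is
  sub-Gaussian with variance proxy of order \<open>d\<close> as long as \<open>s\<close> stays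
  bounded, which gives both its mean size and its tails.
\<close>

lemma nn_integral_normal_exp_sq:
  fixes s :: real assumes "\<bar>s\<bar> \<le> 1/4"
  shows "(\<integral>\<^sup>+x. ennreal (exp (s * (x\<^sup>2 - 1))) \<partial>std_normal_distribution) \<le> ennreal (exp (4 * s\<^sup>2))"
proof -
  have s: "1 - 2 * s > 0" using assms by auto
  define \<sigma> where "\<sigma> = 1 / sqrt (1 - 2 * s)"
  have \<sigma>: "\<sigma> > 0" "\<sigma>\<^sup>2 = 1 / (1 - 2 * s)" using s by (auto simp: \<sigma>_def power_divide)
  have e: "std_normal_density x * exp (s * (x\<^sup>2 - 1)) = (exp (- s) * \<sigma>) * normal_density 0 \<sigma> x" for x
  proof -
    have "sqrt (2 * pi * \<sigma>\<^sup>2) = sqrt (2 * pi) * \<sigma>" by (simp only: real_sqrt_mult real_sqrt_abs abs_of_pos[OF \<sigma>(1)])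
    moreover have "exp (- x\<^sup>2 / 2) * exp (s * (x\<^sup>2 - 1)) = exp (- s) * exp (- x\<^sup>2 / (2 * \<sigma>\<^sup>2))"
      using s by (simp add: mult_exp_exp \<sigma>(2) algebra_simps)
    ultimately show ?thesis
      using \<sigma>(1) by (simp add: normal_density_def del: real_sqrt_mult) 
  qed
  have "(\<integral>\<^sup>+x. ennreal (exp (s * (x\<^sup>2 - 1))) \<partial>std_normal_distribution)
     = (\<integral>\<^sup>+x. ennreal (exp (- s) * \<sigma>) * ennreal (normal_density 0 \<sigma> x) \<partial>lborel)"
    using \<sigma>(1) by (subst nn_integral_density) (auto simp: ennreal_mult[symmetric] e intro!: nn_integral_cong)
  also have "\<dots> = ennreal (exp (- s) * \<sigma>) * (\<integral>\<^sup>+x. ennreal (normal_density 0 \<sigma> x) \<partial>lborel)"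
    by (rule nn_integral_cmult) simp
  also have "(\<integral>\<^sup>+x. ennreal (normal_density 0 \<sigma> x) \<partial>lborel) = 1"
    using prob_space.emeasure_space_1[OF prob_space_normal_density[OF \<sigma>(1), of 0]]
    by (simp add: emeasure_density)
  also have "ennreal (exp (- s) * \<sigma>) * 1 \<le> ennreal (exp (4 * s\<^sup>2))"
  proof -
    have "\<sigma> = exp (- ln (1 - 2 * s) / 2)"
      using s by (simp add: \<sigma>_def exp_minus ln_sqrt[symmetric] inverse_eq_divide)
    then have "exp (- s) * \<sigma> = exp (- (ln (1 + (- 2 * s)) - (- 2 * s)) / 2)"
      by (simp add: mult_exp_exp add_divide_distrib diff_divide_distrib)
    also have "\<dots> \<le> exp (4 * s\<^sup>2)"
    proof -
      have "\<bar>ln (1 + (- 2 * s)) - (- 2 * s)\<bar> \<le> 2 * (- 2 * s)\<^sup>2"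
        by (rule abs_ln_one_plus_x_minus_x_bound) (use assms in auto)
      then show ?thesis by (simp add: power_mult_distrib)
    qed
    finally show ?thesis by (simp add: ennreal_leI)
  qed
  finally show ?thesis .
qed

lemma nn_integral_gauss_exp_sq:
  assumes "\<bar>s\<bar> \<le> 1/4"
  shows "(\<integral>\<^sup>+v. ennreal (exp (s * (dot d v v - real d))) \<partial>gauss d) \<le> ennreal (exp (4 * real d * s\<^sup>2))"
proof -
  have "(\<integral>\<^sup>+v. ennreal (exp (s * (dot d v v - real d))) \<partial>gauss d) = (\<integral>\<^sup>+v. (\<Prod>i<d. ennreal (exp (s * ((v i)\<^sup>2 - 1)))) \<partial>gauss d)"
  proof (intro nn_integral_cong)
    fix v
    have "(\<Prod>i<d. ennreal (exp (s * ((v i)\<^sup>2 - 1)))) = ennreal (\<Prod>i<d. exp (s * ((v i)\<^sup>2 - 1)))"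
      by (rule prod_ennreal) auto
    also have "(\<Prod>i<d. exp (s * ((v i)\<^sup>2 - 1))) = exp (s * (dot d v v - real d))"
      by (simp add: exp_sum[symmetric] dot_def sum_distrib_left[symmetric] sum_subtractf power2_eq_square)
    finally show "ennreal (exp (s * (dot d v v - real d))) = (\<Prod>i<d. ennreal (exp (s * ((v i)\<^sup>2 - 1))))" by simp
  qed
  also have "\<dots> = (\<Prod>i<d. \<integral>\<^sup>+x. ennreal (exp (s * (x\<^sup>2 - 1))) \<partial>std_normal_distribution)"
    unfolding gauss_def by (rule gauss_prod.product_nn_integral_prod) auto
  also have "\<dots> \<le> (\<Prod>i<d. ennreal (exp (4 * s\<^sup>2)))"
    by (intro prod_mono_ennreal nn_integral_normal_exp_sq[OF assms])
  also have "\<dots> = ennreal (exp (4 * real d * s\<^sup>2))"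
    by (simp add: ennreal_power exp_of_nat_mult[symmetric] mult_ac)
  finally show ?thesis .
qed

lemma integrable_exp_dot: "u \<in> space (Rd d) \<Longrightarrow> integrable (gauss d) (\<lambda>v. exp (dot d v u))"
  and integral_exp_dot: "u \<in> space (Rd d) \<Longrightarrow> (\<integral>v. exp (dot d v u) \<partial>gauss d) = exp (dot d u u / 2)"
proof -
  assume u: "u \<in> space (Rd d)"
  then have m: "(\<lambda>v. exp (dot d v u)) \<in> borel_measurable (gauss d)" by measurable
  show "integrable (gauss d) (\<lambda>v. exp (dot d v u))"
    using m by (intro integrableI_nonneg) (auto simp: nn_integral_gauss_exp_dot)
  show "(\<integral>v. exp (dot d v u) \<partial>gauss d) = exp (dot d u u / 2)"
    using m by (subst integral_eq_nn_integral) (auto simp: nn_integral_gauss_exp_dot)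
qed

lemma integrable_exp_sq: "\<bar>s\<bar> \<le> 1/4 \<Longrightarrow> integrable (gauss d) (\<lambda>v. exp (s * (dot d v v - real d)))"
  and integral_exp_sq: "\<bar>s\<bar> \<le> 1/4 \<Longrightarrow> (\<integral>v. exp (s * (dot d v v - real d)) \<partial>gauss d) \<le> exp (4 * real d * s\<^sup>2)"
proof -
  assume s: "\<bar>s\<bar> \<le> 1/4"
  have m: "(\<lambda>v. exp (s * (dot d v v - real d))) \<in> borel_measurable (gauss d)" by measurable
  show i: "integrable (gauss d) (\<lambda>v. exp (s * (dot d v v - real d)))"
    using m nn_integral_gauss_exp_sq[OF s, of d] by (intro integrableI_nonneg) (auto simp: less_top[symmetric] top_unique)
  have "ennreal (\<integral>v. exp (s * (dot d v v - real d)) \<partial>gauss d) \<le> ennreal (exp (4 * real d * s\<^sup>2))"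
    using nn_integral_gauss_exp_sq[OF s, of d] by (subst nn_integral_eq_integral[symmetric, OF i]) auto
  then show "(\<integral>v. exp (s * (dot d v v - real d)) \<partial>gauss d) \<le> exp (4 * real d * s\<^sup>2)"
    by (simp add: ennreal_le_iff)
qed

lemma abs_le_exp_sum: "\<bar>y\<bar> \<le> exp y + exp (- y)" for y :: real
  using exp_ge_add_one_self[of y] exp_ge_add_one_self[of "- y"] exp_gt_zero[of y] exp_gt_zero[of "-y"] by linarith

lemma integrable_abs_dot:
  assumes "u \<in> space (Rd d)" shows "integrable (gauss d) (\<lambda>v. \<bar>dot d v u\<bar>)"
proof (rule Bochner_Integration.integrable_bound)
  show "integrable (gauss d) (\<lambda>v. exp (dot d v u) + exp (dot d v (lin d (-1) 0 u u)))"
    using assms by (intro Bochner_Integration.integrable_add integrable_exp_dot) auto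
  show "(\<lambda>v. \<bar>dot d v u\<bar>) \<in> borel_measurable (gauss d)" using assms by measurable
  show "AE v in gauss d. norm \<bar>dot d v u\<bar> \<le> norm (exp (dot d v u) + exp (dot d v (lin d (-1) 0 u u)))"
    using abs_le_exp_sum by (intro AE_I2) (simp add: dot_lin_right)
qed

text \<open>
  The modulus of \<open>y\<close> is at most \<open>exp y + exp (- y)\<close>. Applied to
  \<open>dot d v u / enorm d u\<close>, this gives the order \<open>enorm d u\<close> from the
  moment generating function alone; the deviation of \<open>dot d v v\<close> from
  \<open>d\<close> is treated in the same way below.
\<close>

lemma integral_abs_dot:
  assumes u: "u \<in> space (Rd d)" shows "(\<integral>v. \<bar>dot d v u\<bar> \<partial>gauss d) \<le> 4 * enorm d u"
proof (cases "dot d u u = 0")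
  case True
  have "\<bar>dot d v u\<bar> = 0" for v
    using dot_Cauchy_Schwarz[of d v u] True by (simp add: enorm_eq_sqrt)
  then show ?thesis by simp
next
  case False
  define s where "s = enorm d u"
  have s: "s > 0" "s\<^sup>2 = dot d u u" using False by (auto simp: s_def enorm_eq_sqrt less_le)
  define w where "w = lin d (1/s) 0 u u"
  define w' where "w' = lin d (-1/s) 0 u u"
  have d1: "dot d v w = dot d v u / s" "dot d v w' = - dot d v u / s" for v
    by (simp_all add: w_def w'_def dot_lin_right)
  have "dot d w w = 1" "dot d w' w' = 1"
    using s(1) by (simp_all add: w_def w'_def dot_lin_right dot_lin_left s(2)[symmetric] power2_eq_square)
  note ww = this
  have wsp: "w \<in> space (Rd d)" "w' \<in> space (Rd d)" by (simp_all add: w_def w'_def)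
  have "(\<integral>v. \<bar>dot d v u\<bar> \<partial>gauss d) = (\<integral>v. s * \<bar>dot d v w\<bar> \<partial>gauss d)"
    using s(1) by (simp add: d1 abs_divide)
  also have "\<dots> \<le> (\<integral>v. s * (exp (dot d v w) + exp (dot d v w')) \<partial>gauss d)"
  proof (rule integral_mono)
    show "integrable (gauss d) (\<lambda>v. s * \<bar>dot d v w\<bar>)" 
      by (intro integrable_mult_right integrable_abs_dot) (simp add: w_def)
    show "integrable (gauss d) (\<lambda>v. s * (exp (dot d v w) + exp (dot d v w')))"
      by (intro integrable_mult_right Bochner_Integration.integrable_add integrable_exp_dot) (simp_all add: w_def w'_def)
    fix v
    show "s * \<bar>dot d v w\<bar> \<le> s * (exp (dot d v w) + exp (dot d v w'))"
      using abs_le_exp_sum[of "dot d v w"] s(1) by (intro mult_left_mono) (simp_all add: d1)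
  qed
  also have "\<dots> = s * (exp (1/2) + exp (1/2))"
    using integral_exp_dot[of w d] integral_exp_dot[of w' d] integrable_exp_dot[of w d] integrable_exp_dot[of w' d] wsp
    by (subst integral_mult_right_zero, subst Bochner_Integration.integral_add) (simp_all add: ww)
  also have "\<dots> \<le> s * 4"
  proof -
    have "exp (1/2::real) \<le> 1 + 1/2 + (1/2)\<^sup>2" by (rule exp_bound) auto
    then show ?thesis using s(1) by (intro mult_left_mono) (auto simp: power2_eq_square)
  qed
  finally show ?thesis by (simp add: s_def mult.commute)
qed

lemma norm_dev_exp:
  assumes "d > 0"
  shows "\<bar>dot d v v - real d\<bar> \<le> 4 * sqrt d * (exp (1 / (4 * sqrt d) * (dot d v v - real d)) + exp (- 1 / (4 * sqrt d) * (dot d v v - real d)))"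
proof -
  have "\<bar>1 / (4 * sqrt d) * (dot d v v - real d)\<bar> \<le> exp (1 / (4 * sqrt d) * (dot d v v - real d)) + exp (- 1 / (4 * sqrt d) * (dot d v v - real d))"
    using abs_le_exp_sum[of "1 / (4 * sqrt d) * (dot d v v - real d)"] by simp
  then show ?thesis using assms by (simp add: abs_mult field_simps)
qed

lemma integrable_norm_dev:
  assumes "d > 0" shows "integrable (gauss d) (\<lambda>v. \<bar>dot d v v - real d\<bar>)"
    and integral_norm_dev: "(\<integral>v. \<bar>dot d v v - real d\<bar> \<partial>gauss d) \<le> 16 * sqrt d"
proof -
  define f where "f = (\<lambda>v. 4 * sqrt d * (exp (1 / (4 * sqrt d) * (dot d v v - real d)) + exp (- 1 / (4 * sqrt d) * (dot d v v - real d))))"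
  have sd: "sqrt d \<ge> 1" using assms by simp
  have s: "\<bar>1 / (4 * sqrt d)\<bar> \<le> 1/4" "\<bar>- 1 / (4 * sqrt d)\<bar> \<le> 1/4" using sd by (auto simp: field_simps)
  have i: "integrable (gauss d) f"
    unfolding f_def by (intro integrable_mult_right Bochner_Integration.integrable_add integrable_exp_sq s)
  have le: "\<bar>dot d v v - real d\<bar> \<le> f v" for v using norm_dev_exp[OF assms] by (simp add: f_def)
  show i2: "integrable (gauss d) (\<lambda>v. \<bar>dot d v v - real d\<bar>)"
  proof (rule Bochner_Integration.integrable_bound[OF i])
    show "AE v in gauss d. norm \<bar>dot d v v - real d\<bar> \<le> norm (f v)"
      using le by (intro AE_I2) (smt (verit) real_norm_def)
  qed measurable
  have "(\<integral>v. \<bar>dot d v v - real d\<bar> \<partial>gauss d) \<le> (\<integral>v. f v \<partial>gauss d)"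
    by (intro integral_mono i i2 le)
  also have "\<dots> = 4 * sqrt d * ((\<integral>v. exp (1 / (4 * sqrt d) * (dot d v v - real d)) \<partial>gauss d) + (\<integral>v. exp (- 1 / (4 * sqrt d) * (dot d v v - real d)) \<partial>gauss d))"
    unfolding f_def by (subst integral_mult_right_zero, subst Bochner_Integration.integral_add) (intro integrable_exp_sq s | simp)+
  also have "\<dots> \<le> 4 * sqrt d * (exp (1/4) + exp (1/4))"
  proof (intro mult_left_mono add_mono)
    have *: "4 * real d * (1 / (4 * sqrt d))\<^sup>2 = 1/4" "4 * real d * (- 1 / (4 * sqrt d))\<^sup>2 = 1/4"
      using assms by (simp_all add: power_divide power_mult_distrib)
    show "(\<integral>v. exp (1 / (4 * sqrt d) * (dot d v v - real d)) \<partial>gauss d) \<le> exp (1/4)"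
      using integral_exp_sq[OF s(1), of d] unfolding * .
    show "(\<integral>v. exp (- 1 / (4 * sqrt d) * (dot d v v - real d)) \<partial>gauss d) \<le> exp (1/4)"
      using integral_exp_sq[OF s(2), of d] unfolding * .
  qed auto
  also have "\<dots> \<le> 4 * sqrt d * (2 + 2)"
  proof -
    have "exp (1/4::real) \<le> 1 + 1/4 + (1/4)\<^sup>2" by (rule exp_bound) auto
    then show ?thesis by (intro mult_left_mono add_mono) (auto simp: power2_eq_square)
  qed
  finally show "(\<integral>v. \<bar>dot d v v - real d\<bar> \<partial>gauss d) \<le> 16 * sqrt d" by simp
qed

lemma gauss_Markov:
  assumes [measurable]: "f \<in> borel_measurable (gauss d)" and i: "integrable (gauss d) f" and nn: "\<And>v. f v \<ge> 0" and c: "c > 0"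
  shows "measure (gauss d) {v \<in> space (Rd d). f v \<ge> c} \<le> (\<integral>v. f v \<partial>gauss d) / c"
  using integral_Markov_inequality_measure[OF i _ _ c, of "{}"] nn by simp

lemma tail_dot_one_sided:
  assumes u: "u \<in> space (Rd d)" and t: "t > 0"
  shows "measure (gauss d) {v \<in> space (Rd d). dot d v u > t * enorm d u} \<le> exp (- t\<^sup>2 / 2)"
proof (cases "dot d u u = 0")
  case True
  have "dot d v u = 0" for v
    using dot_Cauchy_Schwarz[of d v u] True by (simp add: enorm_eq_sqrt)
  then show ?thesis using True by (simp add: enorm_eq_sqrt)
next
  case False
  interpret prob_space "gauss d" by (rule prob_space_gauss)
  define s where "s = enorm d u"
  have s: "s > 0" "s\<^sup>2 = dot d u u" using False by (auto simp: s_def enorm_eq_sqrt less_le)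
  define w where "w = lin d (t/s) 0 u u"
  have w: "w \<in> space (Rd d)" by (simp add: w_def)
  have d1: "dot d v w = t * dot d v u / s" for v by (simp add: w_def dot_lin_right)
  have ww: "dot d w w = t\<^sup>2"
    using s(1) by (simp add: w_def dot_lin_right dot_lin_left s(2)[symmetric] power2_eq_square)
  have "measure (gauss d) {v \<in> space (Rd d). dot d v u > t * s} \<le> measure (gauss d) {v \<in> space (Rd d). exp (dot d v w) \<ge> exp (t\<^sup>2)}"
  proof (rule finite_measure_mono)
    show "{v \<in> space (Rd d). dot d v u > t * s} \<subseteq> {v \<in> space (Rd d). exp (dot d v w) \<ge> exp (t\<^sup>2)}"
      using s(1) t by (auto simp: d1 field_simps power2_eq_square)
    show "{v \<in> space (Rd d). exp (t\<^sup>2) \<le> exp (dot d v w)} \<in> sets (gauss d)" using w by measurable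
  qed
  also have "\<dots> \<le> (\<integral>v. exp (dot d v w) \<partial>gauss d) / exp (t\<^sup>2)"
    using w by (intro gauss_Markov integrable_exp_dot) auto
  also have "\<dots> = exp (t\<^sup>2 / 2) / exp (t\<^sup>2)" by (simp add: integral_exp_dot[OF w] ww)
  also have "\<dots> = exp (- t\<^sup>2 / 2)" by (simp add: exp_diff[symmetric])
  finally show ?thesis by (simp add: s_def)
qed

lemma tail_dot:
  assumes u: "u \<in> space (Rd d)" and t: "t > 0"
  shows "measure (gauss d) {v \<in> space (Rd d). \<bar>dot d v u\<bar> > t * enorm d u} \<le> 2 * exp (- t\<^sup>2 / 2)"
proof -
  interpret prob_space "gauss d" by (rule prob_space_gauss)
  define w where "w = lin d (-1) 0 u u"
  have w: "w \<in> space (Rd d)" "enorm d w = enorm d u" "\<And>v. dot d v w = - dot d v u"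
    by (simp_all add: w_def enorm_eq_sqrt dot_lin_left dot_lin_right)
  have "measure (gauss d) {v \<in> space (Rd d). \<bar>dot d v u\<bar> > t * enorm d u}
      \<le> measure (gauss d) ({v \<in> space (Rd d). dot d v u > t * enorm d u} \<union> {v \<in> space (Rd d). dot d v w > t * enorm d w})"
  proof (rule finite_measure_mono)
    show "{v \<in> space (Rd d). dot d v u > t * enorm d u} \<union> {v \<in> space (Rd d). dot d v w > t * enorm d w} \<in> sets (gauss d)"
      using u w(1) by measurable
  qed (auto simp: w abs_if)
  also have "\<dots> \<le> measure (gauss d) {v \<in> space (Rd d). dot d v u > t * enorm d u} + measure (gauss d) {v \<in> space (Rd d). dot d v w > t * enorm d w}"
    by (rule measure_Un_le) (use u w(1) in measurable)
  also have "\<dots> \<le> exp (- t\<^sup>2 / 2) + exp (- t\<^sup>2 / 2)"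
    by (intro add_mono tail_dot_one_sided u w t)
  finally show ?thesis by simp
qed

lemma tail_norm:
  assumes "d > 0" and t: "t > 0" "t \<le> 2 * sqrt d"
  shows "measure (gauss d) {v \<in> space (Rd d). \<bar>dot d v v - real d\<bar> > t * sqrt d} \<le> 2 * exp (- t\<^sup>2 / 16)"
proof -
  interpret prob_space "gauss d" by (rule prob_space_gauss)
  define s where "s = t / (8 * sqrt d)"
  have sd: "sqrt d > 0" using assms by simp
  have s: "\<bar>s\<bar> \<le> 1/4" "\<bar>- s\<bar> \<le> 1/4" "s > 0" using t sd by (auto simp: s_def field_simps)
  have ss: "s * (t * sqrt d) = t\<^sup>2 / 8" "4 * real d * s\<^sup>2 = t\<^sup>2 / 16"
    using sd by (simp_all add: s_def power2_eq_square field_simps)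
  have one: "measure (gauss d) {v \<in> space (Rd d). exp (r * (dot d v v - real d)) \<ge> exp (s * (t * sqrt d))} \<le> exp (- t\<^sup>2 / 16)"
    if r: "\<bar>r\<bar> \<le> 1/4" "r\<^sup>2 = s\<^sup>2" for r
  proof -
    have "measure (gauss d) {v \<in> space (Rd d). exp (r * (dot d v v - real d)) \<ge> exp (s * (t * sqrt d))} \<le> (\<integral>v. exp (r * (dot d v v - real d)) \<partial>gauss d) / exp (s * (t * sqrt d))"
      by (intro gauss_Markov integrable_exp_sq r) auto
    also have "\<dots> \<le> exp (4 * real d * r\<^sup>2) / exp (s * (t * sqrt d))"
      by (intro divide_right_mono integral_exp_sq r) auto
    also have "\<dots> = exp (- t\<^sup>2 / 16)" unfolding r(2) ss by (simp add: exp_diff[symmetric])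
    finally show ?thesis .
  qed
  have "measure (gauss d) {v \<in> space (Rd d). \<bar>dot d v v - real d\<bar> > t * sqrt d}
    \<le> measure (gauss d) ({v \<in> space (Rd d). exp (s * (dot d v v - real d)) \<ge> exp (s * (t * sqrt d))} \<union> {v \<in> space (Rd d). exp (- s * (dot d v v - real d)) \<ge> exp (s * (t * sqrt d))})"
  proof (rule finite_measure_mono)
    show "{v \<in> space (Rd d). \<bar>dot d v v - real d\<bar> > t * sqrt d} \<subseteq> {v \<in> space (Rd d). exp (s * (dot d v v - real d)) \<ge> exp (s * (t * sqrt d))} \<union> {v \<in> space (Rd d). exp (- s * (dot d v v - real d)) \<ge> exp (s * (t * sqrt d))}"
    proof
      fix v assume v: "v \<in> {v \<in> space (Rd d). \<bar>dot d v v - real d\<bar> > t * sqrt d}"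
      then consider "t * sqrt d \<le> dot d v v - real d" | "t * sqrt d \<le> - (dot d v v - real d)" by force
      then show "v \<in> {v \<in> space (Rd d). exp (s * (dot d v v - real d)) \<ge> exp (s * (t * sqrt d))} \<union> {v \<in> space (Rd d). exp (- s * (dot d v v - real d)) \<ge> exp (s * (t * sqrt d))}"
      proof cases
        case 1 then have "s * (t * sqrt d) \<le> s * (dot d v v - real d)" using s(3) by (intro mult_left_mono) auto
        then show ?thesis using v by simp
      next
        case 2 then have "s * (t * sqrt d) \<le> s * (- (dot d v v - real d))" using s(3) by (intro mult_left_mono) auto
        then have "s * (t * sqrt d) \<le> - s * (dot d v v - real d)" by (simp only: mult_minus_left mult_minus_right)
        then show ?thesis using v by simp
      qed
    qed
  qed measurable
  also have "\<dots> \<le> measure (gauss d) {v \<in> space (Rd d). exp (s * (dot d v v - real d)) \<ge> exp (s * (t * sqrt d))} + measure (gauss d) {v \<in> space (Rd d). exp (- s * (dot d v v - real d)) \<ge> exp (s * (t * sqrt d))}"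
    by (rule measure_Un_le) measurable
  also have "\<dots> \<le> exp (- t\<^sup>2 / 16) + exp (- t\<^sup>2 / 16)"
    by (intro add_mono one s) auto
  finally show ?thesis by simp
qed

section \<open>Weighted measure preservation\<close>

text \<open>
  If \<open>M\<close> has density \<open>exp (- H)\<close> with respect to some other measure,
  this says that \<open>S\<close> preserves that other measure. For the Gaussian measure and
  half the squared norm, this is Lebesgue measure, which need not be mentioned in this way. The
  property is closed under composition.
\<close>

definition wpres :: "'a measure \<Rightarrow> ('a \<Rightarrow> real) \<Rightarrow> ('a \<Rightarrow> 'a) \<Rightarrow> bool" where
  "wpres M H S \<longleftrightarrow> S \<in> measurable M M \<and> H \<in> borel_measurable M \<and>
     (\<forall>F\<in>borel_measurable M. (\<integral>\<^sup>+z. F (S z) * ennreal (exp (H z - H (S z))) \<partial>M) = (\<integral>\<^sup>+z. F z \<partial>M))"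

lemma wpresD: "wpres M H S \<Longrightarrow> F \<in> borel_measurable M \<Longrightarrow> (\<integral>\<^sup>+z. F (S z) * ennreal (exp (H z - H (S z))) \<partial>M) = (\<integral>\<^sup>+z. F z \<partial>M)"
  by (auto simp: wpres_def)

lemma wpres_comp:
  assumes "wpres M H S" "wpres M H T" shows "wpres M H (\<lambda>z. S (T z))"
  unfolding wpres_def
proof (intro conjI ballI)
  have [measurable]: "S \<in> measurable M M" "T \<in> measurable M M" "H \<in> borel_measurable M"
    using assms by (auto simp: wpres_def)
  show "(\<lambda>z. S (T z)) \<in> measurable M M" "H \<in> borel_measurable M" by measurable
  fix F :: "_ \<Rightarrow> ennreal" assume [measurable]: "F \<in> borel_measurable M"
  have "(\<integral>\<^sup>+z. F (S (T z)) * ennreal (exp (H z - H (S (T z)))) \<partial>M)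
    = (\<integral>\<^sup>+z. (F (S (T z)) * ennreal (exp (H (T z) - H (S (T z))))) * ennreal (exp (H z - H (T z))) \<partial>M)"
    by (intro nn_integral_cong) (simp add: mult.assoc ennreal_mult[symmetric] mult_exp_exp)
  also have "\<dots> = (\<integral>\<^sup>+z. F (S z) * ennreal (exp (H z - H (S z))) \<partial>M)"
    by (rule wpresD[OF assms(2)]) measurable
  also have "\<dots> = (\<integral>\<^sup>+z. F z \<partial>M)" by (rule wpresD[OF assms(1)]) measurable
  finally show "(\<integral>\<^sup>+z. F (S (T z)) * ennreal (exp (H z - H (S (T z)))) \<partial>M) = (\<integral>\<^sup>+z. F z \<partial>M)" .
qed

lemma wpres_cong:
  assumes "wpres M H S" "\<And>z. z \<in> space M \<Longrightarrow> S z = T z" shows "wpres M H T"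
  unfolding wpres_def
proof (intro conjI ballI)
  have "S \<in> measurable M M" using assms(1) by (auto simp: wpres_def)
  then show "T \<in> measurable M M" using measurable_cong[of M S T M] assms(2) by auto
  show "H \<in> borel_measurable M" using assms(1) by (auto simp: wpres_def)
  fix F :: "_ \<Rightarrow> ennreal" assume F: "F \<in> borel_measurable M"
  show "(\<integral>\<^sup>+z. F (T z) * ennreal (exp (H z - H (T z))) \<partial>M) = (\<integral>\<^sup>+z. F z \<partial>M)"
    using wpresD[OF assms(1) F] by (subst nn_integral_cong[where v="\<lambda>z. F (S z) * ennreal (exp (H z - H (S z)))"]) (auto simp: assms(2))
qed

lemma wpres_inverse:
  assumes S: "wpres M H S" and T: "T \<in> measurable M M" and TS: "\<And>z. z \<in> space M \<Longrightarrow> T (S z) = z"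
  shows "wpres M H T"
  unfolding wpres_def
proof (intro conjI ballI)
  show "T \<in> measurable M M" "H \<in> borel_measurable M" using S T by (auto simp: wpres_def)
  note [measurable] = this
  fix F :: "_ \<Rightarrow> ennreal" assume [measurable]: "F \<in> borel_measurable M"
  have "(\<integral>\<^sup>+z. F (T z) * ennreal (exp (H z - H (T z))) \<partial>M)
    = (\<integral>\<^sup>+z. (F (T (S z)) * ennreal (exp (H (S z) - H (T (S z))))) * ennreal (exp (H z - H (S z))) \<partial>M)"
    by (rule wpresD[OF S, symmetric]) measurable
  also have "\<dots> = (\<integral>\<^sup>+z. F z \<partial>M)"
    by (intro nn_integral_cong) (simp add: TS mult.assoc ennreal_mult[symmetric] mult_exp_exp)
  finally show "(\<integral>\<^sup>+z. F (T z) * ennreal (exp (H z - H (T z))) \<partial>M) = (\<integral>\<^sup>+z. F z \<partial>M)" .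
qed

lemma wpres_id: "H \<in> borel_measurable M \<Longrightarrow> wpres M H (\<lambda>z. z)"
  by (simp add: wpres_def)

lemma wpres_funpow:
  assumes "wpres M H S" shows "wpres M H (S ^^ n)"
proof (induction n)
  case 0 then show ?case using wpres_id[of H M] assms by (simp add: wpres_def id_def)
next
  case (Suc n) then show ?case using wpres_comp[OF assms Suc] by (simp add: comp_def)
qed

text \<open>
  A shear is handled fibre by fibre with Fubini's theorem, so only a statement about
  translations of one factor is needed. Leapfrog steps are compositions of such shears.
\<close>

lemma wpres_shear_snd:
  assumes N: "sigma_finite_measure N"
    and [measurable]: "h1 \<in> borel_measurable M" "h2 \<in> borel_measurable N"
    and T [measurable]: "(\<lambda>z. T (fst z) (snd z)) \<in> measurable (M \<Otimes>\<^sub>M N) N"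
    and T': "\<And>x G. x \<in> space M \<Longrightarrow> G \<in> borel_measurable N \<Longrightarrow> (\<integral>\<^sup>+v. G (T x v) * ennreal (exp (h2 v - h2 (T x v))) \<partial>N) = (\<integral>\<^sup>+v. G v \<partial>N)"
  shows "wpres (M \<Otimes>\<^sub>M N) (\<lambda>z. h1 (fst z) + h2 (snd z)) (\<lambda>z. (fst z, T (fst z) (snd z)))"
  unfolding wpres_def
proof (intro conjI ballI)
  show "(\<lambda>z. (fst z, T (fst z) (snd z))) \<in> measurable (M \<Otimes>\<^sub>M N) (M \<Otimes>\<^sub>M N)"
    "(\<lambda>z. h1 (fst z) + h2 (snd z)) \<in> borel_measurable (M \<Otimes>\<^sub>M N)" by measurable
  fix F :: "_ \<Rightarrow> ennreal" assume F [measurable]: "F \<in> borel_measurable (M \<Otimes>\<^sub>M N)"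
  let ?f = "\<lambda>z. F (fst z, T (fst z) (snd z)) * ennreal (exp (h1 (fst z) + h2 (snd z) - (h1 (fst z) + h2 (T (fst z) (snd z)))))"
  have m [measurable]: "?f \<in> borel_measurable (M \<Otimes>\<^sub>M N)" by measurable
  have "(\<integral>\<^sup>+z. ?f z \<partial>(M \<Otimes>\<^sub>M N)) = (\<integral>\<^sup>+x. \<integral>\<^sup>+v. ?f (x, v) \<partial>N \<partial>M)"
    using sigma_finite_measure.nn_integral_fst[OF N m] by simp
  also have "\<dots> = (\<integral>\<^sup>+x. \<integral>\<^sup>+v. F (x, v) \<partial>N \<partial>M)"
  proof (rule nn_integral_cong)
    fix x assume x: "x \<in> space M"
    have "(\<lambda>v. F (x, v)) \<in> borel_measurable N" using x by measurable
    from T'[OF x this] show "(\<integral>\<^sup>+v. ?f (x, v) \<partial>N) = (\<integral>\<^sup>+v. F (x, v) \<partial>N)" by simp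
  qed
  also have "\<dots> = (\<integral>\<^sup>+z. F z \<partial>(M \<Otimes>\<^sub>M N))"
    using sigma_finite_measure.nn_integral_fst[OF N F] by simp
  finally show "(\<integral>\<^sup>+z. F (fst z, T (fst z) (snd z)) * ennreal (exp (h1 (fst z) + h2 (snd z) - (h1 (fst (fst z, T (fst z) (snd z))) + h2 (snd (fst z, T (fst z) (snd z)))))) \<partial>(M \<Otimes>\<^sub>M N)) = (\<integral>\<^sup>+z. F z \<partial>(M \<Otimes>\<^sub>M N))" by simp
qed

lemma wpres_shear_fst:
  assumes M: "sigma_finite_measure M" and N: "sigma_finite_measure N"
    and [measurable]: "h1 \<in> borel_measurable M" "h2 \<in> borel_measurable N"
    and T [measurable]: "(\<lambda>z. T (fst z) (snd z)) \<in> measurable (M \<Otimes>\<^sub>M N) M"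
    and T': "\<And>v G. v \<in> space N \<Longrightarrow> G \<in> borel_measurable M \<Longrightarrow> (\<integral>\<^sup>+x. G (T x v) * ennreal (exp (h1 x - h1 (T x v))) \<partial>M) = (\<integral>\<^sup>+x. G x \<partial>M)"
  shows "wpres (M \<Otimes>\<^sub>M N) (\<lambda>z. h1 (fst z) + h2 (snd z)) (\<lambda>z. (T (fst z) (snd z), snd z))"
  unfolding wpres_def
proof (intro conjI ballI)
  interpret pair_sigma_finite M N using M N by (rule pair_sigma_finite.intro)
  show "(\<lambda>z. (T (fst z) (snd z), snd z)) \<in> measurable (M \<Otimes>\<^sub>M N) (M \<Otimes>\<^sub>M N)"
    "(\<lambda>z. h1 (fst z) + h2 (snd z)) \<in> borel_measurable (M \<Otimes>\<^sub>M N)" by measurable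
  fix F :: "_ \<Rightarrow> ennreal" assume F [measurable]: "F \<in> borel_measurable (M \<Otimes>\<^sub>M N)"
  let ?f = "\<lambda>z. F (T (fst z) (snd z), snd z) * ennreal (exp (h1 (fst z) + h2 (snd z) - (h1 (T (fst z) (snd z)) + h2 (snd z))))"
  have m [measurable]: "?f \<in> borel_measurable (M \<Otimes>\<^sub>M N)" by measurable
  have "(\<integral>\<^sup>+z. ?f z \<partial>(M \<Otimes>\<^sub>M N)) = (\<integral>\<^sup>+v. \<integral>\<^sup>+x. ?f (x, v) \<partial>M \<partial>N)"
    using nn_integral_snd[of ?f] m by simp
  also have "\<dots> = (\<integral>\<^sup>+v. \<integral>\<^sup>+x. F (x, v) \<partial>M \<partial>N)"
  proof (rule nn_integral_cong)
    fix v assume v: "v \<in> space N"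
    have "(\<lambda>x. F (x, v)) \<in> borel_measurable M" using v by measurable
    from T'[OF v this] show "(\<integral>\<^sup>+x. ?f (x, v) \<partial>M) = (\<integral>\<^sup>+x. F (x, v) \<partial>M)" by simp
  qed
  also have "\<dots> = (\<integral>\<^sup>+z. F z \<partial>(M \<Otimes>\<^sub>M N))"
    using nn_integral_snd[of F] F by simp
  finally show "(\<integral>\<^sup>+z. F (T (fst z) (snd z), snd z) * ennreal (exp (h1 (fst z) + h2 (snd z) - (h1 (fst (T (fst z) (snd z), snd z)) + h2 (snd (T (fst z) (snd z), snd z))))) \<partial>(M \<Otimes>\<^sub>M N)) = (\<integral>\<^sup>+z. F z \<partial>(M \<Otimes>\<^sub>M N))" by simp
qed

lemma cameron_martin_energy:
  assumes G: "G \<in> borel_measurable (gauss d)"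
  shows "(\<integral>\<^sup>+v. G (lin d 1 c v u) * ennreal (exp (dot d v v / 2 - dot d (lin d 1 c v u) (lin d 1 c v u) / 2)) \<partial>gauss d) = (\<integral>\<^sup>+v. G v \<partial>gauss d)"
proof -
  have "lin d 1 c v u = lin d 1 1 v (lin d c 0 u u)" for v
    by (auto simp: lin_def intro!: restrict_ext)
  moreover have "dot d v v / 2 - dot d (lin d 1 1 v w) (lin d 1 1 v w) / 2 = - dot d v w - dot d w w / 2" for v w
    by (simp add: dot_lin_left dot_lin_right dot_commute[of d w v] field_simps)
  ultimately show ?thesis using cameron_martin[of G d "lin d c 0 u u"] G
    by (simp cong: measurable_cong_sets)
qed

section \<open>Reflections\<close>

lemma sigma_finite_gauss: "sigma_finite_measure (gauss d)"
  by (rule prob_space_imp_sigma_finite) (rule prob_space_gauss)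

lemma sigma_finite_normal: "sigma_finite_measure std_normal_distribution"
  by (rule prob_space_imp_sigma_finite) (rule prob_space_normal_density, simp)

lemma reflect_dot:
  assumes "dot d e e = 1 \<or> dot d e e = 0"
  shows "dot d (reflect d e x) (reflect d e y) = dot d x y"
proof -
  have z: "dot d e e = 0 \<Longrightarrow> dot d x e = 0" for x using dot_Cauchy_Schwarz[of d x e] by (simp add: enorm_eq_sqrt)
  show ?thesis using assms z[of x] z[of y]
    by (auto simp: reflect_def dot_lin_left dot_lin_right dot_commute[of d e y])
qed

lemma reflect_lin: "reflect d e (lin d a b x y) = lin d a b (reflect d e x) (reflect d e y)"
  by (auto simp: reflect_def lin_def dot_lin_left[unfolded lin_def] algebra_simps intro!: restrict_ext)

lemma reflect_zero: "dot d e e = 0 \<Longrightarrow> x \<in> space (Rd d) \<Longrightarrow> reflect d e x = x"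
  using dot_Cauchy_Schwarz[of d x e] by (intro space_Rd_eqI) (auto simp: reflect_def lin_nth enorm_eq_sqrt)

text \<open>
  A half turn in the plane spanned by \<open>e\<close> and an independent auxiliary coordinate
  acts on the first factor as the reflection. A quarter turn is a composition of three shears,
  as for rotations of the plane, and shears are handled by translations. The energy terms
  disappear because the half turn preserves the norm.
\<close>

lemma gauss_reflect:
  assumes e: "e \<in> space (Rd d)" "dot d e e = 1" and F: "F \<in> borel_measurable (Rd d)"
  shows "(\<integral>\<^sup>+v. F (reflect d e v) \<partial>gauss d) = (\<integral>\<^sup>+v. F v \<partial>gauss d)"
proof -
  let ?N = "std_normal_distribution" and ?M = "gauss d"
  define H where "H = (\<lambda>z. dot d (fst z) (fst z) / 2 + (snd z)\<^sup>2 / 2 :: real)"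
  note [measurable] = e(1) F
  \<comment> \<open>as in the factorization of a plane rotation, the two kinds of shear alternate, and the choice of unit coefficients gives a quarter turn\<close>
  define A where "A = (\<lambda>t z. (lin d 1 (t * snd z) (fst z) e, snd z :: real))"
  define B where "B = (\<lambda>t z. (fst z :: nat \<Rightarrow> real, snd z + t * dot d (fst z) e))"
  have A: "wpres (?M \<Otimes>\<^sub>M ?N) H (A t)" for t
    unfolding A_def H_def
  proof (rule wpres_shear_fst[OF sigma_finite_gauss sigma_finite_normal, where T="\<lambda>x s. lin d 1 (t * s) x e" and ?h1.0="\<lambda>x. dot d x x / 2" and ?h2.0="\<lambda>s. s\<^sup>2 / 2"])
    fix v :: real and G :: "(nat \<Rightarrow> real) \<Rightarrow> ennreal" assume "G \<in> borel_measurable (gauss d)"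
    then show "(\<integral>\<^sup>+ x. G (lin d 1 (t * v) x e) * ennreal (exp (dot d x x / 2 - dot d (lin d 1 (t * v) x e) (lin d 1 (t * v) x e) / 2)) \<partial>gauss d) = integral\<^sup>N (gauss d) G"
      by (rule cameron_martin_energy)
  qed measurable
  have mN: "measurable X ?N = borel_measurable X" for X :: "((nat \<Rightarrow> real) \<times> real) measure"
    by (rule measurable_cong_sets) auto
  have B: "wpres (?M \<Otimes>\<^sub>M ?N) H (B t)" for t
  proof -
    have T: "(\<lambda>z. snd z + t * dot d (fst z) e) \<in> measurable (?M \<Otimes>\<^sub>M ?N) ?N"
      unfolding mN by measurable
    have h: "(\<lambda>x. dot d x x / 2) \<in> borel_measurable ?M" "(\<lambda>s::real. s\<^sup>2 / 2) \<in> borel_measurable ?N"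
      subgoal by measurable
      subgoal by (simp cong: measurable_cong_sets)
      done
    have *: "s\<^sup>2 / 2 - (s + u)\<^sup>2 / 2 = - (s * u) - u\<^sup>2 / 2" for s u :: real by (simp add: power2_eq_square field_simps)
    have cm: "(\<integral>\<^sup>+ v. G (v + t * dot d x e) * ennreal (exp (v\<^sup>2 / 2 - (v + t * dot d x e)\<^sup>2 / 2)) \<partial>?N) = integral\<^sup>N ?N G"
      if G: "G \<in> borel_measurable ?N" for x G
      unfolding * by (rule cameron_martin_real) (use G in \<open>simp cong: measurable_cong_sets\<close>)
    show ?thesis
      unfolding B_def H_def by (rule wpres_shear_snd[OF sigma_finite_normal h T cm])
  qed
  define R where "R = (\<lambda>z. A 1 (B (- 1) (A 1 (A 1 (B (- 1) (A 1 z))))))"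
  have wR: "wpres (?M \<Otimes>\<^sub>M ?N) H R"
  proof -
    have q: "wpres (?M \<Otimes>\<^sub>M ?N) H (\<lambda>z. A 1 (B (- 1) (A 1 z)))"
      by (rule wpres_comp[OF A wpres_comp[OF B A]])
    show ?thesis unfolding R_def by (rule wpres_comp[OF q q])
  qed
  have R: "R (x, s) = (reflect d e x, - s)" for x s
  proof -
    have st: "A 1 (B (- 1) (A 1 (x, s))) = (lin d 1 (s - dot d x e) x e, - dot d x e)" for x s
      using e by (simp add: A_def B_def dot_lin_left) (auto simp: lin_def algebra_simps intro!: restrict_ext)
    show ?thesis
      unfolding R_def st using e by (simp add: dot_lin_left) (auto simp: reflect_def lin_def algebra_simps intro!: restrict_ext)
  qed
  have HR: "H (R z) = H z" for z
    using reflect_dot[of d e "fst z" "fst z"] e(2) by (cases z) (simp add: R H_def)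
  have "(\<integral>\<^sup>+z. F (fst (R z)) \<partial>(?M \<Otimes>\<^sub>M ?N)) = (\<integral>\<^sup>+z. F (fst z) \<partial>(?M \<Otimes>\<^sub>M ?N))"
    using wpresD[OF wR, of "\<lambda>z. F (fst z)"] by (simp add: HR)
  then have R1: "(\<integral>\<^sup>+z. F (reflect d e (fst z)) \<partial>(?M \<Otimes>\<^sub>M ?N)) = (\<integral>\<^sup>+z. F (fst z) \<partial>(?M \<Otimes>\<^sub>M ?N))"
    by (metis (no_types, lifting) R fst_conv nn_integral_cong prod.collapse)
  have f: "(\<integral>\<^sup>+z. f (fst z) \<partial>(?M \<Otimes>\<^sub>M ?N)) = (\<integral>\<^sup>+x. f x \<partial>?M)" if [measurable]: "f \<in> borel_measurable (Rd d)" for f :: "_ \<Rightarrow> ennreal"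
    using sigma_finite_measure.nn_integral_fst[OF sigma_finite_normal, of "\<lambda>z. f (fst z)" ?M]
      prob_space.emeasure_space_1[OF prob_space_normal_density[of 1 0]] by simp
  have "(\<integral>\<^sup>+v. F (reflect d e v) \<partial>?M) = (\<integral>\<^sup>+z. F (reflect d e (fst z)) \<partial>(?M \<Otimes>\<^sub>M ?N))"
    by (rule f[symmetric]) measurable
  also have "\<dots> = (\<integral>\<^sup>+v. F v \<partial>?M)"
    unfolding R1 by (rule f) measurable
  finally show ?thesis .
qed

section \<open>Leapfrog in closed form\<close>

text \<open>
  The angle by which one leapfrog step of size \<open>h\<close> rotates phase space. The
  rotation becomes orthogonal after the velocity is divided by \<open>beta h\<close>.
\<close>

definition theta :: "real \<Rightarrow> real" where "theta h = arccos (1 - h\<^sup>2 / 2)"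
definition beta :: "real \<Rightarrow> real" where "beta h = sqrt (1 - h\<^sup>2 / 4)"

definition rot :: "nat \<Rightarrow> real \<Rightarrow> int \<Rightarrow> phase_point \<Rightarrow> phase_point" where
  "rot d h L z = (lin d (cos (of_int L * theta h)) (sin (of_int L * theta h) / beta h) (fst z) (snd z),
                  lin d (- (beta h * sin (of_int L * theta h))) (cos (of_int L * theta h)) (fst z) (snd z))"

lemma rot_in_phase_space [simp]: "rot d h L z \<in> phase_space d"
  by (simp add: rot_def phase_space_def)

lemma rot_zero: "z \<in> phase_space d \<Longrightarrow> rot d h 0 z = z"
  by (cases z) (auto simp: rot_def phase_space_def lin_nth intro!: space_Rd_eqI)

context
  fixes h :: real assumes h: "0 < h" "h \<le> 1"
begin

lemma h_sq_le: "h\<^sup>2 \<le> 1" using h by (simp add: power_le_one)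

lemma beta_pos: "beta h > 0" and beta_sq: "(beta h)\<^sup>2 = 1 - h\<^sup>2 / 4" and beta_le: "beta h \<le> 1"
  using h_sq_le by (auto simp: beta_def)

lemma beta_ge: "beta h \<ge> 1/2"
proof -
  have "(1/2)\<^sup>2 \<le> (beta h)\<^sup>2" unfolding beta_sq using h_sq_le by (simp add: power_divide)
  then show ?thesis using beta_pos by (rule power2_le_imp_le[OF _ less_imp_le])
qed

lemma cos_theta: "cos (theta h) = 1 - h\<^sup>2 / 2"
  using h_sq_le by (simp add: theta_def cos_arccos)

lemma theta_pos: "theta h > 0" and theta_le: "theta h \<le> pi"
proof -
  show "theta h \<le> pi" unfolding theta_def using h_sq_le by (intro arccos_ubound) auto
  have "0 \<le> theta h" unfolding theta_def using h_sq_le by (intro arccos_lbound) auto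
  moreover have "theta h \<noteq> 0" using cos_theta h by auto
  ultimately show "theta h > 0" by simp
qed

lemma sin_theta: "sin (theta h) = h * beta h"
proof -
  have "(sin (theta h))\<^sup>2 = (h * beta h)\<^sup>2"
    unfolding sin_squared_eq power_mult_distrib beta_sq cos_theta by (simp add: power2_eq_square algebra_simps)
  moreover have "sin (theta h) \<ge> 0" using theta_pos theta_le by (intro sin_ge_zero) auto
  ultimately show ?thesis using h beta_pos by (simp add: power2_eq_iff_nonneg)
qed

text \<open>
  The leapfrog matrix has determinant one and trace \<open>2 - h\<^sup>2\<close>, so it is
  conjugate to the rotation by \<open>theta h\<close>; the conjugation only rescales the
  velocity. Iterates then follow from the addition theorems.
\<close>

lemma rot_one: "z \<in> phase_space d \<Longrightarrow> rot d h 1 z = leapfrog d h z"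
proof (cases z)
  case (Pair x v)
  assume "z \<in> phase_space d"
  have 1: "sin (theta h) / beta h = h" using beta_pos by (simp add: sin_theta)
  have 2: "- (beta h * sin (theta h)) = - (h * (1 - h\<^sup>2/4))"
  proof -
    have "beta h * sin (theta h) = h * (beta h)\<^sup>2" by (simp add: sin_theta power2_eq_square)
    then show ?thesis by (simp only: beta_sq)
  qed
  show ?thesis
    unfolding Pair rot_def using 1 2
    by (simp add: cos_theta Let_def lin_def)
      (auto simp: power2_eq_square algebra_simps add_divide_distrib diff_divide_distrib intro!: restrict_ext)
qed

lemma rot_add: "rot d h a (rot d h b z) = rot d h (a + b) z"
proof -
  let ?a = "of_int a * theta h" and ?b = "of_int b * theta h"
  have e: "of_int (a + b) * theta h = ?a + ?b" by (simp add: algebra_simps)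
  have bn: "beta h \<noteq> 0" using beta_pos by simp
  show ?thesis
    unfolding rot_def prod.inject fst_conv snd_conv
  proof (intro conjI space_Rd_eqI lin_in_space)
    fix i assume "i < d"
    then show "lin d (cos ?a) (sin ?a / beta h) (lin d (cos ?b) (sin ?b / beta h) (fst z) (snd z)) (lin d (- (beta h * sin ?b)) (cos ?b) (fst z) (snd z)) i
      = lin d (cos (of_int (a + b) * theta h)) (sin (of_int (a + b) * theta h) / beta h) (fst z) (snd z) i"
      using bn by (simp add: lin_nth e cos_add sin_add field_simps)
    from \<open>i < d\<close> show "lin d (- (beta h * sin ?a)) (cos ?a) (lin d (cos ?b) (sin ?b / beta h) (fst z) (snd z)) (lin d (- (beta h * sin ?b)) (cos ?b) (fst z) (snd z)) i
      = lin d (- (beta h * sin (of_int (a + b) * theta h))) (cos (of_int (a + b) * theta h)) (fst z) (snd z) i"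
      using bn by (simp add: lin_nth e cos_add sin_add field_simps)
  qed (rule lin_in_space)+
qed

lemma inv_leapfrog: 
  assumes z: "z \<in> phase_space d" shows "inv_into (phase_space d) (leapfrog d h) z = rot d h (- 1) z"
proof -
  have "inj_on (leapfrog d h) (phase_space d)"
  proof (rule inj_on_inverseI)
    fix z assume z: "z \<in> phase_space d"
    show "rot d h (- 1) (leapfrog d h z) = z"
      unfolding rot_one[OF z, symmetric] by (simp add: rot_add rot_zero z)
  qed
  moreover have "leapfrog d h (rot d h (- 1) z) = z"
    by (subst rot_one[symmetric]) (simp_all add: rot_add rot_zero z)
  ultimately show ?thesis
    by (metis inv_into_f_f rot_in_phase_space)
qed

lemma leapfrog_funpow: "z \<in> phase_space d \<Longrightarrow> (leapfrog d h ^^ n) z = rot d h (int n) z"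
proof (induction n)
  case (Suc n)
  then show ?case by (simp add: rot_one[symmetric] rot_add)
qed (simp add: rot_zero)

lemma inv_leapfrog_funpow: "z \<in> phase_space d \<Longrightarrow> (inv_into (phase_space d) (leapfrog d h) ^^ n) z = rot d h (- int n) z"
proof (induction n)
  case (Suc n)
  then show ?case by (simp add: inv_leapfrog rot_add)
qed (simp add: rot_zero)

lemma leapfrog_iter_eq_rot: "z \<in> phase_space d \<Longrightarrow> leapfrog_iter d h L z = rot d h L z"
  by (simp add: leapfrog_iter_def leapfrog_funpow inv_leapfrog_funpow)

lemma hamiltonian_eq: "hamiltonian d z = dot d (fst z) (fst z) / 2 + dot d (snd z) (snd z) / 2"
  by (cases z) (simp add: enorm_sq)

lemma space_phase: "space (gauss d \<Otimes>\<^sub>M gauss d) = phase_space d"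
  by (simp add: space_pair_measure phase_space_def)

lemma measurable_rot [measurable]: "rot d h L \<in> measurable (gauss d \<Otimes>\<^sub>M gauss d) (gauss d \<Otimes>\<^sub>M gauss d)"
  unfolding rot_def by measurable

text \<open>
  A leapfrog step is a half kick of the velocity, a drift of the position and another half kick.
  Each of them is a shear by a translation in one of the two Gaussian factors.
\<close>

lemma wpres_leapfrog: "wpres (gauss d \<Otimes>\<^sub>M gauss d) (hamiltonian d) (leapfrog d h)"
proof -
  define A where "A = (\<lambda>z. (lin d 1 h (fst z) (snd z), snd z))"
  define B where "B = (\<lambda>z. (fst z, lin d 1 (- h / 2) (snd z) (fst z)))"
  have H: "hamiltonian d = (\<lambda>z. dot d (fst z) (fst z) / 2 + dot d (snd z) (snd z) / 2)"
    by (auto simp: hamiltonian_eq)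
  have q: "(\<lambda>x. dot d x x / 2) \<in> borel_measurable (gauss d)" by measurable
  have TA: "(\<lambda>z. lin d 1 h (fst z) (snd z)) \<in> measurable (gauss d \<Otimes>\<^sub>M gauss d) (gauss d)" by measurable
  have A: "wpres (gauss d \<Otimes>\<^sub>M gauss d) (hamiltonian d) A"
    unfolding H A_def by (rule wpres_shear_fst[OF sigma_finite_gauss sigma_finite_gauss q q TA cameron_martin_energy])
  have T: "(\<lambda>z. lin d 1 (- h / 2) (snd z) (fst z)) \<in> measurable (gauss d \<Otimes>\<^sub>M gauss d) (gauss d)" by measurable
  have B: "wpres (gauss d \<Otimes>\<^sub>M gauss d) (hamiltonian d) B"
    unfolding H B_def by (rule wpres_shear_snd[OF sigma_finite_gauss q q T cameron_martin_energy])
  show ?thesis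
  proof (rule wpres_cong[OF wpres_comp[OF B wpres_comp[OF A B]]])
    fix z assume "z \<in> space (gauss d \<Otimes>\<^sub>M gauss d)"
    show "B (A (B z)) = leapfrog d h z"
      by (cases z) (auto simp: A_def B_def lin_def Let_def power2_eq_square algebra_simps add_divide_distrib diff_divide_distrib intro!: restrict_ext)
  qed
qed

lemma wpres_rot: "wpres (gauss d \<Otimes>\<^sub>M gauss d) (hamiltonian d) (rot d h L)"
proof (cases "L \<ge> 0")
  case True
  then show ?thesis
    using wpres_cong[OF wpres_funpow[OF wpres_leapfrog], of d "nat L" "rot d h L"] by (simp add: space_phase leapfrog_funpow)
next
  case False
  then have "wpres (gauss d \<Otimes>\<^sub>M gauss d) (hamiltonian d) (rot d h (- L))"
    using wpres_cong[OF wpres_funpow[OF wpres_leapfrog], of d "nat (- L)" "rot d h (- L)"] by (simp add: space_phase leapfrog_funpow)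
  then show ?thesis
    by (rule wpres_inverse) (auto simp: rot_add space_phase rot_zero)
qed

lemma nn_integral_rot:
  assumes "F \<in> borel_measurable (gauss d \<Otimes>\<^sub>M gauss d)"
  shows "(\<integral>\<^sup>+z. F (rot d h L z) * ennreal (exp (hamiltonian d z - hamiltonian d (rot d h L z))) \<partial>(gauss d \<Otimes>\<^sub>M gauss d)) = (\<integral>\<^sup>+z. F z \<partial>(gauss d \<Otimes>\<^sub>M gauss d))"
  using wpresD[OF wpres_rot assms] .

text \<open>
  The leapfrog step conserves the modified energy \<open>beta\<^sup>2 * |x|\<^sup>2 +
  |v|\<^sup>2\<close> exactly. Hence the error in the energy is governed by the change of
  \<open>|x|\<^sup>2\<close> with a factor \<open>h\<^sup>2\<close>, and the index weights are
  nearly uniform on orbits along which the norm of the position is nearly constant.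
\<close>

lemma energy_error:
  "hamiltonian d (rot d h L z) - hamiltonian d z = h\<^sup>2 / 8 * (dot d (fst (rot d h L z)) (fst (rot d h L z)) - dot d (fst z) (fst z))"
proof -
  let ?t = "of_int L * theta h"
  define b c s where "b = beta h" and "c = cos ?t" and "s = sin ?t"
  have b: "b > 0" using beta_pos by (simp add: b_def)
  have cs: "s * s + c * c = 1" using sin_cos_squared_add[of ?t] by (simp add: c_def s_def power2_eq_square)
  define X Y Z where "X = dot d (fst z) (fst z)" and "Y = dot d (fst z) (snd z)" and "Z = dot d (snd z) (snd z)"
  have r: "fst (rot d h L z) = lin d c (s / b) (fst z) (snd z)" "snd (rot d h L z) = lin d (- (b * s)) c (fst z) (snd z)"
    by (simp_all add: rot_def b_def c_def s_def)
  have vx: "dot d (snd z) (fst z) = Y" by (simp add: Y_def dot_commute)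
  have "b\<^sup>2 * dot d (fst (rot d h L z)) (fst (rot d h L z)) = b\<^sup>2 * c\<^sup>2 * X + 2 * b * c * s * Y + s\<^sup>2 * Z"
    using b by (simp add: r dot_lin_left dot_lin_right vx X_def[symmetric] Y_def[symmetric] Z_def[symmetric] power2_eq_square field_simps)
  moreover have "dot d (snd (rot d h L z)) (snd (rot d h L z)) = b\<^sup>2 * s\<^sup>2 * X - 2 * b * c * s * Y + c\<^sup>2 * Z"
    using b by (simp add: r dot_lin_left dot_lin_right vx X_def[symmetric] Y_def[symmetric] Z_def[symmetric] power2_eq_square field_simps)
  ultimately have "dot d (snd (rot d h L z)) (snd (rot d h L z)) + b\<^sup>2 * dot d (fst (rot d h L z)) (fst (rot d h L z)) = (s * s + c * c) * (Z + b\<^sup>2 * X)"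
    by (simp add: power2_eq_square algebra_simps)
  then have "dot d (snd (rot d h L z)) (snd (rot d h L z)) + (beta h)\<^sup>2 * dot d (fst (rot d h L z)) (fst (rot d h L z)) = dot d (snd z) (snd z) + (beta h)\<^sup>2 * dot d (fst z) (fst z)"
    unfolding cs by (simp add: b_def X_def Z_def)
  then have "dot d (snd (rot d h L z)) (snd (rot d h L z)) = dot d (snd z) (snd z) + (1 - h\<^sup>2/4) * dot d (fst z) (fst z) - (1 - h\<^sup>2/4) * dot d (fst (rot d h L z)) (fst (rot d h L z))"
    unfolding beta_sq by simp
  then show ?thesis unfolding hamiltonian_eq by (simp add: algebra_simps)
qed

end

section \<open>Dyadic blocks\<close>

definition blk :: "int \<Rightarrow> nat \<Rightarrow> int set" where "blk lo j = {lo..<lo + 2 ^ j}"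

lemma finite_blk [simp]: "finite (blk lo j)" by (simp add: blk_def)
lemma card_blk [simp]: "card (blk lo j) = 2 ^ j" by (simp add: blk_def nat_power_eq)
lemma blk_ne [simp]: "blk lo j \<noteq> {}" by (auto simp: blk_def)
lemma Min_blk [simp]: "Min (blk lo j) = lo"
  by (rule Min_eqI) (auto simp: blk_def)
lemma Max_blk: "Max (blk lo j) = lo + 2 ^ j - 1"
  by (rule Max_eqI) (auto simp: blk_def)
lemma blk_eq_iff [simp]: "blk lo j = blk lo' j' \<longleftrightarrow> lo = lo' \<and> j = j'"
proof
  assume "blk lo j = blk lo' j'"
  then have "Min (blk lo j) = Min (blk lo' j')" "card (blk lo j) = card (blk lo' j')" by simp_all
  then show "lo = lo' \<and> j = j'" by simp
qed simp
lemma blk_shift: "(\<lambda>i. i + k) ` blk lo j = blk (lo + k) j"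
  by (simp add: blk_def image_add_atLeastLessThan' algebra_simps)
lemma blk_shift_minus: "(\<lambda>i. i - k) ` blk lo j = blk (lo - k) j"
  using blk_shift[of "- k" lo j] by simp
lemma blk_Un_right: "blk lo j \<union> blk (lo + 2 ^ j) j = blk lo (Suc j)"
  by (auto simp: blk_def)
lemma blk_Un_left: "blk lo j \<union> blk (lo - 2 ^ j) j = blk (lo - 2 ^ j) (Suc j)"
  by (auto simp: blk_def)

text \<open>
  An abstract version of the sub-U-turn test: \<open>U lo j\<close> stands for a U-turn of the
  index orbit of length \<open>2 ^ j\<close> that starts at \<open>lo\<close>. Halving is a
  structural recursion here, which makes the orbit law accessible to induction.
\<close>

fun no_sub :: "(int \<Rightarrow> nat \<Rightarrow> bool) \<Rightarrow> int \<Rightarrow> nat \<Rightarrow> bool" where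
  "no_sub U lo 0 = (\<not> U lo 0)"
| "no_sub U lo (Suc j) = (no_sub U lo j \<and> no_sub U (lo + 2 ^ j) j \<and> \<not> U lo (Suc j))"

lemma no_sub_iff: "no_sub U lo k \<longleftrightarrow> (\<forall>j\<le>k. \<forall>m<2 ^ j. \<not> U (lo + int m * 2 ^ (k - j)) (k - j))"
proof (induction k arbitrary: lo)
  case 0 then show ?case by simp
next
  case (Suc k)
  show ?case
  proof
    assume L: "no_sub U lo (Suc k)"
    show "\<forall>j\<le>Suc k. \<forall>m<2 ^ j. \<not> U (lo + int m * 2 ^ (Suc k - j)) (Suc k - j)"
    proof (intro allI impI)
      fix j m :: nat assume j: "j \<le> Suc k" and m: "m < 2 ^ j"
      show "\<not> U (lo + int m * 2 ^ (Suc k - j)) (Suc k - j)"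
      proof (cases j)
        case 0 then show ?thesis using L m by simp
      next
        case (Suc j')
        show ?thesis
        proof (cases "m < 2 ^ j'")
          case True
          then have "\<not> U (lo + int m * 2 ^ (k - j')) (k - j')" using L Suc.IH[of lo] Suc j by auto
          then show ?thesis using Suc by simp
        next
          case False
          then have "m - 2 ^ j' < 2 ^ j'" using m Suc by simp
          then have "\<not> U (lo + 2 ^ k + int (m - 2 ^ j') * 2 ^ (k - j')) (k - j')" using L Suc.IH[of "lo + 2 ^ k"] Suc j by auto
          moreover have "(2::int) ^ k = 2 ^ j' * 2 ^ (k - j')" using j Suc by (simp flip: power_add)
          ultimately show ?thesis using Suc False by (simp add: of_nat_diff algebra_simps)
        qed
      qed
    qed
  next
    assume R: "\<forall>j\<le>Suc k. \<forall>m<2 ^ j. \<not> U (lo + int m * 2 ^ (Suc k - j)) (Suc k - j)"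
    have "no_sub U lo k"
      unfolding Suc.IH
    proof (intro allI impI)
      fix j m :: nat assume j: "j \<le> k" and m: "m < 2 ^ j"
      show "\<not> U (lo + int m * 2 ^ (k - j)) (k - j)" using R[rule_format, of "Suc j" m] j m by simp
    qed
    moreover have "no_sub U (lo + 2 ^ k) k"
      unfolding Suc.IH
    proof (intro allI impI)
      fix j m :: nat assume j: "j \<le> k" and m: "m < 2 ^ j"
      have "(2::int) ^ k = 2 ^ j * 2 ^ (k - j)" using j by (simp flip: power_add)
      then show "\<not> U (lo + 2 ^ k + int m * 2 ^ (k - j)) (k - j)" using R[rule_format, of "Suc j" "2 ^ j + m"] j m by (simp add: algebra_simps)
    qed
    moreover have "\<not> U lo (Suc k)" using R[rule_format, of 0 0] by simp
    ultimately show "no_sub U lo (Suc k)" by simp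
  qed
qed

lemma no_sub_block: "no_sub U lo j \<Longrightarrow> i \<le> j \<Longrightarrow> c < 2 ^ (j - i) \<Longrightarrow> no_sub U (lo + int c * 2 ^ i) i"
proof (induction j arbitrary: lo c)
  case 0 then show ?case by simp
next
  case (Suc j)
  show ?case
  proof (cases "i = Suc j")
    case True then show ?thesis using Suc.prems by simp
  next
    case False
    then have ij: "i \<le> j" using Suc.prems by simp
    show ?thesis
    proof (cases "c < 2 ^ (j - i)")
      case True then show ?thesis using Suc.IH[of lo c] Suc.prems ij by simp
    next
      case False
      then have "c - 2 ^ (j - i) < 2 ^ (j - i)" using Suc.prems ij by (simp add: Suc_diff_le)
      then have "no_sub U (lo + 2 ^ j + int (c - 2 ^ (j - i)) * 2 ^ i) i" using Suc.IH[of "lo + 2 ^ j"] Suc.prems ij by simp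
      moreover have "(2::int) ^ j = 2 ^ (j - i) * 2 ^ i" using ij by (simp flip: power_add)
      ultimately show ?thesis using False by (simp add: of_nat_diff algebra_simps)
    qed
  qed
qed

text \<open>
  A selected orbit has two halves without sub-U-turns, but may itself have a U-turn.
\<close>

fun halves :: "(int \<Rightarrow> nat \<Rightarrow> bool) \<Rightarrow> int \<Rightarrow> nat \<Rightarrow> bool" where
  "halves U lo 0 = True"
| "halves U lo (Suc j) = (no_sub U lo j \<and> no_sub U (lo + 2 ^ j) j)"

lemma no_sub_imp_halves: "no_sub U lo j \<Longrightarrow> halves U lo j"
  by (cases j) auto

lemma halves_block:
  assumes "halves U lo j" "i < j" "c < 2 ^ (j - i)" shows "no_sub U (lo + int c * 2 ^ i) i"
proof (cases j)
  case 0 then show ?thesis using assms by simp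
next
  case (Suc k)
  then have ik: "i \<le> k" using assms by simp
  show ?thesis
  proof (cases "c < 2 ^ (k - i)")
    case True then show ?thesis using no_sub_block[of U lo k i c] assms Suc ik by simp
  next
    case False
    then have "c - 2 ^ (k - i) < 2 ^ (k - i)" using assms Suc ik by (simp add: Suc_diff_le)
    then have "no_sub U (lo + 2 ^ k + int (c - 2 ^ (k - i)) * 2 ^ i) i" using no_sub_block[of U "lo + 2 ^ k" k i] assms Suc ik by simp
    moreover have "(2::int) ^ k = 2 ^ (k - i) * 2 ^ i" using ik by (simp flip: power_add)
    ultimately show ?thesis using False by (simp add: of_nat_diff algebra_simps)
  qed
qed

text \<open>
  The probability that selection stops at the orbit starting at \<open>lo\<close> of length
  \<open>2 ^ j\<close> once this orbit has been reached: with certainty if it makes a U-turn or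
  is maximal, and otherwise if the proposed doubling is rejected.
\<close>

definition stop_prob :: "(int \<Rightarrow> nat \<Rightarrow> bool) \<Rightarrow> nat \<Rightarrow> int \<Rightarrow> nat \<Rightarrow> real" where
  "stop_prob U kmax lo j = (if U lo j \<or> j = kmax then 1 else
     (if no_sub U (lo - 2 ^ j) j then 0 else 1/2) + (if no_sub U (lo + 2 ^ j) j then 0 else 1/2))"

text \<open>
  An orbit of length \<open>2 ^ j\<close> that contains \<open>0\<close> is reached by exactly
  one of the \<open>2 ^ j\<close> equally likely sequences of doubling directions. This
  probability does not refer to the position of \<open>0\<close> in the orbit, which is the
  reason for the reversibility of the sampler.
\<close>

definition orbit_prob :: "(int \<Rightarrow> nat \<Rightarrow> bool) \<Rightarrow> nat \<Rightarrow> int \<Rightarrow> nat \<Rightarrow> real" where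
  "orbit_prob U kmax lo j = (if halves U lo j then stop_prob U kmax lo j / 2 ^ j else 0)"

lemma orbit_prob_nonneg: "0 \<le> orbit_prob U kmax lo j"
  by (simp add: orbit_prob_def stop_prob_def)

section \<open>The orbit law\<close>

definition Ut :: "nat \<Rightarrow> real \<Rightarrow> phase_point \<Rightarrow> int \<Rightarrow> nat \<Rightarrow> bool" where
  "Ut d h z lo j = uturn d h z (blk lo j)"

lemma sub_orbit_blk:
  assumes "j \<le> k" "m \<le> 2 ^ j - 1"
  shows "sub_orbit (blk lo k) j m = blk (lo + int m * 2 ^ (k - j)) (k - j)"
proof -
  have d: "(2::nat) ^ k div 2 ^ j = 2 ^ (k - j)" using assms(1) by (simp add: power_diff)
  have "m + 1 \<le> 2 ^ j" using assms(2) by (metis Suc_eq_plus1 Suc_leI le_imp_less_Suc less_le_trans Suc_diff_1 zero_less_numeral zero_less_power)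
  then have "int ((m + 1) * 2 ^ (k - j)) \<le> int (2 ^ j * 2 ^ (k - j))" by (intro of_nat_mono mult_right_mono) auto
  also have "int (2 ^ j * 2 ^ (k - j)) = 2 ^ k" using assms(1) by (simp flip: power_add)
  finally have *: "int ((m + 1) * 2 ^ (k - j)) \<le> 2 ^ k" .
  define q where "q = int m * 2 ^ (k - j)"
  have q: "0 \<le> q" "int (m * 2 ^ (k - j)) = q" "int ((m + 1) * 2 ^ (k - j)) = q + 2 ^ (k - j)"
    by (simp_all add: q_def algebra_simps)
  show ?thesis
    using * unfolding sub_orbit_def card_blk Min_blk d q(2,3) q_def[symmetric] using q(1) by (auto simp: blk_def)
qed

lemma sub_uturn_blk: "sub_uturn d h z (blk lo k) \<longleftrightarrow> \<not> no_sub (Ut d h z) lo k"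
proof -
  have "sub_uturn d h z (blk lo k) \<longleftrightarrow> (\<exists>j\<le>k. \<exists>m\<le>2 ^ j - 1. uturn d h z (sub_orbit (blk lo k) j m))"
    by (auto simp: sub_uturn_def)
  also have "\<dots> \<longleftrightarrow> (\<exists>j\<le>k. \<exists>m\<le>2 ^ j - 1. Ut d h z (lo + int m * 2 ^ (k - j)) (k - j))"
    unfolding Ut_def using sub_orbit_blk[of _ k _ lo] by metis
  also have "\<dots> \<longleftrightarrow> (\<exists>j\<le>k. \<exists>m<2 ^ j. Ut d h z (lo + int m * 2 ^ (k - j)) (k - j))"
  proof -
    have "m \<le> 2 ^ j - 1 \<longleftrightarrow> m < 2 ^ j" for m j :: nat
      by (metis Suc_diff_1 less_Suc_eq_le zero_less_numeral zero_less_power)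
    then show ?thesis by simp
  qed
  finally show ?thesis by (auto simp: no_sub_iff)
qed

lemma pmf_bind_two:
  assumes "A \<noteq> B"
  shows "pmf (bind_pmf (pmf_of_set {A, B}) f) x = (pmf (f A) x + pmf (f B) x) / 2"
  using assms by (simp add: pmf_bind integral_pmf_of_set)

lemma select_orbit_blk:
  "select_orbit (Suc r) d h kmax z (blk lo i) =
    bind_pmf (pmf_of_set {blk (lo - 2 ^ i) i, blk (lo + 2 ^ i) i}) (\<lambda>I'.
      if sub_uturn d h z I' then return_pmf (blk lo i)
      else if uturn d h z (blk lo i \<union> I') \<or> card (blk lo i \<union> I') = 2 ^ kmax then return_pmf (blk lo i \<union> I')
      else select_orbit r d h kmax z (blk lo i \<union> I'))"
  by (simp add: blk_shift blk_shift_minus)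

text \<open>
  The law of selection started at an intermediate orbit of length \<open>2 ^ i\<close>, which is
  what an induction over the remaining doublings can prove.
\<close>

definition sel_prob :: "(int \<Rightarrow> nat \<Rightarrow> bool) \<Rightarrow> nat \<Rightarrow> int \<Rightarrow> nat \<Rightarrow> int \<Rightarrow> nat \<Rightarrow> real" where
  "sel_prob U kmax lo i lo' j = (if i \<le> j \<and> j \<le> kmax \<and> (\<exists>c<2 ^ (j - i). lo' = lo - int c * 2 ^ i) \<and> halves U lo' j
     then stop_prob U kmax lo' j / 2 ^ (j - i) else 0)"

text \<open>
  One doubling to a fixed side. The two sides differ only in which of the two blocks becomes the
  left half of the union, so the lemma covers both by naming the start \<open>lu\<close> of the
  union and the start \<open>l'\<close> of the added block.
\<close>

lemma sel_branch:
  assumes ns: "no_sub U lo i" and side: "lu = lo \<and> l' = lo + 2 ^ i \<or> lu = lo - 2 ^ i \<and> l' = lo - 2 ^ i"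
    and ik: "i < kmax"
    and IH: "no_sub U lu (Suc i) \<Longrightarrow> Suc i < kmax \<Longrightarrow> pmf S (blk lo' j) = sel_prob U kmax lu (Suc i) lo' j"
  shows "pmf (if \<not> no_sub U l' i then return_pmf (blk lo i) else if U lu (Suc i) \<or> Suc i = kmax then return_pmf (blk lu (Suc i)) else S) (blk lo' j)
     = (if j = i then (if lo' = lo \<and> \<not> no_sub U l' i then 1 else 0) else sel_prob U kmax lu (Suc i) lo' j)"
proof (cases "no_sub U l' i")
  case False
  have "sel_prob U kmax lu (Suc i) lo' j = 0" if "j \<noteq> i"
  proof (rule ccontr)
    assume "sel_prob U kmax lu (Suc i) lo' j \<noteq> 0"
    then obtain c where c: "Suc i \<le> j" "c < 2 ^ (j - Suc i)" "lo' = lu - int c * 2 ^ Suc i" "halves U lo' j"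
      by (auto simp: sel_prob_def split: if_splits)
    have p2: "(2::nat) ^ (j - i) = 2 * 2 ^ (j - Suc i)" using c(1) by (simp add: Suc_diff_Suc flip: power_Suc)
    from side have "\<exists>c'<2 ^ (j - i). l' = lo' + int c' * 2 ^ i"
    proof
      assume "lu = lo \<and> l' = lo + 2 ^ i"
      then show ?thesis using c p2 by (intro exI[of _ "2 * c + 1"]) (auto simp: algebra_simps)
    next
      assume "lu = lo - 2 ^ i \<and> l' = lo - 2 ^ i"
      then show ?thesis using c p2 by (intro exI[of _ "2 * c"]) (auto simp: algebra_simps)
    qed
    then show False using halves_block[OF c(4), of i] c(1) False by auto
  qed
  then show ?thesis using False by (auto simp: pmf_return indicator_def)
next
  case True
  note l' = this
  have hv: "halves U lu (Suc i)" using side ns True by auto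
  show ?thesis
  proof (cases "U lu (Suc i) \<or> Suc i = kmax")
    case stop: True
    have j0: "sel_prob U kmax lu (Suc i) lo' j = (if lo' = lu \<and> j = Suc i then 1 else 0)" if "j \<noteq> i"
    proof (cases "j = Suc i")
      case True
      then show ?thesis using stop hv ik by (auto simp: sel_prob_def stop_prob_def)
    next
      case False
      have "sel_prob U kmax lu (Suc i) lo' j = 0"
      proof (rule ccontr)
        assume "sel_prob U kmax lu (Suc i) lo' j \<noteq> 0"
        then obtain c where c: "Suc i \<le> j" "j \<le> kmax" "c < 2 ^ (j - Suc i)" "lo' = lu - int c * 2 ^ Suc i" "halves U lo' j"
          by (auto simp: sel_prob_def split: if_splits)
        then have "no_sub U (lo' + int c * 2 ^ Suc i) (Suc i)" using False by (intro halves_block) auto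
        then have "\<not> U lu (Suc i)" using c(4) by simp
        then show False using stop c False by simp
      qed
      then show ?thesis using False by simp
    qed
    show ?thesis using stop l' j0 by (auto simp: pmf_return indicator_def)
  next
    case False
    have "no_sub U lu (Suc i)" using side ns l' False by auto
    then have "pmf S (blk lo' j) = sel_prob U kmax lu (Suc i) lo' j" using IH False ik by simp
    moreover have "sel_prob U kmax lu (Suc i) lo' j = 0" if "j = i" using that by (simp add: sel_prob_def)
    ultimately show ?thesis using False l' by auto
  qed
qed

text \<open>
  Every block of length \<open>2 ^ j > 2 ^ i\<close> that arises from the given one by doublings
  arises from exactly one of its two doublings, depending on the parity of the offset
  \<open>c\<close>.
\<close>

lemma sel_prob_step:
  assumes ns: "no_sub U lo i" and ik: "i < kmax"
  shows "sel_prob U kmax lo i lo' j =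
    ((if j = i then (if lo' = lo \<and> \<not> no_sub U (lo - 2 ^ i) i then 1 else 0) else sel_prob U kmax (lo - 2 ^ i) (Suc i) lo' j)
    + (if j = i then (if lo' = lo \<and> \<not> no_sub U (lo + 2 ^ i) i then 1 else 0) else sel_prob U kmax lo (Suc i) lo' j)) / 2"
proof (cases "j = i")
  case True
  have "\<not> U lo i" using ns by (cases i) auto
  then show ?thesis using True ns ik no_sub_imp_halves[OF ns] by (auto simp: sel_prob_def stop_prob_def)
next
  case False
  show ?thesis
  proof (cases "i < j \<and> j \<le> kmax \<and> halves U lo' j")
    case f: False
    then show ?thesis using False by (auto simp: sel_prob_def)
  next
    case True
    have p2: "(2::nat) ^ (j - i) = 2 * 2 ^ (j - Suc i)" "(2::real) ^ (j - i) = 2 * 2 ^ (j - Suc i)"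
      using True by (simp_all add: Suc_diff_Suc flip: power_Suc)
    define S where "S = stop_prob U kmax lo' j"
    let ?L = "\<exists>c<2 ^ (j - Suc i). lo' = (lo - 2 ^ i) - int c * 2 ^ Suc i"
    let ?R = "\<exists>c<2 ^ (j - Suc i). lo' = lo - int c * 2 ^ Suc i"
    have "(\<exists>c<2 ^ (j - i). lo' = lo - int c * 2 ^ i) \<longleftrightarrow> ?L \<or> ?R"
    proof
      assume "\<exists>c<2 ^ (j - i). lo' = lo - int c * 2 ^ i"
      then obtain c where c: "c < 2 ^ (j - i)" "lo' = lo - int c * 2 ^ i" by blast
      show "?L \<or> ?R"
      proof (cases "even c")
        case True
        then obtain b where "c = 2 * b" by blast
        then have ?R using c p2 by (intro exI[of _ b]) (auto simp: algebra_simps)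
        then show ?thesis ..
      next
        case False
        then obtain b where "c = 2 * b + 1" by (auto elim: oddE)
        then have ?L using c p2 by (intro exI[of _ b]) (auto simp: algebra_simps)
        then show ?thesis ..
      qed
    next
      assume "?L \<or> ?R"
      then show "\<exists>c<2 ^ (j - i). lo' = lo - int c * 2 ^ i"
      proof
        assume ?L then obtain b where "b < 2 ^ (j - Suc i)" "lo' = (lo - 2 ^ i) - int b * 2 ^ Suc i" by blast
        then show ?thesis using p2 by (intro exI[of _ "2 * b + 1"]) (auto simp: algebra_simps)
      next
        assume ?R then obtain b where "b < 2 ^ (j - Suc i)" "lo' = lo - int b * 2 ^ Suc i" by blast
        then show ?thesis using p2 by (intro exI[of _ "2 * b"]) (auto simp: algebra_simps)
      qed
    qed
    moreover have "\<not> (?L \<and> ?R)"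
    proof
      assume "?L \<and> ?R"
      then obtain b b' where "(lo - 2 ^ i) - int b * 2 ^ Suc i = lo - int b' * 2 ^ Suc i" by auto
      then have "2 ^ i * (2 * int b + 1) = 2 ^ i * (2 * int b')" by (simp add: algebra_simps)
      then have "2 * int b + 1 = 2 * int b'" by (subst (asm) mult_cancel_left) simp
      then show False by presburger
    qed
    ultimately show ?thesis
      using True False unfolding sel_prob_def p2 S_def[symmetric] by auto
  qed
qed

lemma pmf_select_orbit:
  assumes "i + r = kmax" "r \<ge> 1" "no_sub (Ut d h z) lo i"
  shows "pmf (select_orbit r d h kmax z (blk lo i)) (blk lo' j) = sel_prob (Ut d h z) kmax lo i lo' j"
  using assms
proof (induction r arbitrary: i lo)
  case 0 then show ?case by simp
next
  case (Suc r)
  let ?U = "Ut d h z"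
  have ik: "i < kmax" using Suc.prems by simp
  have IH: "pmf (select_orbit r d h kmax z (blk lu (Suc i))) (blk lo' j) = sel_prob ?U kmax lu (Suc i) lo' j"
    if "no_sub ?U lu (Suc i)" "Suc i < kmax" for lu
    using Suc.IH[of "Suc i" lu] Suc.prems that by simp
  have ne: "blk (lo - 2 ^ i) i \<noteq> blk (lo + 2 ^ i) i" by simp
  have br: "pmf (if \<not> no_sub ?U l' i then return_pmf (blk lo i)
       else if ?U lu (Suc i) \<or> Suc i = kmax then return_pmf (blk lu (Suc i))
       else select_orbit r d h kmax z (blk lu (Suc i))) (blk lo' j)
     = (if j = i then (if lo' = lo \<and> \<not> no_sub ?U l' i then 1 else 0) else sel_prob ?U kmax lu (Suc i) lo' j)"
    if "lu = lo \<and> l' = lo + 2 ^ i \<or> lu = lo - 2 ^ i \<and> l' = lo - 2 ^ i" for lu l'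
    by (rule sel_branch[OF Suc.prems(3) that ik]) (rule IH)
  have card_eq: "card (blk lu (Suc i)) = 2 ^ kmax \<longleftrightarrow> Suc i = kmax" for lu
    unfolding card_blk by (rule power_inject_exp) simp
  show ?case
    unfolding select_orbit_blk pmf_bind_two[OF ne] blk_Un_left blk_Un_right sub_uturn_blk card_eq Ut_def[symmetric]
      sel_prob_step[OF Suc.prems(3) ik]
    by (subst br, simp, subst br, simp, rule refl)
qed

lemma set_select_orbit:
  assumes "i + r = kmax"
  shows "I \<in> set_pmf (select_orbit r d h kmax z (blk lo i)) \<Longrightarrow> \<exists>lo' j. I = blk lo' j \<and> i \<le> j \<and> j \<le> kmax \<and> lo' \<le> lo \<and> lo + 2 ^ i \<le> lo' + 2 ^ j"
  using assms
proof (induction r arbitrary: i lo)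
  case 0 then show ?case by auto
next
  case (Suc r)
  have "set_pmf (pmf_of_set {blk (lo - 2 ^ i) i, blk (lo + 2 ^ i) i}) = {blk (lo - 2 ^ i) i, blk (lo + 2 ^ i) i}" by simp
  then consider "I = blk lo i" | lu where "lu = lo \<or> lu = lo - 2 ^ i" "I = blk lu (Suc i) \<or> I \<in> set_pmf (select_orbit r d h kmax z (blk lu (Suc i)))"
    using Suc.prems(1) unfolding select_orbit_blk set_bind_pmf
    by (auto simp: blk_Un_left blk_Un_right split: if_splits)
  then show ?case
  proof cases
    case 1 then show ?thesis using Suc.prems(2) by (intro exI[of _ lo] exI[of _ i]) auto
  next
    case 2
    from 2(2) show ?thesis
    proof
      assume "I = blk lu (Suc i)" then show ?thesis using Suc.prems(2) 2(1) by (intro exI[of _ lu] exI[of _ "Suc i"]) auto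
    next
      assume "I \<in> set_pmf (select_orbit r d h kmax z (blk lu (Suc i)))"
      from Suc.IH[OF this] Suc.prems(2) obtain lo' j where b: "I = blk lo' j" "Suc i \<le> j" "j \<le> kmax" "lo' \<le> lu" "lu + 2 ^ Suc i \<le> lo' + 2 ^ j" by auto
      have "(2::int) ^ i > 0" "(2::int) ^ Suc i = 2 * 2 ^ i" by simp_all
      then have "lo' \<le> lo" "lo + 2 ^ i \<le> lo' + 2 ^ j" using 2(1) b(4,5) by linarith+
      then show ?thesis using b by (intro exI[of _ lo'] exI[of _ j]) auto
    qed
  qed
qed

lemma Ut_singleton: "\<not> Ut d h z lo 0"
proof -
  have "{lo..<lo + 1} = {lo}" by auto
  then show ?thesis by (simp add: Ut_def uturn_def blk_def dot_def split: prod.split)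
qed

lemma pmf_orbit_law:
  assumes "kmax \<ge> 1"
  shows "pmf (orbit_law d h kmax z) (blk lo j) = (if j \<le> kmax \<and> 0 \<in> blk lo j then orbit_prob (Ut d h z) kmax lo j else 0)"
proof -
  have s: "{0::int} = blk 0 0" by (auto simp: blk_def)
  have "(\<exists>c<2 ^ (j - 0). lo = 0 - int c * 2 ^ 0) \<longleftrightarrow> 0 \<in> blk lo j"
  proof
    assume "\<exists>c<2 ^ (j - 0). lo = 0 - int c * 2 ^ 0"
    then obtain c where "c < 2 ^ j" "lo = - int c" by auto
    moreover then have "int c < 2 ^ j" by (metis of_nat_less_iff of_nat_numeral of_nat_power)
    ultimately show "0 \<in> blk lo j" by (auto simp: blk_def)
  next
    assume "0 \<in> blk lo j"
    then show "\<exists>c<2 ^ (j - 0). lo = 0 - int c * 2 ^ 0" by (intro exI[of _ "nat (- lo)"]) (auto simp: blk_def nat_less_iff)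
  qed
  then show ?thesis
    unfolding orbit_law_def s using assms pmf_select_orbit[of 0 kmax kmax d h z 0 lo j] Ut_singleton[of d h z 0]
    by (auto simp: sel_prob_def orbit_prob_def)
qed

lemma set_orbit_law:
  assumes "I \<in> set_pmf (orbit_law d h kmax z)"
  shows "\<exists>lo j. I = blk lo j \<and> j \<le> kmax \<and> 0 \<in> blk lo j"
proof -
  have s: "{0::int} = blk 0 0" by (auto simp: blk_def)
  from set_select_orbit[of 0 kmax kmax I d h z 0] assms[unfolded orbit_law_def s]
  obtain lo j where "I = blk lo j" "j \<le> kmax" "lo \<le> 0" "0 + 2 ^ 0 \<le> lo + 2 ^ j" by auto
  then show ?thesis by (intro exI[of _ lo] exI[of _ j]) (simp add: blk_def)
qed

section \<open>The transition operator\<close>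

definition orbits :: "nat \<Rightarrow> (int \<times> nat) set" where "orbits kmax = {(lo, j). j \<le> kmax \<and> 0 \<in> blk lo j}"

text \<open>
  A move records the selected orbit and the selected index. Keeping the orbit makes
  \<open>coef\<close> an explicit product, and turns the average over the random choices of one
  step into a finite sum.
\<close>

definition moves :: "nat \<Rightarrow> (int \<times> nat \<times> int) set" where
  "moves kmax = {(lo, j, i). j \<le> kmax \<and> 0 \<in> blk lo j \<and> i \<in> blk lo j}"

definition wgt :: "nat \<Rightarrow> real \<Rightarrow> phase_point \<Rightarrow> int \<Rightarrow> real" where
  "wgt d h z i = exp (hamiltonian d z - hamiltonian d (rot d h i z))"

definition coef :: "nat \<Rightarrow> real \<Rightarrow> nat \<Rightarrow> int \<times> nat \<times> int \<Rightarrow> phase_point \<Rightarrow> real" where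
  "coef d h kmax t z = (case t of (lo, j, i) \<Rightarrow>
     orbit_prob (Ut d h z) kmax lo j * (wgt d h z i / (\<Sum>k\<in>blk lo j. wgt d h z k)))"

definition dest :: "nat \<Rightarrow> real \<Rightarrow> int \<times> nat \<times> int \<Rightarrow> phase_point \<Rightarrow> nat \<Rightarrow> real" where
  "dest d h t z = fst (rot d h (snd (snd t)) z)"

text \<open>
  The action of the NUTS kernel on bounded test functions. The whole argument is carried out for
  this operator; measures enter only at the very end.
\<close>

definition Pop :: "nat \<Rightarrow> real \<Rightarrow> nat \<Rightarrow> ((nat \<Rightarrow> real) \<Rightarrow> real) \<Rightarrow> (nat \<Rightarrow> real) \<Rightarrow> real" where
  "Pop d h kmax f x = (\<integral>v. (\<Sum>t\<in>moves kmax. coef d h kmax t (x, v) * f (dest d h t (x, v))) \<partial>gauss d)"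

lemma finite_dy [simp]: "finite (orbits kmax)"
proof (rule finite_subset)
  show "orbits kmax \<subseteq> {- (2 ^ kmax)..0} \<times> {..kmax}"
  proof
    fix p assume "p \<in> orbits kmax"
    then obtain lo j where p: "p = (lo, j)" "j \<le> kmax" "0 \<in> blk lo j" by (auto simp: orbits_def)
    have "(2::int) ^ j \<le> 2 ^ kmax" using p by simp
    moreover have "lo \<le> 0" "- (2 ^ j) < lo" using p(3) by (auto simp: blk_def)
    ultimately have "- (2 ^ kmax) \<le> lo" by linarith
    then show "p \<in> {- (2 ^ kmax)..0} \<times> {..kmax}" using p(1,2) \<open>lo \<le> 0\<close> by simp
  qed
qed simp

lemma moves_alt: "moves kmax = (\<lambda>(p, i). (fst p, snd p, i)) ` (SIGMA p:orbits kmax. blk (fst p) (snd p))"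
  by (force simp: moves_def orbits_def)

lemma finite_moves [simp]: "finite (moves kmax)"
  unfolding moves_alt by (intro finite_imageI finite_SigmaI) auto

lemma sum_moves: "(\<Sum>t\<in>moves kmax. f t) = (\<Sum>(lo, j)\<in>orbits kmax. \<Sum>i\<in>blk lo j. f (lo, j, i))"
proof -
  have "inj_on (\<lambda>(p, i). (fst p, snd p, i)) (SIGMA p:orbits kmax. blk (fst p) (snd p))" by (auto simp: inj_on_def)
  then show ?thesis
    unfolding moves_alt by (subst sum.reindex) (auto simp: sum.Sigma case_prod_beta intro!: sum.cong)
qed

lemma wgt_pos: "wgt d h z i > 0" by (simp add: wgt_def)

lemma sum_wgt_pos: "(\<Sum>k\<in>blk lo j. wgt d h z k) > 0"
  by (intro sum_pos wgt_pos) auto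

lemma coef_nonneg: "0 \<le> coef d h kmax t z"
  by (auto simp: coef_def orbit_prob_nonneg sum_wgt_pos wgt_pos less_imp_le split: prod.split intro!: mult_nonneg_nonneg divide_nonneg_nonneg)

locale nuts =
  fixes d :: nat and h :: real and kmax :: nat
  assumes h_pos: "0 < h" and h_le: "h \<le> 1" and kmax_pos: "kmax \<ge> 1" and d_pos: "d \<ge> 1"
begin

abbreviation "G2 \<equiv> gauss d \<Otimes>\<^sub>M gauss d"

lemma space_G2: "space G2 = phase_space d" by (rule space_phase[OF h_pos h_le])

lemma ham_eq: "hamiltonian d z = dot d (fst z) (fst z) / 2 + dot d (snd z) (snd z) / 2"
  by (rule hamiltonian_eq[OF h_pos h_le])

lemma iter_rot: "z \<in> phase_space d \<Longrightarrow> leapfrog_iter d h L z = rot d h L z"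
  by (rule leapfrog_iter_eq_rot[OF h_pos h_le])

lemma rot_rot: "rot d h a (rot d h b z) = rot d h (a + b) z"
  by (rule rot_add[OF h_pos h_le])

lemma meas_rot [measurable]: "rot d h L \<in> measurable G2 G2" by (rule measurable_rot[OF h_pos h_le])

lemma meas_rot_fst [measurable]: "(\<lambda>z. fst (rot d h L z)) \<in> measurable G2 (Rd d)"
  and meas_rot_snd [measurable]: "(\<lambda>z. snd (rot d h L z)) \<in> measurable G2 (Rd d)"
  unfolding rot_def fst_conv snd_conv by measurable

lemma index_weight_wgt: "z \<in> phase_space d \<Longrightarrow> index_weight d h z i = wgt d h z i"
  by (simp add: index_weight_def wgt_def iter_rot)

text \<open>
  The differences of positions are only taken on coordinates below \<open>d\<close> by the inner
  product, so the extensional difference \<open>lin d 1 (- 1)\<close> may replace the plain one.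
\<close>

lemma Ut_iff:
  assumes "z \<in> phase_space d"
  shows "Ut d h z lo j \<longleftrightarrow>
    (let p = rot d h (lo + 2 ^ j - 1) z; m = rot d h lo z in
      dot d (snd p) (lin d 1 (- 1) (fst p) (fst m)) < 0 \<or> dot d (snd m) (lin d 1 (- 1) (fst p) (fst m)) < 0)"
proof -
  have "dot d v (lin d 1 (- 1) x y) = dot d v (\<lambda>i. x i - y i)" for v x y by (simp add: dot_def lin_def)
  then show ?thesis
    using assms by (simp add: Ut_def uturn_def Max_blk iter_rot Let_def case_prod_beta)
qed

text \<open>
  Shifting the starting point along its orbit shifts the indices. Together with the fact that
  \<open>orbit_prob\<close> does not see the position of \<open>0\<close>, this gives detailed
  balance.
\<close>

lemma Ut_rot: "z \<in> phase_space d \<Longrightarrow> Ut d h (rot d h L z) lo j = Ut d h z (lo + L) j"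
  by (simp add: Ut_iff rot_rot Let_def algebra_simps)

lemma no_sub_shift: "(\<And>lo j. U' lo j = U (lo + L) j) \<Longrightarrow> no_sub U' lo j = no_sub U (lo + L) j"
  by (induction j arbitrary: lo) (simp_all add: algebra_simps)

lemma orbit_prob_shift:
  assumes "\<And>lo j. U' lo j = U (lo + L) j" shows "orbit_prob U' kmax lo j = orbit_prob U kmax (lo + L) j"
proof -
  note ns = no_sub_shift[of U' U L, OF assms]
  have "halves U' lo j = halves U (lo + L) j" by (cases j) (simp_all add: ns algebra_simps)
  moreover have "stop_prob U' kmax lo j = stop_prob U kmax (lo + L) j" by (simp add: stop_prob_def ns assms algebra_simps)
  ultimately show ?thesis by (simp add: orbit_prob_def)
qed

lemma meas_wgt [measurable]: "(\<lambda>z. wgt d h z i) \<in> borel_measurable G2"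
  unfolding wgt_def ham_eq by measurable

lemma meas_Ut [measurable]: "(\<lambda>z. Ut d h z lo j) \<in> measurable G2 (count_space UNIV)"
proof -
  have "(\<lambda>z. let p = rot d h (lo + 2 ^ j - 1) z; m = rot d h lo z in
      dot d (snd p) (lin d 1 (- 1) (fst p) (fst m)) < 0 \<or> dot d (snd m) (lin d 1 (- 1) (fst p) (fst m)) < 0) \<in> measurable G2 (count_space UNIV)"
    unfolding Let_def by measurable
  then show ?thesis
    by (rule measurable_cong[THEN iffD1, rotated]) (simp add: Ut_iff space_G2)
qed

lemma meas_no_sub [measurable]: "(\<lambda>z. no_sub (Ut d h z) lo j) \<in> measurable G2 (count_space UNIV)"
  by (induction j arbitrary: lo) simp_all

lemma meas_orbit_prob [measurable]: "(\<lambda>z. orbit_prob (Ut d h z) kmax lo j) \<in> borel_measurable G2"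
proof -
  have [measurable]: "(\<lambda>z. halves (Ut d h z) lo j) \<in> measurable G2 (count_space UNIV)"
    by (cases j) simp_all
  show ?thesis unfolding orbit_prob_def stop_prob_def by measurable
qed

lemma meas_coef [measurable]: "coef d h kmax t \<in> borel_measurable G2"
  unfolding coef_def by (cases t) simp

lemma meas_dest [measurable]: "dest d h t \<in> measurable G2 (Rd d)"
proof -
  show ?thesis unfolding dest_def[abs_def] by measurable
qed

lemma dest_in_space [simp]: "dest d h t z \<in> space (Rd d)" by (simp add: dest_def rot_def)

section \<open>The kernel in terms of moves\<close>

definition step_law :: "phase_point \<Rightarrow> (nat \<Rightarrow> real) measure" where
  "step_law z = distr (measure_pmf (bind_pmf (orbit_law d h kmax z) (index_law d h z))) (Rd d) (\<lambda>L. fst (leapfrog_iter d h L z))"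

lemma pmf_index_law:
  assumes z: "z \<in> phase_space d" and I: "I = blk lo j"
  shows "pmf (index_law d h z I) i = (if i \<in> I then wgt d h z i / (\<Sum>k\<in>I. wgt d h z k) else 0)"
  unfolding index_law_def index_weight_wgt[OF z] I
proof (rule pmf_embed_pmf)
  let ?S = "\<Sum>k\<in>blk lo j. wgt d h z k"
  show "0 \<le> (if i \<in> blk lo j then wgt d h z i / ?S else 0)" for i
    using sum_wgt_pos[of d h z lo j] wgt_pos[of d h z i] by simp
  have "(\<integral>\<^sup>+i. ennreal (if i \<in> blk lo j then wgt d h z i / ?S else 0) \<partial>count_space UNIV)
      = (\<Sum>i\<in>blk lo j. ennreal (if i \<in> blk lo j then wgt d h z i / ?S else 0))"
    by (rule nn_integral_count_space') auto
  also have "\<dots> = (\<Sum>i\<in>blk lo j. ennreal (wgt d h z i / ?S))" by (rule sum.cong) auto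
  also have "\<dots> = ennreal (\<Sum>i\<in>blk lo j. wgt d h z i / ?S)"
    using sum_wgt_pos[of d h z lo j] wgt_pos[of d h z] by (intro sum_ennreal) (simp add: less_imp_le)
  also have "(\<Sum>i\<in>blk lo j. wgt d h z i / ?S) = 1"
    using sum_wgt_pos[of d h z lo j] by (simp flip: sum_divide_distrib)
  finally show "(\<integral>\<^sup>+i. ennreal (if i \<in> blk lo j then wgt d h z i / ?S else 0) \<partial>count_space UNIV) = 1" by simp
qed

lemma nn_integral_step_law:
  assumes z: "z \<in> phase_space d" and f: "f \<in> borel_measurable (Rd d)"
  shows "(\<integral>\<^sup>+y. f y \<partial>step_law z) = (\<Sum>t\<in>moves kmax. f (dest d h t z) * ennreal (coef d h kmax t z))"
proof -
  have m: "(\<lambda>L. fst (leapfrog_iter d h L z)) \<in> measurable (measure_pmf p) (Rd d)" for p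
    using z by (auto simp: measurable_def iter_rot rot_def)
  define g where "g = (\<lambda>L. f (fst (leapfrog_iter d h L z)))"
  have inner: "(\<integral>\<^sup>+L. g L \<partial>measure_pmf (index_law d h z (blk lo j))) = (\<Sum>i\<in>blk lo j. g i * ennreal (wgt d h z i / (\<Sum>k\<in>blk lo j. wgt d h z k)))" for lo j
  proof (subst nn_integral_measure_pmf_support[of "blk lo j"])
    show "g x = 0" if "x \<in> set_pmf (index_law d h z (blk lo j))" "x \<notin> blk lo j" for x
      using that pmf_index_law[OF z refl, of lo j x] by (simp add: set_pmf_iff)
    show "(\<Sum>x\<in>blk lo j. g x * ennreal (pmf (index_law d h z (blk lo j)) x)) = (\<Sum>i\<in>blk lo j. g i * ennreal (wgt d h z i / (\<Sum>k\<in>blk lo j. wgt d h z k)))"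
      by (intro sum.cong) (auto simp: pmf_index_law[OF z refl])
  qed auto
  have "(\<integral>\<^sup>+y. f y \<partial>step_law z) = (\<integral>\<^sup>+L. g L \<partial>measure_pmf (bind_pmf (orbit_law d h kmax z) (index_law d h z)))"
    unfolding step_law_def g_def by (rule nn_integral_distr[OF m]) (use f in simp)
  also have "\<dots> = (\<integral>\<^sup>+I. \<integral>\<^sup>+L. g L \<partial>measure_pmf (index_law d h z I) \<partial>measure_pmf (orbit_law d h kmax z))"
    by (rule nn_integral_bind_pmf)
  also have "\<dots> = (\<Sum>I\<in>(\<lambda>(lo, j). blk lo j) ` orbits kmax. (\<integral>\<^sup>+L. g L \<partial>measure_pmf (index_law d h z I)) * ennreal (pmf (orbit_law d h kmax z) I))"
    by (rule nn_integral_measure_pmf_support) (auto dest!: set_orbit_law simp: orbits_def intro: finite_imageI[OF finite_dy, unfolded orbits_def])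
  also have "\<dots> = (\<Sum>(lo, j)\<in>orbits kmax. (\<integral>\<^sup>+L. g L \<partial>measure_pmf (index_law d h z (blk lo j))) * ennreal (pmf (orbit_law d h kmax z) (blk lo j)))"
    by (subst sum.reindex) (auto simp: inj_on_def case_prod_beta)
  also have "\<dots> = (\<Sum>(lo, j)\<in>orbits kmax. \<Sum>i\<in>blk lo j. f (dest d h (lo, j, i) z) * ennreal (coef d h kmax (lo, j, i) z))"
  proof (intro sum.cong refl, clarify)
    fix lo j assume "(lo, j) \<in> orbits kmax"
    then have p: "pmf (orbit_law d h kmax z) (blk lo j) = orbit_prob (Ut d h z) kmax lo j"
      by (simp add: pmf_orbit_law[OF kmax_pos] orbits_def)
    show "(\<integral>\<^sup>+L. g L \<partial>measure_pmf (index_law d h z (blk lo j))) * ennreal (pmf (orbit_law d h kmax z) (blk lo j))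
      = (\<Sum>i\<in>blk lo j. f (dest d h (lo, j, i) z) * ennreal (coef d h kmax (lo, j, i) z))"
      unfolding inner p sum_distrib_right
    proof (intro sum.cong refl)
      fix i assume "i \<in> blk lo j"
      have e: "ennreal (coef d h kmax (lo, j, i) z) = ennreal (orbit_prob (Ut d h z) kmax lo j) * ennreal (wgt d h z i / (\<Sum>k\<in>blk lo j. wgt d h z k))"
        unfolding coef_def prod.case
        using sum_wgt_pos[of d h z lo j] wgt_pos[of d h z i] by (intro ennreal_mult orbit_prob_nonneg) simp
      show "g i * ennreal (wgt d h z i / (\<Sum>k\<in>blk lo j. wgt d h z k)) * ennreal (orbit_prob (Ut d h z) kmax lo j)
        = f (dest d h (lo, j, i) z) * ennreal (coef d h kmax (lo, j, i) z)"
        unfolding e by (simp add: g_def dest_def iter_rot[OF z] mult_ac)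
    qed
  qed
  finally show ?thesis unfolding sum_moves .
qed

lemma prob_space_step_law: "z \<in> phase_space d \<Longrightarrow> prob_space (step_law z)"
  unfolding step_law_def
  by (intro prob_space.prob_space_distr measure_pmf.prob_space_axioms) (auto simp: measurable_def iter_rot rot_def)

lemma sets_step_law [simp]: "sets (step_law z) = sets (Rd d)" by (simp add: step_law_def)

lemma sum_coef:
  assumes "z \<in> phase_space d" shows "(\<Sum>t\<in>moves kmax. coef d h kmax t z) = 1"
proof -
  have "ennreal (\<Sum>t\<in>moves kmax. coef d h kmax t z) = (\<Sum>t\<in>moves kmax. 1 * ennreal (coef d h kmax t z))"
    by (simp add: sum_ennreal coef_nonneg)
  also have "\<dots> = (\<integral>\<^sup>+y. 1 \<partial>step_law z)" using nn_integral_step_law[OF assms, of "\<lambda>_. 1"] by simp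
  also have "\<dots> = 1" using prob_space.emeasure_space_1[OF prob_space_step_law[OF assms]] by simp
  finally show ?thesis by (simp add: ennreal_eq_1 sum_nonneg coef_nonneg)
qed

lemma meas_step_law [measurable]: "step_law \<in> measurable G2 (subprob_algebra (Rd d))"
proof (rule measurable_subprob_algebra)
  fix z assume "z \<in> space G2"
  then show "subprob_space (step_law z)" by (intro prob_space_imp_subprob_space prob_space_step_law) (simp add: space_G2)
next
  fix A assume A: "A \<in> sets (Rd d)"
  have "(\<lambda>z. \<Sum>t\<in>moves kmax. indicator A (dest d h t z) * ennreal (coef d h kmax t z)) \<in> borel_measurable G2"
    using A by measurable
  then show "(\<lambda>z. emeasure (step_law z) A) \<in> borel_measurable G2"
  proof (rule measurable_cong[THEN iffD1, rotated])
    fix z assume "z \<in> space G2"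
    then show "(\<Sum>t\<in>moves kmax. indicator A (dest d h t z) * ennreal (coef d h kmax t z)) = emeasure (step_law z) A"
      using nn_integral_step_law[of z "indicator A"] A by (simp add: space_G2)
  qed
qed simp

lemma nuts_kernel_eq: "nuts_kernel d h kmax x = gauss d \<bind> (\<lambda>v. step_law (x, v))"
  by (simp add: nuts_kernel_def step_law_def)

lemma meas_kernel [measurable]: "nuts_kernel d h kmax \<in> measurable (Rd d) (subprob_algebra (Rd d))"
proof -
  have 1: "(\<lambda>x. gauss d) \<in> measurable (Rd d) (subprob_algebra (gauss d))"
    using prob_space_imp_subprob_space[OF prob_space_gauss[of d]] by (intro measurable_const) (simp add: space_subprob_algebra)
  have "G2 = G2" ..
  have "sets (Rd d \<Otimes>\<^sub>M gauss d) = sets G2" by (rule sets_pair_measure_cong) auto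
  then have 2: "case_prod (\<lambda>x v. step_law (x, v)) \<in> measurable (Rd d \<Otimes>\<^sub>M gauss d) (subprob_algebra (Rd d))"
    using meas_step_law measurable_cong_sets[of "Rd d \<Otimes>\<^sub>M gauss d" G2] by auto
  show ?thesis unfolding nuts_kernel_eq[abs_def] by (rule measurable_bind'[OF 1 2])
qed

lemma nn_integral_kernel:
  assumes x: "x \<in> space (Rd d)" and f: "f \<in> borel_measurable (Rd d)"
  shows "(\<integral>\<^sup>+y. f y \<partial>nuts_kernel d h kmax x) = (\<integral>\<^sup>+v. (\<Sum>t\<in>moves kmax. f (dest d h t (x, v)) * ennreal (coef d h kmax t (x, v))) \<partial>gauss d)"
proof -
  have x': "x \<in> space (gauss d)" using x by simp
  have m: "(\<lambda>v. step_law (x, v)) \<in> measurable (gauss d) (subprob_algebra (Rd d))"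
    by (rule measurable_compose[OF measurable_Pair1'[OF x'] meas_step_law])
  show ?thesis
    unfolding nuts_kernel_eq nn_integral_bind[OF f m]
    using x by (intro nn_integral_cong nn_integral_step_law f) (simp add: phase_space_def)
qed

text \<open>
  Test functions. Boundedness is required only on the space of \<open>d\<close>-tuples, as
  functions are arbitrary outside of it.
\<close>

definition test_fn :: "((nat \<Rightarrow> real) \<Rightarrow> real) \<Rightarrow> bool" where
  "test_fn f \<longleftrightarrow> f \<in> borel_measurable (Rd d) \<and> (\<exists>B. \<forall>x\<in>space (Rd d). \<bar>f x\<bar> \<le> B)"

lemma meas_section:
  assumes f: "f \<in> borel_measurable (Rd d)" and x: "x \<in> space (Rd d)"
  shows "(\<lambda>v. coef d h kmax t (x, v) * f (dest d h t (x, v))) \<in> borel_measurable (gauss d)"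
proof -
  have m: "(\<lambda>z. coef d h kmax t z * f (dest d h t z)) \<in> borel_measurable G2" using f by measurable
  have x': "x \<in> space (gauss d)" using x by simp
  show ?thesis by (rule measurable_compose[OF measurable_Pair1'[OF x'] m])
qed

lemma coef_le_1: "z \<in> phase_space d \<Longrightarrow> t \<in> moves kmax \<Longrightarrow> coef d h kmax t z \<le> 1"
  using sum_coef[of z] member_le_sum[of t "moves kmax" "\<lambda>t. coef d h kmax t z"] coef_nonneg by simp

lemma integrable_coef:
  assumes f: "test_fn f" and x: "x \<in> space (Rd d)" and t: "t \<in> moves kmax"
  shows "integrable (gauss d) (\<lambda>v. coef d h kmax t (x, v) * f (dest d h t (x, v)))"
proof -
  interpret prob_space "gauss d" by (rule prob_space_gauss)
  from f obtain B where B: "\<And>x. x \<in> space (Rd d) \<Longrightarrow> \<bar>f x\<bar> \<le> B" by (auto simp: test_fn_def)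
  show ?thesis
  proof (rule integrable_const_bound[where B=B])
    show "AE v in gauss d. norm (coef d h kmax t (x, v) * f (dest d h t (x, v))) \<le> B"
    proof (rule AE_I2)
      fix v assume "v \<in> space (gauss d)"
      then have "coef d h kmax t (x, v) \<le> 1" using x t by (intro coef_le_1) (auto simp: phase_space_def)
      then have "\<bar>coef d h kmax t (x, v)\<bar> * \<bar>f (dest d h t (x, v))\<bar> \<le> 1 * B"
        using coef_nonneg[of d h kmax t "(x, v)"] B[of "dest d h t (x, v)"] by (intro mult_mono) auto
      then show "norm (coef d h kmax t (x, v) * f (dest d h t (x, v))) \<le> B" by (simp add: abs_mult)
    qed
  qed (use f x in \<open>auto intro!: meas_section simp: test_fn_def\<close>)
qed

lemma integrable_step:
  assumes "test_fn f" "x \<in> space (Rd d)"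
  shows "integrable (gauss d) (\<lambda>v. \<Sum>t\<in>moves kmax. coef d h kmax t (x, v) * f (dest d h t (x, v)))"
  using assms by (intro Bochner_Integration.integrable_sum integrable_coef) auto

lemma Pop_cong: "x \<in> space (Rd d) \<Longrightarrow> (\<And>y. y \<in> space (Rd d) \<Longrightarrow> f y = g y) \<Longrightarrow> Pop d h kmax f x = Pop d h kmax g x"
  unfolding Pop_def by (intro Bochner_Integration.integral_cong sum.cong) auto

lemma sum_coef_le:
  assumes "z \<in> phase_space d" "\<And>t. t \<in> moves kmax \<Longrightarrow> g t \<le> c"
  shows "(\<Sum>t\<in>moves kmax. coef d h kmax t z * g t) \<le> c"
proof -
  have "(\<Sum>t\<in>moves kmax. coef d h kmax t z * g t) \<le> (\<Sum>t\<in>moves kmax. coef d h kmax t z * c)"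
    by (intro sum_mono mult_left_mono assms coef_nonneg)
  also have "\<dots> = c" by (simp add: sum_coef[OF assms(1)] flip: sum_distrib_right)
  finally show ?thesis .
qed

lemma Pop_mono:
  assumes "test_fn f" "test_fn g" "x \<in> space (Rd d)" "\<And>y. y \<in> space (Rd d) \<Longrightarrow> f y \<le> g y"
  shows "Pop d h kmax f x \<le> Pop d h kmax g x"
  unfolding Pop_def using assms
  by (intro integral_mono integrable_step sum_mono mult_left_mono coef_nonneg) auto

lemma Pop_const: "x \<in> space (Rd d) \<Longrightarrow> Pop d h kmax (\<lambda>_. c) x = c"
proof -
  interpret prob_space "gauss d" by (rule prob_space_gauss)
  assume x: "x \<in> space (Rd d)"
  have "Pop d h kmax (\<lambda>_. c) x = (\<integral>v. c \<partial>gauss d)"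
    unfolding Pop_def using x
    by (intro Bochner_Integration.integral_cong refl) (simp add: sum_coef phase_space_def flip: sum_distrib_right)
  then show ?thesis using prob_space by simp
qed

lemma tf_const [simp]: "test_fn (\<lambda>_. c)" by (auto simp: test_fn_def)

lemma tf_lin: assumes "test_fn f" "test_fn g" shows "test_fn (\<lambda>x. a * f x + b * g x)"
proof -
  from assms obtain B C where "\<And>x. x \<in> space (Rd d) \<Longrightarrow> \<bar>f x\<bar> \<le> B" "\<And>x. x \<in> space (Rd d) \<Longrightarrow> \<bar>g x\<bar> \<le> C" by (auto simp: test_fn_def)
  then have "\<bar>a * f x + b * g x\<bar> \<le> \<bar>a\<bar> * B + \<bar>b\<bar> * C" if "x \<in> space (Rd d)" for x
    using that by (intro order_trans[OF abs_triangle_ineq] add_mono) (auto simp: abs_mult intro!: mult_left_mono)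
  moreover have "(\<lambda>x. a * f x + b * g x) \<in> borel_measurable (Rd d)" using assms by (auto simp: test_fn_def)
  ultimately show ?thesis by (auto simp: test_fn_def)
qed

lemma Pop_lin:
  assumes "test_fn f" "test_fn g" "x \<in> space (Rd d)"
  shows "Pop d h kmax (\<lambda>y. a * f y + b * g y) x = a * Pop d h kmax f x + b * Pop d h kmax g x"
proof -
  have "Pop d h kmax (\<lambda>y. a * f y + b * g y) x
     = (\<integral>v. a * (\<Sum>t\<in>moves kmax. coef d h kmax t (x, v) * f (dest d h t (x, v))) + b * (\<Sum>t\<in>moves kmax. coef d h kmax t (x, v) * g (dest d h t (x, v))) \<partial>gauss d)"
    unfolding Pop_def by (intro Bochner_Integration.integral_cong refl) (simp add: sum_distrib_left sum.distrib algebra_simps)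
  also have "\<dots> = a * Pop d h kmax f x + b * Pop d h kmax g x"
    unfolding Pop_def using integrable_step[OF assms(1,3)] integrable_step[OF assms(2,3)] by simp
  finally show ?thesis .
qed

lemma tf_Pop: assumes f: "test_fn f" shows "test_fn (Pop d h kmax f)"
proof -
  interpret prob_space "gauss d" by (rule prob_space_gauss)
  from f obtain B where B: "\<And>x. x \<in> space (Rd d) \<Longrightarrow> \<bar>f x\<bar> \<le> B" and [measurable]: "f \<in> borel_measurable (Rd d)" by (auto simp: test_fn_def)
  have "sets (Rd d \<Otimes>\<^sub>M gauss d) = sets G2" by (rule sets_pair_measure_cong) auto
  moreover have "(\<lambda>z. \<Sum>t\<in>moves kmax. coef d h kmax t z * f (dest d h t z)) \<in> borel_measurable G2" by measurable
  ultimately have "(\<lambda>(x, v). \<Sum>t\<in>moves kmax. coef d h kmax t (x, v) * f (dest d h t (x, v))) \<in> borel_measurable (Rd d \<Otimes>\<^sub>M gauss d)"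
    using measurable_cong_sets[of "Rd d \<Otimes>\<^sub>M gauss d" G2] by (auto simp: case_prod_beta')
  then have "Pop d h kmax f \<in> borel_measurable (Rd d)" unfolding Pop_def[abs_def] by (rule borel_measurable_lebesgue_integral)
  moreover have "\<bar>Pop d h kmax f x\<bar> \<le> B" if x: "x \<in> space (Rd d)" for x
  proof -
    have "Pop d h kmax f x \<le> Pop d h kmax (\<lambda>_. B) x" using B f x by (intro Pop_mono) (auto simp: abs_le_iff)
    moreover have "Pop d h kmax (\<lambda>_. - B) x \<le> Pop d h kmax f x" using B f x by (intro Pop_mono) (auto simp: abs_le_iff minus_le_iff)
    ultimately show ?thesis using x by (simp add: Pop_const abs_le_iff)
  qed
  ultimately show ?thesis by (auto simp: test_fn_def)
qed

lemma nn_integral_kernel_real: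
  assumes x: "x \<in> space (Rd d)" and f: "test_fn f" and nn: "\<And>y. y \<in> space (Rd d) \<Longrightarrow> 0 \<le> f y"
  shows "(\<integral>\<^sup>+y. ennreal (f y) \<partial>nuts_kernel d h kmax x) = ennreal (Pop d h kmax f x)"
proof -
  have "(\<integral>\<^sup>+y. ennreal (f y) \<partial>nuts_kernel d h kmax x) = (\<integral>\<^sup>+v. ennreal (\<Sum>t\<in>moves kmax. coef d h kmax t (x, v) * f (dest d h t (x, v))) \<partial>gauss d)"
    using f x nn
    by (subst nn_integral_kernel) (auto simp: test_fn_def ennreal_mult[symmetric] coef_nonneg mult.commute intro!: nn_integral_cong sum_ennreal)
  also have "\<dots> = ennreal (Pop d h kmax f x)"
    unfolding Pop_def using nn coef_nonneg
    by (intro nn_integral_eq_integral integrable_step f x AE_I2 sum_nonneg mult_nonneg_nonneg) auto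
  finally show ?thesis .
qed

lemma Pop_nonneg: "x \<in> space (Rd d) \<Longrightarrow> test_fn f \<Longrightarrow> (\<And>y. y \<in> space (Rd d) \<Longrightarrow> 0 \<le> f y) \<Longrightarrow> 0 \<le> Pop d h kmax f x"
  using Pop_mono[of "\<lambda>_. 0" f x] by (simp add: Pop_const)

end

context nuts begin

section \<open>Invariance of the Gaussian\<close>

lemma wgt_rot:
  "wgt d h (rot d h L z) i = exp (hamiltonian d (rot d h L z) - hamiltonian d z) * wgt d h z (i + L)"
  by (simp add: wgt_def rot_rot mult_exp_exp add.commute)

text \<open>
  Detailed balance for a single move: the move \<open>(lo, j, i)\<close> seen from its starting
  point and the reversed move \<open>(lo - i, j, - i)\<close> seen from its end point have the
  same probability up to the ratio of the Gaussian densities.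
\<close>

lemma coef_rot:
  assumes z: "z \<in> phase_space d"
  shows "coef d h kmax (lo, j, i) (rot d h (- i) z) * exp (hamiltonian d z - hamiltonian d (rot d h (- i) z)) = coef d h kmax (lo - i, j, - i) z"
proof -
  let ?e = "exp (hamiltonian d (rot d h (- i) z) - hamiltonian d z)"
  have o: "orbit_prob (Ut d h (rot d h (- i) z)) kmax lo j = orbit_prob (Ut d h z) kmax (lo - i) j"
    using orbit_prob_shift[of "Ut d h (rot d h (- i) z)" "Ut d h z" "- i"] Ut_rot[OF z] by simp
  have S: "(\<Sum>k\<in>blk lo j. wgt d h (rot d h (- i) z) k) = ?e * (\<Sum>k\<in>blk (lo - i) j. wgt d h z k)"
  proof -
    have "(\<Sum>k\<in>blk (lo - i) j. wgt d h z k) = (\<Sum>k\<in>(\<lambda>k. k - i) ` blk lo j. wgt d h z k)"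
      by (simp add: blk_shift_minus)
    also have "\<dots> = (\<Sum>k\<in>blk lo j. wgt d h z (k - i))" by (subst sum.reindex) (auto simp: inj_on_def)
    finally show ?thesis by (simp add: wgt_rot sum_distrib_left)
  qed
  have w0: "wgt d h (rot d h (- i) z) i = ?e"
    using rot_zero[OF z, of h] by (simp add: wgt_rot wgt_def rot_rot)
  have w1: "wgt d h z (- i) = exp (hamiltonian d z - hamiltonian d (rot d h (- i) z))" by (simp add: wgt_def)
  show ?thesis
    unfolding coef_def prod.case o S w0 w1 by simp
qed

lemma measurable_G2_fst: "f \<in> borel_measurable (Rd d) \<Longrightarrow> (\<lambda>z. f (fst z)) \<in> borel_measurable G2"
  by (rule measurable_compose[OF measurable_fst]) (simp cong: measurable_cong_sets)

lemma nn_integral_fst_G2: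
  assumes f: "f \<in> borel_measurable (Rd d)"
  shows "(\<integral>\<^sup>+z. f (fst z) \<partial>G2) = (\<integral>\<^sup>+x. f x \<partial>gauss d)"
  using sigma_finite_measure.nn_integral_fst[OF sigma_finite_gauss measurable_G2_fst[OF f]]
    prob_space.emeasure_space_1[OF prob_space_gauss[of d]] by simp

text \<open>
  By weighted invariance of the rotation, each move is exchanged with its reversed move by a
  change of variables. Reversal permutes the moves, and the coefficients of all moves sum to
  one.
\<close>

lemma gauss_invariant:
  assumes f: "test_fn f" and nn: "\<And>y. y \<in> space (Rd d) \<Longrightarrow> 0 \<le> f y"
  shows "(\<integral>\<^sup>+x. ennreal (Pop d h kmax f x) \<partial>gauss d) = (\<integral>\<^sup>+x. ennreal (f x) \<partial>gauss d)"
proof -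
  have [measurable]: "f \<in> borel_measurable (Rd d)" using f by (simp add: test_fn_def)
  have *: "(\<integral>\<^sup>+z. ennreal (f (dest d h (lo, j, i) z)) * ennreal (coef d h kmax (lo, j, i) z) \<partial>G2)
    = (\<integral>\<^sup>+z. ennreal (f (fst z)) * ennreal (coef d h kmax (lo - i, j, - i) z) \<partial>G2)" for lo j i
  proof -
    define F where "F = (\<lambda>z. ennreal (f (fst z)) * ennreal (coef d h kmax (lo - i, j, - i) z))"
    have F: "F \<in> borel_measurable G2" unfolding F_def by measurable
    have "(\<integral>\<^sup>+z. F z \<partial>G2) = (\<integral>\<^sup>+z. F (rot d h i z) * ennreal (exp (hamiltonian d z - hamiltonian d (rot d h i z))) \<partial>G2)"
      by (rule nn_integral_rot[OF h_pos h_le F, symmetric])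
    also have "\<dots> = (\<integral>\<^sup>+z. ennreal (f (dest d h (lo, j, i) z)) * ennreal (coef d h kmax (lo, j, i) z) \<partial>G2)"
    proof (rule nn_integral_cong)
      fix z assume z: "z \<in> space G2"
      then have "coef d h kmax (lo, j, i) z * exp (hamiltonian d (rot d h i z) - hamiltonian d z) = coef d h kmax (lo - i, j, - i) (rot d h i z)"
        using coef_rot[of "rot d h i z" lo j i] by (simp add: rot_rot rot_zero space_G2)
      then have c: "coef d h kmax (lo - i, j, - i) (rot d h i z) * exp (hamiltonian d z - hamiltonian d (rot d h i z)) = coef d h kmax (lo, j, i) z"
        by (simp flip: \<open>_ = coef d h kmax (lo - i, j, - i) (rot d h i z)\<close> add: mult.assoc mult_exp_exp)
      show "F (rot d h i z) * ennreal (exp (hamiltonian d z - hamiltonian d (rot d h i z))) = ennreal (f (dest d h (lo, j, i) z)) * ennreal (coef d h kmax (lo, j, i) z)"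
        unfolding F_def c[symmetric] by (simp add: dest_def mult.assoc ennreal_mult coef_nonneg)
    qed
    finally show ?thesis unfolding F_def by simp
  qed
  let ?flip = "\<lambda>(lo, j, i). (lo - i, j, - i :: int)"
  have bij: "bij_betw ?flip (moves kmax) (moves kmax)"
    by (rule bij_betw_byWitness[where f'="?flip"]) (auto simp: moves_def blk_def)
  have "(\<integral>\<^sup>+x. ennreal (Pop d h kmax f x) \<partial>gauss d) = (\<integral>\<^sup>+x. \<integral>\<^sup>+v. (\<Sum>t\<in>moves kmax. ennreal (f (dest d h t (x, v))) * ennreal (coef d h kmax t (x, v))) \<partial>gauss d \<partial>gauss d)"
    using f nn by (intro nn_integral_cong) (simp flip: nn_integral_kernel_real add: nn_integral_kernel)
  also have "\<dots> = (\<integral>\<^sup>+z. (\<Sum>t\<in>moves kmax. ennreal (f (dest d h t z)) * ennreal (coef d h kmax t z)) \<partial>G2)"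
    by (rule sigma_finite_measure.nn_integral_fst[OF sigma_finite_gauss]) measurable
  also have "\<dots> = (\<Sum>t\<in>moves kmax. \<integral>\<^sup>+z. ennreal (f (dest d h t z)) * ennreal (coef d h kmax t z) \<partial>G2)"
    by (rule nn_integral_sum) measurable
  also have "\<dots> = (\<Sum>t\<in>moves kmax. \<integral>\<^sup>+z. ennreal (f (fst z)) * ennreal (coef d h kmax (?flip t) z) \<partial>G2)"
    by (intro sum.cong refl) (use * in auto)
  also have "\<dots> = (\<Sum>t\<in>moves kmax. \<integral>\<^sup>+z. ennreal (f (fst z)) * ennreal (coef d h kmax t z) \<partial>G2)"
    by (rule sum.reindex_bij_betw[OF bij, where g="\<lambda>t. \<integral>\<^sup>+z. ennreal (f (fst z)) * ennreal (coef d h kmax t z) \<partial>G2"])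
  also have "\<dots> = (\<integral>\<^sup>+z. (\<Sum>t\<in>moves kmax. ennreal (f (fst z)) * ennreal (coef d h kmax t z)) \<partial>G2)"
    by (rule nn_integral_sum[symmetric]) measurable
  also have "\<dots> = (\<integral>\<^sup>+z. ennreal (f (fst z)) \<partial>G2)"
  proof (rule nn_integral_cong)
    fix z assume z: "z \<in> space G2"
    have "(\<Sum>t\<in>moves kmax. ennreal (coef d h kmax t z)) = 1"
      using sum_coef[of z] z by (simp add: sum_ennreal coef_nonneg space_G2)
    then show "(\<Sum>t\<in>moves kmax. ennreal (f (fst z)) * ennreal (coef d h kmax t z)) = ennreal (f (fst z))"
      by (simp flip: sum_distrib_left)
  qed
  also have "\<dots> = (\<integral>\<^sup>+x. ennreal (f x) \<partial>gauss d)" by (rule nn_integral_fst_G2) measurable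
  finally show ?thesis .
qed

section \<open>Equivariance under reflections\<close>

definition good_dir :: "(nat \<Rightarrow> real) \<Rightarrow> bool" where
  "good_dir e \<longleftrightarrow> e \<in> space (Rd d) \<and> (dot d e e = 1 \<or> dot d e e = 0)"

lemma rot_reflect: "rot d h L (reflect d e x, reflect d e v) = (reflect d e (fst (rot d h L (x, v))), reflect d e (snd (rot d h L (x, v))))"
  by (simp add: rot_def reflect_lin)

text \<open>
  U-turns and energies only depend on inner products, which reflections preserve.
\<close>

lemma coef_reflect:
  assumes e: "good_dir e" and x: "x \<in> space (Rd d)" and v: "v \<in> space (Rd d)"
  shows "coef d h kmax t (reflect d e x, reflect d e v) = coef d h kmax t (x, v)"
proof -
  have rd: "dot d (reflect d e x) (reflect d e y) = dot d x y" for x y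
    using e by (intro reflect_dot) (auto simp: good_dir_def)
  have "hamiltonian d (rot d h i (reflect d e x, reflect d e v)) = hamiltonian d (rot d h i (x, v))" for i
    by (simp add: rot_reflect ham_eq enorm_sq rd)
  moreover have "hamiltonian d (reflect d e x, reflect d e v) = hamiltonian d (x, v)" by (simp add: ham_eq enorm_sq rd)
  ultimately have w: "wgt d h (reflect d e x, reflect d e v) = wgt d h (x, v)" by (auto simp: wgt_def)
  have "Ut d h (reflect d e x, reflect d e v) lo j = Ut d h (x, v) lo j" for lo j
    using x v by (simp add: Ut_iff phase_space_def rot_reflect Let_def rd flip: reflect_lin)
  then have "Ut d h (reflect d e x, reflect d e v) = Ut d h (x, v)" by blast
  then show ?thesis by (simp add: coef_def w)
qed

lemma dest_reflect: "dest d h t (reflect d e x, reflect d e v) = reflect d e (dest d h t (x, v))"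
  by (simp add: dest_def rot_reflect)

lemma tf_reflect: "test_fn f \<Longrightarrow> e \<in> space (Rd d) \<Longrightarrow> test_fn (\<lambda>y. f (reflect d e y))"
proof -
  assume f: "test_fn f" and e: "e \<in> space (Rd d)"
  then obtain B where B: "\<And>x. x \<in> space (Rd d) \<Longrightarrow> \<bar>f x\<bar> \<le> B" and [measurable]: "f \<in> borel_measurable (Rd d)" by (auto simp: test_fn_def)
  have "(\<lambda>y. f (reflect d e y)) \<in> borel_measurable (Rd d)" using e by measurable
  moreover have "\<forall>x\<in>space (Rd d). \<bar>f (reflect d e x)\<bar> \<le> B" using B by simp
  ultimately show ?thesis unfolding test_fn_def by blast
qed

text \<open>
  The velocity is integrated out against a law that is invariant under the reflection, so that
  it may be reflected together with the position.
\<close>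

lemma Pop_reflect_nonneg:
  assumes e: "good_dir e" and x: "x \<in> space (Rd d)" and f: "test_fn f" and nn: "\<And>y. y \<in> space (Rd d) \<Longrightarrow> 0 \<le> f y"
  shows "Pop d h kmax f (reflect d e x) = Pop d h kmax (\<lambda>y. f (reflect d e y)) x"
proof (cases "dot d e e = 1")
  case True
  have es: "e \<in> space (Rd d)" using e by (simp add: good_dir_def)
  have [measurable]: "f \<in> borel_measurable (Rd d)" using f by (simp add: test_fn_def)
  define F where "F = (\<lambda>v. \<Sum>t\<in>moves kmax. ennreal (f (dest d h t (reflect d e x, v))) * ennreal (coef d h kmax t (reflect d e x, v)))"
  have rx: "reflect d e x \<in> space (gauss d)" by simp
  have F: "F \<in> borel_measurable (gauss d)"
    unfolding F_def
    by (rule measurable_compose[OF measurable_Pair1'[OF rx], of "\<lambda>z. \<Sum>t\<in>moves kmax. ennreal (f (dest d h t z)) * ennreal (coef d h kmax t z)"]) measurable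
  have "ennreal (Pop d h kmax f (reflect d e x)) = (\<integral>\<^sup>+v. F v \<partial>gauss d)"
    unfolding F_def using f nn by (simp flip: nn_integral_kernel_real add: nn_integral_kernel)
  also have "\<dots> = (\<integral>\<^sup>+v. F (reflect d e v) \<partial>gauss d)"
    by (rule gauss_reflect[OF es True, symmetric]) (use F in \<open>simp cong: measurable_cong_sets\<close>)
  also have "\<dots> = (\<integral>\<^sup>+v. (\<Sum>t\<in>moves kmax. ennreal (f (reflect d e (dest d h t (x, v)))) * ennreal (coef d h kmax t (x, v))) \<partial>gauss d)"
    by (rule nn_integral_cong) (simp add: F_def coef_reflect[OF e x] dest_reflect)
  also have "\<dots> = ennreal (Pop d h kmax (\<lambda>y. f (reflect d e y)) x)"
    using tf_reflect[OF f es] nn x by (simp flip: nn_integral_kernel_real add: nn_integral_kernel test_fn_def)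
  finally show ?thesis
    using f tf_reflect[OF f es] x nn by (subst (asm) ennreal_inj) (auto intro!: Pop_nonneg)
next
  case False
  then have "dot d e e = 0" using e by (auto simp: good_dir_def)
  then have r: "reflect d e y = y" if "y \<in> space (Rd d)" for y using that by (rule reflect_zero)
  show ?thesis unfolding r[OF x] by (rule Pop_cong[OF x]) (simp add: r)
qed

lemma Pop_reflect:
  assumes e: "good_dir e" and x: "x \<in> space (Rd d)" and f: "test_fn f"
  shows "Pop d h kmax f (reflect d e x) = Pop d h kmax (\<lambda>y. f (reflect d e y)) x"
proof -
  have es: "e \<in> space (Rd d)" using e by (simp add: good_dir_def)
  from f obtain B where B: "\<And>x. x \<in> space (Rd d) \<Longrightarrow> \<bar>f x\<bar> \<le> B" by (auto simp: test_fn_def)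
  define g where "g = (\<lambda>y. 1 * f y + B * 1)"
  have g: "test_fn g" unfolding g_def by (intro tf_lin f tf_const)
  have "Pop d h kmax g (reflect d e x) = Pop d h kmax (\<lambda>y. g (reflect d e y)) x"
  proof (rule Pop_reflect_nonneg[OF e x g])
    show "0 \<le> g y" if "y \<in> space (Rd d)" for y using B[OF that] by (simp add: g_def abs_le_iff)
  qed
  moreover have "Pop d h kmax g (reflect d e x) = 1 * Pop d h kmax f (reflect d e x) + B * Pop d h kmax (\<lambda>_. 1) (reflect d e x)"
    unfolding g_def by (rule Pop_lin) (use f in auto)
  moreover have "Pop d h kmax (\<lambda>y. g (reflect d e y)) x = 1 * Pop d h kmax (\<lambda>y. f (reflect d e y)) x + B * Pop d h kmax (\<lambda>_. 1) x"
    unfolding g_def by (rule Pop_lin) (use tf_reflect[OF f es] x in auto)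
  ultimately show ?thesis using x by (simp add: Pop_const)
qed

section \<open>Iterates of the transition operator\<close>

abbreviation Pit :: "nat \<Rightarrow> ((nat \<Rightarrow> real) \<Rightarrow> real) \<Rightarrow> (nat \<Rightarrow> real) \<Rightarrow> real" where
  "Pit n \<equiv> Pop d h kmax ^^ n"

lemma tf_Pit: "test_fn f \<Longrightarrow> test_fn (Pit n f)"
  by (induction n) (auto intro: tf_Pop)

lemma Pit_mono:
  assumes "test_fn f" "test_fn g" "x \<in> space (Rd d)" "\<And>y. y \<in> space (Rd d) \<Longrightarrow> f y \<le> g y"
  shows "Pit n f x \<le> Pit n g x"
  using assms by (induction n arbitrary: x) (auto intro!: Pop_mono tf_Pit)

lemma Pit_const: "x \<in> space (Rd d) \<Longrightarrow> Pit n (\<lambda>_. c) x = c"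
proof (induction n arbitrary: x)
  case (Suc n)
  then have "Pop d h kmax (Pit n (\<lambda>_. c)) x = Pop d h kmax (\<lambda>_. c) x" by (intro Pop_cong) auto
  then show ?case using Suc.prems by (simp add: Pop_const)
qed simp

lemma Pit_lin:
  assumes "test_fn f" "test_fn g" "x \<in> space (Rd d)"
  shows "Pit n (\<lambda>y. a * f y + b * g y) x = a * Pit n f x + b * Pit n g x"
  using assms(3)
proof (induction n arbitrary: x)
  case (Suc n)
  then have "Pit (Suc n) (\<lambda>y. a * f y + b * g y) x = Pop d h kmax (\<lambda>y. a * Pit n f y + b * Pit n g y) x"
    by (auto intro: Pop_cong)
  also have "\<dots> = a * Pit (Suc n) f x + b * Pit (Suc n) g x"
    using Pop_lin[OF tf_Pit[OF assms(1)] tf_Pit[OF assms(2)] Suc.prems] by simp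
  finally show ?case .
qed simp

lemma Pit_range:
  assumes "test_fn f" "x \<in> space (Rd d)" "\<And>y. y \<in> space (Rd d) \<Longrightarrow> a \<le> f y \<and> f y \<le> b"
  shows "a \<le> Pit n f x \<and> Pit n f x \<le> b"
  using Pit_mono[of "\<lambda>_. a" f x n] Pit_mono[of f "\<lambda>_. b" x n] assms by (simp add: Pit_const)

lemma gauss_invariant_Pit:
  assumes f: "test_fn f" and nn: "\<And>y. y \<in> space (Rd d) \<Longrightarrow> 0 \<le> f y"
  shows "(\<integral>\<^sup>+x. ennreal (Pit n f x) \<partial>gauss d) = (\<integral>\<^sup>+x. ennreal (f x) \<partial>gauss d)"
proof (induction n)
  case (Suc n)
  have "0 \<le> Pit n f y" if "y \<in> space (Rd d)" for y
    using Pit_mono[of "\<lambda>_. 0" f y n] f nn that by (simp add: Pit_const)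
  then show ?case using gauss_invariant[OF tf_Pit[OF f, of n]] Suc by simp
qed simp

lemma sets_nuts_law:
  assumes "sets \<nu> = sets (Rd d)" shows "sets (nuts_law d h kmax \<nu> n) = sets (Rd d)"
proof (induction n)
  case 0 then show ?case using assms by (simp add: nuts_law_def)
next
  case (Suc n)
  have "space (nuts_law d h kmax \<nu> n) = space (Rd d)" by (rule sets_eq_imp_space_eq[OF Suc])
  then have ne: "space (nuts_law d h kmax \<nu> n) \<noteq> {}" by (metis empty_iff lin_in_space)
  have "sets (nuts_law d h kmax \<nu> n \<bind> nuts_kernel d h kmax) = sets (Rd d)"
  proof (rule sets_bind[OF _ ne])
    fix x assume "x \<in> space (nuts_law d h kmax \<nu> n)"
    then show "sets (nuts_kernel d h kmax x) = sets (Rd d)"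
      using sets_kernel[OF meas_kernel] sets_eq_imp_space_eq[OF Suc] by auto
  qed
  then show ?case by (simp add: nuts_law_def)
qed

lemma nn_integral_nuts_law:
  assumes sets: "sets \<nu> = sets (Rd d)" and f: "test_fn f" and nn: "\<And>y. y \<in> space (Rd d) \<Longrightarrow> 0 \<le> f y"
  shows "(\<integral>\<^sup>+x. ennreal (f x) \<partial>nuts_law d h kmax \<nu> n) = (\<integral>\<^sup>+x. ennreal (Pit n f x) \<partial>\<nu>)"
  using f nn
proof (induction n arbitrary: f)
  case 0 then show ?case by (simp add: nuts_law_def)
next
  case (Suc n)
  let ?\<mu> = "nuts_law d h kmax \<nu> n"
  note s = sets_nuts_law[OF sets, of n]
  have K: "nuts_kernel d h kmax \<in> measurable ?\<mu> (subprob_algebra (Rd d))"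
    unfolding measurable_cong_sets[OF s refl] by (rule meas_kernel)
  have fm: "(\<lambda>x. ennreal (f x)) \<in> borel_measurable (Rd d)" using Suc.prems by (auto simp: test_fn_def)
  have "(\<integral>\<^sup>+x. ennreal (f x) \<partial>nuts_law d h kmax \<nu> (Suc n)) = (\<integral>\<^sup>+x. ennreal (f x) \<partial>(?\<mu> \<bind> nuts_kernel d h kmax))"
    by (simp add: nuts_law_def)
  also have "\<dots> = (\<integral>\<^sup>+x. \<integral>\<^sup>+y. ennreal (f y) \<partial>nuts_kernel d h kmax x \<partial>?\<mu>)" by (rule nn_integral_bind[OF fm K])
  also have "\<dots> = (\<integral>\<^sup>+x. ennreal (Pop d h kmax f x) \<partial>?\<mu>)"
    using Suc.prems sets_eq_imp_space_eq[OF s] by (intro nn_integral_cong nn_integral_kernel_real) auto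
  also have "\<dots> = (\<integral>\<^sup>+x. ennreal (Pit n (Pop d h kmax f) x) \<partial>\<nu>)"
    using Suc.prems by (intro Suc.IH tf_Pop Pop_nonneg) auto
  finally show ?case by (simp add: funpow_swap1)
qed

lemma prob_space_nuts_law:
  assumes sets: "sets \<nu> = sets (Rd d)" and p: "prob_space \<nu>" shows "prob_space (nuts_law d h kmax \<nu> n)"
proof
  have "emeasure (nuts_law d h kmax \<nu> n) (space (nuts_law d h kmax \<nu> n)) = (\<integral>\<^sup>+x. ennreal 1 \<partial>nuts_law d h kmax \<nu> n)" by simp
  also have "\<dots> = (\<integral>\<^sup>+x. ennreal (Pit n (\<lambda>_. 1) x) \<partial>\<nu>)" by (rule nn_integral_nuts_law[OF sets]) auto
  also have "\<dots> = (\<integral>\<^sup>+x. 1 \<partial>\<nu>)" using sets_eq_imp_space_eq[OF sets] by (intro nn_integral_cong) (simp add: Pit_const)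
  also have "\<dots> = 1" using prob_space.emeasure_space_1[OF p] by simp
  finally show "emeasure (nuts_law d h kmax \<nu> n) (space (nuts_law d h kmax \<nu> n)) = 1" .
qed

end

section \<open>Elementary estimates for the rotation angle\<close>

text \<open>
  The next Taylor term, which is needed to see that \<open>theta h\<close> exceeds
  \<open>h\<close> only by a cubic term: the gap hypothesis speaks of multiples of
  \<open>h\<close>, but the arcs of the orbits are multiples of \<open>theta h\<close>.
\<close>

lemma sin_cubic: "x - x ^ 3 / 6 \<le> sin x" if "0 \<le> x" for x :: real
proof -
  have "(\<Sum>m<3. sin_coeff m * x ^ m) = x" by (simp add: numeral_3_eq_3 sin_coeff_def)
  then have "\<bar>sin x - x\<bar> \<le> inverse (fact 3) * \<bar>x\<bar> ^ 3" using Maclaurin_sin_bound[of x 3] by simp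
  then have "\<bar>sin x - x\<bar> \<le> x ^ 3 / 6" using that by (simp add: fact_numeral)
  then show ?thesis by linarith
qed

context fixes h :: real assumes h: "0 < h" "h \<le> 1"
begin

lemma sin_half_theta: "sin (theta h / 2) = h / 2"
proof -
  have "1 - 2 * (sin (theta h / 2))\<^sup>2 = cos (theta h)" using cos_double_sin[of "theta h / 2"] by simp
  then have "(sin (theta h / 2))\<^sup>2 = (h / 2)\<^sup>2" by (simp add: cos_theta[OF h] power_divide)
  moreover have "sin (theta h / 2) \<ge> 0" using theta_pos[OF h] theta_le[OF h] by (intro sin_ge_zero) auto
  ultimately show ?thesis using h by (simp add: power2_eq_iff_nonneg)
qed

lemma theta_ge: "h \<le> theta h"
  using sin_half_theta sin_x_le_x[of "theta h / 2"] theta_pos[OF h] by simp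

lemma theta_bounds: "theta h \<le> 2 * h" "theta h \<le> h + h ^ 3"
proof -
  have half: "theta h / 2 \<le> 1"
  proof (rule ccontr)
    assume "\<not> theta h / 2 \<le> 1"
    then have "1 \<le> theta h / 2" by simp
    moreover have "theta h / 2 \<le> pi / 2" using theta_le[OF h] by simp
    ultimately have "sin 1 \<le> sin (theta h / 2)" by (intro sin_monotone_2pi_le) (use pi_ge_two in auto)
    moreover have "sin (1::real) > 1/2" using sin_cubic[of 1] by simp
    ultimately show False using sin_half_theta h by simp
  qed
  define x where "x = theta h / 2"
  have x: "0 < x" "x \<le> 1" "sin x = h / 2" using half theta_pos[OF h] sin_half_theta by (auto simp: x_def)
  have s: "x - x ^ 3 / 6 \<le> h / 2" using sin_cubic[of x] x by simp
  have "x ^ 3 \<le> x" using x by (simp add: power3_eq_cube mult_le_one)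
  then have x2: "x \<le> h" using s x h by linarith
  then show "theta h \<le> 2 * h" by (simp add: x_def)
  have "x ^ 3 \<le> h ^ 3" using x x2 by (intro power_mono) auto
  then have "2 * x \<le> h + h ^ 3" using s zero_less_power[OF h(1), of 3] by linarith
  then show "theta h \<le> h + h ^ 3" by (simp add: x_def)
qed

end

section \<open>Averages of squared sines over dyadic blocks\<close>

text \<open>
  A lower bound for the average of \<open>sin\<^sup>2\<close> over the angles visited by a
  dyadic orbit whose total arc is at least \<open>\<tau>\<close>.
\<close>

definition kap :: "real \<Rightarrow> real" where "kap \<tau> = (sin (min (\<tau> / 2) (pi / 4)))\<^sup>2 / 4"

lemma kap_pos: "0 < \<tau> \<Longrightarrow> 0 < kap \<tau>"
  unfolding kap_def using pi_gt_zero by (intro divide_pos_pos zero_less_power sin_gt_zero) (auto simp: min_def)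

lemma kap_le: "kap \<tau> \<le> 1/4"
  unfolding kap_def by (simp add: abs_square_le_1)

lemma sin_sq_pair: "(sin (t - s))\<^sup>2 / 2 \<le> (sin s)\<^sup>2 + (sin t)\<^sup>2" for s t :: real
proof -
  have "\<bar>sin (t - s)\<bar> \<le> \<bar>sin t\<bar> * \<bar>cos s\<bar> + \<bar>cos t\<bar> * \<bar>sin s\<bar>"
    unfolding sin_diff by (rule order_trans[OF abs_triangle_ineq4]) (simp add: abs_mult)
  also have "\<dots> \<le> \<bar>sin t\<bar> * 1 + 1 * \<bar>sin s\<bar>" by (intro add_mono mult_mono) auto
  finally have "\<bar>sin (t - s)\<bar> \<le> \<bar>sin t\<bar> + \<bar>sin s\<bar>" by simp
  then have "\<bar>sin (t - s)\<bar>\<^sup>2 \<le> (\<bar>sin t\<bar> + \<bar>sin s\<bar>)\<^sup>2" by (intro power_mono) auto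
  also have "\<dots> \<le> 2 * ((sin t)\<^sup>2 + (sin s)\<^sup>2)"
    using sum_squares_bound[of "\<bar>sin t\<bar>" "\<bar>sin s\<bar>"] by (simp add: power2_sum)
  finally show ?thesis by simp
qed

lemma blk_Suc_disjoint: "blk a J \<inter> blk (a + 2 ^ J) J = {}"
  by (auto simp: blk_def)

lemma sum_blk_Suc: "(\<Sum>i\<in>blk a (Suc J). f i) = (\<Sum>i\<in>blk a J. f i) + (\<Sum>i\<in>blk (a + 2 ^ J) J. f i)"
  unfolding blk_Un_right[symmetric] by (rule sum.union_disjoint) (simp_all add: blk_Suc_disjoint)

lemma sum_blk_shift: "(\<Sum>i\<in>blk (a + k) J. f i) = (\<Sum>i\<in>blk a J. f (i + k))"
  unfolding blk_shift[symmetric] by (subst sum.reindex) (auto simp: inj_on_def)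

text \<open>
  Two indices at distance \<open>2 ^ l\<close> cannot both have an angle close to a multiple of
  \<open>pi\<close> if \<open>2 ^ l * \<phi>\<close> is far from such multiples. A dyadic block
  longer than \<open>2 ^ l\<close> splits into such pairs.
\<close>

lemma blk_sin_avg_aux:
  fixes \<phi> \<psi> :: real assumes "l < J"
  shows "2 ^ J * ((sin (2 ^ l * \<phi>))\<^sup>2 / 4) \<le> (\<Sum>i\<in>blk a J. (sin (of_int i * \<phi> + \<psi>))\<^sup>2)"
  using assms
proof (induction J arbitrary: a)
  case 0 then show ?case by simp
next
  case (Suc J)
  show ?case
  proof (cases "l = J")
    case True
    have "(\<Sum>i\<in>blk a (Suc J). (sin (of_int i * \<phi> + \<psi>))\<^sup>2)
      = (\<Sum>i\<in>blk a J. (sin (of_int i * \<phi> + \<psi>))\<^sup>2 + (sin (of_int (i + 2 ^ J) * \<phi> + \<psi>))\<^sup>2)"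
      unfolding sum_blk_Suc sum_blk_shift by (simp add: sum.distrib)
    also have "\<dots> \<ge> (\<Sum>i\<in>blk a J. (sin (2 ^ l * \<phi>))\<^sup>2 / 2)"
    proof (intro sum_mono)
      fix i
      show "(sin (2 ^ l * \<phi>))\<^sup>2 / 2 \<le> (sin (of_int i * \<phi> + \<psi>))\<^sup>2 + (sin (of_int (i + 2 ^ J) * \<phi> + \<psi>))\<^sup>2"
        using sin_sq_pair[of "of_int (i + 2 ^ J) * \<phi> + \<psi>" "of_int i * \<phi> + \<psi>"] True by (simp add: algebra_simps)
    qed
    finally show ?thesis using True by simp
  next
    case False
    then show ?thesis using Suc.IH[of a] Suc.IH[of "a + 2 ^ J"] Suc.prems by (simp add: sum_blk_Suc)
  qed
qed

text \<open>
  Choose the largest scale \<open>l\<close> at which the pair distance \<open>2 ^ l *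
  \<phi>\<close> is still at most \<open>pi / 2\<close>. Then this distance is either at least
  \<open>pi / 4\<close> or at least half of the arc of the block.
\<close>

lemma blk_sin_avg:
  fixes \<phi> \<psi> \<tau> :: real assumes \<phi>: "0 < \<phi>" "\<phi> \<le> pi / 2" and \<tau>: "0 < \<tau>" "\<tau> \<le> (2 ^ J - 1) * \<phi>"
  shows "2 ^ J * kap \<tau> \<le> (\<Sum>i\<in>blk a J. (sin (of_int i * \<phi> + \<psi>))\<^sup>2)"
proof -
  have J: "J \<ge> 1" using \<tau> by (cases J) auto
  define P where "P = (\<lambda>l. l < J \<and> 2 ^ l * \<phi> \<le> pi / 2)"
  have P0: "P 0" using \<phi> J by (simp add: P_def)
  define l where "l = (GREATEST l. P l)"
  have Pl: "P l" unfolding l_def by (rule GreatestI_nat[of P 0 J, OF P0]) (auto simp: P_def)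
  have m: "min (\<tau> / 2) (pi / 4) \<le> 2 ^ l * \<phi>"
  proof (cases "Suc l < J")
    case True
    have "\<not> P (Suc l)"
    proof
      assume "P (Suc l)"
      then have "Suc l \<le> l" unfolding l_def by (rule Greatest_le_nat[where P=P and b=J]) (auto simp: P_def)
      then show False by simp
    qed
    then have "pi / 2 < 2 * (2 ^ l * \<phi>)" using True by (simp add: P_def)
    then show ?thesis by simp
  next
    case False
    then have "J = Suc l" using Pl by (simp add: P_def)
    then have "\<tau> \<le> 2 * (2 ^ l * \<phi>)" using \<tau> \<phi> by (simp add: algebra_simps)
    then show ?thesis by simp
  qed
  have "0 \<le> sin (min (\<tau> / 2) (pi / 4))" using \<tau> pi_gt_zero by (intro sin_ge_zero) (auto simp: min_def)
  moreover have "sin (min (\<tau> / 2) (pi / 4)) \<le> sin (2 ^ l * \<phi>)"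
    using m Pl \<tau> pi_gt_zero by (intro sin_monotone_2pi_le) (auto simp: P_def min_def)
  ultimately have "kap \<tau> \<le> (sin (2 ^ l * \<phi>))\<^sup>2 / 4"
    unfolding kap_def by (intro divide_right_mono power_mono) auto
  then have "2 ^ J * kap \<tau> \<le> 2 ^ J * ((sin (2 ^ l * \<phi>))\<^sup>2 / 4)" by (intro mult_left_mono) auto
  moreover have "l < J" using Pl by (simp add: P_def)
  note blk_sin_avg_aux[where l=l and J=J and \<phi>=\<phi> and a=a and \<psi>=\<psi>, OF this]
  ultimately show ?thesis by (rule order_trans)
qed

section \<open>Inner products along an orbit\<close>

text \<open>
  The inner product of position and velocity along the orbit, with the factor \<open>beta
  h\<close> that makes its evolution a rotation by the double angle.
\<close>

definition gt :: "nat \<Rightarrow> real \<Rightarrow> phase_point \<Rightarrow> int \<Rightarrow> real" where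
  "gt d h z L = beta h * dot d (fst (rot d h L z)) (snd (rot d h L z))"

text \<open>
  The squared norm of the velocity along the orbit.
\<close>

definition sn :: "nat \<Rightarrow> real \<Rightarrow> phase_point \<Rightarrow> int \<Rightarrow> real" where
  "sn d h z L = dot d (snd (rot d h L z)) (snd (rot d h L z))"

text \<open>
  By \<open>Ut_sign\<close>, the sign of \<open>(1 - cos T) * gt + sin T * sn\<close> decides
  about the U-turn of an orbit of arc \<open>T\<close>. On typical phase points
  \<open>sn\<close> is close to \<open>d\<close> and \<open>gt\<close> is small compared to
  \<open>d\<close>. If \<open>w\<close> bounds the ratio, an arc is quiet if it certainly makes
  no U-turn, and turns if it certainly makes one. The remaining arcs are close to odd multiples
  of \<open>pi\<close>.
\<close>

definition quiet :: "real \<Rightarrow> real \<Rightarrow> bool" where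
  "quiet w T \<longleftrightarrow> 0 \<le> sin T \<and> w * (1 - cos T) \<le> sin T"

definition turns :: "real \<Rightarrow> real \<Rightarrow> bool" where
  "turns w T \<longleftrightarrow> sin T < 0 \<and> w * (1 - cos T) \<le> - sin T"

lemma quiet_mono: "quiet w T \<Longrightarrow> w' \<le> w \<Longrightarrow> quiet w' T"
  unfolding quiet_def by (meson cos_le_one diff_ge_0_iff_ge mult_right_mono order_trans)

lemma turns_mono: "turns w T \<Longrightarrow> w' \<le> w \<Longrightarrow> turns w' T"
  unfolding turns_def by (meson cos_le_one diff_ge_0_iff_ge mult_right_mono order_trans)

lemma quiet_quarter: "0 \<le> T \<Longrightarrow> T \<le> pi / 2 \<Longrightarrow> w \<le> 1 \<Longrightarrow> quiet w T"
proof (rule quiet_mono[of 1])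
  assume T: "0 \<le> T" "T \<le> pi / 2"
  have s: "0 \<le> sin T" "0 \<le> cos T" using T by (auto intro: sin_ge_zero cos_ge_zero)
  have "1 \<le> (sin T + cos T)\<^sup>2" using s by (simp add: power2_sum)
  then have "1 \<le> sin T + cos T" using s power2_le_imp_le[of 1 "sin T + cos T"] by simp
  then show "quiet 1 T" using s by (simp add: quiet_def)
qed

text \<open>
  Phase points whose three inner products have the values that are typical in high dimension, up
  to \<open>A\<close>.
\<close>

definition calm :: "nat \<Rightarrow> real \<Rightarrow> phase_point \<Rightarrow> bool" where
  "calm d A z \<longleftrightarrow> z \<in> phase_space d \<and> \<bar>dot d (fst z) (fst z) - real d\<bar> \<le> A \<and> \<bar>dot d (fst z) (snd z)\<bar> \<le> A
     \<and> \<bar>dot d (snd z) (snd z) - real d\<bar> \<le> A"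

context nuts begin

abbreviation "\<theta> \<equiv> theta h"
abbreviation "\<beta> \<equiv> beta h"
definition "ang L = of_int L * \<theta>"

lemma beta_bounds: "\<beta> > 0" "\<beta> \<le> 1" "\<beta>\<^sup>2 = 1 - h\<^sup>2 / 4" "1 / 2 \<le> \<beta>" "h\<^sup>2 \<le> 1" "3/4 \<le> \<beta>\<^sup>2"
  using beta_pos[OF h_pos h_le] beta_le[OF h_pos h_le] beta_sq[OF h_pos h_le] beta_ge[OF h_pos h_le] h_sq_le[OF h_pos h_le]
  by auto

lemma inv_beta: "1 / \<beta> \<le> 2" "1 / \<beta>\<^sup>2 \<le> 4 / 3"
  using beta_bounds by (simp_all add: field_simps)

lemma gt_formula: "gt d h z L = ((cos (ang L))\<^sup>2 - (sin (ang L))\<^sup>2) * (\<beta> * dot d (fst z) (snd z))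
    + sin (ang L) * cos (ang L) * (dot d (snd z) (snd z) - \<beta>\<^sup>2 * dot d (fst z) (fst z))"
proof -
  define b c s where "b = \<beta>" and "c = cos (ang L)" and "s = sin (ang L)"
  have b: "b \<noteq> 0" using beta_bounds by (simp add: b_def)
  have r: "fst (rot d h L z) = lin d c (s / b) (fst z) (snd z)" "snd (rot d h L z) = lin d (- (b * s)) c (fst z) (snd z)"
    by (simp_all add: rot_def b_def c_def s_def ang_def)
  show ?thesis
    unfolding gt_def r b_def[symmetric] c_def[symmetric] s_def[symmetric]
    using b by (simp add: dot_lin_left dot_lin_right dot_commute[of d "snd z" "fst z"] power2_eq_square) (simp add: field_simps)
qed

lemma sn_formula: "sn d h z L = (sin (ang L))\<^sup>2 * (\<beta>\<^sup>2 * dot d (fst z) (fst z)) + (cos (ang L))\<^sup>2 * dot d (snd z) (snd z)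
    - 2 * sin (ang L) * cos (ang L) * (\<beta> * dot d (fst z) (snd z))"
proof -
  define b c s where "b = \<beta>" and "c = cos (ang L)" and "s = sin (ang L)"
  have r: "snd (rot d h L z) = lin d (- (b * s)) c (fst z) (snd z)"
    by (simp_all add: rot_def b_def c_def s_def ang_def)
  show ?thesis
    unfolding sn_def r b_def[symmetric] c_def[symmetric] s_def[symmetric]
    by (simp add: dot_lin_left dot_lin_right dot_commute[of d "snd z" "fst z"] power2_eq_square algebra_simps)
qed

lemma rn_formula: "dot d (fst (rot d h L z)) (fst (rot d h L z)) = (cos (ang L))\<^sup>2 * dot d (fst z) (fst z)
    + (sin (ang L))\<^sup>2 * (dot d (snd z) (snd z) / \<beta>\<^sup>2) + 2 * sin (ang L) * cos (ang L) * (dot d (fst z) (snd z) / \<beta>)"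
proof -
  define b c s where "b = \<beta>" and "c = cos (ang L)" and "s = sin (ang L)"
  have b: "b \<noteq> 0" using beta_bounds by (simp add: b_def)
  have r: "fst (rot d h L z) = lin d c (s / b) (fst z) (snd z)"
    by (simp_all add: rot_def b_def c_def s_def ang_def)
  show ?thesis
    unfolding r b_def[symmetric] c_def[symmetric] s_def[symmetric]
    using b by (simp add: dot_lin_left dot_lin_right dot_commute[of d "snd z" "fst z"] power2_eq_square) (simp add: field_simps)
qed

text \<open>
  Position and velocity at one end of the orbit are obtained from those at the other end by a
  rotation by \<open>T\<close>. Inserting this into the inner products leaves only quantities at
  the end where the velocity is taken.
\<close>

lemma Ut_sign:
  assumes z: "z \<in> phase_space d" and T_def: "T = (2 ^ j - 1) * \<theta>"
  shows "Ut d h z lo j \<longleftrightarrow>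
     (1 - cos T) * gt d h z (lo + 2 ^ j - 1) + sin T * sn d h z (lo + 2 ^ j - 1) < 0 \<or>
     - (1 - cos T) * gt d h z lo + sin T * sn d h z lo < 0"
proof -
  define p m where "p = rot d h (lo + 2 ^ j - 1) z" and "m = rot d h lo z"
  have aT: "of_int (2 ^ j - 1) * \<theta> = T" "of_int (- (2 ^ j - 1)) * \<theta> = - T" by (simp_all add: T_def algebra_simps)
  have mp: "m = rot d h (- (2 ^ j - 1)) p" and pm: "p = rot d h (2 ^ j - 1) m"
    unfolding p_def m_def rot_rot by (simp_all add: algebra_simps)
  have fm: "fst m = lin d (cos T) (- sin T / \<beta>) (fst p) (snd p)" 
    by (subst mp) (simp only: rot_def aT, simp)
  have fp: "fst p = lin d (cos T) (sin T / \<beta>) (fst m) (snd m)" 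
    by (subst pm) (simp only: rot_def aT, simp)
  have b: "\<beta> > 0" using beta_bounds by simp
  have 1: "\<beta> * dot d (snd p) (lin d 1 (- 1) (fst p) (fst m)) = (1 - cos T) * gt d h z (lo + 2 ^ j - 1) + sin T * sn d h z (lo + 2 ^ j - 1)"
    unfolding gt_def sn_def p_def[symmetric] using b
    by (simp add: dot_lin_right fm dot_commute[of d "snd p" "fst p"] field_simps)
  have 2: "\<beta> * dot d (snd m) (lin d 1 (- 1) (fst p) (fst m)) = - (1 - cos T) * gt d h z lo + sin T * sn d h z lo"
    unfolding gt_def sn_def m_def[symmetric] using b
    by (simp add: dot_lin_right fp dot_commute[of d "snd m" "fst m"] field_simps)
  have "Ut d h z lo j \<longleftrightarrow> \<beta> * dot d (snd p) (lin d 1 (- 1) (fst p) (fst m)) < 0 \<or> \<beta> * dot d (snd m) (lin d 1 (- 1) (fst p) (fst m)) < 0"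
    using b by (simp add: Ut_iff[OF z] Let_def p_def[symmetric] m_def[symmetric] mult_less_0_iff)
  then show ?thesis unfolding 1 2 .
qed

lemma sin_cos_half: "\<bar>sin x * cos x\<bar> \<le> 1/2" for x :: real
  using abs_sin_le_one[of "2 * x"] by (simp add: sin_double)

lemma abs_cos_double: "\<bar>(cos x)\<^sup>2 - (sin x)\<^sup>2\<bar> \<le> 1" for x :: real
  using abs_cos_le_one[of "2 * x"] by (simp add: cos_double)

lemma calm_bounds:
  assumes c: "calm d A z" and A: "real d * h\<^sup>2 \<le> A"
  shows "\<bar>gt d h z L\<bar> \<le> 3 * A" "real d - 3 * A \<le> sn d h z L" "sn d h z L \<le> real d + 3 * A"
    "\<bar>dot d (fst (rot d h L z)) (fst (rot d h L z)) - dot d (fst z) (fst z)\<bar> \<le> 6 * A"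
proof -
  define R G S where "R = dot d (fst z) (fst z)" and "G = dot d (fst z) (snd z)" and "S = dot d (snd z) (snd z)"
  have g: "\<bar>R - d\<bar> \<le> A" "\<bar>G\<bar> \<le> A" "\<bar>S - d\<bar> \<le> A" using c by (auto simp: calm_def R_def G_def S_def)
  have A0: "0 \<le> A" using g by linarith
  have hR: "0 \<le> h\<^sup>2 / 4 * R" "h\<^sup>2 / 4 * R \<le> A / 2"
  proof -
    show "0 \<le> h\<^sup>2 / 4 * R" by (simp add: R_def)
    have "h\<^sup>2 * R \<le> h\<^sup>2 * (d + A)" using g by (intro mult_left_mono) auto
    also have "\<dots> \<le> A + 1 * A" using A mult_right_mono[OF beta_bounds(5) A0] by (simp add: algebra_simps)
    finally have "h\<^sup>2 * R \<le> 2 * A" by simp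
    moreover have "h\<^sup>2 / 4 * R = (h\<^sup>2 * R) / 4" by simp
    ultimately show "h\<^sup>2 / 4 * R \<le> A / 2" by linarith
  qed
  have bR: "\<beta>\<^sup>2 * R = R - h\<^sup>2 / 4 * R" by (simp add: beta_bounds(3) algebra_simps)
  have SR: "\<bar>S - \<beta>\<^sup>2 * R\<bar> \<le> 5/2 * A" using g hR bR by linarith
  have bG: "\<bar>\<beta> * G\<bar> \<le> A" using g(2) beta_bounds A0 by (simp add: abs_mult mult_left_le_one_le order_trans[OF mult_left_le_one_le])
  define c s where "c = cos (ang L)" and "s = sin (ang L)"
  have cs: "s\<^sup>2 + c\<^sup>2 = 1" "\<bar>s * c\<bar> \<le> 1/2" "\<bar>c\<^sup>2 - s\<^sup>2\<bar> \<le> 1" "0 \<le> s\<^sup>2" "0 \<le> c\<^sup>2"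
    using sin_cos_half[of "ang L"] abs_cos_double[of "ang L"] by (simp_all add: c_def s_def)
  have "\<bar>gt d h z L\<bar> \<le> \<bar>c\<^sup>2 - s\<^sup>2\<bar> * \<bar>\<beta> * G\<bar> + \<bar>s * c\<bar> * \<bar>S - \<beta>\<^sup>2 * R\<bar>"
    unfolding gt_formula R_def[symmetric] G_def[symmetric] S_def[symmetric] c_def[symmetric] s_def[symmetric]
    by (rule order_trans[OF abs_triangle_ineq]) (simp add: abs_mult)
  also have "\<dots> \<le> 1 * A + 1/2 * (5/2 * A)" by (intro add_mono mult_mono cs bG SR) auto
  finally show "\<bar>gt d h z L\<bar> \<le> 3 * A" using A0 by simp
  have scG: "\<bar>2 * s * c * (\<beta> * G)\<bar> \<le> A"
  proof -
    have "\<bar>s * c\<bar> * \<bar>\<beta> * G\<bar> \<le> 1/2 * A" by (intro mult_mono cs bG) auto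
    then show ?thesis by (simp add: abs_mult)
  qed
  have sn: "sn d h z L = s\<^sup>2 * (\<beta>\<^sup>2 * R) + c\<^sup>2 * S - 2 * s * c * (\<beta> * G)"
    unfolding sn_formula R_def G_def S_def c_def s_def ..
  have lo: "d - 2 * A \<le> \<beta>\<^sup>2 * R" "\<beta>\<^sup>2 * R \<le> d + 2 * A" "d - 2 * A \<le> S" "S \<le> d + 2 * A"
    using g hR bR A0 by linarith+
  have "s\<^sup>2 * (d - 2 * A) + c\<^sup>2 * (d - 2 * A) \<le> s\<^sup>2 * (\<beta>\<^sup>2 * R) + c\<^sup>2 * S"
    by (intro add_mono mult_left_mono lo cs)
  moreover have "s\<^sup>2 * (d - 2 * A) + c\<^sup>2 * (d - 2 * A) = d - 2 * A" using cs(1) by (simp flip: distrib_right)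
  ultimately show "real d - 3 * A \<le> sn d h z L" using scG unfolding sn by linarith
  have "s\<^sup>2 * (\<beta>\<^sup>2 * R) + c\<^sup>2 * S \<le> s\<^sup>2 * (d + 2 * A) + c\<^sup>2 * (d + 2 * A)"
    by (intro add_mono mult_left_mono lo cs)
  moreover have "s\<^sup>2 * (d + 2 * A) + c\<^sup>2 * (d + 2 * A) = d + 2 * A" using cs(1) by (simp flip: distrib_right)
  ultimately show "sn d h z L \<le> real d + 3 * A" using scG unfolding sn by linarith
  have "dot d (fst (rot d h L z)) (fst (rot d h L z)) - R = s\<^sup>2 * ((S - \<beta>\<^sup>2 * R) / \<beta>\<^sup>2) + 2 * (s * c) * (G / \<beta>)"
  proof -
    have "c\<^sup>2 * R = R - s\<^sup>2 * R" using cs(1) by (simp add: algebra_simps flip: distrib_left)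
    then show ?thesis
      unfolding rn_formula R_def[symmetric] G_def[symmetric] S_def[symmetric] c_def[symmetric] s_def[symmetric]
      using beta_bounds(1) by (simp add: diff_divide_distrib right_diff_distrib)
  qed
  also have "\<bar>\<dots>\<bar> \<le> s\<^sup>2 * (\<bar>S - \<beta>\<^sup>2 * R\<bar> * (1 / \<beta>\<^sup>2)) + 2 * \<bar>s * c\<bar> * (\<bar>G\<bar> * (1 / \<beta>))"
    by (rule order_trans[OF abs_triangle_ineq]) (use beta_bounds(1) in \<open>simp add: abs_mult\<close>)
  also have "\<dots> \<le> 1 * (5/2 * A * (4/3)) + 2 * (1/2) * (A * 2)"
    using cs inv_beta g(2) SR A0 beta_bounds(1) by (intro add_mono mult_mono) (auto intro!: mult_nonneg_nonneg)
  finally show "\<bar>dot d (fst (rot d h L z)) (fst (rot d h L z)) - dot d (fst z) (fst z)\<bar> \<le> 6 * A"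
    using A0 by (simp add: R_def)
qed

definition "arcl j = (2 ^ j - 1) * \<theta>"

text \<open>
  Here \<open>sin T * sn\<close> dominates, as \<open>sn\<close> is at least half of
  \<open>d\<close>, while \<open>gt\<close> is at most \<open>3 * A\<close>.
\<close>

lemma quiet_no_uturn:
  assumes c: "calm d A z" and A: "real d * h\<^sup>2 \<le> A" "6 * A \<le> real d" and q: "quiet (6 * A / real d) (arcl j)"
  shows "\<not> Ut d h z lo j"
proof -
  have z: "z \<in> phase_space d" using c by (simp add: calm_def)
  have d: "real d > 0" using d_pos by simp
  define T where "T = arcl j"
  have A0: "0 \<le> A" using A(1) by (meson of_nat_0_le_iff order_trans mult_nonneg_nonneg zero_le_power2)
  have T: "0 \<le> sin T" "6 * A / d * (1 - cos T) \<le> sin T" using q by (auto simp: quiet_def T_def)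
  have key: "(1 - cos T) * (3 * A) \<le> sin T * sn d h z L" for L
  proof -
    have "(1 - cos T) * (3 * A) = 6 * A / d * (1 - cos T) * (d / 2)" using d by simp
    also have "\<dots> \<le> sin T * (d / 2)" using T d by (intro mult_right_mono) auto
    also have "\<dots> \<le> sin T * sn d h z L" using calm_bounds(2)[OF c A(1), of L] A(2) T by (intro mult_left_mono) auto
    finally show ?thesis .
  qed
  have "\<bar>(1 - cos T) * gt d h z L\<bar> \<le> (1 - cos T) * (3 * A)" for L
    using calm_bounds(1)[OF c A(1), of L] by (simp add: abs_mult mult_left_mono)
  then have k: "\<bar>(1 - cos T) * gt d h z L\<bar> \<le> sin T * sn d h z L" for L using key order_trans by blast
  show ?thesis
    unfolding Ut_sign[OF z T_def[unfolded arcl_def]] using k[of lo] k[of "lo + 2 ^ j - 1"]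
    by (simp only: mult_minus_left) linarith
qed

lemma turns_uturn:
  assumes c: "calm d A z" and A: "real d * h\<^sup>2 \<le> A" "12 * A \<le> real d" and q: "turns (6 * A / real d) (arcl j)"
  shows "Ut d h z lo j"
proof -
  have z: "z \<in> phase_space d" using c by (simp add: calm_def)
  have d: "real d > 0" using d_pos by simp
  define T where "T = arcl j"
  have T: "sin T < 0" "6 * A / d * (1 - cos T) \<le> - sin T" using q by (auto simp: turns_def T_def)
  let ?L = "lo + 2 ^ j - 1"
  have "(1 - cos T) * gt d h z ?L \<le> (1 - cos T) * (3 * A)"
    using calm_bounds(1)[OF c A(1), of ?L] by (intro mult_left_mono) (auto simp: abs_le_iff)
  also have "\<dots> = 6 * A / d * (1 - cos T) * (d / 2)" using d by simp
  also have "\<dots> \<le> - sin T * (d / 2)" using T d by (intro mult_right_mono) auto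
  also have "\<dots> < - sin T * sn d h z ?L" using calm_bounds(2)[OF c A(1), of ?L] A(2) T d by (intro mult_strict_left_mono) auto
  finally have "(1 - cos T) * gt d h z ?L + sin T * sn d h z ?L < 0" by simp
  then show ?thesis unfolding Ut_sign[OF z T_def[unfolded arcl_def]] by simp
qed

lemma no_sub_quiet:
  assumes c: "calm d A z" and A: "real d * h\<^sup>2 \<le> A" "6 * A \<le> real d" and q: "\<And>i. i \<le> j \<Longrightarrow> quiet (6 * A / real d) (arcl i)"
  shows "no_sub (Ut d h z) lo j"
  unfolding no_sub_iff using quiet_no_uturn[OF c A] q by simp

lemma halves_quiet:
  assumes c: "calm d A z" and A: "real d * h\<^sup>2 \<le> A" "6 * A \<le> real d" and q: "\<And>i. i < j \<Longrightarrow> quiet (6 * A / real d) (arcl i)"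
  shows "halves (Ut d h z) lo j"
  using no_sub_quiet[OF c A] q by (cases j) auto

text \<open>
  If all shorter arcs are quiet then selection cannot stop before length \<open>2 ^ j\<close>,
  and if the orbit then stops, its law is uniform over the positions of \<open>0\<close>.
\<close>

lemma orbit_prob_quiet:
  assumes c: "calm d A z" and A: "real d * h\<^sup>2 \<le> A" "6 * A \<le> real d" and q: "\<And>i. i < j \<Longrightarrow> quiet (6 * A / real d) (arcl i)"
    and s: "j = kmax \<or> Ut d h z lo j"
  shows "orbit_prob (Ut d h z) kmax lo j = 1 / 2 ^ j"
  using halves_quiet[OF c A q, of j lo] s by (auto simp: orbit_prob_def stop_prob_def)

lemma arcl_mono: "i \<le> j \<Longrightarrow> arcl i \<le> arcl j"
  unfolding arcl_def using theta_pos[OF h_pos h_le] by (intro mult_right_mono) auto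

lemma arcl_nonneg: "0 \<le> arcl j"
  unfolding arcl_def using theta_pos[OF h_pos h_le] by (intro mult_nonneg_nonneg) auto

text \<open>
  Arcs of at most a quarter turn are always quiet, hence doubling from a length with such an arc
  is accepted: the proposed block has the same arc.
\<close>

lemma orbit_prob_short:
  assumes c: "calm d A z" and A: "real d * h\<^sup>2 \<le> A" "6 * A \<le> real d" and j: "j < kmax" "arcl j \<le> pi / 2"
  shows "orbit_prob (Ut d h z) kmax lo j = 0"
proof -
  have w: "6 * A / real d \<le> 1" using A d_pos by simp
  have q: "quiet (6 * A / real d) (arcl i)" if "i \<le> j" for i
    by (rule quiet_quarter[OF arcl_nonneg _ w]) (use arcl_mono[OF that] j(2) in linarith)
  note n = no_sub_quiet[OF c A q]
  have "stop_prob (Ut d h z) kmax lo j = 0"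
    using n quiet_no_uturn[OF c A q[OF order_refl]] j(1) by (simp add: stop_prob_def)
  then show ?thesis by (simp add: orbit_prob_def)
qed

text \<open>
  On calm points the energy error is at most \<open>h\<^sup>2 * 6 * A / 8\<close>, so that the
  index is chosen almost uniformly.
\<close>

lemma wgt_bounds:
  assumes c: "calm d A z" and A: "real d * h\<^sup>2 \<le> A" "h\<^sup>2 * A \<le> 1/2"
  shows "exp (- 1/2) \<le> wgt d h z i" "wgt d h z i \<le> exp (1/2)"
    "1 / 3 \<le> 2 ^ j * (wgt d h z i / (\<Sum>k\<in>blk lo j. wgt d h z k))"
proof -
  have b: "exp (- 1/2) \<le> wgt d h z i \<and> wgt d h z i \<le> exp (1/2)" for i
  proof -
    have "\<bar>hamiltonian d z - hamiltonian d (rot d h i z)\<bar> = h\<^sup>2 / 8 * \<bar>dot d (fst (rot d h i z)) (fst (rot d h i z)) - dot d (fst z) (fst z)\<bar>"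
      unfolding abs_minus_commute[of "hamiltonian d z"] energy_error[OF h_pos h_le] by (simp add: abs_mult)
    also have "\<dots> \<le> h\<^sup>2 / 8 * (6 * A)" by (intro mult_left_mono calm_bounds(4)[OF c A(1)]) auto
    also have "\<dots> = 3 / 4 * (h\<^sup>2 * A)" by simp
    also have "\<dots> \<le> 1/2" using A(2) by linarith
    finally have "- (1/2) \<le> hamiltonian d z - hamiltonian d (rot d h i z)" "hamiltonian d z - hamiltonian d (rot d h i z) \<le> 1/2"
      by linarith+
    then show ?thesis by (simp add: wgt_def)
  qed
  then show "exp (- 1/2) \<le> wgt d h z i" "wgt d h z i \<le> exp (1/2)" by auto
  have "(\<Sum>k\<in>blk lo j. wgt d h z k) \<le> (\<Sum>k\<in>blk lo j. exp (1/2))" using b by (intro sum_mono) auto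
  then have "(\<Sum>k\<in>blk lo j. wgt d h z k) \<le> 2 ^ j * exp (1/2)" by simp
  moreover have "exp (1/2) \<le> 3 * wgt d h z i"
  proof -
    have "exp (1::real) \<le> 3" by (rule exp_le)
    then have "exp 1 * exp (- 1/2) \<le> 3 * exp (- 1/2::real)" by (rule mult_right_mono) simp
    then have "exp (1/2) \<le> 3 * exp (- 1/2::real)" by (simp add: mult_exp_exp)
    then show ?thesis using b[of i] by linarith
  qed
  ultimately have "(\<Sum>k\<in>blk lo j. wgt d h z k) \<le> 2 ^ j * (3 * wgt d h z i)"
    by (meson mult_left_mono order_trans zero_le_numeral zero_le_power)
  then show "1 / 3 \<le> 2 ^ j * (wgt d h z i / (\<Sum>k\<in>blk lo j. wgt d h z k))"
    using sum_wgt_pos[of d h z lo j] by (simp add: field_simps)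
qed

lemma sum_orbit_prob:
  assumes "z \<in> phase_space d"
  shows "(\<Sum>(lo, j)\<in>orbits kmax. orbit_prob (Ut d h z) kmax lo j) = 1"
proof -
  have "1 = (\<Sum>(lo, j)\<in>orbits kmax. \<Sum>i\<in>blk lo j. coef d h kmax (lo, j, i) z)"
    using sum_coef[OF assms] by (simp add: sum_moves)
  also have "\<dots> = (\<Sum>(lo, j)\<in>orbits kmax. orbit_prob (Ut d h z) kmax lo j)"
  proof (intro sum.cong refl, clarify)
    fix lo j
    have "(\<Sum>i\<in>blk lo j. wgt d h z i / (\<Sum>k\<in>blk lo j. wgt d h z k)) = 1"
      using sum_wgt_pos[of d h z lo j] by (simp flip: sum_divide_distrib)
    then show "(\<Sum>i\<in>blk lo j. coef d h kmax (lo, j, i) z) = orbit_prob (Ut d h z) kmax lo j"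
      unfolding coef_def prod.case sum_distrib_left[symmetric] by (simp only: mult_1_right)
  qed
  finally show ?thesis by simp
qed

lemma theta_le_half_pi: "\<theta> \<le> pi / 2"
proof -
  have "cos \<theta> \<ge> 0" using cos_theta[OF h_pos h_le] beta_bounds(5) by simp
  then show ?thesis
    using theta_le[OF h_pos h_le] cos_monotone_0_pi[of "pi / 2" \<theta>] pi_gt_zero by (cases "\<theta> \<le> pi / 2") auto
qed

text \<open>
  Selected orbits either have maximal length or an arc beyond a quarter turn, so their arc is at
  least \<open>\<tau>\<close> and the average over the nearly uniform index is controlled by
  \<open>blk_sin_avg\<close>. This is the source of all contraction: a move by the angle
  \<open>a\<close> multiplies the memory of the starting point by \<open>cos a\<close>.
\<close>

lemma mean_sin_sq:
  assumes c: "calm d A z" and A: "real d * h\<^sup>2 \<le> A" "6 * A \<le> real d" "h\<^sup>2 * A \<le> 1/2"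
    and \<tau>: "0 < \<tau>" "\<tau> \<le> pi / 2" "\<tau> \<le> arcl kmax"
  shows "kap \<tau> / 3 \<le> (\<Sum>t\<in>moves kmax. coef d h kmax t z * (sin (ang (snd (snd t))))\<^sup>2)"
proof -
  have z: "z \<in> phase_space d" using c by (simp add: calm_def)
  have "kap \<tau> / 3 = (\<Sum>(lo, j)\<in>orbits kmax. orbit_prob (Ut d h z) kmax lo j) * (kap \<tau> / 3)"
    using sum_orbit_prob[OF z] by simp
  also have "\<dots> = (\<Sum>(lo, j)\<in>orbits kmax. orbit_prob (Ut d h z) kmax lo j * (kap \<tau> / 3))"
    unfolding sum_distrib_right by (simp add: case_prod_beta)
  also have "\<dots> \<le> (\<Sum>(lo, j)\<in>orbits kmax. \<Sum>i\<in>blk lo j. coef d h kmax (lo, j, i) z * (sin (ang i))\<^sup>2)"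
  proof (intro sum_mono, clarify)
    fix lo j assume lj: "(lo, j) \<in> orbits kmax"
    show "orbit_prob (Ut d h z) kmax lo j * (kap \<tau> / 3) \<le> (\<Sum>i\<in>blk lo j. coef d h kmax (lo, j, i) z * (sin (ang i))\<^sup>2)"
    proof (cases "orbit_prob (Ut d h z) kmax lo j = 0")
      case True then show ?thesis by (simp add: coef_def)
    next
      case False
      then have "j = kmax \<or> arcl j > pi / 2" using orbit_prob_short[OF c A(1,2), of j lo] lj
        by (cases "j = kmax"; cases "arcl j \<le> pi / 2") (auto simp: orbits_def)
      then have s: "\<tau> \<le> arcl j" using \<tau> by auto
      define q where "q = (\<lambda>i. wgt d h z i / (\<Sum>k\<in>blk lo j. wgt d h z k))"
      have q: "1 / 3 \<le> 2 ^ j * q i" for i unfolding q_def by (rule wgt_bounds(3)[OF c A(1,3)])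
      have "2 ^ j * kap \<tau> \<le> (\<Sum>i\<in>blk lo j. (sin (ang i))\<^sup>2)"
        using blk_sin_avg[where \<phi>=\<theta> and \<tau>=\<tau> and J=j and a=lo and \<psi>=0] theta_pos[OF h_pos h_le] theta_le_half_pi \<tau>(1) s by (simp add: arcl_def ang_def)
      then have "2 ^ j * kap \<tau> * (1/3) \<le> (\<Sum>i\<in>blk lo j. (sin (ang i))\<^sup>2) * (1/3)" by (rule mult_right_mono) simp
      also have "\<dots> = (\<Sum>i\<in>blk lo j. (sin (ang i))\<^sup>2 * (1/3))" by (rule sum_distrib_right)
      also have "\<dots> \<le> (\<Sum>i\<in>blk lo j. (sin (ang i))\<^sup>2 * (2 ^ j * q i))" using q by (intro sum_mono mult_left_mono) auto
      also have "\<dots> = 2 ^ j * (\<Sum>i\<in>blk lo j. q i * (sin (ang i))\<^sup>2)" by (simp add: sum_distrib_left mult_ac)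
      finally have "kap \<tau> / 3 \<le> (\<Sum>i\<in>blk lo j. q i * (sin (ang i))\<^sup>2)" by simp
      then have "orbit_prob (Ut d h z) kmax lo j * (kap \<tau> / 3) \<le> orbit_prob (Ut d h z) kmax lo j * (\<Sum>i\<in>blk lo j. q i * (sin (ang i))\<^sup>2)"
        by (intro mult_left_mono orbit_prob_nonneg)
      also have "\<dots> = (\<Sum>i\<in>blk lo j. coef d h kmax (lo, j, i) z * (sin (ang i))\<^sup>2)"
        by (simp add: sum_distrib_left coef_def q_def mult.assoc)
      finally show ?thesis .
    qed
  qed
  also have "\<dots> = (\<Sum>t\<in>moves kmax. coef d h kmax t z * (sin (ang (snd (snd t))))\<^sup>2)"
    by (simp add: sum_moves)
  finally show ?thesis .
qed

end

section \<open>How the orbit length escapes from the quiet regime\<close>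

lemma quiet_below_pi:
  assumes "0 \<le> T" "T \<le> pi - \<delta>" "0 < \<delta>" "\<delta> \<le> 1" "w \<le> \<delta> / 4"
  shows "quiet w T"
proof -
  have s: "0 \<le> sin (T / 2)" using assms by (intro sin_ge_zero) auto
  have "\<delta> / 2 - (\<delta> / 2) ^ 3 / 6 \<le> sin (\<delta> / 2)" using assms by (intro sin_cubic) auto
  moreover have "(\<delta> / 2) ^ 3 \<le> \<delta> / 2" using assms power_decreasing[of 1 3 "\<delta> / 2"] by simp
  ultimately have "w \<le> sin (\<delta> / 2)" using assms by linarith
  also have "sin (\<delta> / 2) = cos (pi / 2 - \<delta> / 2)" by (simp add: cos_diff)
  also have "\<dots> \<le> cos (T / 2)" using assms by (intro cos_monotone_0_pi_le) auto
  finally have c: "w \<le> cos (T / 2)" .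
  have "0 \<le> cos (T / 2)" using assms by (intro cos_ge_zero) auto
  have st: "sin T = 2 * sin (T / 2) * cos (T / 2)" "1 - cos T = 2 * sin (T / 2) * sin (T / 2)"
    using sin_double[of "T / 2"] cos_double_sin[of "T / 2"] by (simp_all add: power2_eq_square)
  have "w * sin (T / 2) \<le> cos (T / 2)"
  proof (cases "0 \<le> w")
    case True
    then have "w * sin (T / 2) \<le> w" by (simp add: mult_left_le)
    then show ?thesis using c by simp
  next
    case False
    then have "w * sin (T / 2) \<le> 0" using s by (simp add: mult_nonpos_nonneg)
    then show ?thesis using \<open>0 \<le> cos (T / 2)\<close> by linarith
  qed
  then have "2 * sin (T / 2) * (w * sin (T / 2)) \<le> 2 * sin (T / 2) * cos (T / 2)" using s by (intro mult_left_mono) auto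
  then show ?thesis using s \<open>0 \<le> cos (T / 2)\<close> by (simp add: quiet_def st mult_ac)
qed

lemma turns_above_pi:
  assumes "pi + \<delta> \<le> T" "T < 2 * pi" "0 < \<delta>" "\<delta> \<le> 1" "w \<le> \<delta> / 4"
  shows "turns w T"
proof -
  have "quiet w (2 * pi - T)" using assms by (intro quiet_below_pi[of _ \<delta>]) auto
  moreover have "0 < sin (2 * pi - T)" using assms by (intro sin_gt_zero) auto
  ultimately show ?thesis by (simp add: quiet_def turns_def sin_diff cos_diff)
qed

lemma quiet_cong: "sin T = sin T' \<Longrightarrow> cos T = cos T' \<Longrightarrow> quiet w T = quiet w T'"
  by (simp add: quiet_def)

lemma turns_cong: "sin T = sin T' \<Longrightarrow> cos T = cos T' \<Longrightarrow> turns w T = turns w T'"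
  by (simp add: turns_def)

lemma quiet_not_turns: "quiet w T \<Longrightarrow> \<not> turns w T"
  by (auto simp: quiet_def turns_def)

text \<open>
  The condition pins the arc to the left of an odd multiple of \<open>pi\<close>, at a distance
  of order between \<open>c\<close> and \<open>w\<close>: by the half angle formula, \<open>sin
  T / (1 - cos T)\<close> is the tangent of half that distance.
\<close>

lemma near_pi:
  assumes s: "c * (1 - cos T) < sin T" "sin T < w * (1 - cos T)" and cw: "0 < c" "w \<le> 1"
  obtains \<epsilon> :: real and k :: int where "T = (pi - \<epsilon>) + 2 * pi * of_int k" "c \<le> \<epsilon>" "\<epsilon> \<le> 2 * w"
proof -
  have n: "0 < 1 - cos T"
  proof (rule ccontr)
    assume "\<not> 0 < 1 - cos T"
    then have "cos T = 1" using cos_le_one[of T] by linarith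
    then show False using s by simp
  qed
  define a where "a = sin T / (1 - cos T)"
  have a: "c < a" "a < w" "sin T = a * (1 - cos T)" using s n by (auto simp: a_def field_simps)
  define x where "x = arctan a"
  have x: "0 < x" "x < pi / 4" "tan x = a"
    using a cw arctan_less_iff[of a 1] by (auto simp: x_def arctan_one tan_arctan)
  have cx: "1/2 \<le> cos x"
  proof -
    have "cos (pi / 3) \<le> cos x" using x by (intro cos_monotone_0_pi_le) auto
    then show ?thesis by (simp add: cos_60)
  qed
  have sx: "sin x \<le> x" using sin_x_le_x x by simp
  have "a \<le> 2 * x"
  proof -
    have "a = sin x / cos x" using x(3) by (simp add: tan_def)
    also have "\<dots> \<le> x / (1/2)" using cx sx x by (intro frac_le) auto
    finally show ?thesis by simp
  qed
  moreover have "x \<le> a" using arctan_le_self[of a] a cw by (simp add: x_def)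
  moreover have "sin T = sin (pi - 2 * x) \<and> cos T = cos (pi - 2 * x)"
  proof -
    have aa: "a\<^sup>2 * (1 - cos T) = 1 + cos T"
    proof -
      have "a\<^sup>2 * (1 - cos T) * (1 - cos T) = (sin T)\<^sup>2" unfolding a(3) by (simp add: power2_eq_square mult_ac)
      also have "\<dots> = (1 + cos T) * (1 - cos T)" by (simp add: sin_squared_eq power2_eq_square algebra_simps)
      finally show ?thesis using n by simp
    qed
    have "1 + a\<^sup>2 \<noteq> 0" by (metis add_pos_nonneg less_irrefl zero_le_power2 zero_less_one)
    then have "sin (2 * x) = 2 * a / (1 + a\<^sup>2)" "cos (2 * x) = (1 - a\<^sup>2) / (1 + a\<^sup>2)"
      using sin_tan_half[of x] cos_tan_half[of x] cx x(3) by auto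
    moreover have "(1 + a\<^sup>2) * (1 - cos T) = 2" using aa by (simp add: algebra_simps)
    then have "2 / (1 + a\<^sup>2) = 1 - cos T" using \<open>1 + a\<^sup>2 \<noteq> 0\<close> by (simp add: field_simps)
    ultimately have "sin (2 * x) = a * (1 - cos T)" "cos (2 * x) = (1 - a\<^sup>2) * (1 - cos T) / 2"
      by (metis times_divide_eq_right mult.commute, metis times_divide_eq_right times_divide_eq_left mult.commute nonzero_mult_div_cancel_left zero_neq_numeral)
    then have "sin (2 * x) = sin T" "cos (2 * x) = - cos T" using a(3) aa by (auto simp: algebra_simps)
    then show ?thesis by (simp add: sin_diff cos_diff)
  qed
  then obtain k :: int where "T = (pi - 2 * x) + 2 * pi * of_int k" unfolding sin_cos_eq_iff by auto
  ultimately show ?thesis using that[of "2 * x" k] a by auto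
qed

text \<open>
  Let \<open>w\<close> and \<open>c\<close> be two noise levels. Suppose that \<open>F\<close>
  is the first length whose arc is not quiet at the larger level \<open>w\<close>. If its arc
  turns at level \<open>w\<close>, or if \<open>sin (T F)\<close> is so small that a U-turn is
  within reach even of the smaller noise level \<open>c\<close>, then \<open>J = F\<close>
  works. The remaining case is an arc that falls short of an odd multiple of \<open>pi\<close>
  by some \<open>\<epsilon>\<close> between \<open>c\<close> and \<open>2 * w\<close>; such an
  arc is quiet at level \<open>c\<close>, so it suffices to find a later length that turns.

  Since no arc is within \<open>\<delta>\<close> of \<open>pi\<close> in the first half cycle,
  the arc jumps over \<open>pi\<close>, from below \<open>pi - \<delta>\<close> at some length
  \<open>n\<close>. It cannot land in the turning region, as then \<open>F\<close> would be a
  turning arc. Hence it lands just beyond \<open>2 * pi\<close>, with excess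
  \<open>\<sigma>\<close> of order \<open>\<theta>\<close>. Modulo full turns, doubling beyond
  this point repeats the first cycle, and the same dichotomy at its end forces \<open>2 ^ n *
  \<sigma> \<le> \<theta>\<close>, so that \<open>\<sigma>\<close> is in fact of order
  \<open>\<theta>\<^sup>2\<close>. Doubling beyond \<open>F\<close> also repeats the first
  cycle, but it lags behind by \<open>2 ^ m * \<epsilon>\<close>. Because \<open>\<theta> ^ 3
  \<le> c \<le> \<epsilon>\<close>, the accumulated lag exceeds \<open>\<sigma>\<close> at the
  end of the cycle, and the arc ends just before a full turn, where it turns.
\<close>

lemma escape:
  fixes \<theta> w c \<delta> :: real and kmax :: nat
  defines "T \<equiv> \<lambda>j. (2 ^ j - 1) * \<theta>"
  assumes \<theta>: "0 < \<theta>" "\<theta> \<le> 1/10" "\<theta>\<^sup>2 \<le> \<delta>" "\<theta> ^ 3 \<le> c"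
    and w: "0 < c" "c \<le> w" "w \<le> \<delta> / 4" "w \<le> \<theta> / 20" and \<delta>: "0 < \<delta>" "\<delta> \<le> 1"
    and gap: "\<And>j. T j \<le> pi - \<delta> \<or> T j > pi + \<delta>"
  shows "\<exists>J\<le>kmax. (J = kmax \<or> T J > pi / 2) \<and>
     ((\<forall>i<J. quiet c (T i)) \<and> (J = kmax \<or> turns c (T J)) \<or>
      (\<forall>i<J. quiet w (T i)) \<and> sin (T J) \<le> c * (1 - cos (T J)) \<and> 0 < 1 - cos (T J))"
proof (cases "\<forall>i<kmax. quiet w (T i)")
  case True
  then show ?thesis using quiet_mono[OF _ w(2)] by (intro exI[of _ kmax]) auto
next
  case False
  have T_dbl: "T (j + k) = 2 ^ k * (T j + \<theta>) - \<theta>" for j k by (simp add: T_def power_add algebra_simps)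
  have T_mono: "T i \<le> T j" if "i \<le> j" for i j
    using that \<theta>(1) by (auto simp: T_def intro!: mult_right_mono)
  have T_nn: "0 \<le> T j" for j using T_mono[of 0 j] by (simp add: T_def)
  have w1: "w \<le> 1" using w \<delta> by linarith
  define F where "F = (LEAST i. \<not> quiet w (T i))"
  from False obtain i where i: "i < kmax" "\<not> quiet w (T i)" by blast
  have F: "\<not> quiet w (T F)" "F \<le> i" unfolding F_def
    using LeastI[of "\<lambda>i. \<not> quiet w (T i)", OF i(2)] Least_le[of "\<lambda>i. \<not> quiet w (T i)", OF i(2)] by auto
  have Fq: "quiet w (T j)" if "j < F" for j using not_less_Least[of j "\<lambda>i. \<not> quiet w (T i)"] that by (auto simp: F_def)
  have Fk: "F < kmax" using F(2) i(1) by simp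
  have TF: "T F > pi / 2" using quiet_quarter[OF T_nn _ w1, of F] F(1) by force
  have nz: "0 < 1 - cos (T F)"
  proof (rule ccontr)
    assume "\<not> 0 < 1 - cos (T F)"
    then have c1: "cos (T F) = 1" using cos_le_one[of "T F"] by linarith
    then have "sin (T F) = 0" by (metis cos_one_sin_zero)
    then show False using F(1) c1 by (simp add: quiet_def)
  qed
  consider "turns w (T F)" | "sin (T F) \<le> c * (1 - cos (T F))"
    | "\<not> turns w (T F)" "c * (1 - cos (T F)) < sin (T F)" by linarith
  then show ?thesis
  proof cases
    case 1
    then show ?thesis using Fk TF Fq quiet_mono[OF _ w(2)] turns_mono[OF _ w(2)] by (intro exI[of _ F]) auto
  next
    case 2
    then show ?thesis using Fk TF Fq nz by (intro exI[of _ F]) auto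
  next
    case 3
    have sF: "0 \<le> sin (T F)" using 3(2) w(1) nz by (smt (verit) mult_pos_pos)
    have "sin (T F) < w * (1 - cos (T F))" using F(1) sF by (auto simp: quiet_def)
    then obtain \<epsilon> :: real and k :: int where \<epsilon>: "T F = (pi - \<epsilon>) + 2 * pi * of_int k" "c \<le> \<epsilon>" "\<epsilon> \<le> 2 * w"
      using near_pi[OF 3(2) _ w(1) w1] by blast
    \<comment> \<open>the first arc beyond pi; by the gap, the arc before it is still below pi - \<delta>\<close>
    have "\<exists>j. T j > pi + \<delta>"
    proof -
      obtain j where "(pi + \<delta>) / \<theta> + 1 < 2 ^ j" using real_arch_pow[of 2 "(pi + \<delta>) / \<theta> + 1"] by auto
      then have "(pi + \<delta>) / \<theta> < 2 ^ j - 1" by simp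
      then have "T j > pi + \<delta>" using \<theta>(1) by (simp add: T_def field_simps)
      then show ?thesis ..
    qed
    define n' where "n' = (LEAST j. T j > pi + \<delta>)"
    have n': "T n' > pi + \<delta>" unfolding n'_def by (rule LeastI_ex) fact
    have "n' \<noteq> 0"
    proof
      assume "n' = 0"
      then have "T n' = 0" by (simp add: T_def)
      then show False using n' \<delta> pi_gt_zero by linarith
    qed
    then obtain n where n: "n' = Suc n" by (cases n') auto
    have "\<not> T n > pi + \<delta>" using not_less_Least[of n "\<lambda>j. T j > pi + \<delta>"] n by (simp add: n'_def)
    then have Tn: "T n \<le> pi - \<delta>" using gap[of n] by blast
    define P where "P = (2::real) ^ n"
    have P: "P \<ge> 1" by (simp add: P_def)
    have TnP: "T n = P * \<theta> - \<theta>" by (simp add: T_def P_def algebra_simps)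
    have q0: "quiet w (T j)" if "j \<le> n" for j
      using Tn T_mono[OF that] w \<delta> by (intro quiet_below_pi[of _ \<delta>] T_nn) auto
    have Fn: "n < F" using q0 F(1) not_le by blast
    define \<sigma> where "\<sigma> = T (Suc n) - 2 * pi"
    have T1: "T (Suc n) = 2 * T n + \<theta>" by (simp add: T_def algebra_simps)
    have \<sigma>0: "0 \<le> \<sigma>"
    proof (rule ccontr)
      assume "\<not> 0 \<le> \<sigma>"
      then have t: "turns w (T (Suc n))" using n' n w \<delta> by (intro turns_above_pi[of \<delta>]) (auto simp: \<sigma>_def)
      then have "F = Suc n" using quiet_not_turns Fq[of "Suc n"] Fn by (metis Suc_lessI)
      then show False using t 3(1) by simp
    qed
    have \<sigma>1: "\<sigma> \<le> \<theta> - 2 * \<delta>" using Tn T1 by (simp add: \<sigma>_def)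
    have P\<theta>: "pi \<le> P * \<theta>" using \<sigma>0 \<theta> T1 TnP by (simp add: \<sigma>_def)
    have P\<theta>2: "P * \<theta> \<le> 5" using Tn TnP \<theta> \<delta> pi_less_4 by linarith
    have trig: "sin (T (n + Suc k)) = sin (2 ^ k * (\<sigma> + \<theta>) - \<theta>) \<and> cos (T (n + Suc k)) = cos (2 ^ k * (\<sigma> + \<theta>) - \<theta>)" for k
      unfolding sin_cos_eq_iff
    proof (intro exI[of _ "2 ^ k"])
      have "T (n + Suc k) = 2 ^ k * (T (Suc n) + \<theta>) - \<theta>" using T_dbl[of "Suc n" k] by simp
      then show "T (n + Suc k) = 2 ^ k * (\<sigma> + \<theta>) - \<theta> + 2 * pi * of_int (2 ^ k)"
        by (simp add: \<sigma>_def algebra_simps)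
    qed
    have pow_le: "2 ^ Suc k * \<theta> \<le> P * \<theta>" if "k < n" for k
      unfolding P_def using that \<theta> by (intro mult_right_mono power_increasing) auto
    have q1: "quiet w (T (n + Suc k))" if k: "k < n" for k
    proof -
      have "0 \<le> 2 ^ k * \<sigma>" using \<sigma>0 by simp
      moreover have "\<theta> \<le> 2 ^ k * \<theta>" using \<theta> by simp
      ultimately have lo: "0 \<le> 2 ^ k * (\<sigma> + \<theta>) - \<theta>" by (simp add: algebra_simps)
      have "2 ^ k * (\<sigma> + \<theta>) \<le> 2 ^ k * (2 * \<theta>)" using \<sigma>1 \<delta> by (intro mult_left_mono) auto
      moreover have "2 ^ k * (2 * \<theta>) = 2 ^ Suc k * \<theta>" by simp
      ultimately have "2 ^ k * (\<sigma> + \<theta>) - \<theta> \<le> T n" using pow_le[OF k] TnP by linarith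
      then have "quiet w (2 ^ k * (\<sigma> + \<theta>) - \<theta>)" using lo Tn w \<delta> by (intro quiet_below_pi[of _ \<delta>]) auto
      then show ?thesis using trig[of k] quiet_cong by blast
    qed
    have F2: "n + Suc n \<le> F"
    proof (rule ccontr)
      assume "\<not> n + Suc n \<le> F"
      then obtain k where "k < n" "F = n + Suc k" using Fn
        by (metis add_Suc_right add_less_cancel_left less_imp_Suc_add linorder_not_le not_less_eq)
      then show False using q1 F(1) by blast
    qed
    have nt: "\<not> turns w (T (n + Suc n))"
    proof (cases "F = n + Suc n")
      case True then show ?thesis using 3(1) by simp
    next
      case False then show ?thesis using F2 Fq[of "n + Suc n"] quiet_not_turns by simp
    qed
    have P\<sigma>: "P * \<sigma> \<le> \<theta>"
    proof (rule ccontr)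
      assume big: "\<not> P * \<sigma> \<le> \<theta>"
      define s where "s = P * (\<sigma> + \<theta>) - \<theta>"
      have s: "s = T n + P * \<sigma>" by (simp add: s_def TnP algebra_simps)
      have s1: "pi + \<theta> / 2 \<le> s" using big \<sigma>0 T1 by (simp add: s \<sigma>_def)
      have "P * \<sigma> \<le> P * (\<theta> - 2 * \<delta>)" using \<sigma>1 P by (intro mult_left_mono) auto
      then have "s \<le> 2 * T n + \<theta> - 2 * (P * \<delta>)" by (simp add: s TnP algebra_simps)
      then have s2: "s \<le> 2 * pi + \<sigma> - 2 * (P * \<delta>)" using T1 by (simp add: \<sigma>_def)
      have "P * \<theta>\<^sup>2 \<le> P * \<delta>" using \<theta> P by (intro mult_left_mono) auto
      moreover have "pi * \<theta> \<le> P * \<theta>\<^sup>2" using mult_right_mono[OF P\<theta>, of \<theta>] \<theta> by (simp add: power2_eq_square mult.assoc)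
      moreover have "3 * \<theta> \<le> pi * \<theta>" using pi_gt3 \<theta> by (intro mult_right_mono) auto
      ultimately have "s < 2 * pi" using s2 \<sigma>1 \<delta> \<theta> by linarith
      then have "turns w s" using s1 \<theta> w by (intro turns_above_pi[of "\<theta> / 2"]) auto
      moreover have "sin (T (n + Suc n)) = sin s" "cos (T (n + Suc n)) = cos s" using trig[of n] unfolding s_def P_def by blast+
      ultimately show False using nt turns_cong by blast
    qed
    \<comment> \<open>modulo full turns, the doublings after F repeat the first cycle with theta - \<epsilon> in place of theta\<close>
    have trig2: "sin (T (F + Suc m)) = sin (2 ^ Suc m * (\<theta> - \<epsilon>) - \<theta>) \<and> cos (T (F + Suc m)) = cos (2 ^ Suc m * (\<theta> - \<epsilon>) - \<theta>)" for m
      unfolding sin_cos_eq_iff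
    proof (intro exI[of _ "2 ^ m + 2 ^ Suc m * k"])
      have "T (F + Suc m) = 2 ^ Suc m * (T F + \<theta>) - \<theta>" by (rule T_dbl)
      then show "T (F + Suc m) = 2 ^ Suc m * (\<theta> - \<epsilon>) - \<theta> + 2 * pi * of_int (2 ^ m + 2 ^ Suc m * k)"
        unfolding \<epsilon>(1) by (simp add: algebra_simps)
    qed
    have q2: "quiet w (T (F + Suc m))" if m: "m < n" for m
    proof -
      have "\<theta> \<le> 2 * (\<theta> - \<epsilon>)" using \<epsilon>(3) w(4) \<theta>(1) by (simp add: field_simps)
      also have "\<dots> \<le> 2 ^ Suc m * (\<theta> - \<epsilon>)" using \<epsilon>(3) w(4) \<theta>(1) by (intro mult_right_mono) auto
      finally have "0 \<le> 2 ^ Suc m * (\<theta> - \<epsilon>) - \<theta>" by simp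
      moreover have "2 ^ Suc m * (\<theta> - \<epsilon>) \<le> 2 ^ Suc m * \<theta>" using \<epsilon> w by (intro mult_left_mono) auto
      then have "2 ^ Suc m * (\<theta> - \<epsilon>) - \<theta> \<le> T n" using pow_le[OF m] TnP by linarith
      ultimately have "quiet w (2 ^ Suc m * (\<theta> - \<epsilon>) - \<theta>)" using Tn w \<delta> by (intro quiet_below_pi[of _ \<delta>]) auto
      then show ?thesis using trig2[of m] quiet_cong by blast
    qed
    have qc: "quiet c (T j)" if j: "j < F + Suc n" for j
    proof -
      consider "j < F" | "j = F" | m where "m < n" "j = F + Suc m"
        using j by (metis add_less_cancel_left less_imp_Suc_add add_Suc_right linorder_neqE_nat not_less_eq)
      then show ?thesis
        using Fq q2 quiet_mono[OF _ w(2)] sF 3(2) by cases (auto simp: quiet_def[of c "T F"])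
    qed
    have late: "turns c (T (F + Suc n))"
    proof -
      define Y where "Y = 2 ^ Suc n * (\<theta> - \<epsilon>) - \<theta>"
      have Y: "Y = 2 * pi + \<sigma> - 2 * (P * \<epsilon>)" by (simp add: Y_def P_def \<sigma>_def T_def algebra_simps)
      have "\<sigma> < 2 * (P * \<epsilon>)"
      proof -
        have "P * \<sigma> * \<theta>\<^sup>2 \<le> \<theta> * \<theta>\<^sup>2" using P\<sigma> by (intro mult_right_mono) auto
        also have "\<dots> = \<theta> ^ 3" by (simp add: power2_eq_square power3_eq_cube)
        also have "\<dots> \<le> c" by (rule \<theta>(4))
        also have "\<dots> < 2 * 1 * \<epsilon>" using \<epsilon> w by simp
        also have "2 * 1 * \<epsilon> \<le> 2 * (P * \<theta>)\<^sup>2 * \<epsilon>"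
          using P\<theta> pi_gt3 \<epsilon> w by (intro mult_right_mono mult_left_mono one_le_power) auto
        also have "\<dots> = P * (2 * (P * \<epsilon>)) * \<theta>\<^sup>2" by (simp add: power2_eq_square mult_ac)
        finally have "P * \<sigma> < P * (2 * (P * \<epsilon>))" using \<theta>(1) by (simp add: mult_less_cancel_right)
        then show ?thesis using P by simp
      qed
      then have "Y < 2 * pi" using Y by simp
      moreover have "2 * (P * \<epsilon>) \<le> 1"
      proof -
        have "P * \<epsilon> \<le> P * (\<theta> / 10)" using \<epsilon> w P by (intro mult_left_mono) auto
        then show ?thesis using P\<theta>2 by simp
      qed
      then have "pi + 1 \<le> Y" using Y \<sigma>0 pi_gt3 by simp
      moreover have "w \<le> 1 / 4" using w \<delta> by simp
      ultimately have "turns w Y" by (intro turns_above_pi[of 1]) auto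
      moreover have "sin (T (F + Suc n)) = sin Y" "cos (T (F + Suc n)) = cos Y" using trig2[of n] unfolding Y_def by blast+
      ultimately have "turns w (T (F + Suc n))" using turns_cong by blast
      then show ?thesis by (rule turns_mono[OF _ w(2)])
    qed
    show ?thesis
    proof (cases "kmax \<le> F + Suc n")
      case True
      then show ?thesis using qc by (intro exI[of _ kmax]) auto
    next
      case False
      moreover have "T (F + Suc n) > pi / 2" using TF T_mono[of F "F + Suc n"] by simp
      ultimately show ?thesis using qc late by (intro exI[of _ "F + Suc n"]) auto
    qed
  qed
qed

section \<open>Lower bounds for the transition operator\<close>

text \<open>
  The Bochner version, for which integrability has to be transported along with the value.
\<close>

lemma cameron_martin_integral:
  assumes u: "u \<in> space (Rd d)" and F: "F \<in> borel_measurable (Rd d)" and nn: "\<And>v. v \<in> space (Rd d) \<Longrightarrow> 0 \<le> F v"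
    and i: "integrable (gauss d) F"
  shows "integrable (gauss d) (\<lambda>v. F (lin d 1 1 v u) * exp (- dot d v u - dot d u u / 2))"
    and "(\<integral>v. F (lin d 1 1 v u) * exp (- dot d v u - dot d u u / 2) \<partial>gauss d) = (\<integral>v. F v \<partial>gauss d)"
proof -
  let ?G = "\<lambda>v. F (lin d 1 1 v u) * exp (- dot d v u - dot d u u / 2)"
  have mF: "F \<in> borel_measurable (gauss d)" using F by (simp cong: measurable_cong_sets)
  have mG: "?G \<in> borel_measurable (gauss d)" using u F by measurable
  have eq: "(\<integral>\<^sup>+v. ennreal (?G v) \<partial>gauss d) = (\<integral>\<^sup>+v. ennreal (F v) \<partial>gauss d)"
    using cameron_martin[of "\<lambda>v. ennreal (F v)" d u] F nn by (simp add: ennreal_mult)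
  have fin: "(\<integral>\<^sup>+v. ennreal (F v) \<partial>gauss d) < \<infinity>"
    using nn_integral_eq_integral[OF i AE_I2] nn by simp
  show "integrable (gauss d) ?G"
    using eq fin nn by (intro integrableI_nonneg mG AE_I2) auto
  show "(\<integral>v. ?G v \<partial>gauss d) = (\<integral>v. F v \<partial>gauss d)"
    using integral_eq_nn_integral[OF mG AE_I2] integral_eq_nn_integral[OF mF AE_I2] eq nn by simp
qed

context nuts begin

text \<open>
  A shift \<open>u t\<close> of the velocity may be chosen separately for each move
  \<open>t\<close>, because the operator is a sum over moves. Restricting the sum to
  \<open>S\<close> and the velocity to \<open>E\<close> leaves a lower bound in which all
  coefficients and densities are replaced by \<open>q\<close>.
\<close>

lemma Pop_lower:
  assumes x: "x \<in> space (Rd d)" and f: "test_fn f" and nn: "\<And>y. y \<in> space (Rd d) \<Longrightarrow> 0 \<le> f y"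
    and S: "S \<subseteq> moves kmax" and u: "\<And>t. t \<in> S \<Longrightarrow> u t \<in> space (Rd d)" and E: "E \<in> sets (Rd d)"
    and q: "\<And>t v. t \<in> S \<Longrightarrow> v \<in> E \<Longrightarrow> q \<le> coef d h kmax t (x, lin d 1 1 v (u t)) * exp (- dot d v (u t) - dot d (u t) (u t) / 2)" "0 \<le> q"
  shows "q * (\<Sum>t\<in>S. \<integral>v. indicator E v * f (dest d h t (x, lin d 1 1 v (u t))) \<partial>gauss d) \<le> Pop d h kmax f x"
proof -
  interpret prob_space "gauss d" by (rule prob_space_gauss)
  have fS: "finite S" by (rule finite_subset[OF S finite_moves])
  from f obtain B where B: "\<And>x. x \<in> space (Rd d) \<Longrightarrow> \<bar>f x\<bar> \<le> B" and fm: "f \<in> borel_measurable (Rd d)" by (auto simp: test_fn_def)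
  have x': "x \<in> space (gauss d)" using x by simp
  have "q * (\<Sum>t\<in>S. \<integral>v. indicator E v * f (dest d h t (x, lin d 1 1 v (u t))) \<partial>gauss d)
      = (\<Sum>t\<in>S. \<integral>v. q * (indicator E v * f (dest d h t (x, lin d 1 1 v (u t)))) \<partial>gauss d)"
    by (simp add: sum_distrib_left)
  also have "\<dots> \<le> (\<Sum>t\<in>S. \<integral>v. coef d h kmax t (x, v) * f (dest d h t (x, v)) \<partial>gauss d)"
  proof (rule sum_mono)
    fix t assume t: "t \<in> S"
    define F where "F = (\<lambda>v. coef d h kmax t (x, v) * f (dest d h t (x, v)))"
    have Fi: "integrable (gauss d) F" unfolding F_def using t S by (intro integrable_coef f x) auto
    have Fm: "F \<in> borel_measurable (Rd d)"
      using meas_section[OF fm x, of t] unfolding F_def by (simp cong: measurable_cong_sets)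
    have Fn: "0 \<le> F v" for v unfolding F_def using coef_nonneg nn by simp
    note cm = cameron_martin_integral[OF u[OF t] Fm Fn Fi]
    have dm: "(\<lambda>v. dest d h t (x, lin d 1 1 v (u t))) \<in> measurable (gauss d) (Rd d)"
    proof -
      have "(\<lambda>v. lin d 1 1 v (u t)) \<in> measurable (gauss d) (gauss d)" using u[OF t] by measurable
      then show ?thesis by (rule measurable_compose[OF _ measurable_compose[OF measurable_Pair1'[OF x'] meas_dest]])
    qed
    have "(\<integral>v. q * (indicator E v * f (dest d h t (x, lin d 1 1 v (u t)))) \<partial>gauss d)
       \<le> (\<integral>v. F (lin d 1 1 v (u t)) * exp (- dot d v (u t) - dot d (u t) (u t) / 2) \<partial>gauss d)"
    proof (rule integral_mono[OF _ cm(1)])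
      show "integrable (gauss d) (\<lambda>v. q * (indicator E v * f (dest d h t (x, lin d 1 1 v (u t)))))"
      proof (rule integrable_const_bound[where B="q * B"])
        show "AE v in gauss d. norm (q * (indicator E v * f (dest d h t (x, lin d 1 1 v (u t))))) \<le> q * B"
        proof (rule AE_I2)
          fix v
          have b: "\<bar>f (dest d h t (x, lin d 1 1 v (u t)))\<bar> \<le> B" by (rule B) simp
          then have "0 \<le> B" by linarith
          then have "\<bar>indicator E v * f (dest d h t (x, lin d 1 1 v (u t)))\<bar> \<le> B" using b by (simp add: indicator_def)
          then show "norm (q * (indicator E v * f (dest d h t (x, lin d 1 1 v (u t))))) \<le> q * B"
            using q(2) by (simp add: abs_mult mult_left_mono del: abs_mult) (simp add: abs_mult mult_left_mono)
        qed
        have "(\<lambda>v. f (dest d h t (x, lin d 1 1 v (u t)))) \<in> borel_measurable (gauss d)" by (rule measurable_compose[OF dm fm])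
        then show "(\<lambda>v. q * (indicator E v * f (dest d h t (x, lin d 1 1 v (u t))))) \<in> borel_measurable (gauss d)" using E by measurable
      qed
      fix v assume "v \<in> space (gauss d)"
      show "q * (indicator E v * f (dest d h t (x, lin d 1 1 v (u t)))) \<le> F (lin d 1 1 v (u t)) * exp (- dot d v (u t) - dot d (u t) (u t) / 2)"
      proof (cases "v \<in> E")
        case True
        have "q * f (dest d h t (x, lin d 1 1 v (u t))) \<le> (coef d h kmax t (x, lin d 1 1 v (u t)) * exp (- dot d v (u t) - dot d (u t) (u t) / 2)) * f (dest d h t (x, lin d 1 1 v (u t)))"
          by (intro mult_right_mono q t True nn) simp
        then show ?thesis using True by (simp add: F_def mult_ac)
      next
        case False
        then show ?thesis using Fn by simp
      qed
    qed
    also have "\<dots> = (\<integral>v. F v \<partial>gauss d)" by (rule cm(2))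
    finally show "(\<integral>v. q * (indicator E v * f (dest d h t (x, lin d 1 1 v (u t)))) \<partial>gauss d) \<le> (\<integral>v. coef d h kmax t (x, v) * f (dest d h t (x, v)) \<partial>gauss d)"
      by (simp add: F_def)
  qed
  also have "\<dots> \<le> (\<Sum>t\<in>moves kmax. \<integral>v. coef d h kmax t (x, v) * f (dest d h t (x, v)) \<partial>gauss d)"
    using S coef_nonneg nn by (intro sum_mono2 Bochner_Integration.integral_nonneg mult_nonneg_nonneg) auto
  also have "\<dots> = Pop d h kmax f x"
    unfolding Pop_def using f x by (subst Bochner_Integration.integral_sum) (auto intro: integrable_coef)
  finally show ?thesis .
qed

section \<open>A typical velocity\<close>

text \<open>
  Velocities for which all random inner products in the coupling have their typical size. The
  constants are six times the bounds on the means, so that Markov's inequality leaves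
  probability one half.
\<close>

definition typical :: "(nat \<Rightarrow> real) \<Rightarrow> (nat \<Rightarrow> real) \<Rightarrow> real \<Rightarrow> (nat \<Rightarrow> real) set" where
  "typical x D M = {v \<in> space (Rd d). \<bar>dot d v v - real d\<bar> \<le> 96 * sqrt d \<and> \<bar>dot d v x\<bar> \<le> 24 * enorm d x \<and> \<bar>dot d v D\<bar> \<le> 24 * M}"

lemma typical_prob:
  assumes x: "x \<in> space (Rd d)" and D: "D \<in> space (Rd d)" "enorm d D \<le> M" "0 < M" and xp: "0 < enorm d x"
  shows "typical x D M \<in> sets (Rd d)" "1 / 2 \<le> measure (gauss d) (typical x D M)"
proof -
  interpret prob_space "gauss d" by (rule prob_space_gauss)
  note [measurable] = x D(1)
  show m: "typical x D M \<in> sets (Rd d)" unfolding typical_def by measurable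
  have d0: "d > 0" using d_pos by simp
  define A1 where "A1 = {v \<in> space (Rd d). 96 * sqrt d \<le> \<bar>dot d v v - real d\<bar>}"
  define A2 where "A2 = {v \<in> space (Rd d). 24 * enorm d x \<le> \<bar>dot d v x\<bar>}"
  define A3 where "A3 = {v \<in> space (Rd d). 24 * M \<le> \<bar>dot d v D\<bar>}"
  have ms: "A1 \<in> sets (gauss d)" "A2 \<in> sets (gauss d)" "A3 \<in> sets (gauss d)"
    unfolding A1_def A2_def A3_def by measurable
  have sq: "0 < 96 * sqrt d" using d0 by simp
  have "prob A1 \<le> (\<integral>v. \<bar>dot d v v - real d\<bar> \<partial>gauss d) / (96 * sqrt d)"
    unfolding A1_def by (rule gauss_Markov) (use integrable_norm_dev[OF d0] sq in auto)
  also have "\<dots> \<le> (16 * sqrt d) / (96 * sqrt d)" using sq by (intro divide_right_mono integral_norm_dev d0) auto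
  finally have p1: "prob A1 \<le> 1/6" using d0 by simp
  have "prob A2 \<le> (\<integral>v. \<bar>dot d v x\<bar> \<partial>gauss d) / (24 * enorm d x)"
    unfolding A2_def by (rule gauss_Markov) (use integrable_abs_dot[OF x] xp x in auto)
  also have "\<dots> \<le> (4 * enorm d x) / (24 * enorm d x)" using xp by (intro divide_right_mono integral_abs_dot x) auto
  finally have p2: "prob A2 \<le> 1/6" using xp by simp
  have "prob A3 \<le> (\<integral>v. \<bar>dot d v D\<bar> \<partial>gauss d) / (24 * M)"
    unfolding A3_def by (rule gauss_Markov) (use integrable_abs_dot[OF D(1)] D in auto)
  also have "\<dots> \<le> (4 * enorm d D) / (24 * M)" using D by (intro divide_right_mono integral_abs_dot) auto
  also have "\<dots> \<le> (4 * M) / (24 * M)" using D by (intro divide_right_mono) auto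
  finally have p3: "prob A3 \<le> 1/6" using D by simp
  have "space (gauss d) - typical x D M \<subseteq> A1 \<union> A2 \<union> A3" by (auto simp: typical_def A1_def A2_def A3_def)
  then have "prob (space (gauss d) - typical x D M) \<le> prob (A1 \<union> A2 \<union> A3)" using ms by (intro finite_measure_mono) auto
  also have "\<dots> \<le> prob (A1 \<union> A2) + prob A3" using ms by (intro measure_Un_le) auto
  also have "\<dots> \<le> (prob A1 + prob A2) + prob A3" using ms by (intro add_right_mono measure_Un_le) auto
  also have "\<dots> \<le> 1/2" using p1 p2 p3 by simp
  finally show "1 / 2 \<le> measure (gauss d) (typical x D M)" using m by (subst (asm) prob_compl) auto
qed

end

lemma dot_add_self: "dot d (lin d 1 1 v u) (lin d 1 1 v u) = dot d v v + 2 * dot d v u + dot d u u"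
  by (simp add: dot_lin_left dot_lin_right dot_commute[of d u v])

text \<open>
  The expansion of \<open>|v0 + g * x + b * D|\<^sup>2\<close>, with bounds on its terms.
\<close>

lemma shifted_norm_bound:
  fixes S t1 t2 t3 t4 t5 :: real
  assumes "\<bar>S - d\<bar> \<le> 96 * q" "\<bar>t1\<bar> \<le> 48 * N" "\<bar>t2\<bar> \<le> 24 * N" "0 \<le> t3" "t3 \<le> 2 * N" "0 \<le> t4" "t4 \<le> N" "\<bar>t5\<bar> \<le> 2 * N" "1000 * N \<le> q"
  shows "\<bar>S + 2 * (t1 + t2) + (t3 + 2 * t5 + t4) - d\<bar> \<le> 97 * q"
  using assms unfolding abs_le_iff by auto

text \<open>
  The exponent of the Cameron--Martin density for the shift \<open>g * x + b * D\<close>, with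
  bounds on its terms.
\<close>

lemma shift_cost_bound:
  fixes t1 t2 t3 t4 t5 :: real
  assumes "\<bar>t1\<bar> \<le> 48 * C" "\<bar>t2\<bar> \<le> K" "t3 \<le> 2 * C2" "t4 \<le> Q" "2 * \<bar>t5\<bar> \<le> t3 + t4" "0 \<le> Z" "0 \<le> C2"
  shows "- (48 * C + K + (4 * C2 + 4 * Z + Q)) \<le> - (t1 + t2) - (t3 + 2 * t5 + t4) / 2"
proof -
  have "t1 \<le> 48 * C" "t2 \<le> K" "2 * t5 \<le> t3 + t4" using assms(1,2,5) by linarith+
  then show ?thesis using assms(3,4,6,7) by (simp add: add_divide_distrib; linarith)
qed

lemma abs_mult_le: "\<bar>a\<bar> \<le> A \<Longrightarrow> \<bar>b\<bar> \<le> B \<Longrightarrow> \<bar>a * b\<bar> \<le> A * (B::real)"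
  unfolding abs_mult by (rule mult_mono) auto

text \<open>
  Two shifts are compared. The first, \<open>g * x\<close>, is used for the chain at
  \<open>x\<close>, and the second, \<open>g * x + b * D\<close>, for the chain at
  \<open>y\<close>; the part \<open>b * D\<close> makes the destinations coincide. As
  \<open>g\<close> is of order \<open>1 / sqrt d\<close>, the first shift has length of order
  one but changes \<open>dot d x v\<close> by \<open>g * dot d x x\<close>, which is of order
  \<open>sqrt d\<close> and exceeds the fluctuations of this inner product by a large factor.
\<close>

lemma shift_bounds:
  fixes d :: nat and x y v0 :: "nat \<Rightarrow> real" and q M B C4 g b :: real
  defines "D \<equiv> lin d 1 (- 1) x y"
  defines "v1 \<equiv> lin d 1 1 v0 (lin d g 0 x x)" and "v2 \<equiv> lin d 1 1 v0 (lin d g b x D)"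
  assumes q: "q = sqrt d" "1000 * C4\<^sup>2 * M\<^sup>2 \<le> q" and c: "1 \<le> M" "1 \<le> B" "B \<le> C4"
    and R: "\<bar>dot d x x - d\<bar> \<le> M * q" "\<bar>dot d y y - d\<bar> \<le> M * q" and DD: "dot d D D \<le> M\<^sup>2"
    and v0: "\<bar>dot d v0 v0 - d\<bar> \<le> 96 * q" "\<bar>dot d v0 x\<bar> \<le> 24 * enorm d x" "\<bar>dot d v0 D\<bar> \<le> 24 * M"
    and g: "\<bar>g\<bar> * q \<le> G4" "G4 \<le> C4" and b: "\<bar>b\<bar> \<le> B"
  shows "\<bar>dot d x v1 - g * dot d x x\<bar> \<le> 48 * q" "\<bar>dot d v1 v1 - d\<bar> \<le> 97 * q"
    "\<bar>dot d y v2 - g * dot d x x\<bar> \<le> (49 + B * M) * q" "\<bar>dot d v2 v2 - d\<bar> \<le> 97 * q"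
    "\<bar>g * dot d x x\<bar> \<le> 2 * G4 * q" "real d / 2 \<le> dot d x x" "dot d x x \<le> 2 * real d"
    "- dot d v0 (lin d g 0 x x) - dot d (lin d g 0 x x) (lin d g 0 x x) / 2 \<ge> - (48 * C4 + 24 * B * M + (2 * C4 + B * M)\<^sup>2)"
    "- dot d v0 (lin d g b x D) - dot d (lin d g b x D) (lin d g b x D) / 2 \<ge> - (48 * C4 + 24 * B * M + (2 * C4 + B * M)\<^sup>2)"
proof -
  define R where "R = dot d x x" define Ry where "Ry = dot d y y" define a where "a = dot d v0 x"
  define e where "e = dot d v0 D" define S where "S = dot d v0 v0" define E where "E = dot d D D"
  define xD where "xD = dot d x D"
  have C4: "1 \<le> C4" using c by simp
  define N where "N = C4\<^sup>2 * M\<^sup>2"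
  have CM1: "1 \<le> N" using C4 c by (simp add: N_def mult_ge1_I one_le_power)
  have qN: "1000 * N \<le> q" using q(2) by (simp add: N_def mult.assoc)
  have q1: "1000 \<le> q" using qN CM1 by linarith
  have q2: "q\<^sup>2 = real d" "q * q = real d" using q(1) by (simp_all add: power2_eq_square)
  have MM: "M \<le> M\<^sup>2" "C4 \<le> C4\<^sup>2" using c C4 by (simp_all add: self_le_power)
  have CMa: "C4 \<le> N" "M\<^sup>2 \<le> N" "C4\<^sup>2 \<le> N" "M \<le> N"
  proof -
    have m1: "1 \<le> M\<^sup>2" "1 \<le> C4\<^sup>2" using c C4 by (simp_all add: one_le_power)
    show 3: "C4\<^sup>2 \<le> N" using mult_left_mono[OF m1(1), of "C4\<^sup>2"] by (simp add: N_def)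
    show 2: "M\<^sup>2 \<le> N" using mult_right_mono[OF m1(2), of "M\<^sup>2"] by (simp add: N_def)
    show "C4 \<le> N" "M \<le> N" using MM 2 3 by linarith+
  qed
  have g0: "0 \<le> G4" using g(1) q1 by (smt (verit) abs_ge_zero mult_nonneg_nonneg)
  have gC: "\<bar>g\<bar> * q \<le> C4" using g by simp
  have Mq: "M * q \<le> real d / 2"
  proof -
    have "2 * M \<le> q" using qN CMa CM1 by linarith
    then have "2 * M * q \<le> q * q" using q1 by (intro mult_right_mono) auto
    then show ?thesis using q2 by simp
  qed
  have Rb: "real d / 2 \<le> R" "R \<le> 2 * real d" using R(1) Mq by (auto simp: R_def abs_le_iff)
  then show "real d / 2 \<le> dot d x x" "dot d x x \<le> 2 * real d" by (simp_all add: R_def)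
  have R0: "0 \<le> R" by (simp add: R_def)
  have ex: "enorm d x \<le> 2 * q"
  proof -
    have "enorm d x \<le> sqrt (4 * real d)" unfolding enorm_eq_sqrt using Rb by (intro real_sqrt_le_mono) (simp add: R_def)
    then show ?thesis by (simp add: real_sqrt_mult q(1))
  qed
  have ab: "\<bar>a\<bar> \<le> 48 * q" using v0(2) ex by (simp add: a_def)
  have eb: "\<bar>e\<bar> \<le> 24 * M" using v0(3) by (simp add: e_def)
  have E0: "0 \<le> E" by (simp add: E_def)
  have Eb: "\<bar>E\<bar> \<le> M\<^sup>2" using DD E0 by (simp add: E_def)
  have dxy: "dot d y x = dot d x y" "dot d x v0 = a" "dot d D v0 = e" "dot d D x = xD" "dot d y v0 = a - e"
    by (simp_all add: dot_commute a_def e_def xD_def D_def dot_lin_right)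
  have xDe: "2 * xD = R - Ry + E"
    unfolding xD_def E_def D_def R_def Ry_def using dxy(1) by (simp add: dot_lin_left dot_lin_right)
  have yDe: "2 * dot d y D = R - Ry - E"
    unfolding E_def D_def R_def Ry_def using dxy(1) by (simp add: dot_lin_left dot_lin_right)
  have RRy: "\<bar>R - Ry\<bar> \<le> 2 * (M * q)" using R unfolding R_def Ry_def by linarith
  have xDb: "\<bar>xD\<bar> \<le> M * q + M\<^sup>2" using xDe RRy Eb by linarith
  have yDb: "\<bar>dot d y D\<bar> \<le> M * q + M\<^sup>2" using yDe RRy Eb by linarith
  have gx: "\<bar>g * xD\<bar> \<le> 2 * (C4 * M\<^sup>2)"
  proof -
    have "M * q + M\<^sup>2 \<le> 2 * M\<^sup>2 * q"
    proof -
      have "M * q \<le> M\<^sup>2 * q" "M\<^sup>2 * 1 \<le> M\<^sup>2 * q" using MM q1 c by (auto intro!: mult_right_mono mult_left_mono)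
      then show ?thesis by linarith
    qed
    then have "\<bar>xD\<bar> \<le> 2 * M\<^sup>2 * q" using xDb by simp
    then have "\<bar>g * xD\<bar> \<le> \<bar>g\<bar> * (2 * M\<^sup>2 * q)" unfolding abs_mult by (intro mult_left_mono) auto
    also have "\<dots> = 2 * M\<^sup>2 * (\<bar>g\<bar> * q)" by simp
    also have "\<dots> \<le> 2 * M\<^sup>2 * C4" by (intro mult_left_mono gC) auto
    finally show ?thesis by (simp add: mult_ac)
  qed
  have ga: "\<bar>g * a\<bar> \<le> 48 * C4"
  proof -
    have "\<bar>g * a\<bar> \<le> \<bar>g\<bar> * (48 * q)" unfolding abs_mult by (intro mult_left_mono ab) auto
    then show ?thesis using gC by simp
  qed
  have gR: "\<bar>g * R\<bar> \<le> 2 * G4 * q"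
  proof -
    have "\<bar>g * R\<bar> \<le> \<bar>g\<bar> * (2 * (q * q))" unfolding abs_mult using Rb R0 q2 by (intro mult_left_mono) auto
    also have "\<dots> = 2 * (\<bar>g\<bar> * q) * q" by simp
    also have "\<dots> \<le> 2 * G4 * q" using g(1) q1 by (intro mult_right_mono mult_left_mono) auto
    finally show ?thesis .
  qed
  then show "\<bar>g * dot d x x\<bar> \<le> 2 * G4 * q" by (simp add: R_def)
  have ggR: "0 \<le> g * (g * R)" "g * (g * R) \<le> 2 * C4\<^sup>2"
  proof -
    show "0 \<le> g * (g * R)" using R0 by (simp flip: mult.assoc)
    have "g * (g * R) \<le> \<bar>g\<bar> * \<bar>g * R\<bar>" by (metis abs_ge_self abs_mult)
    also have "\<dots> \<le> \<bar>g\<bar> * (2 * G4 * q)" by (intro mult_left_mono gR) auto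
    also have "\<dots> = 2 * G4 * (\<bar>g\<bar> * q)" by simp
    also have "\<dots> \<le> 2 * C4 * C4" using g g0 gC q1 by (intro mult_mono) auto
    finally show "g * (g * R) \<le> 2 * C4\<^sup>2" by (simp add: power2_eq_square)
  qed
  have BM: "0 \<le> B * M" "B * M \<le> C4 * M" using c by auto
  have be: "\<bar>b * e\<bar> \<le> 24 * (N)" 
  proof -
    have "\<bar>b * e\<bar> \<le> B * (24 * M)" by (rule abs_mult_le[OF b eb])
    also have "\<dots> \<le> C4\<^sup>2 * (24 * M\<^sup>2)" using c C4 MM by (intro mult_mono) auto
    finally show ?thesis by (simp add: N_def)
  qed
  have be': "\<bar>b * e\<bar> \<le> 24 * B * M" using abs_mult_le[OF b eb] by simp
  have bbE: "0 \<le> b * (b * E)" "b * (b * E) \<le> (B * M)\<^sup>2"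
  proof -
    show "0 \<le> b * (b * E)" using E0 by (simp flip: mult.assoc)
    have "\<bar>b * (b * E)\<bar> \<le> B * (B * M\<^sup>2)" by (intro abs_mult_le b Eb)
    then show "b * (b * E) \<le> (B * M)\<^sup>2" by (simp add: power2_eq_square mult_ac)
  qed
  have BM2: "(B * M)\<^sup>2 \<le> N" using c by (simp add: N_def power_mult_distrib mult_right_mono power_mono)
  have bgx: "\<bar>b * (g * xD)\<bar> \<le> B * (2 * (C4 * M\<^sup>2))" by (rule abs_mult_le[OF b gx])
  have bgx2: "B * (2 * (C4 * M\<^sup>2)) \<le> 2 * (N)"
  proof -
    have "B * (C4 * M\<^sup>2) \<le> C4 * (C4 * M\<^sup>2)" using c C4 by (intro mult_right_mono) auto
    then show ?thesis by (simp add: N_def power2_eq_square mult_ac)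
  qed
  have xv1: "dot d x v1 = a + g * R" unfolding v1_def R_def by (simp add: dot_lin_right dxy)
  then show "\<bar>dot d x v1 - g * dot d x x\<bar> \<le> 48 * q" using ab by (simp add: R_def)
  have v11: "dot d v1 v1 = S + 2 * (g * a) + g * (g * R)"
    unfolding v1_def R_def S_def by (simp add: dot_lin_left dot_lin_right dxy a_def[symmetric] algebra_simps)
  show "\<bar>dot d v1 v1 - d\<bar> \<le> 97 * q"
    using v0(1)[folded S_def] ga ggR CMa CM1 qN unfolding v11 by linarith
  have yv2: "dot d y v2 - g * R = (a - e) - g * xD + b * dot d y D"
    unfolding v2_def R_def xD_def D_def[symmetric] using dxy(5)
    by (simp add: dot_lin_right; simp add: D_def dot_lin_right dxy(1) algebra_simps)
  have byD: "\<bar>b * dot d y D\<bar> \<le> B * (M * q) + N"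
  proof -
    have "\<bar>b * dot d y D\<bar> \<le> B * (M * q + M\<^sup>2)" by (rule abs_mult_le[OF b yDb])
    moreover have "B * M\<^sup>2 \<le> N" using c MM unfolding N_def by (intro mult_right_mono) auto
    ultimately show ?thesis by (simp add: algebra_simps)
  qed
  have gx2: "C4 * M\<^sup>2 \<le> N" using MM unfolding N_def by (intro mult_right_mono) auto
  have "\<bar>dot d y v2 - g * R\<bar> \<le> 49 * q + B * (M * q)"
    unfolding yv2 using ab eb gx gx2 byD CMa CM1 qN by linarith
  then show "\<bar>dot d y v2 - g * dot d x x\<bar> \<le> (49 + B * M) * q" by (simp add: R_def algebra_simps)
  have uu: "dot d (lin d g b x D) (lin d g b x D) = g * (g * R) + 2 * (b * (g * xD)) + b * (b * E)" for b
    unfolding R_def E_def xD_def[symmetric] by (simp add: dot_lin_left dot_lin_right dxy(4) xD_def[symmetric] algebra_simps)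
  have v0u: "dot d v0 (lin d g b x D) = g * a + b * e" for b
    unfolding a_def e_def by (simp add: dot_lin_right)
  have v22: "dot d v2 v2 = S + 2 * (g * a + b * e) + (g * (g * R) + 2 * (b * (g * xD)) + b * (b * E))"
  proof -
    have "dot d v2 v2 = dot d v0 v0 + 2 * dot d v0 (lin d g b x D) + dot d (lin d g b x D) (lin d g b x D)"
      unfolding v2_def by (rule dot_add_self)
    then show ?thesis unfolding v0u uu S_def .
  qed
  show "\<bar>dot d v2 v2 - d\<bar> \<le> 97 * q"
    unfolding v22
  proof (rule shifted_norm_bound[OF v0(1)[folded S_def] _ be ggR(1) _ bbE(1) _ _ qN])
    show "\<bar>g * a\<bar> \<le> 48 * N" using ga CMa(1) by linarith
    show "g * (g * R) \<le> 2 * N" using ggR(2) CMa(3) by linarith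
    show "b * (b * E) \<le> N" using bbE(2) BM2 by linarith
    show "\<bar>b * (g * xD)\<bar> \<le> 2 * N" using bgx bgx2 by linarith
  qed
  have sq: "(2 * C4 + B * M)\<^sup>2 = 4 * C4\<^sup>2 + 4 * (C4 * (B * M)) + (B * M)\<^sup>2" by (simp add: power2_eq_square algebra_simps)
  have z0: "0 \<le> C4 * (B * M)" using C4 BM by simp
  have l0: "lin d g 0 x x = lin d g 0 x D" by (auto simp: lin_def)
  show "- dot d v0 (lin d g 0 x x) - dot d (lin d g 0 x x) (lin d g 0 x x) / 2 \<ge> - (48 * C4 + 24 * B * M + (2 * C4 + B * M)\<^sup>2)"
    unfolding l0 uu v0u sq
    by (rule shift_cost_bound) (use ga ggR z0 BM in auto)
  show "- dot d v0 (lin d g b x D) - dot d (lin d g b x D) (lin d g b x D) / 2 \<ge> - (48 * C4 + 24 * B * M + (2 * C4 + B * M)\<^sup>2)"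
  proof -
    have "0 \<le> dot d (lin d g b x D) (lin d g b x D)" "0 \<le> dot d (lin d g (- b) x D) (lin d g (- b) x D)" by simp_all
    then have ge2: "2 * \<bar>b * (g * xD)\<bar> \<le> g * (g * R) + b * (b * E)" unfolding uu by (simp add: abs_if)
    show ?thesis
      unfolding uu v0u sq by (rule shift_cost_bound[OF ga be' ggR(2) bbE(2) ge2 z0]) simp
  qed
qed

section \<open>One-shot coupling\<close>

text \<open>
  Constants of the coupling that depend on the arc \<open>\<tau>\<close> and on the distance
  scale \<open>M\<close>: \<open>cB\<close> bounds the cotangent of the angle of a move that is
  used, \<open>cC\<close> the fluctuations of the inner products in units of \<open>sqrt
  d\<close>, \<open>cG\<close> the push along the position that overrides these fluctuations,
  \<open>cA\<close> the inner products after the push, \<open>cK\<close> the cost of the shifts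
  in the exponent, \<open>shot\<close> the overlap achieved in one step, and \<open>cW\<close>
  the width of the shell in which the common destination lies.
\<close>

definition cB :: "real \<Rightarrow> real" where "cB \<tau> = 1 / sqrt (kap \<tau> / 2)"
definition cC :: "real \<Rightarrow> real \<Rightarrow> real" where "cC \<tau> M = 200 * (1 + cB \<tau>)\<^sup>2 * M\<^sup>2"
definition cG :: "real \<Rightarrow> real \<Rightarrow> real" where "cG \<tau> M = 80 * cC \<tau> M * cB \<tau>"
definition cA :: "real \<Rightarrow> real \<Rightarrow> real" where "cA \<tau> M = 2 * cG \<tau> M + cC \<tau> M"
definition cK :: "real \<Rightarrow> real \<Rightarrow> real" where
  "cK \<tau> M = 48 * cG \<tau> M + 24 * cB \<tau> * M + (2 * cG \<tau> M + cB \<tau> * M)\<^sup>2"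
definition shot :: "real \<Rightarrow> real \<Rightarrow> real" where "shot \<tau> M = (kap \<tau>)\<^sup>2 * exp (- cK \<tau> M) / 24"
definition cW :: "real \<Rightarrow> real \<Rightarrow> real" where "cW \<tau> M = M + 6 * cA \<tau> M"

lemma const_bounds:
  assumes \<tau>: "0 < \<tau>" and M: "1 \<le> M"
  shows "1 \<le> cB \<tau>" "100 + M + 2 * (cB \<tau> * M) \<le> cC \<tau> M" "cB \<tau> \<le> cG \<tau> M" "cC \<tau> M \<le> cG \<tau> M" "1 \<le> cC \<tau> M"
    "cA \<tau> M \<le> 3 * cG \<tau> M" "0 < shot \<tau> M" "shot \<tau> M \<le> 1" "(cB \<tau>)\<^sup>2 = 2 / kap \<tau>"
proof -
  have k: "0 < kap \<tau>" "kap \<tau> \<le> 1/4" using kap_pos[OF \<tau>] kap_le by auto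
  have "sqrt (kap \<tau> / 2) \<le> 1" using k by simp
  then show B: "1 \<le> cB \<tau>" using k by (simp add: cB_def field_simps)
  show "(cB \<tau>)\<^sup>2 = 2 / kap \<tau>" using k by (simp add: cB_def power_divide)
  have BM: "1 \<le> cB \<tau> * M" using B M by (simp add: mult_ge1_I)
  have e: "(1 + cB \<tau>)\<^sup>2 * M\<^sup>2 = (M + cB \<tau> * M)\<^sup>2" by (simp add: power2_eq_square algebra_simps)
  have "M + cB \<tau> * M \<le> (M + cB \<tau> * M)\<^sup>2" using M BM by (intro self_le_power) auto
  then have "200 * (M + cB \<tau> * M) \<le> cC \<tau> M" unfolding cC_def mult.assoc e by simp
  then show C: "100 + M + 2 * (cB \<tau> * M) \<le> cC \<tau> M" using M BM by simp
  then show C1: "1 \<le> cC \<tau> M" using M BM by simp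
  have "1 * 1 \<le> 80 * cB \<tau>" using B by simp
  then have "cC \<tau> M * 1 \<le> cC \<tau> M * (80 * cB \<tau>)" using C1 by (intro mult_left_mono) auto
  then show CG: "cC \<tau> M \<le> cG \<tau> M" by (simp add: cG_def)
  have "cB \<tau> * 1 \<le> cB \<tau> * (80 * cC \<tau> M)" using C1 B by (intro mult_left_mono) auto
  then show "cB \<tau> \<le> cG \<tau> M" by (simp add: cG_def mult_ac)
  show "cA \<tau> M \<le> 3 * cG \<tau> M" using CG by (simp add: cA_def)
  show "0 < shot \<tau> M" using k by (simp add: shot_def)
  have K0: "0 \<le> cK \<tau> M" unfolding cK_def using CG C1 B M by (intro add_nonneg_nonneg mult_nonneg_nonneg) auto
  have "(kap \<tau>)\<^sup>2 * exp (- cK \<tau> M) \<le> 1 * 1" using k K0 by (intro mult_mono power_le_one) auto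
  then show "shot \<tau> M \<le> 1" by (simp add: shot_def)
qed

text \<open>
  If the average of values that are at most one is at least \<open>k\<close>, then a fraction
  \<open>k / 2\<close> of them is at least \<open>k / 2\<close>.
\<close>

lemma card_large_values:
  fixes f :: "'a \<Rightarrow> real"
  assumes A: "finite A" and f: "\<And>a. a \<in> A \<Longrightarrow> f a \<le> 1" and s: "real (card A) * k \<le> (\<Sum>a\<in>A. f a)" and k: "0 \<le> k"
  shows "real (card A) * (k / 2) \<le> real (card {a \<in> A. k / 2 \<le> f a})"
proof -
  have "(\<Sum>a\<in>A. f a) \<le> (\<Sum>a\<in>A. (if k / 2 \<le> f a then 1 else 0) + k / 2)"
    using f k by (intro sum_mono) (auto simp: not_le intro: add_increasing2)
  also have "\<dots> = real (card {a \<in> A. k / 2 \<le> f a}) + real (card A) * (k / 2)"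
    using A by (simp add: sum.distrib sum.If_cases Int_def conj_commute)
  finally show ?thesis using s by (simp add: algebra_simps)
qed

context nuts begin

text \<open>
  In \<open>gt_formula\<close>, the push \<open>gR\<close> contributes \<open>cos (2 * ang p) *
  gR\<close> at the right end \<open>p\<close> of the orbit. If this is negative and large, so
  is \<open>gt\<close>, and it outweighs the term \<open>sin T * sn\<close>, because \<open>sin
  T\<close> is at most a small multiple of \<open>1 - cos T\<close>. By \<open>Ut_sign\<close>
  the orbit then makes a U-turn.
\<close>

lemma trigger:
  assumes z: "calm d (cA \<tau> M * sqrt d) (x, v)" and \<tau>: "0 < \<tau>" and M: "1 \<le> M"
    and hd: "h\<^sup>2 * real d \<le> sqrt d" and big: "12 * cA \<tau> M \<le> sqrt d"
    and R: "\<bar>dot d x x - d\<bar> \<le> M * sqrt d" and S: "\<bar>dot d v v - d\<bar> \<le> 97 * sqrt d"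
    and G: "\<bar>dot d x v - gR\<bar> \<le> (49 + cB \<tau> * M) * sqrt d"
    and k: "cos (2 * ang (lo + 2 ^ j - 1)) * gR \<le> - (cG \<tau> M * sqrt d / (2 * cB \<tau>))"
    and T: "sin (arcl j) \<le> 6 * cC \<tau> M / sqrt d * (1 - cos (arcl j))" "0 < 1 - cos (arcl j)"
  shows "Ut d h (x, v) lo j"
proof -
  define q where "q = sqrt d"
  have q: "0 < q" "q * q = real d" using d_pos by (simp_all add: q_def)
  note cb = const_bounds[OF \<tau> M]
  define p where "p = lo + 2 ^ j - 1"
  have zp: "(x, v) \<in> phase_space d" using z by (simp add: calm_def)
  have Aq: "real d * h\<^sup>2 \<le> cA \<tau> M * sqrt d"
  proof -
    have "1 \<le> cA \<tau> M" using cb by (simp add: cA_def)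
    then have "1 * q \<le> cA \<tau> M * q" using q by (intro mult_right_mono) auto
    then show ?thesis using hd by (simp add: q_def mult.commute)
  qed
  have A12: "12 * (cA \<tau> M * q) \<le> real d" using mult_right_mono[OF big, of q] q by (simp add: q_def)
  have sn: "0 \<le> sn d h (x, v) p" "sn d h (x, v) p \<le> 2 * real d"
    using calm_bounds(2,3)[OF z Aq, of p] A12 cb(5) q by (auto simp: q_def)
  have gt: "gt d h (x, v) p \<le> - (19 * cC \<tau> M * q)"
  proof -
    define kk where "kk = cos (2 * ang p)"
    have kk: "kk = (cos (ang p))\<^sup>2 - (sin (ang p))\<^sup>2" by (simp add: kk_def cos_double)
    have f: "gt d h (x, v) p = \<beta> * (kk * gR) + \<beta> * (kk * (dot d x v - gR)) + sin (ang p) * cos (ang p) * (dot d v v - \<beta>\<^sup>2 * dot d x x)"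
      unfolding gt_formula kk by (simp add: algebra_simps)
    have "\<beta> * (kk * gR) \<le> \<beta> * (- (cG \<tau> M * q / (2 * cB \<tau>)))"
      using k beta_bounds(1) by (intro mult_left_mono) (auto simp: kk_def p_def q_def)
    also have "\<dots> \<le> 1/2 * (- (cG \<tau> M * q / (2 * cB \<tau>)))"
      using beta_bounds(4) cb q by (intro mult_right_mono_neg) auto
    also have "\<dots> = - (20 * cC \<tau> M * q)" using cb(1) by (simp add: cG_def field_simps)
    finally have 1: "\<beta> * (kk * gR) \<le> - (20 * cC \<tau> M * q)" .
    have k2: "\<bar>kk * (dot d x v - gR)\<bar> \<le> 1 * ((49 + cB \<tau> * M) * q)" using G by (intro abs_mult_le) (auto simp: kk_def q_def)
    have "\<bar>\<beta> * (kk * (dot d x v - gR))\<bar> \<le> 1 * (1 * ((49 + cB \<tau> * M) * q))"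
      by (rule abs_mult_le[OF _ k2]) (use beta_bounds in auto)
    then have 2: "\<beta> * (kk * (dot d x v - gR)) \<le> (49 + cB \<tau> * M) * q" by (simp add: abs_le_iff)
    have Rd: "0 \<le> dot d x x" "dot d x x \<le> 2 * real d"
    proof -
      have "M * q \<le> real d"
      proof -
        have "M \<le> 12 * cA \<tau> M" using cb M by (simp add: cA_def) (use mult_nonneg_nonneg[of "cB \<tau>" M] in linarith)
        then have "M * q \<le> q * q" using big q by (intro mult_right_mono) (auto simp: q_def)
        then show ?thesis using q by simp
      qed
      then show "dot d x x \<le> 2 * real d" using R unfolding q_def by linarith
    qed simp
    have "h\<^sup>2 / 4 * dot d x x \<le> h\<^sup>2 / 4 * (2 * real d)" using Rd by (intro mult_left_mono) auto
    also have "\<dots> = (h\<^sup>2 * real d) / 2" by simp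
    also have "\<dots> \<le> q" using hd q(1) unfolding q_def by linarith
    finally have hR: "0 \<le> h\<^sup>2 / 4 * dot d x x" "h\<^sup>2 / 4 * dot d x x \<le> q" using Rd by auto
    have bR: "\<beta>\<^sup>2 * dot d x x = dot d x x - h\<^sup>2 / 4 * dot d x x" by (simp add: beta_bounds(3) algebra_simps)
    have "\<bar>dot d v v - \<beta>\<^sup>2 * dot d x x\<bar> \<le> (98 + M) * q"
    proof -
      have "(98 + M) * q = 98 * q + M * q" by (simp add: algebra_simps)
      then show ?thesis unfolding bR using S[folded q_def] R[folded q_def] hR by linarith
    qed
    then have "\<bar>sin (ang p) * cos (ang p) * (dot d v v - \<beta>\<^sup>2 * dot d x x)\<bar> \<le> 1/2 * ((98 + M) * q)"
      by (intro abs_mult_le sin_cos_half)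
    then have "sin (ang p) * cos (ang p) * (dot d v v - \<beta>\<^sup>2 * dot d x x) \<le> 1/2 * ((98 + M) * q)"
      by (rule order_trans[OF abs_ge_self])
    then have 3: "sin (ang p) * cos (ang p) * (dot d v v - \<beta>\<^sup>2 * dot d x x) \<le> (49 + M / 2) * q" by (simp add: algebra_simps)
    have "(100 + M + 2 * (cB \<tau> * M)) * q \<le> cC \<tau> M * q" using cb(2) q by (intro mult_right_mono) auto
    moreover have "0 \<le> cB \<tau> * M * q" "0 \<le> M * q" using cb(1) M q by auto
    ultimately show ?thesis unfolding f using 1 2 3 q by (simp add: algebra_simps)
  qed
  have cd: "6 * cC \<tau> M / sqrt d * (2 * real d) = 12 * cC \<tau> M * q"
  proof -
    have "6 * cC \<tau> M / q * (2 * (q * q)) = 12 * cC \<tau> M * q" using q(1) by simp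
    then show ?thesis unfolding q(2) by (simp only: q_def)
  qed
  have "sin (arcl j) * sn d h (x, v) p \<le> (1 - cos (arcl j)) * (12 * cC \<tau> M * q)"
  proof (cases "0 \<le> sin (arcl j)")
    case True
    have "sin (arcl j) * sn d h (x, v) p \<le> (6 * cC \<tau> M / sqrt d * (1 - cos (arcl j))) * (2 * real d)"
      using True sn T by (intro mult_mono) auto
    also have "\<dots> = (1 - cos (arcl j)) * (12 * cC \<tau> M * q)" unfolding cd[symmetric] by simp
    finally show ?thesis .
  next
    case False
    then have "sin (arcl j) * sn d h (x, v) p \<le> 0" using sn by (simp add: mult_nonpos_nonneg)
    moreover have "0 \<le> (1 - cos (arcl j)) * (12 * cC \<tau> M * q)" using T cb q by (intro mult_nonneg_nonneg) auto
    ultimately show ?thesis by linarith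
  qed
  moreover have "(1 - cos (arcl j)) * gt d h (x, v) p < (1 - cos (arcl j)) * (- (12 * cC \<tau> M * q))"
  proof (intro mult_strict_left_mono T)
    have "0 < cC \<tau> M * q" using cb(5) q by simp
    then show "gt d h (x, v) p < - (12 * cC \<tau> M * q)" using gt by simp
  qed
  ultimately have "(1 - cos (arcl j)) * gt d h (x, v) p + sin (arcl j) * sn d h (x, v) p < 0" by simp
  then show ?thesis unfolding Ut_sign[OF zp arcl_def] p_def by blast
qed

lemma coef_lower:
  assumes c: "calm d A z" and A: "real d * h\<^sup>2 \<le> A" "6 * A \<le> real d" "h\<^sup>2 * A \<le> 1/2"
    and q: "\<And>i. i < j \<Longrightarrow> quiet (6 * A / real d) (arcl i)" and s: "j = kmax \<or> Ut d h z lo j"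
  shows "1 / (3 * 4 ^ j) \<le> coef d h kmax (lo, j, i) z"
proof -
  have o: "orbit_prob (Ut d h z) kmax lo j = 1 / 2 ^ j" by (rule orbit_prob_quiet[OF c A(1,2) q s])
  have "1 / 3 \<le> 2 ^ j * (wgt d h z i / (\<Sum>k\<in>blk lo j. wgt d h z k))" by (rule wgt_bounds(3)[OF c A(1,3)])
  then have "(1 / 3) * (1 / 4 ^ j) \<le> (2 ^ j * (wgt d h z i / (\<Sum>k\<in>blk lo j. wgt d h z k))) * (1 / 4 ^ j)"
    by (intro mult_right_mono) auto
  also have "\<dots> = coef d h kmax (lo, j, i) z"
  proof -
    have "(4::real) ^ j = 2 ^ j * 2 ^ j" by (simp flip: power_mult_distrib)
    then show ?thesis unfolding coef_def prod.case o by simp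
  qed
  finally show ?thesis by simp
qed

text \<open>
  The difference of the positions enters the destination with the factor \<open>cos\<close> of
  the angle of the move, and the shift of the velocity with the factor \<open>sin /
  \<beta>\<close>.
\<close>

lemma dest_shift:
  assumes "sin (ang (snd (snd t))) \<noteq> 0"
  shows "dest d h t (y, lin d 1 1 v (lin d g (\<beta> * cos (ang (snd (snd t))) / sin (ang (snd (snd t)))) x (lin d 1 (- 1) x y)))
       = dest d h t (x, lin d 1 1 v (lin d g 0 x x))"
  unfolding dest_def rot_def fst_conv snd_conv ang_def[symmetric] using assms beta_bounds(1)
  by (intro space_Rd_eqI[where d=d]) (simp_all add: lin_nth field_simps)

text \<open>
  Two chains whose positions are at distance at most \<open>M\<close>, both in the typical
  shell, end in the same point with probability at least \<open>shot \<tau> M\<close>, and this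
  point lies in a shell of width of order \<open>sqrt d\<close>. The coupling is expressed by
  test functions: if \<open>f1\<close> exceeds \<open>f2\<close> by at most \<open>s < 1\<close>
  on that shell, then the difference of the images is smaller than one by a definite fraction of
  \<open>1 - s\<close>.

  For each move in a set \<open>S\<close>, the velocities of the two chains are shifted by
  vectors of length of order one such that the destinations agree. This only makes sense if the
  move has a substantial probability for both chains, that is, if both select the same orbit. If
  the length at which selection stops is decided by the arcs alone, this holds for all typical
  velocities. Otherwise the velocity is pushed along the position, which forces the U-turn; the
  sign of the push depends on the position of \<open>0\<close> in the orbit through \<open>cos
  (2 * ang p)\<close>, and the positions for which this cosine is too small are left out. In
  both cases \<open>S\<close> contains a fixed fraction of the \<open>4 ^ J\<close> moves with
  orbits of length \<open>2 ^ J\<close>, each of which has probability of order \<open>1 / 4 ^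
  J\<close>.
\<close>

lemma one_shot:
  fixes M \<tau> s :: real
  assumes M: "1 \<le> M" and \<tau>: "0 < \<tau>" "\<tau> \<le> pi / 2" "\<tau> \<le> arcl kmax" and th: "\<theta> \<le> pi / 4"
    and big: "1000 * (cG \<tau> M)\<^sup>2 * M\<^sup>2 \<le> sqrt d" and hd: "h\<^sup>2 * real d \<le> sqrt d" and hA: "h\<^sup>2 * (cA \<tau> M * sqrt d) \<le> 1/2"
    and esc: "\<exists>J\<le>kmax. (J = kmax \<or> arcl J > pi / 2) \<and>
      ((\<forall>i<J. quiet (6 * cC \<tau> M / sqrt d) (arcl i)) \<and> (J = kmax \<or> turns (6 * cC \<tau> M / sqrt d) (arcl J)) \<or>
       (\<forall>i<J. quiet (6 * cA \<tau> M / sqrt d) (arcl i)) \<and> sin (arcl J) \<le> 6 * cC \<tau> M / sqrt d * (1 - cos (arcl J)) \<and> 0 < 1 - cos (arcl J))"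
    and x: "x \<in> space (Rd d)" "\<bar>dot d x x - d\<bar> \<le> M * sqrt d" and y: "y \<in> space (Rd d)" "\<bar>dot d y y - d\<bar> \<le> M * sqrt d"
    and D: "dot d (lin d 1 (- 1) x y) (lin d 1 (- 1) x y) \<le> M\<^sup>2"
    and f1: "test_fn f1" "\<And>z. z \<in> space (Rd d) \<Longrightarrow> 0 \<le> f1 z \<and> f1 z \<le> 1"
    and f2: "test_fn f2" "\<And>z. z \<in> space (Rd d) \<Longrightarrow> 0 \<le> f2 z \<and> f2 z \<le> 1"
    and s: "s \<le> 1" and f12: "\<And>z. z \<in> space (Rd d) \<Longrightarrow> \<bar>dot d z z - d\<bar> \<le> cW \<tau> M * sqrt d \<Longrightarrow> f1 z \<le> f2 z + s"
  shows "Pop d h kmax f1 x - Pop d h kmax f2 y \<le> 1 - shot \<tau> M * (1 - s)"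
proof -
  interpret prob_space "gauss d" by (rule prob_space_gauss)
  note cb = const_bounds[OF \<tau>(1) M]
  define q where "q = sqrt d"
  have q: "0 < q" "q * q = real d" using d_pos by (simp_all add: q_def)
  let ?D = "lin d 1 (- 1) x y"
  have Dsp: "?D \<in> space (Rd d)" by simp
  have kp: "0 < kap \<tau>" "kap \<tau> \<le> 1/4" using kap_pos[OF \<tau>(1)] kap_le by auto
  have big': "12 * cA \<tau> M \<le> q"
  proof -
    have g1: "1 \<le> cG \<tau> M" using cb by linarith
    have "cG \<tau> M * 1 \<le> (cG \<tau> M)\<^sup>2 * M\<^sup>2" using g1 M by (intro mult_mono self_le_power one_le_power) auto
    then have "36 * cG \<tau> M \<le> q" using big g1 by (simp add: q_def; linarith)
    then show ?thesis using cb(6) by linarith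
  qed
  have q1: "1 \<le> q" using big' cb by (simp add: cA_def; linarith)
  have cA1: "1 \<le> cA \<tau> M" "cC \<tau> M \<le> cA \<tau> M" using cb by (auto simp: cA_def)
  have div: "6 * (a * q) / real d = 6 * a / q" for a unfolding q(2)[symmetric] using q(1) by simp
  have amp: "real d * h\<^sup>2 \<le> a * q" "6 * (a * q) \<le> real d" "12 * (a * q) \<le> real d" "h\<^sup>2 * (a * q) \<le> 1/2"
    if a: "1 \<le> a" "a \<le> cA \<tau> M" for a
  proof -
    have "1 * q \<le> a * q" using a q by (intro mult_right_mono) auto
    then show "real d * h\<^sup>2 \<le> a * q" using hd by (simp add: q_def mult.commute)
    have "12 * a * q \<le> q * q" using big' a q by (intro mult_right_mono) auto
    then show 12: "12 * (a * q) \<le> real d" using q by simp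
    have "0 \<le> a * q" using a q by simp
    then show "6 * (a * q) \<le> real d" using 12 by linarith
    have "h\<^sup>2 * (a * q) \<le> h\<^sup>2 * (cA \<tau> M * q)" using a q by (intro mult_left_mono mult_right_mono) auto
    then show "h\<^sup>2 * (a * q) \<le> 1/2" using hA by (simp add: q_def)
  qed
  have xpos: "0 < enorm d x"
  proof -
    have "M * q < real d"
    proof -
      have "M < 12 * cA \<tau> M" using cb M cA1 by (simp add: cA_def) (use mult_nonneg_nonneg[of "cB \<tau>" M] in linarith)
      then have "M * q < q * q" using big' q by (intro mult_strict_right_mono) auto
      then show ?thesis using q by simp
    qed
    then have "0 < dot d x x" using x(2) unfolding q_def by linarith
    then show ?thesis by (simp add: enorm_eq_sqrt)
  qed
  define E where "E = typical x ?D M"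
  have "enorm d ?D \<le> M" using D M by (simp add: enorm_eq_sqrt real_le_lsqrt)
  then have E: "E \<in> sets (Rd d)" "1/2 \<le> prob E"
    unfolding E_def using typical_prob[OF x(1) Dsp _ _ xpos] M by auto
  from esc obtain J where J: "J \<le> kmax" "J = kmax \<or> arcl J > pi / 2"
    and alt: "((\<forall>i<J. quiet (6 * cC \<tau> M / q) (arcl i)) \<and> (J = kmax \<or> turns (6 * cC \<tau> M / q) (arcl J)) \<or>
       (\<forall>i<J. quiet (6 * cA \<tau> M / q) (arcl i)) \<and> sin (arcl J) \<le> 6 * cC \<tau> M / q * (1 - cos (arcl J)) \<and> 0 < 1 - cos (arcl J))"
    unfolding q_def by blast
  have \<tau>J: "\<tau> \<le> arcl J" using J(2) \<tau> by auto
  let ?N = "(2::real) ^ J"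
  \<comment> \<open>if the arcs alone do not decide, the push along x is of order 1 / sqrt d and its sign is chosen so that it forces the U-turn at the right end of the orbit\<close>
  define det where "det = ((\<forall>i<J. quiet (6 * cC \<tau> M / q) (arcl i)) \<and> (J = kmax \<or> turns (6 * cC \<tau> M / q) (arcl J)))"
  define c2 where "c2 = (\<lambda>lo. cos (2 * ang (lo + 2 ^ J - 1)))"
  define g where "g = (\<lambda>lo. if det then 0 else if 0 \<le> c2 lo then - (cG \<tau> M / q) else cG \<tau> M / q)"
  define Pos where "Pos = {lo. 0 \<in> blk lo J \<and> (det \<or> kap \<tau> / 2 \<le> (c2 lo)\<^sup>2)}"
  define Ls where "Ls = (\<lambda>lo. {L \<in> blk lo J. kap \<tau> / 2 \<le> (sin (ang L))\<^sup>2})"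
  define S where "S = {(lo, j, L). lo \<in> Pos \<and> j = J \<and> L \<in> Ls lo}"
  define bb where "bb = (\<lambda>L. \<beta> * cos (ang L) / sin (ang L))"
  define u1 where "u1 = (\<lambda>t::int \<times> nat \<times> int. lin d (g (fst t)) 0 x x)"
  define u2 where "u2 = (\<lambda>t::int \<times> nat \<times> int. lin d (g (fst t)) (bb (snd (snd t))) x ?D)"
  have blk0: "{lo. 0 \<in> blk lo J} = (\<lambda>p. p - (2 ^ J - 1)) ` blk 0 J"
  proof (intro set_eqI iffI)
    fix lo assume "lo \<in> {lo. 0 \<in> blk lo J}"
    then show "lo \<in> (\<lambda>p. p - (2 ^ J - 1)) ` blk 0 J" by (intro image_eqI[of _ _ "lo + (2 ^ J - 1)"]) (auto simp: blk_def)
  qed (auto simp: blk_def)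
  have finS: "S \<subseteq> moves kmax" using J(1) by (auto simp: S_def Pos_def Ls_def moves_def)
  have cardLs: "?N * (kap \<tau> / 2) \<le> real (card (Ls lo))" for lo
  proof -
    have "?N * kap \<tau> \<le> (\<Sum>i\<in>blk lo J. (sin (ang i))\<^sup>2)"
      using blk_sin_avg[where \<phi>=\<theta> and \<tau>=\<tau> and J=J and a=lo and \<psi>=0] theta_pos[OF h_pos h_le] theta_le_half_pi \<tau>(1) \<tau>J by (simp add: arcl_def ang_def)
    then show ?thesis
      using card_large_values[of "blk lo J" "\<lambda>i. (sin (ang i))\<^sup>2" "kap \<tau>"] kp unfolding Ls_def by (simp add: abs_square_le_1)
  qed
  have cardPos: "?N * (kap \<tau> / 2) \<le> real (card Pos)"
  proof (cases det)
    case True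
    then have "Pos = (\<lambda>p. p - (2 ^ J - 1)) ` blk 0 J" unfolding blk0[symmetric] Pos_def by simp
    then have "card Pos = 2 ^ J" by (simp add: card_image inj_on_def)
    then show ?thesis using kp by (simp add: mult_left_le)
  next
    case False
    define PP where "PP = {p \<in> blk 0 J. kap \<tau> / 2 \<le> (cos (2 * ang p))\<^sup>2}"
    have "Pos = (\<lambda>p. p - (2 ^ J - 1)) ` PP"
    proof -
      have "Pos = {lo \<in> (\<lambda>p. p - (2 ^ J - 1)) ` blk 0 J. kap \<tau> / 2 \<le> (c2 lo)\<^sup>2}"
        unfolding blk0[symmetric] Pos_def using False by auto
      then show ?thesis by (auto simp: PP_def c2_def)
    qed
    then have cP: "card Pos = card PP" by (simp add: card_image inj_on_def)
    have "\<tau> \<le> (2 ^ J - 1) * (2 * \<theta>)" using \<tau>J arcl_nonneg[of J] by (simp add: arcl_def; linarith)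
    then have "?N * kap \<tau> \<le> (\<Sum>i\<in>blk 0 J. (sin (of_int i * (2 * \<theta>) + pi / 2))\<^sup>2)"
      using theta_pos[OF h_pos h_le] th \<tau>(1) by (intro blk_sin_avg) auto
    also have "\<dots> = (\<Sum>i\<in>blk 0 J. (cos (2 * ang i))\<^sup>2)"
      by (intro sum.cong refl) (simp add: sin_add ang_def mult_ac)
    finally show ?thesis
      using card_large_values[of "blk 0 J" "\<lambda>i. (cos (2 * ang i))\<^sup>2" "kap \<tau>"] kp unfolding PP_def cP by (simp add: abs_square_le_1)
  qed
  have finPos: "finite Pos"
  proof (rule finite_subset)
    show "Pos \<subseteq> (\<lambda>p. p - (2 ^ J - 1)) ` blk 0 J" unfolding blk0[symmetric] by (auto simp: Pos_def)
  qed simp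
  have cardS: "4 ^ J * ((kap \<tau>)\<^sup>2 / 4) \<le> real (card S)"
  proof -
    have "S = (\<lambda>(lo, L). (lo, J, L)) ` (SIGMA lo:Pos. Ls lo)" by (auto simp: S_def)
    then have "card S = card (SIGMA lo:Pos. Ls lo)" by (simp add: card_image inj_on_def)
    also have "\<dots> = (\<Sum>lo\<in>Pos. card (Ls lo))" using finPos by (intro card_SigmaI) (auto simp: Ls_def)
    finally have "real (card S) = (\<Sum>lo\<in>Pos. real (card (Ls lo)))" by simp
    also have "\<dots> \<ge> (\<Sum>lo\<in>Pos. ?N * (kap \<tau> / 2))" by (intro sum_mono cardLs)
    finally have "real (card Pos) * (?N * (kap \<tau> / 2)) \<le> real (card S)" by simp
    moreover have "(?N * (kap \<tau> / 2)) * (?N * (kap \<tau> / 2)) \<le> real (card Pos) * (?N * (kap \<tau> / 2))"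
      using kp by (intro mult_right_mono cardPos) auto
    moreover have "(?N * (kap \<tau> / 2)) * (?N * (kap \<tau> / 2)) = 4 ^ J * ((kap \<tau>)\<^sup>2 / 4)"
    proof -
      have "(4::real) ^ J = ?N * ?N" by (simp flip: power_mult_distrib)
      then show ?thesis by (simp add: power2_eq_square)
    qed
    ultimately show ?thesis by linarith
  qed
  have key: "1 / (3 * 4 ^ J) * exp (- cK \<tau> M) \<le> coef d h kmax t (x, lin d 1 1 v (u1 t)) * exp (- dot d v (u1 t) - dot d (u1 t) (u1 t) / 2)
      \<and> 1 / (3 * 4 ^ J) * exp (- cK \<tau> M) \<le> coef d h kmax t (y, lin d 1 1 v (u2 t)) * exp (- dot d v (u2 t) - dot d (u2 t) (u2 t) / 2)
      \<and> dest d h t (y, lin d 1 1 v (u2 t)) = dest d h t (x, lin d 1 1 v (u1 t))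
      \<and> \<bar>dot d (dest d h t (x, lin d 1 1 v (u1 t))) (dest d h t (x, lin d 1 1 v (u1 t))) - d\<bar> \<le> cW \<tau> M * sqrt d"
    if t: "t \<in> S" and v: "v \<in> E" for t v
  proof -
    obtain lo L where tt: "t = (lo, J, L)" "lo \<in> Pos" "L \<in> Ls lo" using t by (auto simp: S_def)
    have sL: "kap \<tau> / 2 \<le> (sin (ang L))\<^sup>2" using tt(3) by (simp add: Ls_def)
    then have sL0: "sin (ang L) \<noteq> 0" using kp by auto
    have bbB: "\<bar>bb L\<bar> \<le> cB \<tau>"
    proof -
      have "sqrt (kap \<tau> / 2) \<le> \<bar>sin (ang L)\<bar>" using real_sqrt_le_mono[OF sL] by simp
      moreover have "\<bar>\<beta> * cos (ang L)\<bar> \<le> 1 * 1" using beta_bounds by (intro abs_mult_le) auto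
      ultimately have "\<bar>\<beta> * cos (ang L)\<bar> / \<bar>sin (ang L)\<bar> \<le> 1 / sqrt (kap \<tau> / 2)" using kp by (intro frac_le) auto
      then show ?thesis by (simp add: bb_def cB_def)
    qed
    define G4 where "G4 = (if det then 0 else cG \<tau> M)"
    have gG: "\<bar>g lo\<bar> * sqrt d \<le> G4" "G4 \<le> cG \<tau> M" using q cb by (auto simp: g_def G4_def q_def)
    have vE: "\<bar>dot d v v - d\<bar> \<le> 96 * q" "\<bar>dot d v x\<bar> \<le> 24 * enorm d x" "\<bar>dot d v ?D\<bar> \<le> 24 * M"
      using v by (auto simp: E_def typical_def q_def)
    define v1 where "v1 = lin d 1 1 v (u1 t)"
    define v2 where "v2 = lin d 1 1 v (u2 t)"
    have vv: "v1 = lin d 1 1 v (lin d (g lo) 0 x x)" "v2 = lin d 1 1 v (lin d (g lo) (bb L) x ?D)"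
      by (simp_all add: v1_def v2_def u1_def u2_def tt)
    note sb = shift_bounds[OF refl big M cb(1) cb(3) x(2) y(2) D vE[unfolded q_def] gG bbB, folded vv q_def]
    have gb: "(49 + cB \<tau> * M) * q \<le> (cC \<tau> M) * q" "97 * q \<le> cC \<tau> M * q" "48 * q \<le> (49 + cB \<tau> * M) * q" "M * q \<le> cC \<tau> M * q"
      using cb(1,2) M q by (auto intro!: mult_right_mono) (use mult_nonneg_nonneg[of "cB \<tau>" M] in linarith)+
    define a where "a = 2 * G4 + cC \<tau> M"
    have G4n: "0 \<le> G4" using cb by (simp add: G4_def)
    have a: "1 \<le> a" "a \<le> cA \<tau> M" using cb gG(2) G4n by (auto simp: a_def cA_def)
    have aq: "a * q = 2 * G4 * q + cC \<tau> M * q" by (simp add: a_def algebra_simps)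
    have G4q: "0 \<le> 2 * G4 * q" using G4n q by simp
    have c1: "calm d (a * q) (x, v1)"
      unfolding calm_def fst_conv snd_conv
    proof (intro conjI)
      show "(x, v1) \<in> phase_space d" using x by (simp add: phase_space_def vv)
      show "\<bar>dot d x x - d\<bar> \<le> a * q" using x(2)[folded q_def] gb(4) G4q unfolding aq by linarith
      show "\<bar>dot d x v1\<bar> \<le> a * q" using sb(1,5) gb unfolding aq by linarith
      show "\<bar>dot d v1 v1 - d\<bar> \<le> a * q" using sb(2) gb G4q unfolding aq by linarith
    qed
    have c2': "calm d (a * q) (y, v2)"
      unfolding calm_def fst_conv snd_conv
    proof (intro conjI)
      show "(y, v2) \<in> phase_space d" using y by (simp add: phase_space_def vv)
      show "\<bar>dot d y y - d\<bar> \<le> a * q" using y(2)[folded q_def] gb(4) G4q unfolding aq by linarith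
      show "\<bar>dot d y v2\<bar> \<le> a * q" using sb(3,5) gb unfolding aq by linarith
      show "\<bar>dot d v2 v2 - d\<bar> \<le> a * q" using sb(4) gb G4q unfolding aq by linarith
    qed
    have quiet: "quiet (6 * (a * q) / real d) (arcl i)" if "i < J" for i
      unfolding div using alt that by (cases det) (auto simp: det_def a_def G4_def cA_def)
    have ut: "(J = kmax \<or> Ut d h (x, v1) lo J) \<and> (J = kmax \<or> Ut d h (y, v2) lo J)"
    proof (cases det)
      case True
      then have "J = kmax \<or> turns (6 * (a * q) / real d) (arcl J)" unfolding div by (simp add: det_def a_def G4_def)
      then show ?thesis using turns_uturn[OF c1 amp(1,3)[OF a]] turns_uturn[OF c2' amp(1,3)[OF a]] by blast
    next
      case False
      then have aA: "a = cA \<tau> M" by (simp add: a_def G4_def cA_def)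
      have T: "sin (arcl J) \<le> 6 * cC \<tau> M / sqrt d * (1 - cos (arcl J))" "0 < 1 - cos (arcl J)"
        using alt False unfolding det_def q_def by blast+
      have k: "cos (2 * ang (lo + 2 ^ J - 1)) * (g lo * dot d x x) \<le> - (cG \<tau> M * sqrt d / (2 * cB \<tau>))"
      proof -
        have "kap \<tau> / 2 \<le> (c2 lo)\<^sup>2" using tt(2) False by (simp add: Pos_def)
        then have "sqrt (kap \<tau> / 2) \<le> sqrt ((c2 lo)\<^sup>2)" by (rule real_sqrt_le_mono)
        then have "sqrt (kap \<tau> / 2) \<le> \<bar>c2 lo\<bar>" by simp
        then have s1: "1 / cB \<tau> \<le> \<bar>c2 lo\<bar>" by (simp add: cB_def)
        have "c2 lo * g lo = - (\<bar>c2 lo\<bar> * (cG \<tau> M / q))" using False by (simp add: g_def)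
        then have "c2 lo * (g lo * dot d x x) = - (\<bar>c2 lo\<bar> * (cG \<tau> M / q * dot d x x))" by (simp flip: mult.assoc)
        moreover have "1 / cB \<tau> * (cG \<tau> M / q * (q * q / 2)) \<le> \<bar>c2 lo\<bar> * (cG \<tau> M / q * dot d x x)"
          using s1 sb(6) cb q by (intro mult_mono) auto
        moreover have "1 / cB \<tau> * (cG \<tau> M / q * (q * q / 2)) = cG \<tau> M * sqrt d / (2 * cB \<tau>)"
          using q(1) by (simp add: q_def[symmetric])
        ultimately show ?thesis unfolding c2_def by linarith
      qed
      have b12: "12 * cA \<tau> M \<le> sqrt d" using big' by (simp add: q_def)
      have "\<bar>dot d x v1 - g lo * dot d x x\<bar> \<le> (49 + cB \<tau> * M) * q" using sb(1) gb(3) by linarith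
      then have "Ut d h (x, v1) lo J"
        using trigger[OF c1[unfolded aA q_def] \<tau>(1) M hd b12 x(2) sb(2)[unfolded q_def] _ k T] by (simp add: q_def)
      moreover have "Ut d h (y, v2) lo J"
        using trigger[OF c2'[unfolded aA q_def] \<tau>(1) M hd b12 y(2) sb(4)[unfolded q_def] sb(3)[unfolded q_def] k T] .
      ultimately show ?thesis by blast
    qed
    note am = amp[OF a]
    have co: "1 / (3 * 4 ^ J) \<le> coef d h kmax t (x, v1)" "1 / (3 * 4 ^ J) \<le> coef d h kmax t (y, v2)"
      unfolding tt(1) using coef_lower[where lo=lo and i=L and j=J, OF c1 am(1,2,4) quiet] coef_lower[where lo=lo and i=L and j=J, OF c2' am(1,2,4) quiet] ut by auto
    have ex: "exp (- cK \<tau> M) \<le> exp (- dot d v (u1 t) - dot d (u1 t) (u1 t) / 2)" "exp (- cK \<tau> M) \<le> exp (- dot d v (u2 t) - dot d (u2 t) (u2 t) / 2)"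
      using sb(8,9) by (simp_all add: cK_def u1_def u2_def tt(1))
    have "dest d h t (y, v2) = dest d h t (x, v1)"
      unfolding vv bb_def using dest_shift[of t y v "g lo" x] sL0 by (simp add: tt(1))
    moreover have "\<bar>dot d (dest d h t (x, v1)) (dest d h t (x, v1)) - d\<bar> \<le> cW \<tau> M * sqrt d"
    proof -
      have "\<bar>dot d (dest d h t (x, v1)) (dest d h t (x, v1)) - dot d x x\<bar> \<le> 6 * (a * q)"
        using calm_bounds(4)[OF c1 am(1), of L] by (simp add: dest_def tt(1))
      moreover have "a * q \<le> cA \<tau> M * q" using a q by (intro mult_right_mono) auto
      ultimately show ?thesis using x(2) by (simp add: cW_def q_def algebra_simps; linarith)
    qed
    ultimately show ?thesis
      unfolding v1_def[symmetric] v2_def[symmetric] using co ex coef_nonneg by (intro conjI mult_mono) auto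
  qed
  define r where "r = 1 / (3 * 4 ^ J) * exp (- cK \<tau> M)"
  have r: "0 \<le> r" by (simp add: r_def)
  define X where "X = (\<lambda>t v. dest d h t (x, lin d 1 1 v (u1 t)))"
  have us: "u1 t \<in> space (Rd d)" "u2 t \<in> space (Rd d)" for t by (simp_all add: u1_def u2_def)
  have tf1: "test_fn (\<lambda>z. 1 * 1 + (- 1) * f1 z)" by (intro tf_lin f1 tf_const)
  have "r * (\<Sum>t\<in>S. \<integral>v. indicator E v * (1 * 1 + (- 1) * f1 (dest d h t (x, lin d 1 1 v (u1 t)))) \<partial>gauss d) \<le> Pop d h kmax (\<lambda>z. 1 * 1 + (- 1) * f1 z) x"
  proof (rule Pop_lower[OF x(1) tf1 _ finS us(1) E(1) _ r])
    show "r \<le> coef d h kmax t (x, lin d 1 1 v (u1 t)) * exp (- dot d v (u1 t) - dot d (u1 t) (u1 t) / 2)" if "t \<in> S" "v \<in> E" for t v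
      using key[OF that] by (simp add: r_def)
    show "0 \<le> 1 * 1 + - 1 * f1 z" if "z \<in> space (Rd d)" for z using f1(2)[OF that] by simp
  qed
  also have "\<dots> = 1 - Pop d h kmax f1 x"
    using Pop_lin[OF tf_const f1(1) x(1), of 1 1 "- 1"] x(1) by (simp add: Pop_const)
  finally have L1: "r * (\<Sum>t\<in>S. \<integral>v. indicator E v * (1 - f1 (X t v)) \<partial>gauss d) \<le> 1 - Pop d h kmax f1 x" by (simp add: X_def)
  have "r * (\<Sum>t\<in>S. \<integral>v. indicator E v * f2 (dest d h t (y, lin d 1 1 v (u2 t))) \<partial>gauss d) \<le> Pop d h kmax f2 y"
  proof (rule Pop_lower[OF y(1) f2(1) _ finS us(2) E(1) _ r])
    show "r \<le> coef d h kmax t (y, lin d 1 1 v (u2 t)) * exp (- dot d v (u2 t) - dot d (u2 t) (u2 t) / 2)" if "t \<in> S" "v \<in> E" for t v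
      using key[OF that] by (simp add: r_def)
  qed (use f2 in auto)
  also have "(\<Sum>t\<in>S. \<integral>v. indicator E v * f2 (dest d h t (y, lin d 1 1 v (u2 t))) \<partial>gauss d) = (\<Sum>t\<in>S. \<integral>v. indicator E v * f2 (X t v) \<partial>gauss d)"
    by (intro sum.cong refl Bochner_Integration.integral_cong) (use key in \<open>auto simp: X_def indicator_def\<close>)
  finally have L2: "r * (\<Sum>t\<in>S. \<integral>v. indicator E v * f2 (X t v) \<partial>gauss d) \<le> Pop d h kmax f2 y" .
  have int: "integrable (gauss d) (\<lambda>v. indicator E v * F (X t v))" if F: "F \<in> borel_measurable (Rd d)" "\<And>z. z \<in> space (Rd d) \<Longrightarrow> \<bar>F z\<bar> \<le> 1" for F :: "_ \<Rightarrow> real" and t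
  proof (rule integrable_const_bound[where B=1])
    show "AE v in gauss d. norm (indicator E v * F (X t v)) \<le> 1"
      using F(2) by (intro AE_I2) (auto simp: indicator_def X_def)
    have x': "x \<in> space (gauss d)" using x by simp
    have "(\<lambda>v. lin d 1 1 v (u1 t)) \<in> measurable (gauss d) (gauss d)" using us(1)[of t] by measurable
    then have "(\<lambda>v. X t v) \<in> measurable (gauss d) (Rd d)"
      unfolding X_def by (rule measurable_compose[OF _ measurable_compose[OF measurable_Pair1'[OF x'] meas_dest]])
    then have "(\<lambda>v. F (X t v)) \<in> borel_measurable (gauss d)" by (rule measurable_compose[OF _ F(1)])
    then show "(\<lambda>v. indicator E v * F (X t v)) \<in> borel_measurable (gauss d)" using E(1) by measurable
  qed
  have "(1 - s) / 2 \<le> (\<integral>v. indicator E v * (1 - f1 (X t v)) \<partial>gauss d) + (\<integral>v. indicator E v * f2 (X t v) \<partial>gauss d)" if t: "t \<in> S" for t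
  proof -
    have i1: "integrable (gauss d) (\<lambda>v. indicator E v * (1 - f1 (X t v)))" 
      by (rule int[of "\<lambda>z. 1 - f1 z"]) (use f1 in \<open>auto simp: test_fn_def\<close>)
    have i2: "integrable (gauss d) (\<lambda>v. indicator E v * f2 (X t v))" 
      by (rule int) (use f2 in \<open>auto simp: test_fn_def\<close>)
    have "(1 - s) / 2 \<le> (1 - s) * prob E" using E(2) s mult_left_mono[of "1/2" "prob E" "1 - s"] by simp
    also have "\<dots> = (\<integral>v. (1 - s) * indicator E v \<partial>gauss d)" using E(1) by simp
    also have "\<dots> \<le> (\<integral>v. indicator E v * (1 - f1 (X t v)) + indicator E v * f2 (X t v) \<partial>gauss d)"
    proof (rule integral_mono[OF _ Bochner_Integration.integrable_add[OF i1 i2]])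
      show "integrable (gauss d) (\<lambda>v. (1 - s) * indicator E v)" using E(1) by (intro integrable_mult_right) (simp add: integrable_indicator_iff emeasure_eq_measure)
      fix v
      show "(1 - s) * indicator E v \<le> indicator E v * (1 - f1 (X t v)) + indicator E v * f2 (X t v)"
        using key[OF t, of v] f12[of "X t v"] by (auto simp: indicator_def X_def)
    qed
    also have "\<dots> = (\<integral>v. indicator E v * (1 - f1 (X t v)) \<partial>gauss d) + (\<integral>v. indicator E v * f2 (X t v) \<partial>gauss d)"
      by (rule Bochner_Integration.integral_add[OF i1 i2])
    finally show ?thesis .
  qed
  then have "(\<Sum>t\<in>S. (1 - s) / 2) \<le> (\<Sum>t\<in>S. (\<integral>v. indicator E v * (1 - f1 (X t v)) \<partial>gauss d) + (\<integral>v. indicator E v * f2 (X t v) \<partial>gauss d))"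
    by (rule sum_mono)
  then have "real (card S) * ((1 - s) / 2) \<le> (\<Sum>t\<in>S. \<integral>v. indicator E v * (1 - f1 (X t v)) \<partial>gauss d) + (\<Sum>t\<in>S. \<integral>v. indicator E v * f2 (X t v) \<partial>gauss d)"
    by (simp add: sum.distrib)
  then have "r * (real (card S) * ((1 - s) / 2)) \<le> 1 - Pop d h kmax f1 x + Pop d h kmax f2 y"
    using L1 L2 mult_left_mono[OF _ r] by (smt (verit) distrib_left)
  moreover have "shot \<tau> M * (1 - s) \<le> r * (real (card S) * ((1 - s) / 2))"
  proof -
    have "r * (4 ^ J * ((kap \<tau>)\<^sup>2 / 4) * ((1 - s) / 2)) \<le> r * (real (card S) * ((1 - s) / 2))"
      using cardS r s by (intro mult_left_mono mult_right_mono) auto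
    moreover have e: "r * (4 ^ J * ((kap \<tau>)\<^sup>2 / 4) * ((1 - s) / 2)) = shot \<tau> M * (1 - s)"
      by (simp add: r_def shot_def)
    ultimately show ?thesis unfolding e by blast
  qed
  ultimately show ?thesis by simp
qed

end

section \<open>Maximal coupling\<close>

definition plus_measure :: "'a measure \<Rightarrow> 'a measure \<Rightarrow> 'a measure" where
  "plus_measure A B = measure_of (space A) (sets A) (\<lambda>X. emeasure A X + emeasure B X)"

lemma sets_plus_measure [simp]: "sets (plus_measure A B) = sets A"
  and space_plus_measure [simp]: "space (plus_measure A B) = space A"
  by (simp_all add: plus_measure_def sets.space_closed)

lemma emeasure_plus_measure:
  assumes s: "sets A = sets B" and X: "X \<in> sets A"
  shows "emeasure (plus_measure A B) X = emeasure A X + emeasure B X"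
  unfolding plus_measure_def
proof (rule emeasure_measure_of_sigma[OF _ _ _ X])
  show "sigma_algebra (space A) (sets A)" by (rule sets.sigma_algebra_axioms)
  show "positive (sets A) (\<lambda>X. emeasure A X + emeasure B X)" by (simp add: positive_def)
  show "countably_additive (sets A) (\<lambda>X. emeasure A X + emeasure B X)"
  proof (rule countably_additiveI)
    fix F :: "nat \<Rightarrow> _" assume F: "range F \<subseteq> sets A" "disjoint_family F" "\<Union> (range F) \<in> sets A"
    have "(\<Sum>i. emeasure A (F i) + emeasure B (F i)) = (\<Sum>i. emeasure A (F i)) + (\<Sum>i. emeasure B (F i))"
      by (rule suminf_add[symmetric]) auto
    also have "\<dots> = emeasure A (\<Union> (range F)) + emeasure B (\<Union> (range F))"
      using F s by (simp add: suminf_emeasure)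
    finally show "(\<Sum>i. emeasure A (F i) + emeasure B (F i)) = emeasure A (\<Union> (range F)) + emeasure B (\<Union> (range F))" .
  qed
qed

lemma TV_le_coupling:
  assumes "P \<in> couplings M N" "measure P {z \<in> space P. fst z \<noteq> snd z} \<le> \<epsilon>"
  shows "TV M N \<le> \<epsilon>"
proof -
  have "TV M N \<le> measure P {z \<in> space P. fst z \<noteq> snd z}"
    unfolding TV_def by (rule cINF_lower[OF _ assms(1)]) (auto intro!: bdd_belowI[of _ 0])
  then show ?thesis using assms(2) by simp
qed

text \<open>
  The maximal coupling. By the Hahn decomposition, the space is split into a set
  \<open>Y\<close> where \<open>M\<close> dominates and its complement \<open>Z\<close>, where
  \<open>N\<close> dominates. The common part \<open>m\<close> of the two measures is placed on
  the diagonal, and the excesses \<open>eM\<close> and \<open>eN\<close>, which both have mass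
  \<open>\<delta> = measure M Y - measure N Y\<close>, are coupled independently. The coupled
  points then differ with probability at most \<open>\<delta>\<close>.
\<close>

lemma TV_le:
  fixes M N :: "'a measure"
  assumes M: "prob_space M" and N: "prob_space N" and sets: "sets M = sets N"
    and diag: "{z \<in> space (M \<Otimes>\<^sub>M N). fst z \<noteq> snd z} \<in> sets (M \<Otimes>\<^sub>M N)"
    and diff: "\<And>A. A \<in> sets M \<Longrightarrow> measure M A - measure N A \<le> \<epsilon>"
  shows "TV M N \<le> \<epsilon>"
proof -
  interpret M: prob_space M by fact
  interpret N: prob_space N by fact
  have sp: "space M = space N" using sets by (rule sets_eq_imp_space_eq)
  obtain Y where Y: "Y \<in> sets M" and Y1: "\<And>X. X \<in> sets M \<Longrightarrow> X \<subseteq> Y \<Longrightarrow> emeasure N X \<le> emeasure M X"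
    and Y2: "\<And>X. X \<in> sets M \<Longrightarrow> X \<inter> Y = {} \<Longrightarrow> emeasure M X \<le> emeasure N X"
    using finite_unsigned_Hahn_decomposition[OF M.finite_measure_axioms N.finite_measure_axioms sets[symmetric]] by metis
  define Z where "Z = space M - Y"
  have Z: "Z \<in> sets M" using Y by (simp add: Z_def)
  have Z2: "emeasure M (A \<inter> Z) \<le> emeasure N (A \<inter> Z)" if "A \<in> sets M" for A
    by (rule Y2) (use that Z in \<open>auto simp: Z_def\<close>)
  have YN: "Y \<in> sets N" "Z \<in> sets N" using Y Z sets by auto
  define re where "re = (\<lambda>(Q::'a measure) A. density Q (indicator A))"
  have re: "emeasure (re Q A) X = emeasure Q (X \<inter> A)" if "A \<in> sets Q" "X \<in> sets Q" for Q A X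
    using emeasure_restricted[OF that] by (simp add: re_def Int_commute)
  have sre [simp]: "sets (re Q A) = sets Q" for Q A by (simp add: re_def)
  have fre: "finite_measure (re M A)" "finite_measure (re N A)" if "A \<in> sets M" for A
    using that sets re[of A M "space M"] re[of A N "space N"] by (auto intro!: finite_measureI simp: re_def sp M.emeasure_eq_measure N.emeasure_eq_measure)
  define eM where "eM = diff_measure (re M Y) (re N Y)"
  define eN where "eN = diff_measure (re N Z) (re M Z)"
  have seM [simp]: "sets eM = sets M" and seN [simp]: "sets eN = sets M"
    using sets by (simp_all add: eM_def eN_def sets_diff_measure)
  have eM: "emeasure eM X = emeasure M (X \<inter> Y) - emeasure N (X \<inter> Y)" if X: "X \<in> sets M" for X
    unfolding eM_def
    by (subst emeasure_diff_measure) (use X Y YN sets fre[OF Y] Y1 re in \<open>auto\<close>)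
  have eN: "emeasure eN X = emeasure N (X \<inter> Z) - emeasure M (X \<inter> Z)" if X: "X \<in> sets M" for X
    unfolding eN_def
    by (subst emeasure_diff_measure) (use X Z YN sets fre[OF Z] Z2 re in \<open>auto\<close>)
  define \<delta> where "\<delta> = measure M Y - measure N Y"
  have d1: "emeasure eM (space M) = ennreal \<delta>"
    using Y sets.sets_into_space[OF Y] by (subst eM) (auto simp: \<delta>_def M.emeasure_eq_measure N.emeasure_eq_measure Int_absorb1 ennreal_minus)
  have "measure M Z = 1 - measure M Y" "measure N Z = 1 - measure N Y"
    using M.prob_compl[OF Y] N.prob_compl[OF YN(1)] by (simp_all add: Z_def sp)
  then have d2: "emeasure eN (space M) = ennreal \<delta>"
    using Z sets.sets_into_space[OF Z] by (subst eN) (auto simp: \<delta>_def M.emeasure_eq_measure N.emeasure_eq_measure Int_absorb1 ennreal_minus)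
  have d0: "0 \<le> \<delta>" using Y1[OF Y order_refl] by (simp add: \<delta>_def M.emeasure_eq_measure N.emeasure_eq_measure)
  have fe: "finite_measure eM" "finite_measure eN"
    using d1 d2 sets_eq_imp_space_eq[OF seM] sets_eq_imp_space_eq[OF seN] by (auto intro!: finite_measureI)
  interpret eM: finite_measure eM by (rule fe)
  interpret eN: finite_measure eN by (rule fe)
  define m where "m = plus_measure (re M Z) (re N Y)"
  have sm [simp]: "sets m = sets M" by (simp add: m_def)
  have m: "emeasure m X = emeasure M (X \<inter> Z) + emeasure N (X \<inter> Y)" if "X \<in> sets M" for X
    unfolding m_def using that sets Y Z YN re by (subst emeasure_plus_measure) auto
  define Dg where "Dg = distr m (M \<Otimes>\<^sub>M N) (\<lambda>x. (x, x))"
  define Ex where "Ex = scale_measure (ennreal (1 / \<delta>)) (eM \<Otimes>\<^sub>M eN)"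
  define P where "P = plus_measure Dg Ex"
  have sMN: "sets (eM \<Otimes>\<^sub>M eN) = sets (M \<Otimes>\<^sub>M N)" by (rule sets_pair_measure_cong[OF seM trans[OF seN sets]])
  have sD: "sets Dg = sets (M \<Otimes>\<^sub>M N)" and sE: "sets Ex = sets (M \<Otimes>\<^sub>M N)" 
    unfolding Dg_def Ex_def by (rule sets_distr) (rule trans[OF sets_scale_measure sMN])
  have sP: "sets P = sets (M \<Otimes>\<^sub>M N)" by (simp add: P_def sD)
  have dm: "(\<lambda>x. (x, x)) \<in> measurable m (M \<Otimes>\<^sub>M N)"
  proof -
    have "(\<lambda>x. (x, x)) \<in> measurable M (M \<Otimes>\<^sub>M N)"
      by (rule measurable_Pair) (simp_all add: measurable_ident_sets sets)
    then show ?thesis by (subst measurable_cong_sets[OF sm refl])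
  qed
  have P: "emeasure P X = emeasure m ((\<lambda>x. (x, x)) -` X \<inter> space m) + ennreal (1 / \<delta>) * emeasure (eM \<Otimes>\<^sub>M eN) X" if "X \<in> sets (M \<Otimes>\<^sub>M N)" for X
    unfolding P_def using that sD sE dm sMN
    by (subst emeasure_plus_measure) (simp_all add: Dg_def Ex_def emeasure_distr)
  have spm: "space m = space M" by (rule sets_eq_imp_space_eq) simp
  have cancel: "ennreal (1 / \<delta>) * (a * ennreal \<delta>) = a" if "a \<le> ennreal \<delta>" for a
  proof (cases "\<delta> = 0")
    case True then show ?thesis using that by simp
  next
    case False
    then have "ennreal (1 / \<delta>) * ennreal \<delta> = 1" using d0 by (simp flip: ennreal_mult)
    then show ?thesis by (metis mult.commute mult.left_commute mult.right_neutral)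
  qed
  have split: "emeasure Q X = emeasure Q (X \<inter> Y) + emeasure Q (X \<inter> Z)" if "X \<in> sets M" "sets Q = sets M" for Q :: "'a measure" and X
  proof -
    have "X = (X \<inter> Y) \<union> (X \<inter> Z)" using sets.sets_into_space[OF that(1)] by (auto simp: Z_def)
    then show ?thesis using that Y Z by (subst plus_emeasure) (auto simp: Z_def)
  qed
  have margM: "emeasure P (A \<times> space N) = emeasure M A" if A: "A \<in> sets M" for A
  proof -
    have "emeasure (eM \<Otimes>\<^sub>M eN) (A \<times> space N) = emeasure eM A * ennreal \<delta>"
      using A d2 sp sets.top[of M] by (subst eN.emeasure_pair_measure_Times) auto
    moreover have "emeasure eM A \<le> ennreal \<delta>"
      unfolding d1[symmetric] using A sets.sets_into_space[OF A] by (intro emeasure_mono) auto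
    moreover have "(\<lambda>x. (x, x)) -` (A \<times> space N) \<inter> space m = A" using sets.sets_into_space[OF A] by (auto simp: spm sp)
    ultimately have "emeasure P (A \<times> space N) = emeasure m A + emeasure eM A"
      using A by (subst P) (auto simp: cancel)
    also have "\<dots> = emeasure M (A \<inter> Z) + (emeasure N (A \<inter> Y) + (emeasure M (A \<inter> Y) - emeasure N (A \<inter> Y)))"
      using A by (simp add: m eM add.assoc)
    also have "emeasure N (A \<inter> Y) + (emeasure M (A \<inter> Y) - emeasure N (A \<inter> Y)) = emeasure M (A \<inter> Y)"
      using Y1[of "A \<inter> Y"] A Y by (intro add_diff_inverse_ennreal) auto
    finally show ?thesis using split[OF A refl] by (simp add: add.commute)
  qed
  have margN: "emeasure P (space M \<times> B) = emeasure N B" if B: "B \<in> sets M" for B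
  proof -
    have "emeasure (eM \<Otimes>\<^sub>M eN) (space M \<times> B) = ennreal \<delta> * emeasure eN B"
      using B d1 sets.top[of M] by (subst eN.emeasure_pair_measure_Times) auto
    moreover have "emeasure eN B \<le> ennreal \<delta>"
      unfolding d2[symmetric] using B sets.sets_into_space[OF B] by (intro emeasure_mono) auto
    moreover have "(\<lambda>x. (x, x)) -` (space M \<times> B) \<inter> space m = B" using sets.sets_into_space[OF B] by (auto simp: spm)
    ultimately have "emeasure P (space M \<times> B) = emeasure m B + emeasure eN B"
      using B sets cancel[of "emeasure eN B"] by (subst P) (auto simp: mult.commute)
    also have "\<dots> = emeasure N (B \<inter> Y) + (emeasure M (B \<inter> Z) + (emeasure N (B \<inter> Z) - emeasure M (B \<inter> Z)))"
      using B by (simp add: m eN add_ac)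
    also have "emeasure M (B \<inter> Z) + (emeasure N (B \<inter> Z) - emeasure M (B \<inter> Z)) = emeasure N (B \<inter> Z)"
      using Z2[OF B] by (rule add_diff_inverse_ennreal)
    finally show ?thesis using split[OF B sets[symmetric]] by simp
  qed
  have spP: "space P = space M \<times> space N" using sets_eq_imp_space_eq[OF sP] by (simp add: space_pair_measure)
  have "P \<in> couplings M N"
    unfolding couplings_def mem_Collect_eq
  proof (intro conjI sP)
    show "prob_space P"
      by (rule prob_spaceI) (use margM[of "space M"] in \<open>simp add: spP M.emeasure_space_1\<close>)
    show "distr P M fst = M"
    proof (rule measure_eqI)
      fix A assume A: "A \<in> sets (distr P M fst)"
      then have "fst -` A \<inter> space P = A \<times> space N" using sets.sets_into_space[of A M] by (auto simp: spP)
      moreover have "fst \<in> measurable P M" by (subst measurable_cong_sets[OF sP refl]) simp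
      ultimately show "emeasure (distr P M fst) A = emeasure M A" using A margM by (simp add: emeasure_distr)
    qed simp
    show "distr P N snd = N"
    proof (rule measure_eqI)
      fix A assume A: "A \<in> sets (distr P N snd)"
      then have "snd -` A \<inter> space P = space M \<times> A" using sets.sets_into_space[of A N] by (auto simp: spP)
      moreover have "snd \<in> measurable P N" by (subst measurable_cong_sets[OF sP refl]) simp
      ultimately show "emeasure (distr P N snd) A = emeasure N A" using A margN sets by (simp add: emeasure_distr)
    qed simp
  qed
  moreover have "measure P {z \<in> space P. fst z \<noteq> snd z} \<le> \<epsilon>"
  proof -
    let ?D = "{z \<in> space P. fst z \<noteq> snd z}"
    have De: "?D = {z \<in> space (M \<Otimes>\<^sub>M N). fst z \<noteq> snd z}" by (simp add: spP space_pair_measure)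
    have D: "?D \<in> sets (M \<Otimes>\<^sub>M N)" unfolding De by (rule diag)
    have "(\<lambda>x. (x, x)) -` ?D \<inter> space m = {}" by auto
    then have "emeasure P ?D = ennreal (1 / \<delta>) * emeasure (eM \<Otimes>\<^sub>M eN) ?D" using P[OF D] by simp
    also have "\<dots> \<le> ennreal (1 / \<delta>) * emeasure (eM \<Otimes>\<^sub>M eN) (space M \<times> space N)"
    proof (rule mult_left_mono[OF emeasure_mono])
      show "?D \<subseteq> space M \<times> space N" by (auto simp: spP)
      show "space M \<times> space N \<in> sets (eM \<Otimes>\<^sub>M eN)" unfolding sMN by (intro pair_measureI sets.top)
    qed simp
    also have "\<dots> = ennreal (1 / \<delta>) * (ennreal \<delta> * ennreal \<delta>)"
      using d1 d2 sp sets.top[of M] by (subst eN.emeasure_pair_measure_Times) auto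
    also have "\<dots> = ennreal \<delta>" by (rule cancel) simp
    finally have "measure P ?D \<le> \<delta>" using d0 by (simp add: measure_def enn2real_leI)
    also have "\<dots> \<le> \<epsilon>" using diff[OF Y] by (simp add: \<delta>_def)
    finally show ?thesis .
  qed
  ultimately show ?thesis by (rule TV_le_coupling)
qed

lemma diag_Rd:
  assumes "sets M = sets (Rd d)" "sets N = sets (Rd d)"
  shows "{z \<in> space (M \<Otimes>\<^sub>M N). fst z \<noteq> snd z} \<in> sets (M \<Otimes>\<^sub>M N)"
proof -
  have sp: "space M = space (Rd d)" "space N = space (Rd d)" using assms(1,2)[THEN sets_eq_imp_space_eq] .
  have m1: "fst \<in> measurable (M \<Otimes>\<^sub>M N) (Rd d)"
    using measurable_fst[of M N] unfolding measurable_cong_sets[OF refl[of "sets (M \<Otimes>\<^sub>M N)"] assms(1)] .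
  have m2: "snd \<in> measurable (M \<Otimes>\<^sub>M N) (Rd d)"
    using measurable_snd[of M N] unfolding measurable_cong_sets[OF refl[of "sets (M \<Otimes>\<^sub>M N)"] assms(2)] .
  have "{z \<in> space (M \<Otimes>\<^sub>M N). fst z \<noteq> snd z} = (\<Union>i<d. {z \<in> space (M \<Otimes>\<^sub>M N). fst z i \<noteq> snd z i})"
  proof (intro set_eqI iffI)
    fix z assume z: "z \<in> {z \<in> space (M \<Otimes>\<^sub>M N). fst z \<noteq> snd z}"
    then have "fst z \<in> space (Rd d)" "snd z \<in> space (Rd d)" using sp by (auto simp: space_pair_measure)
    then obtain i where "i < d" "fst z i \<noteq> snd z i" using space_Rd_eqI z by blast
    then show "z \<in> (\<Union>i<d. {z \<in> space (M \<Otimes>\<^sub>M N). fst z i \<noteq> snd z i})" using z by auto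
  qed auto
  also have "\<dots> \<in> sets (M \<Otimes>\<^sub>M N)"
  proof (intro sets.finite_UN)
    fix i assume "i \<in> {..<d}"
    then have "i < d" by simp
    note [measurable] = measurable_coord[OF m1 this] measurable_coord[OF m2 this]
    show "{z \<in> space (M \<Otimes>\<^sub>M N). fst z i \<noteq> snd z i} \<in> sets (M \<Otimes>\<^sub>M N)" by measurable
  qed simp
  finally show ?thesis .
qed

section \<open>Contraction of the norm\<close>

context nuts begin

definition dev :: "(nat \<Rightarrow> real) \<Rightarrow> real" where "dev x = \<bar>dot d x x - real d\<bar>"
definition dst :: "(nat \<Rightarrow> real) \<Rightarrow> (nat \<Rightarrow> real) \<Rightarrow> real" where "dst x y = enorm d (lin d 1 (- 1) x y)"
text \<open>
  The change of the deviation in a move that is due to the velocity and to the factor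
  \<open>beta h\<close>.
\<close>

definition nse :: "(nat \<Rightarrow> real) \<Rightarrow> (nat \<Rightarrow> real) \<Rightarrow> real" where
  "nse x v = 2 * \<bar>dot d v v - real d\<bar> + h\<^sup>2 * real d + 2 * \<bar>dot d v x\<bar>"

lemma meas_dev [measurable]: "dev \<in> borel_measurable (Rd d)"
  unfolding dev_def[abs_def] by measurable

lemma dev_nonneg: "0 \<le> dev x" by (simp add: dev_def)

text \<open>
  A move by the angle \<open>a\<close> replaces \<open>|x|\<^sup>2\<close> by \<open>cos\<^sup>2
  a * |x|\<^sup>2 + sin\<^sup>2 a * |v|\<^sup>2 / \<beta>\<^sup>2\<close> plus a mixed term.
\<close>

lemma dev_dest:
  "dev (dest d h t (x, v)) \<le> (cos (ang (snd (snd t))))\<^sup>2 * dev x + nse x v"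
proof -
  define c s where "c = cos (ang (snd (snd t)))" and "s = sin (ang (snd (snd t)))"
  define R S G where "R = dot d x x" and "S = dot d v v" and "G = dot d v x"
  have cs: "s\<^sup>2 + c\<^sup>2 = 1" "\<bar>s * c\<bar> \<le> 1/2" "0 \<le> s\<^sup>2" "s\<^sup>2 \<le> 1"
    using sin_cos_half by (simp_all add: c_def s_def abs_square_le_1)
  have S0: "0 \<le> S" by (simp add: S_def)
  have e: "dot d (dest d h t (x, v)) (dest d h t (x, v)) - d = c\<^sup>2 * (R - d) + s\<^sup>2 * (S / \<beta>\<^sup>2 - d) + 2 * (s * c) * (G / \<beta>)"
  proof -
    have "c\<^sup>2 * d + s\<^sup>2 * d = d" using cs(1) by (simp add: add.commute flip: distrib_right)
    then show ?thesis
      unfolding dest_def rn_formula fst_conv snd_conv R_def S_def G_def c_def[symmetric] s_def[symmetric] dot_commute[of d v x]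
      by (simp add: algebra_simps)
  qed
  have b1: "\<bar>c\<^sup>2 * (R - d)\<bar> = c\<^sup>2 * dev x" by (simp add: abs_mult dev_def R_def)
  have b2: "\<bar>s\<^sup>2 * (S / \<beta>\<^sup>2 - d)\<bar> \<le> 1 * (4/3 * \<bar>S - d\<bar> + h\<^sup>2 * d / 3)"
  proof (rule abs_mult_le)
    have "S / \<beta>\<^sup>2 - d = (1 / \<beta>\<^sup>2) * (S - d) + (1 / \<beta>\<^sup>2) * (h\<^sup>2 / 4 * d)"
    proof -
      have "\<beta>\<^sup>2 \<noteq> 0" using beta_bounds by simp
      then have "(1 / \<beta>\<^sup>2) * (\<beta>\<^sup>2 * d) = d" by simp
      then have "(1 / \<beta>\<^sup>2) * ((1 - h\<^sup>2 / 4) * d) = d" by (simp only: beta_bounds(3))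
      moreover define q where "q = 1 / \<beta>\<^sup>2"
      ultimately have "q * d - q * (h\<^sup>2 / 4 * d) = d" by (simp add: algebra_simps)
      moreover have "S / \<beta>\<^sup>2 = q * S" by (simp add: q_def)
      ultimately show ?thesis unfolding q_def[symmetric] right_diff_distrib by linarith
    qed
    then have "\<bar>S / \<beta>\<^sup>2 - d\<bar> \<le> \<bar>(1 / \<beta>\<^sup>2) * (S - d)\<bar> + \<bar>(1 / \<beta>\<^sup>2) * (h\<^sup>2 / 4 * d)\<bar>" by linarith
    also have "\<dots> \<le> 4/3 * \<bar>S - d\<bar> + 4/3 * \<bar>h\<^sup>2 / 4 * d\<bar>"
      using inv_beta beta_bounds(1) unfolding abs_mult[of "1 / \<beta>\<^sup>2"] by (intro add_mono mult_right_mono) auto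
    finally show "\<bar>S / \<beta>\<^sup>2 - d\<bar> \<le> 4/3 * \<bar>S - d\<bar> + h\<^sup>2 * d / 3" by (simp add: mult.commute)
  qed (use cs in auto)
  have b3: "\<bar>2 * (s * c) * (G / \<beta>)\<bar> \<le> (2 * (1/2)) * (\<bar>G\<bar> * 2)"
  proof (rule abs_mult_le)
    have "\<bar>G / \<beta>\<bar> = \<bar>G\<bar> * (1 / \<beta>)" using beta_bounds(1) by simp
    also have "\<dots> \<le> \<bar>G\<bar> * 2" using inv_beta by (intro mult_left_mono) auto
    finally show "\<bar>G / \<beta>\<bar> \<le> \<bar>G\<bar> * 2" .
    show "\<bar>2 * (s * c)\<bar> \<le> 2 * (1/2)" using cs(2) by simp
  qed
  have "0 \<le> h\<^sup>2 * d" by simp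
  then have "dev (dest d h t (x, v)) \<le> c\<^sup>2 * dev x + (2 * \<bar>S - d\<bar> + h\<^sup>2 * d + 2 * \<bar>G\<bar>)"
  proof -
    have tri: "\<bar>a + b + e\<bar> \<le> A + (2 * B + N + 2 * E)"
      if "\<bar>a\<bar> \<le> A" "\<bar>b\<bar> \<le> 1 * (4/3 * B + N / 3)" "\<bar>e\<bar> \<le> (2 * (1/2)) * (E * 2)" "0 \<le> B" "0 \<le> N" for a b e A B N E :: real
      using that unfolding abs_le_iff by (intro conjI) (simp_all add: abs_le_iff)
    show ?thesis unfolding dev_def[of "dest d h t (x, v)"] e by (rule tri[OF eq_refl[OF b1] b2 b3]) simp_all
  qed
  then show ?thesis by (simp add: nse_def c_def S_def G_def)
qed

lemma integrable_nse: "x \<in> space (Rd d) \<Longrightarrow> integrable (gauss d) (nse x)"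
  unfolding nse_def[abs_def] using d_pos prob_space_gauss[of d]
  by (intro Bochner_Integration.integrable_add integrable_mult_right integrable_norm_dev integrable_abs_dot) (auto simp: finite_measure.integrable_const prob_space.finite_measure)

lemma integral_nse:
  assumes x: "x \<in> space (Rd d)"
  shows "(\<integral>v. nse x v \<partial>gauss d) \<le> 32 * sqrt d + h\<^sup>2 * real d + 8 * enorm d x"
proof -
  interpret prob_space "gauss d" by (rule prob_space_gauss)
  have d0: "d > 0" using d_pos by simp
  have "(\<integral>v. nse x v \<partial>gauss d) = 2 * (\<integral>v. \<bar>dot d v v - real d\<bar> \<partial>gauss d) + h\<^sup>2 * real d + 2 * (\<integral>v. \<bar>dot d v x\<bar> \<partial>gauss d)"
    unfolding nse_def using integrable_norm_dev[OF d0] integrable_abs_dot[OF x] prob_space by simp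
  then show ?thesis using integral_norm_dev[OF d0] integral_abs_dot[OF x] by simp
qed

text \<open>
  Velocities whose inner products exceed their typical size at most by the factor
  \<open>t\<close>. With \<open>t\<close> of order \<open>sqrt (ln (1 / \<eta>))\<close> the
  exceptional probability is at most \<open>\<eta>\<close>, so that \<open>\<eta>\<close> times
  the number of steps stays small over the whole run.
\<close>

definition vgood :: "real \<Rightarrow> (nat \<Rightarrow> real) \<Rightarrow> (nat \<Rightarrow> real) set" where
  "vgood t x = {v \<in> space (Rd d). \<bar>dot d v v - real d\<bar> \<le> t * sqrt d \<and> \<bar>dot d v x\<bar> \<le> t * enorm d x}"

lemma vgood_prob:
  assumes x: "x \<in> space (Rd d)" and t: "0 < t" "t \<le> 2 * sqrt d"
  shows "vgood t x \<in> sets (Rd d)" "measure (gauss d) (space (Rd d) - vgood t x) \<le> 4 * exp (- t\<^sup>2 / 16)"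
proof -
  interpret prob_space "gauss d" by (rule prob_space_gauss)
  note [measurable] = x
  show m: "vgood t x \<in> sets (Rd d)" unfolding vgood_def by measurable
  have d0: "d > 0" using d_pos by simp
  have "measure (gauss d) (space (Rd d) - vgood t x) \<le> measure (gauss d) ({v \<in> space (Rd d). \<bar>dot d v v - real d\<bar> > t * sqrt d} \<union> {v \<in> space (Rd d). \<bar>dot d v x\<bar> > t * enorm d x})"
  proof (rule finite_measure_mono)
    show "{v \<in> space (Rd d). \<bar>dot d v v - real d\<bar> > t * sqrt d} \<union> {v \<in> space (Rd d). \<bar>dot d v x\<bar> > t * enorm d x} \<in> events" by measurable
  qed (auto simp: vgood_def)
  also have "\<dots> \<le> measure (gauss d) {v \<in> space (Rd d). \<bar>dot d v v - real d\<bar> > t * sqrt d} + measure (gauss d) {v \<in> space (Rd d). \<bar>dot d v x\<bar> > t * enorm d x}"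
    by (rule measure_Un_le) measurable
  also have "\<dots> \<le> 2 * exp (- t\<^sup>2 / 16) + 2 * exp (- t\<^sup>2 / 2)"
    by (intro add_mono tail_norm d0 t tail_dot x)
  also have "2 * exp (- t\<^sup>2 / 2) \<le> 2 * exp (- t\<^sup>2 / 16)" by simp
  finally show "measure (gauss d) (space (Rd d) - vgood t x) \<le> 4 * exp (- t\<^sup>2 / 16)" by simp
qed

end

text \<open>
  The regime in which one step is under control as long as the deviation of the position is at
  most \<open>\<alpha>\<close>: all phase points \<open>(x, v)\<close> with \<open>v \<in> vgood
  t x\<close> are then calm at level \<open>\<alpha>\<close>, and the energy errors are bounded.
  The probability \<open>\<eta>\<close> bounds that of the other velocities.
\<close>

locale nuts_regime = nuts +
  fixes \<alpha> t \<tau> \<eta> :: real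
  assumes hd: "h\<^sup>2 * real d \<le> sqrt d" and t1: "1 \<le> t" and t\<alpha>: "2 * t * sqrt d \<le> \<alpha>" and \<alpha>d: "6 * \<alpha> \<le> real d"
    and h\<alpha>: "h\<^sup>2 * \<alpha> \<le> 1/2" and \<tau>: "0 < \<tau>" "\<tau> \<le> pi / 2" "\<tau> \<le> arcl kmax" and \<eta>: "4 * exp (- t\<^sup>2 / 16) \<le> \<eta>"
begin

text \<open>
  The mean of \<open>sin\<^sup>2\<close> over the moves is at least \<open>k1\<close>, the
  factor \<open>\<rho>\<close> is the resulting contraction in one step, and \<open>rad\<close>
  bounds the increase of the deviation in one good step.
\<close>

definition "k1 = kap \<tau> / 3"
definition "\<rho> = 1 - k1 / 2"
definition "rad = 7 * t * sqrt d"

lemma k1: "0 < k1" "k1 \<le> 1/12" using kap_pos[OF \<tau>(1)] kap_le[of \<tau>] by (auto simp: k1_def)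

lemma \<rho>: "0 < \<rho>" "\<rho> < 1" using k1 by (auto simp: \<rho>_def)

lemma sqd: "1 \<le> sqrt d" "sqrt d * sqrt d = real d" using d_pos by auto

lemma t_le: "t \<le> 2 * sqrt d" "0 < t"
proof -
  have "12 * t * sqrt d \<le> sqrt d * sqrt d" using t\<alpha> \<alpha>d sqd by simp
  moreover have "0 < sqrt d" using d_pos by simp
  ultimately have "12 * t \<le> sqrt d" by (rule mult_right_le_imp_le)
  then show "t \<le> 2 * sqrt d" "0 < t" using t1 sqd by auto
qed

lemma \<eta>0: "0 \<le> \<eta>" using \<eta> exp_gt_zero[of "- t\<^sup>2 / 16"] by linarith

lemma rad0: "0 \<le> rad" using t1 by (simp add: rad_def)

lemma enorm_le: "dev x \<le> \<alpha> \<Longrightarrow> enorm d x \<le> 2 * sqrt d"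
proof -
  assume "dev x \<le> \<alpha>"
  then have "dot d x x \<le> 4 * real d" using \<alpha>d by (simp add: dev_def abs_le_iff)
  then have "enorm d x \<le> sqrt (4 * real d)" unfolding enorm_eq_sqrt by (rule real_sqrt_le_mono)
  then show ?thesis by (simp add: real_sqrt_mult)
qed

lemma calm_good:
  assumes x: "x \<in> space (Rd d)" "dev x \<le> \<alpha>" and v: "v \<in> vgood t x"
  shows "calm d \<alpha> (x, v)"
proof -
  have "t * enorm d x \<le> t * (2 * sqrt d)" using enorm_le[OF x(2)] t1 by (intro mult_left_mono) auto
  then have "\<bar>dot d x v\<bar> \<le> \<alpha>" using v t\<alpha> by (auto simp: vgood_def dot_commute[of d x v])
  moreover have "1 * (t * sqrt d) \<le> 2 * t * sqrt d" using t1 sqd by simp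
  then have "\<bar>dot d v v - d\<bar> \<le> \<alpha>" using v t\<alpha> by (auto simp: vgood_def)
  ultimately show ?thesis using x v by (auto simp: calm_def dev_def vgood_def phase_space_def)
qed

lemma dh\<alpha>: "real d * h\<^sup>2 \<le> \<alpha>"
proof -
  have "1 * sqrt d \<le> 2 * t * sqrt d" using t1 by (intro mult_right_mono) auto
  then show ?thesis using hd t\<alpha> by (simp add: mult.commute)
qed

text \<open>
  Both bounds follow from \<open>mean_sin_sq\<close>, as \<open>cos\<^sup>2 a\<close> and
  \<open>|cos a|\<close> are at most \<open>1 - sin\<^sup>2 a / 2\<close>.
\<close>

lemma mean_cos_sq:
  assumes x: "x \<in> space (Rd d)" "dev x \<le> \<alpha>" and v: "v \<in> vgood t x"
  shows "(\<Sum>t\<in>moves kmax. coef d h kmax t (x, v) * (cos (ang (snd (snd t))))\<^sup>2) \<le> \<rho>"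
    and "(\<Sum>t\<in>moves kmax. coef d h kmax t (x, v) * \<bar>cos (ang (snd (snd t)))\<bar>) \<le> \<rho>"
proof -
  have c: "calm d \<alpha> (x, v)" by (rule calm_good[OF x v])
  then have z: "(x, v) \<in> phase_space d" by (simp add: calm_def)
  have m: "k1 \<le> (\<Sum>t\<in>moves kmax. coef d h kmax t (x, v) * (sin (ang (snd (snd t))))\<^sup>2)"
    unfolding k1_def by (rule mean_sin_sq[OF c dh\<alpha> \<alpha>d h\<alpha> \<tau>])
  have e: "(\<Sum>t\<in>moves kmax. coef d h kmax t (x, v) * (1 - (sin (ang (snd (snd t))))\<^sup>2 / 2))
    = 1 - (\<Sum>t\<in>moves kmax. coef d h kmax t (x, v) * (sin (ang (snd (snd t))))\<^sup>2) / 2"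
    using sum_coef[OF z] by (simp add: algebra_simps sum_subtractf sum_divide_distrib)
  have r: "(\<Sum>t\<in>moves kmax. coef d h kmax t (x, v) * (1 - (sin (ang (snd (snd t))))\<^sup>2 / 2)) \<le> \<rho>"
    unfolding e \<rho>_def using m by simp
  have a: "\<bar>cos a\<bar> \<le> 1 - (sin a)\<^sup>2 / 2" for a :: real
  proof -
    have "0 \<le> (\<bar>cos a\<bar> - 1)\<^sup>2" by simp
    then have "2 * \<bar>cos a\<bar> \<le> 1 + (cos a)\<^sup>2" by (simp add: power2_diff)
    then show ?thesis by (simp add: cos_squared_eq)
  qed
  have b: "(cos a)\<^sup>2 \<le> 1 - (sin a)\<^sup>2 / 2" for a :: real by (simp add: cos_squared_eq)
  show "(\<Sum>t\<in>moves kmax. coef d h kmax t (x, v) * (cos (ang (snd (snd t))))\<^sup>2) \<le> \<rho>"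
    by (rule order_trans[OF sum_mono r]) (intro mult_left_mono b coef_nonneg)
  show "(\<Sum>t\<in>moves kmax. coef d h kmax t (x, v) * \<bar>cos (ang (snd (snd t)))\<bar>) \<le> \<rho>"
    by (rule order_trans[OF sum_mono r]) (intro mult_left_mono a coef_nonneg)
qed

lemma dev_good:
  assumes x: "x \<in> space (Rd d)" "dev x \<le> \<alpha>" and v: "v \<in> vgood t x"
  shows "dev (dest d h s (x, v)) \<le> dev x + rad"
proof -
  have "(cos (ang (snd (snd s))))\<^sup>2 * dev x \<le> 1 * dev x" by (intro mult_right_mono) (auto simp: abs_square_le_1 dev_nonneg)
  moreover have "nse x v \<le> rad"
  proof -
    have "t * enorm d x \<le> t * (2 * sqrt d)" using enorm_le[OF x(2)] t1 by (intro mult_left_mono) auto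
    then have "\<bar>dot d v x\<bar> \<le> 2 * (t * sqrt d)" using v by (auto simp: vgood_def)
    moreover have "\<bar>dot d v v - d\<bar> \<le> t * sqrt d" using v by (auto simp: vgood_def)
    moreover have "1 * sqrt d \<le> t * sqrt d" using t1 by (intro mult_right_mono) auto
    ultimately show ?thesis using hd by (simp add: nse_def rad_def)
  qed
  ultimately show ?thesis using dev_dest[of s x v] by linarith
qed

text \<open>
  Bad velocities are charged to \<open>\<eta>\<close>, so only good ones have to be considered
  when one step is estimated.
\<close>

lemma step_bound_Pop:
  assumes x: "x \<in> space (Rd d)" and f: "test_fn f" "\<And>y. y \<in> space (Rd d) \<Longrightarrow> f y \<le> 1"
    and n: "integrable (gauss d) n" "\<And>v. v \<in> space (Rd d) \<Longrightarrow> 0 \<le> n v" and a: "0 \<le> a"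
    and g: "\<And>v. v \<in> vgood t x \<Longrightarrow> (\<Sum>s\<in>moves kmax. coef d h kmax s (x, v) * f (dest d h s (x, v))) \<le> a + n v"
  shows "Pop d h kmax f x \<le> a + (\<integral>v. n v \<partial>gauss d) + \<eta>"
proof -
  interpret prob_space "gauss d" by (rule prob_space_gauss)
  let ?B = "space (Rd d) - vgood t x"
  note vg = vgood_prob[OF x t_le(2,1)]
  have B: "?B \<in> sets (gauss d)" using vg(1) by auto
  have iB: "integrable (gauss d) (indicator ?B :: _ \<Rightarrow> real)" using B by (simp add: integrable_indicator_iff emeasure_eq_measure)
  have "Pop d h kmax f x \<le> (\<integral>v. (a + n v) + indicator ?B v \<partial>gauss d)"
    unfolding Pop_def
  proof (rule integral_mono[OF integrable_step[OF f(1) x]])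
    show "integrable (gauss d) (\<lambda>v. (a + n v) + indicator ?B v)" using n(1) iB by auto
    fix v assume "v \<in> space (gauss d)"
    then have v: "v \<in> space (Rd d)" by simp
    show "(\<Sum>s\<in>moves kmax. coef d h kmax s (x, v) * f (dest d h s (x, v))) \<le> (a + n v) + indicator ?B v"
    proof (cases "v \<in> vgood t x")
      case True then show ?thesis using g by simp
    next
      case False
      have "(\<Sum>s\<in>moves kmax. coef d h kmax s (x, v) * f (dest d h s (x, v))) \<le> 1"
        using x v f(2) by (intro sum_coef_le) (auto simp: phase_space_def)
      then show ?thesis using False v n(2)[OF v] a by simp
    qed
  qed
  also have "\<dots> = (\<integral>v. a + n v \<partial>gauss d) + (\<integral>v. indicator ?B v \<partial>gauss d)"
    by (rule Bochner_Integration.integral_add) (use n(1) iB in auto)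
  also have "(\<integral>v. a + n v \<partial>gauss d) = a + (\<integral>v. n v \<partial>gauss d)"
    using n(1) prob_space by simp
  also have "(\<integral>v. indicator ?B v \<partial>gauss d) = prob ?B" using B by simp
  finally show ?thesis using vg(2) \<eta> by linarith
qed

lemma sum_coef_const: "z \<in> phase_space d \<Longrightarrow> (\<Sum>s\<in>moves kmax. coef d h kmax s z * c) = c"
  using sum_coef[of z] by (simp flip: sum_distrib_right)

lemma vgood_space: "v \<in> vgood t x \<Longrightarrow> x \<in> space (Rd d) \<Longrightarrow> (x, v) \<in> phase_space d"
  by (simp add: vgood_def phase_space_def)

lemma tf_dev_gt: "test_fn (\<lambda>x. if Q < dev x then 1 else 0)"
proof -
  have "(\<lambda>x. if Q < dev x then 1 else 0 :: real) \<in> borel_measurable (Rd d)" by measurable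
  then show ?thesis unfolding test_fn_def by (intro conjI exI[of _ 1]) auto
qed

text \<open>
  Each step increases the deviation by at most \<open>rad\<close>, except with probability
  \<open>\<eta>\<close>.
\<close>

lemma exit_bound:
  assumes "x \<in> space (Rd d)" "dev x + real k * rad \<le> A" "A \<le> \<alpha>"
  shows "Pit k (\<lambda>x. if A < dev x then 1 else 0) x \<le> real k * \<eta>"
  using assms(1,2)
proof (induction k arbitrary: x)
  case 0 then show ?case by simp
next
  case (Suc k)
  let ?F = "\<lambda>x. if A < dev x then 1 else 0 :: real"
  have r: "0 \<le> real k * rad" using rad0 by simp
  have dx: "dev x \<le> \<alpha>" using Suc.prems assms(3) r rad0 by (simp add: algebra_simps; linarith)
  have F1: "Pit k ?F y \<le> 1" if "y \<in> space (Rd d)" for y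
    using Pit_range[OF tf_dev_gt that, of 0 A 1 k] by auto
  have "Pop d h kmax (Pit k ?F) x \<le> real k * \<eta> + (\<integral>v. 0 \<partial>gauss d) + \<eta>"
  proof (rule step_bound_Pop[OF Suc.prems(1) tf_Pit[OF tf_dev_gt] F1])
    fix v assume v: "v \<in> vgood t x"
    show "(\<Sum>s\<in>moves kmax. coef d h kmax s (x, v) * Pit k ?F (dest d h s (x, v))) \<le> real k * \<eta> + 0"
    proof (simp, rule sum_coef_le[OF vgood_space[OF v Suc.prems(1)]])
      fix s
      have "dev (dest d h s (x, v)) \<le> dev x + rad" by (rule dev_good[OF Suc.prems(1) dx v])
      then show "Pit k ?F (dest d h s (x, v)) \<le> real k * \<eta>" using Suc.prems by (intro Suc.IH) (auto simp: algebra_simps)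
    qed
  qed (use \<eta>0 in auto)
  then show ?case by (simp add: algebra_simps)
qed

lemma integral_nse_le: "x \<in> space (Rd d) \<Longrightarrow> dev x \<le> \<alpha> \<Longrightarrow> (\<integral>v. nse x v \<partial>gauss d) \<le> 49 * sqrt d"
  using integral_nse[of x] enorm_le[of x] hd by simp

lemma nse_nonneg: "0 \<le> nse x v" by (simp add: nse_def)

text \<open>
  In one step the deviation contracts by \<open>\<rho>\<close> in the mean and receives noise of
  order \<open>sqrt d\<close>. The fixed point of this recursion is of order \<open>sqrt
  d\<close>, and Markov's inequality at level \<open>Q\<close> turns the mean into a
  probability. The argument is an induction for the indicator function rather than for the
  deviation itself, since the estimate of a step is only available while the deviation is at
  most \<open>\<alpha>\<close>.
\<close>

lemma lyapunov:
  assumes Q: "0 < Q" and "x \<in> space (Rd d)" "dev x + real k * rad \<le> \<alpha>"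
  shows "Pit k (\<lambda>x. if Q < dev x then 1 else 0) x \<le> \<rho> ^ k * dev x / Q + (1 - \<rho> ^ k) * (98 * sqrt d / (k1 * Q)) + real k * \<eta>"
  using assms(2,3)
proof (induction k arbitrary: x)
  case 0
  then show ?case using Q dev_nonneg[of x] by (auto simp: field_simps)
next
  case (Suc k)
  let ?F = "\<lambda>x. if Q < dev x then 1 else 0 :: real"
  define Z where "Z = 98 * sqrt d / (k1 * Q)"
  have Zn: "(1 - \<rho>) * Z = 49 * sqrt d / Q" using k1 Q by (simp add: Z_def \<rho>_def)
  have Z0: "0 \<le> Z" using k1 Q by (simp add: Z_def)
  have rk: "0 \<le> \<rho> ^ k" "\<rho> ^ k \<le> 1" using \<rho> by (auto simp: power_le_one)
  have r: "0 \<le> real k * rad" using rad0 by simp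
  have dx: "dev x \<le> \<alpha>" using Suc.prems r rad0 by (simp add: algebra_simps; linarith)
  have F1: "Pit k ?F y \<le> 1" if "y \<in> space (Rd d)" for y
    using Pit_range[OF tf_dev_gt that, of 0 Q 1 k] by auto
  define a where "a = \<rho> ^ k * (\<rho> * dev x) / Q + (1 - \<rho> ^ k) * Z + real k * \<eta>"
  have a0: "0 \<le> a" unfolding a_def using rk \<rho> Q Z0 \<eta>0 dev_nonneg[of x] by (intro add_nonneg_nonneg mult_nonneg_nonneg divide_nonneg_nonneg) auto
  have "Pop d h kmax (Pit k ?F) x \<le> a + (\<integral>v. \<rho> ^ k / Q * nse x v \<partial>gauss d) + \<eta>"
  proof (rule step_bound_Pop[OF Suc.prems(1) tf_Pit[OF tf_dev_gt] F1])
    fix v assume v: "v \<in> vgood t x"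
    note zp = vgood_space[OF v Suc.prems(1)]
    have "(\<Sum>s\<in>moves kmax. coef d h kmax s (x, v) * Pit k ?F (dest d h s (x, v)))
      \<le> (\<Sum>s\<in>moves kmax. coef d h kmax s (x, v) * (\<rho> ^ k / Q * ((cos (ang (snd (snd s))))\<^sup>2 * dev x) + (\<rho> ^ k / Q * nse x v + (1 - \<rho> ^ k) * Z + real k * \<eta>)))"
    proof (intro sum_mono mult_left_mono coef_nonneg)
      fix s
      have "dev (dest d h s (x, v)) \<le> dev x + rad" by (rule dev_good[OF Suc.prems(1) dx v])
      then have "Pit k ?F (dest d h s (x, v)) \<le> \<rho> ^ k * dev (dest d h s (x, v)) / Q + (1 - \<rho> ^ k) * Z + real k * \<eta>"
        unfolding Z_def using Suc.prems by (intro Suc.IH) (auto simp: algebra_simps)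
      also have "\<rho> ^ k * dev (dest d h s (x, v)) / Q \<le> \<rho> ^ k / Q * ((cos (ang (snd (snd s))))\<^sup>2 * dev x + nse x v)"
        using mult_left_mono[OF dev_dest[of s x v], of "\<rho> ^ k / Q"] rk Q by simp
      finally show "Pit k ?F (dest d h s (x, v)) \<le> \<rho> ^ k / Q * ((cos (ang (snd (snd s))))\<^sup>2 * dev x) + (\<rho> ^ k / Q * nse x v + (1 - \<rho> ^ k) * Z + real k * \<eta>)"
        by (simp add: algebra_simps)
    qed
    also have "\<dots> = \<rho> ^ k / Q * dev x * (\<Sum>s\<in>moves kmax. coef d h kmax s (x, v) * (cos (ang (snd (snd s))))\<^sup>2) + (\<rho> ^ k / Q * nse x v + (1 - \<rho> ^ k) * Z + real k * \<eta>)"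
      unfolding distrib_left sum.distrib sum_coef_const[OF zp] by (simp add: sum_distrib_left mult_ac distrib_left)
    also have "\<dots> \<le> \<rho> ^ k / Q * dev x * \<rho> + (\<rho> ^ k / Q * nse x v + (1 - \<rho> ^ k) * Z + real k * \<eta>)"
      using rk Q dev_nonneg[of x] by (intro add_right_mono mult_left_mono mean_cos_sq(1)[OF Suc.prems(1) dx v]) auto
    finally show "(\<Sum>s\<in>moves kmax. coef d h kmax s (x, v) * Pit k ?F (dest d h s (x, v))) \<le> a + \<rho> ^ k / Q * nse x v"
      by (simp add: a_def mult_ac)
  qed (use a0 rk Q nse_nonneg integrable_nse[OF Suc.prems(1)] in \<open>auto\<close>)
  also have "(\<integral>v. \<rho> ^ k / Q * nse x v \<partial>gauss d) \<le> \<rho> ^ k / Q * (49 * sqrt d)"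
    using integral_nse_le[OF Suc.prems(1) dx] rk Q by (simp add: mult_left_mono divide_right_mono)
  also have "\<rho> ^ k / Q * (49 * sqrt d) = \<rho> ^ k * ((1 - \<rho>) * Z)" unfolding Zn by simp
  finally have "Pop d h kmax (Pit k ?F) x \<le> a + \<rho> ^ k * ((1 - \<rho>) * Z) + \<eta>" by simp
  also have "a + \<rho> ^ k * ((1 - \<rho>) * Z) + \<eta> = \<rho> ^ Suc k * dev x / Q + (1 - \<rho> ^ Suc k) * Z + real (Suc k) * \<eta>"
    by (simp add: a_def algebra_simps)
  finally show ?case by (simp add: Z_def)
qed

end

section \<open>Contraction of the distance and merging\<close>

text \<open>
  A comparison of all values of \<open>A\<close> with all values of \<open>B\<close> passes
  through a constant. Applying a positive operator to \<open>A\<close> and to \<open>B\<close>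
  at two different points then preserves the comparison, which replaces the product coupling of
  two independent chains.
\<close>

lemma separating_constant:
  fixes A B :: "'a \<Rightarrow> real"
  assumes "\<And>x y. x \<in> S \<Longrightarrow> y \<in> S \<Longrightarrow> A x \<le> B y"
  obtains \<kappa> where "\<And>x. x \<in> S \<Longrightarrow> A x \<le> \<kappa>" "\<And>x. x \<in> S \<Longrightarrow> \<kappa> \<le> B x"
proof (cases "S = {}")
  case False
  then obtain z where z: "z \<in> S" by blast
  have "bdd_above (A ` S)" using assms z by (intro bdd_aboveI2[of _ _ "B z"]) auto
  then have "A x \<le> Sup (A ` S)" if "x \<in> S" for x using that by (intro cSup_upper) auto
  moreover have "Sup (A ` S) \<le> B x" if "x \<in> S" for x using False assms that by (intro cSup_least) auto
  ultimately show ?thesis by (rule that)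
qed (use that in auto)

context nuts begin

lemma dst_reflect:
  assumes "good_dir e" shows "dst z (reflect d e z) \<le> 2 * \<bar>dot d z e\<bar>"
proof -
  define p where "p = dot d z e"
  have "dot d (lin d 1 (- 1) z (reflect d e z)) (lin d 1 (- 1) z (reflect d e z)) = (2 * p)\<^sup>2 * dot d e e"
    unfolding reflect_def p_def[symmetric]
    by (simp add: dot_lin_left dot_lin_right dot_commute[of d e z] flip: p_def) (simp add: power2_eq_square algebra_simps)
  also have "\<dots> \<le> (2 * p)\<^sup>2 * 1" using assms by (intro mult_left_mono) (auto simp: good_dir_def)
  finally have "sqrt (dot d (lin d 1 (- 1) z (reflect d e z)) (lin d 1 (- 1) z (reflect d e z))) \<le> sqrt ((2 * p)\<^sup>2)"
    by (intro real_sqrt_le_mono) simp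
  then show ?thesis unfolding dst_def enorm_eq_sqrt by (simp only: real_sqrt_abs p_def abs_mult abs_numeral)
qed

text \<open>
  Two points of equal norm are exchanged by the reflection along their difference.
\<close>

lemma reflection_swap:
  assumes x: "x \<in> space (Rd d)" and y: "y \<in> space (Rd d)" and n: "dot d x x = dot d y y"
  obtains e where "good_dir e" "reflect d e x = y" "2 * \<bar>dot d x e\<bar> \<le> dst x y"
proof -
  define D where "D = lin d 1 (- 1) x y"
  define m where "m = dst x y"
  have D: "D \<in> space (Rd d)" by (simp add: D_def)
  have mm: "m\<^sup>2 = dot d D D" by (simp add: m_def dst_def enorm_sq D_def)
  have m0: "0 \<le> m" by (simp add: m_def dst_def enorm_nonneg)
  have xD: "dot d x D = m\<^sup>2 / 2"
    unfolding mm unfolding D_def by (simp add: dot_lin_left dot_lin_right dot_commute[of d y x] n)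
  show ?thesis
  proof (cases "m = 0")
    case True
    define e where "e = lin d 0 0 x x"
    have e: "dot d e e = 0" "dot d x e = 0" "e \<in> space (Rd d)" by (simp_all add: e_def dot_lin_left dot_lin_right)
    have "x = y"
    proof (rule space_Rd_eqI[OF x y])
      fix i assume i: "i < d"
      have "(\<Sum>i<d. D i * D i) = 0" using mm True by (simp add: dot_def)
      then have "\<forall>i\<in>{..<d}. D i * D i = 0" by (subst (asm) sum_nonneg_eq_0_iff) auto
      then show "x i = y i" using i by (simp add: D_def lin_nth)
    qed
    then show ?thesis using e x m0 by (intro that[of e]) (auto simp: good_dir_def reflect_zero m_def)
  next
    case False
    define e where "e = lin d (1 / m) 0 D D"
    have "dot d e e = dot d D D / m\<^sup>2" unfolding e_def by (simp add: dot_lin_left dot_lin_right power2_eq_square)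
    then have ee: "dot d e e = 1" using False by (simp flip: mm)
    have xe: "dot d x e = m / 2" using False by (simp add: e_def dot_lin_right xD power2_eq_square)
    have r: "reflect d e x = y"
    proof (rule space_Rd_eqI)
      fix i assume "i < d"
      then show "reflect d e x i = y i"
        unfolding reflect_def xe using False by (simp add: lin_nth e_def D_def)
    qed (use y in auto)
    show ?thesis by (rule that[of e]) (use ee xe r m0 in \<open>auto simp: good_dir_def e_def m_def[symmetric]\<close>)
  qed
qed

end

context nuts_regime begin

lemma one_sub_\<rho>: "1 - \<rho> = k1 / 2" by (simp add: \<rho>_def)

text \<open>
  The second chain is the mirror image of the first under the reflection that exchanges their
  starting points. The two chains then stay at equal norms, and their distance is \<open>2 *
  |dot d x e|\<close>, which evolves linearly: it is multiplied by \<open>cos\<close> of the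
  angle of the move, and \<open>2 * |dot d v e|\<close> is added up to a constant. So distance
  and deviation both contract by \<open>\<rho>\<close> in the mean, with noise of order one and
  of order \<open>sqrt d\<close>. A bound on \<open>g x - g y\<close> that is affine in the
  scaled distance and deviation therefore improves under iteration, until both are of order
  \<open>1 / (k1 * M)\<close>.
\<close>

lemma recenter:
  fixes M c :: real
  assumes M: "0 < M" and c: "0 \<le> c" "c \<le> 1"
    and g: "test_fn g" "\<And>x. x \<in> space (Rd d) \<Longrightarrow> 0 \<le> g x \<and> g x \<le> 1"
    and base: "\<And>x y. x \<in> space (Rd d) \<Longrightarrow> y \<in> space (Rd d) \<Longrightarrow> dot d x x = dot d y y \<Longrightarrow>
      g x - g y \<le> 1 - c + c * (dst x y / M + dev x / (M * sqrt d))"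
    and "x \<in> space (Rd d)" "y \<in> space (Rd d)" "dot d x x = dot d y y" "dev x + real k * rad \<le> \<alpha>"
  shows "Pit k g x - Pit k g y \<le> 1 - c + c * (\<rho> ^ k * (dst x y / M + dev x / (M * sqrt d)) + (1 - \<rho> ^ k) * (130 / (k1 * M))) + real k * \<eta>"
  using assms(7-)
proof (induction k arbitrary: x y)
  case 0 then show ?case using base by simp
next
  case (Suc k)
  define Z where "Z = 130 / (k1 * M)"
  define F where "F = Pit k g"
  define U where "U = (\<lambda>x y. dst x y / M + dev x / (M * sqrt d))"
  have Zn: "(1 - \<rho>) * Z = 65 / M" unfolding one_sub_\<rho> using k1 M by (simp add: Z_def)
  have Z0: "0 \<le> Z" using k1 M by (simp add: Z_def)
  have sq: "0 < sqrt d" using d_pos by simp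
  have rk: "0 \<le> \<rho> ^ k" "\<rho> ^ k \<le> 1" using \<rho> by (auto simp: power_le_one)
  have r: "0 \<le> real k * rad" using rad0 by simp
  have dx: "dev x \<le> \<alpha>" using Suc.prems(4) r rad0 by (simp add: algebra_simps; linarith)
  note x = Suc.prems(1)
  obtain e where e: "good_dir e" "reflect d e x = y" "2 * \<bar>dot d x e\<bar> \<le> dst x y"
    using reflection_swap[OF Suc.prems(1-3)] by blast
  have es: "e \<in> space (Rd d)" and ee: "dot d e e \<le> 1" using e(1) by (auto simp: good_dir_def)
  have F: "test_fn F" unfolding F_def by (rule tf_Pit[OF g(1)])
  have F1: "0 \<le> F z \<and> F z \<le> 1" if "z \<in> space (Rd d)" for z unfolding F_def by (rule Pit_range[OF g(1) that g(2)])
  have FR: "test_fn (\<lambda>z. F (reflect d e z))" by (rule tf_reflect[OF F es])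
  define G where "G = (\<lambda>z. 1 * F z + (- 1) * F (reflect d e z))"
  have G: "test_fn G" unfolding G_def by (rule tf_lin[OF F FR])
  have G1: "G z \<le> 1" if "z \<in> space (Rd d)" for z using F1[OF that] F1[of "reflect d e z"] by (simp add: G_def)
  have PG: "Pop d h kmax F x - Pop d h kmax F y = Pop d h kmax G x"
    unfolding G_def Pop_lin[OF F FR x] e(2)[symmetric] Pop_reflect[OF e(1) x F] by simp
  define a where "a = 1 - c + c * (\<rho> ^ k * (\<rho> * U x y) + (1 - \<rho> ^ k) * Z) + real k * \<eta>"
  define n where "n = (\<lambda>v. (c * \<rho> ^ k * (4 / M)) * \<bar>dot d v e\<bar> + (c * \<rho> ^ k / (M * sqrt d)) * nse x v)"
  have U0: "0 \<le> U x y" using M sq by (simp add: U_def dev_nonneg dst_def enorm_nonneg)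
  have a0: "0 \<le> a" unfolding a_def using rk \<rho> Z0 \<eta>0 U0 c by (intro add_nonneg_nonneg mult_nonneg_nonneg) auto
  have ni: "integrable (gauss d) n" unfolding n_def
    by (intro Bochner_Integration.integrable_add integrable_mult_right integrable_nse[OF x] integrable_abs_dot[OF es])
  have n0: "0 \<le> n v" for v unfolding n_def using c rk M sq nse_nonneg by (intro add_nonneg_nonneg mult_nonneg_nonneg divide_nonneg_nonneg) auto
  have "Pop d h kmax G x \<le> a + (\<integral>v. n v \<partial>gauss d) + \<eta>"
  proof (rule step_bound_Pop[OF x G G1 ni n0 a0])
    fix v assume v: "v \<in> vgood t x"
    note zp = vgood_space[OF v x]
    define C where "C = (\<lambda>s :: int \<times> nat \<times> int. ang (snd (snd s)))"
    define W where "W = (4 / M) * \<bar>dot d v e\<bar> + nse x v / (M * sqrt d)"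
    have st: "G (dest d h s (x, v)) \<le> c * \<rho> ^ k * (dst x y / M) * \<bar>cos (C s)\<bar> + c * \<rho> ^ k * (dev x / (M * sqrt d)) * (cos (C s))\<^sup>2
        + (1 - c + c * (\<rho> ^ k * W + (1 - \<rho> ^ k) * Z) + real k * \<eta>)" for s
    proof -
      define z where "z = dest d h s (x, v)"
      have zs: "z \<in> space (Rd d)" by (simp add: z_def)
      have "dev z \<le> dev x + rad" unfolding z_def by (rule dev_good[OF x dx v])
      then have dz: "dev z + real k * rad \<le> \<alpha>" using Suc.prems(4) by (simp add: algebra_simps)
      have "dot d z z = dot d (reflect d e z) (reflect d e z)"
        using e(1) by (subst reflect_dot) (auto simp: good_dir_def)
      from Suc.IH[OF zs _ this dz]
      have 1: "G z \<le> 1 - c + c * (\<rho> ^ k * U z (reflect d e z) + (1 - \<rho> ^ k) * Z) + real k * \<eta>"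
        by (simp add: G_def F_def U_def Z_def)
      have ze: "dot d z e = cos (C s) * dot d x e + sin (C s) * (1 / \<beta>) * dot d v e"
        by (simp add: z_def C_def dest_def rot_def ang_def dot_lin_left)
      have "\<bar>dot d z e\<bar> \<le> \<bar>cos (C s)\<bar> * \<bar>dot d x e\<bar> + \<bar>sin (C s) * (1 / \<beta>) * dot d v e\<bar>"
        unfolding ze by (rule order_trans[OF abs_triangle_ineq]) (simp add: abs_mult)
      also have "\<bar>sin (C s) * (1 / \<beta>) * dot d v e\<bar> \<le> 1 * 2 * \<bar>dot d v e\<bar>"
        unfolding abs_mult using inv_beta beta_bounds(1) by (intro mult_mono) auto
      finally have "dst z (reflect d e z) \<le> \<bar>cos (C s)\<bar> * dst x y + 4 * \<bar>dot d v e\<bar>"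
        using dst_reflect[OF e(1), of z] mult_left_mono[OF e(3), of "\<bar>cos (C s)\<bar>"] by simp
      then have "dst z (reflect d e z) / M \<le> (\<bar>cos (C s)\<bar> * dst x y + 4 * \<bar>dot d v e\<bar>) / M"
        using M by (intro divide_right_mono) auto
      moreover have "dev z / (M * sqrt d) \<le> ((cos (C s))\<^sup>2 * dev x + nse x v) / (M * sqrt d)"
        unfolding z_def C_def using M by (intro divide_right_mono dev_dest) auto
      ultimately have "U z (reflect d e z) \<le> (dst x y / M) * \<bar>cos (C s)\<bar> + (dev x / (M * sqrt d)) * (cos (C s))\<^sup>2 + W"
        by (simp add: U_def W_def add_divide_distrib mult.commute)
      then have "c * \<rho> ^ k * U z (reflect d e z) \<le> c * \<rho> ^ k * ((dst x y / M) * \<bar>cos (C s)\<bar> + (dev x / (M * sqrt d)) * (cos (C s))\<^sup>2 + W)"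
        using c rk by (intro mult_left_mono) auto
      then show ?thesis using 1 by (simp add: z_def algebra_simps)
    qed
    have "(\<Sum>s\<in>moves kmax. coef d h kmax s (x, v) * G (dest d h s (x, v)))
      \<le> (\<Sum>s\<in>moves kmax. coef d h kmax s (x, v) * (c * \<rho> ^ k * (dst x y / M) * \<bar>cos (C s)\<bar> + c * \<rho> ^ k * (dev x / (M * sqrt d)) * (cos (C s))\<^sup>2
        + (1 - c + c * (\<rho> ^ k * W + (1 - \<rho> ^ k) * Z) + real k * \<eta>)))"
      by (intro sum_mono mult_left_mono coef_nonneg st)
    also have "\<dots> = c * \<rho> ^ k * (dst x y / M) * (\<Sum>s\<in>moves kmax. coef d h kmax s (x, v) * \<bar>cos (C s)\<bar>)
      + c * \<rho> ^ k * (dev x / (M * sqrt d)) * (\<Sum>s\<in>moves kmax. coef d h kmax s (x, v) * (cos (C s))\<^sup>2)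
      + (1 - c + c * (\<rho> ^ k * W + (1 - \<rho> ^ k) * Z) + real k * \<eta>)"
      unfolding distrib_left[of "coef _ _ _ _ _"] sum.distrib sum_coef_const[OF zp] sum_distrib_left by (simp add: mult_ac)
    also have "\<dots> \<le> c * \<rho> ^ k * (dst x y / M) * \<rho> + c * \<rho> ^ k * (dev x / (M * sqrt d)) * \<rho>
      + (1 - c + c * (\<rho> ^ k * W + (1 - \<rho> ^ k) * Z) + real k * \<eta>)"
      unfolding C_def using c rk M sq dev_nonneg[of x]
      by (intro add_mono order_refl mult_left_mono mean_cos_sq[OF x dx v]) (auto simp: dst_def enorm_nonneg)
    also have "\<dots> = a + n v"
    proof -
      have "U x y = dst x y / M + dev x / (M * sqrt d)" by (simp add: U_def)
      moreover have "n v = c * \<rho> ^ k * W" by (simp add: n_def W_def algebra_simps)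
      ultimately show ?thesis unfolding a_def by (simp only: algebra_simps)
    qed
    finally show "(\<Sum>s\<in>moves kmax. coef d h kmax s (x, v) * G (dest d h s (x, v))) \<le> a + n v" .
  qed
  also have "(\<integral>v. n v \<partial>gauss d) = (c * \<rho> ^ k * (4 / M)) * (\<integral>v. \<bar>dot d v e\<bar> \<partial>gauss d) + (c * \<rho> ^ k / (M * sqrt d)) * (\<integral>v. nse x v \<partial>gauss d)"
    unfolding n_def using integrable_nse[OF x] integrable_abs_dot[OF es] by simp
  also have "\<dots> \<le> (c * \<rho> ^ k * (4 / M)) * 4 + (c * \<rho> ^ k / (M * sqrt d)) * (49 * sqrt d)"
  proof (intro add_mono mult_left_mono integral_nse_le[OF x dx])
    have "enorm d e \<le> 1" using ee by (simp add: enorm_eq_sqrt)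
    then show "(\<integral>v. \<bar>dot d v e\<bar> \<partial>gauss d) \<le> 4" using integral_abs_dot[OF es] by simp
  qed (use c rk M in auto)
  also have "\<dots> = c * \<rho> ^ k * ((1 - \<rho>) * Z)" unfolding Zn using sq M by (simp add: field_simps)
  finally have "Pop d h kmax F x - Pop d h kmax F y \<le> a + c * \<rho> ^ k * ((1 - \<rho>) * Z) + \<eta>" unfolding PG by simp
  also have "\<dots> = 1 - c + c * (\<rho> ^ Suc k * U x y + (1 - \<rho> ^ Suc k) * Z) + real (Suc k) * \<eta>"
    by (simp add: a_def algebra_simps)
  finally show ?case by (simp add: F_def U_def Z_def)
qed

end

text \<open>
  The distance scale at which the chains are merged. It is a large multiple of \<open>1 / kap
  \<tau>\<close>, so that the stationary mean distance under the reflection coupling is a small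
  fraction of it.
\<close>

definition cM :: "real \<Rightarrow> real" where "cM \<tau> = 4704 / kap \<tau>"

text \<open>
  An epoch consists of \<open>n1\<close> steps that bring the deviation down to order
  \<open>sqrt d\<close>, one step that makes the norms of the two chains agree,
  \<open>n1\<close> steps in which chains of equal norm approach each other, and a last step
  that merges them. The assumptions say that \<open>n1\<close> steps suffice to contract all
  quantities from their largest possible size, and that an epoch does not leave the region where
  steps are under control.
\<close>

locale nuts_epoch = nuts_regime +
  fixes n1 :: nat
  assumes th: "\<theta> \<le> pi / 4" and big: "1000 * (cG \<tau> (cM \<tau>))\<^sup>2 * (cM \<tau>)\<^sup>2 \<le> sqrt d"
    and hA: "h\<^sup>2 * (cA \<tau> (cM \<tau>) * sqrt d) \<le> 1/2"
    and esc: "\<exists>J\<le>kmax. (J = kmax \<or> arcl J > pi / 2) \<and>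
      ((\<forall>i<J. quiet (6 * cC \<tau> (cM \<tau>) / sqrt d) (arcl i)) \<and> (J = kmax \<or> turns (6 * cC \<tau> (cM \<tau>) / sqrt d) (arcl J)) \<or>
       (\<forall>i<J. quiet (6 * cA \<tau> (cM \<tau>) / sqrt d) (arcl i)) \<and> sin (arcl J) \<le> 6 * cC \<tau> (cM \<tau>) / sqrt d * (1 - cos (arcl J)) \<and> 0 < 1 - cos (arcl J))"
    and mixed: "(1 - kap \<tau> / 6) ^ n1 * (4 * sqrt d + cW \<tau> (cM \<tau>)) \<le> 1/4"
    and n1\<eta>: "real n1 * \<eta> \<le> shot \<tau> (cM \<tau>) / 4"
    and room: "cW \<tau> (cM \<tau>) * sqrt d + real n1 * (7 * t * sqrt d) \<le> \<alpha>"
begin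

abbreviation "M \<equiv> cM \<tau>"
abbreviation "c \<equiv> shot \<tau> M"
abbreviation "n0 \<equiv> n1 + (n1 + 2)"

lemma M1: "1 \<le> M" and Mk: "k1 * M = 1568"
  using k1 kap_pos[OF \<tau>(1)] by (auto simp: cM_def k1_def field_simps)

lemma c: "0 < c" "c \<le> 1/2"
proof -
  show "0 < c" using kap_pos[OF \<tau>(1)] by (simp add: shot_def)
  have "0 \<le> kap \<tau>" "kap \<tau> \<le> 1" using kap_pos[OF \<tau>(1)] kap_le[of \<tau>] by auto
  then have "(kap \<tau>)\<^sup>2 \<le> 1" by (simp add: power_le_one)
  moreover have "exp (- cK \<tau> M) \<le> 1"
  proof -
    have "0 \<le> cK \<tau> M" using const_bounds[of \<tau> M] M1 \<tau> by (auto simp: cK_def intro!: add_nonneg_nonneg)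
    then show ?thesis by simp
  qed
  ultimately have "(kap \<tau>)\<^sup>2 * exp (- cK \<tau> M) \<le> 1 * 1" by (intro mult_mono) auto
  then show "c \<le> 1/2" by (simp add: shot_def)
qed

lemma rn1: "\<rho> ^ n1 * (4 * sqrt d + cW \<tau> M) \<le> 1/4" using mixed by (simp add: \<rho>_def k1_def)

lemma room': "cW \<tau> M * sqrt d + real n1 * rad \<le> \<alpha>" using room by (simp add: rad_def)

lemma cW: "M \<le> cW \<tau> M"
  using const_bounds[of \<tau> M] M1 \<tau> by (simp add: cW_def cA_def)

text \<open>
  If distance or deviation are too large for \<open>one_shot\<close>, the right side is at least
  one and there is nothing to prove.
\<close>

lemma base:
  assumes f: "test_fn f" "\<And>x. x \<in> space (Rd d) \<Longrightarrow> 0 \<le> f x \<and> f x \<le> 1"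
    and x: "x \<in> space (Rd d)" and y: "y \<in> space (Rd d)" and n: "dot d x x = dot d y y"
  shows "Pop d h kmax f x - Pop d h kmax f y \<le> 1 - c + c * (dst x y / M + dev x / (M * sqrt d))"
proof -
  have sq: "0 < sqrt d" using d_pos by simp
  have P1: "0 \<le> Pop d h kmax f z \<and> Pop d h kmax f z \<le> 1" if "z \<in> space (Rd d)" for z
    using Pit_range[OF f(1) that f(2), of 1] by simp
  have dd: "0 \<le> dst x y" by (simp add: dst_def enorm_nonneg)
  have nn: "0 \<le> dst x y / M" "0 \<le> dev x / (M * sqrt d)" using M1 sq dev_nonneg[of x] dd by auto
  show ?thesis
  proof (cases "dst x y \<le> M \<and> dev x \<le> M * sqrt d")
    case True
    have "(dst x y)\<^sup>2 \<le> M\<^sup>2" using True dd by (intro power_mono) auto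
    then have D: "dot d (lin d 1 (- 1) x y) (lin d 1 (- 1) x y) \<le> M\<^sup>2" by (simp add: dst_def enorm_sq)
    have "Pop d h kmax f x - Pop d h kmax f y \<le> 1 - c * (1 - 0)"
      by (rule one_shot[OF M1 \<tau> th big hd hA esc x _ y _ D f f]) (use True n in \<open>auto simp: dev_def\<close>)
    moreover have "0 \<le> c * (dst x y / M + dev x / (M * sqrt d))" using nn c by (intro mult_nonneg_nonneg) auto
    ultimately show ?thesis by simp
  next
    case False
    then have "1 \<le> dst x y / M \<or> 1 \<le> dev x / (M * sqrt d)" using M1 sq by auto
    then have "c * 1 \<le> c * (dst x y / M + dev x / (M * sqrt d))" using nn c by (intro mult_left_mono) auto
    then show ?thesis using P1[OF x] P1[OF y] by linarith
  qed
qed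

lemma spherical_contraction:
  assumes f: "test_fn f" "\<And>x. x \<in> space (Rd d) \<Longrightarrow> 0 \<le> f x \<and> f x \<le> 1"
    and x: "x \<in> space (Rd d)" and y: "y \<in> space (Rd d)" and n: "dot d x x = dot d y y" and dx: "dev x \<le> cW \<tau> M * sqrt d"
  shows "Pit n1 (Pop d h kmax f) x - Pit n1 (Pop d h kmax f) y \<le> 1 - c / 4"
proof -
  have sq: "0 < sqrt d" using d_pos by simp
  have rk: "0 \<le> \<rho> ^ n1" "\<rho> ^ n1 \<le> 1" using \<rho> by (auto simp: power_le_one)
  have P1: "0 \<le> Pop d h kmax f z \<and> Pop d h kmax f z \<le> 1" if "z \<in> space (Rd d)" for z
    using Pit_range[OF f(1) that f(2), of 1] by simp
  have da: "dev x + real n1 * rad \<le> \<alpha>" using dx room' by linarith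
  have da2: "dev x \<le> \<alpha>" using da rad0 mult_nonneg_nonneg[of "real n1" rad] by linarith
  have c1: "0 \<le> c" "c \<le> 1" using c by auto
  define U where "U = dst x y / M + dev x / (M * sqrt d)"
  have "Pit n1 (Pop d h kmax f) x - Pit n1 (Pop d h kmax f) y \<le> 1 - c + c * (\<rho> ^ n1 * U + (1 - \<rho> ^ n1) * (130 / (k1 * M))) + real n1 * \<eta>"
    unfolding U_def by (rule recenter[OF _ c1 tf_Pop[OF f(1)] P1 base[OF f] x y n da]) (use M1 in auto)
  also have "\<dots> \<le> 1 - c + c * (1/4 + 1/4) + c / 4"
  proof (intro add_mono order_refl mult_left_mono c1 n1\<eta>)
    have "(dst x y)\<^sup>2 \<le> (4 * sqrt d)\<^sup>2"
    proof -
      have "0 \<le> dot d (lin d 1 1 x y) (lin d 1 1 x y)" by simp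
      then have "dot d (lin d 1 (- 1) x y) (lin d 1 (- 1) x y) \<le> 4 * dot d x x"
        by (simp add: dot_lin_left dot_lin_right dot_commute[of d y x] n)
      moreover have "dot d x x \<le> 4 * real d" using da2 \<alpha>d by (simp add: dev_def abs_le_iff)
      ultimately show ?thesis by (simp add: dst_def enorm_sq power_mult_distrib)
    qed
    then have "dst x y \<le> 4 * sqrt d" by (rule power2_le_imp_le) simp
    then have "dst x y / M \<le> 4 * sqrt d / 1" using M1 by (intro frac_le) auto
    moreover have "dev x / (M * sqrt d) \<le> (cW \<tau> M * sqrt d) / (1 * sqrt d)" using M1 sq dx dev_nonneg[of x] cW by (intro frac_le mult_right_mono) auto
    ultimately have "U \<le> 4 * sqrt d + cW \<tau> M" using sq by (simp add: U_def)
    then have "\<rho> ^ n1 * U \<le> \<rho> ^ n1 * (4 * sqrt d + cW \<tau> M)" using rk by (intro mult_left_mono) auto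
    then show "\<rho> ^ n1 * U \<le> 1/4" using rn1 by linarith
    show "(1 - \<rho> ^ n1) * (130 / (k1 * M)) \<le> 1/4" using rk by (simp add: Mk)
  qed
  finally show ?thesis by (simp add: algebra_simps)
qed

text \<open>
  Chains of different norm are compared through the point \<open>y'\<close> on the ray through
  \<open>x\<close> that has the norm of \<open>y\<close>. It is close to \<open>x\<close>, so
  \<open>one_shot\<close> applies to \<open>x\<close> and \<open>y'\<close>, and a reflection
  takes \<open>y'\<close> to \<open>y\<close>. After the step, the two chains are at points
  \<open>z\<close> and \<open>reflect d e z\<close> of equal norm with positive probability, for
  which \<open>spherical_contraction\<close> provides the hypothesis \<open>f1 \<le> f2 +
  s\<close>.
\<close>

lemma align:
  assumes f: "test_fn f" "\<And>x. x \<in> space (Rd d) \<Longrightarrow> 0 \<le> f x \<and> f x \<le> 1"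
    and x: "x \<in> space (Rd d)" "dev x \<le> M / 2 * sqrt d" and y: "y \<in> space (Rd d)" "dev y \<le> M / 2 * sqrt d"
  shows "Pop d h kmax (Pit n1 (Pop d h kmax f)) x - Pop d h kmax (Pit n1 (Pop d h kmax f)) y \<le> 1 - c\<^sup>2 / 4"
proof -
  have sq: "0 < sqrt d" "sqrt d * sqrt d = real d" using d_pos by auto
  define g where "g = Pit n1 (Pop d h kmax f)"
  have P1: "0 \<le> Pop d h kmax f z \<and> Pop d h kmax f z \<le> 1" if "z \<in> space (Rd d)" for z
    using Pit_range[OF f(1) that f(2), of 1] by simp
  have g: "test_fn g" unfolding g_def by (intro tf_Pit tf_Pop f)
  have g1: "0 \<le> g z \<and> g z \<le> 1" if "z \<in> space (Rd d)" for z unfolding g_def by (rule Pit_range[OF tf_Pop[OF f(1)] that P1])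
  have "0 \<le> real n1 * rad" using rad0 by simp
  moreover have "M * sqrt d \<le> cW \<tau> M * sqrt d" using cW sq by (intro mult_right_mono) auto
  ultimately have Ma: "M * sqrt d \<le> \<alpha>" using room' by linarith
  define p q where "p = enorm d x" and "q = enorm d y"
  have pq: "p\<^sup>2 = dot d x x" "q\<^sup>2 = dot d y y" "0 \<le> p" "0 \<le> q" by (simp_all add: p_def q_def enorm_sq enorm_nonneg)
  have half: "sqrt d / 2 \<le> enorm d z" if "dev z \<le> M / 2 * sqrt d" for z
  proof -
    have "M / 2 * sqrt d \<le> M * sqrt d" using M1 by simp
    then have "dev z \<le> \<alpha>" using that Ma by linarith
    then have "d / 4 \<le> dot d z z" using \<alpha>d by (simp add: dev_def abs_le_iff; linarith)
    then have "sqrt (d / 4) \<le> sqrt (dot d z z)" by (rule real_sqrt_le_mono)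
    then show ?thesis by (simp add: real_sqrt_divide enorm_eq_sqrt)
  qed
  have p: "sqrt d / 2 \<le> p" "sqrt d / 2 \<le> q" "0 < p"
    using half[OF x(2)] half[OF y(2)] sq(1) unfolding p_def q_def by linarith+
  define y' where "y' = lin d (q / p) 0 x x"
  have y's: "y' \<in> space (Rd d)" by (simp add: y'_def)
  have y'n: "dot d y' y' = dot d y y"
    using p by (simp add: y'_def dot_lin_left dot_lin_right flip: pq) (simp add: power2_eq_square)
  obtain e where e: "good_dir e" "reflect d e y' = y"
    using reflection_swap[OF y's y(1) y'n] by blast
  have es: "e \<in> space (Rd d)" using e(1) by (simp add: good_dir_def)
  have dpq: "\<bar>p - q\<bar> \<le> M"
  proof -
    have "\<bar>p - q\<bar> * sqrt d \<le> \<bar>p - q\<bar> * (p + q)" using p pq by (intro mult_left_mono) auto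
    also have "\<dots> = \<bar>(p - q) * (p + q)\<bar>" using pq by (simp add: abs_mult)
    also have "(p - q) * (p + q) = dot d x x - dot d y y" by (simp add: algebra_simps flip: pq) (simp add: power2_eq_square)
    also have "\<bar>dot d x x - dot d y y\<bar> \<le> M / 2 * sqrt d + M / 2 * sqrt d"
      using x(2) y(2) unfolding dev_def by linarith
    also have "\<dots> = M * sqrt d" by simp
    finally show ?thesis using sq(1) by (rule mult_right_le_imp_le)
  qed
  define k where "k = q / p"
  have "dot d (lin d 1 (- 1) x y') (lin d 1 (- 1) x y') = (1 - k)\<^sup>2 * p\<^sup>2"
    unfolding pq y'_def k_def[symmetric] by (simp add: dot_lin_left dot_lin_right) (simp add: power2_eq_square algebra_simps)
  also have "\<dots> = (p - q)\<^sup>2" using p by (simp add: k_def field_simps flip: power_mult_distrib)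
  finally have Dn: "dot d (lin d 1 (- 1) x y') (lin d 1 (- 1) x y') = (p - q)\<^sup>2" .
  have D: "dot d (lin d 1 (- 1) x y') (lin d 1 (- 1) x y') \<le> M\<^sup>2"
    unfolding Dn using dpq by (metis abs_ge_zero power2_abs power_mono)
  have "M / 2 * sqrt d \<le> M * sqrt d" using M1 by simp
  then have xM: "\<bar>dot d x x - d\<bar> \<le> M * sqrt d" and yM: "\<bar>dot d y' y' - d\<bar> \<le> M * sqrt d"
    using x(2) y(2) unfolding y'n dev_def by linarith+
  have gr: "test_fn (\<lambda>z. g (reflect d e z))" by (rule tf_reflect[OF g es])
  have gr1: "0 \<le> g (reflect d e z) \<and> g (reflect d e z) \<le> 1" for z by (rule g1) simp
  have s: "g z \<le> g (reflect d e z) + (1 - c / 4)" if "z \<in> space (Rd d)" "\<bar>dot d z z - d\<bar> \<le> cW \<tau> M * sqrt d" for z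
  proof -
    have "dot d z z = dot d (reflect d e z) (reflect d e z)"
      using e(1) by (subst reflect_dot) (auto simp: good_dir_def)
    from spherical_contraction[OF f that(1) _ this] that(2) show ?thesis by (simp add: dev_def g_def)
  qed
  have "Pop d h kmax g x - Pop d h kmax (\<lambda>z. g (reflect d e z)) y' \<le> 1 - c * (1 - (1 - c / 4))"
    by (rule one_shot[OF M1 \<tau> th big hd hA esc x(1) xM y's yM D g g1 gr gr1 _ s]) (use c in auto)
  then show ?thesis using Pop_reflect[OF e(1) y's g] by (simp add: g_def e(2) power2_eq_square)
qed

text \<open>
  By \<open>align\<close>, the values of the operator after the last three phases differ by less
  than one, unless a point deviates from the sphere by more than a multiple of \<open>sqrt
  d\<close>. By \<open>lyapunov\<close> this is unlikely after \<open>n1\<close> steps from any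
  point in the region.
\<close>

lemma epoch:
  assumes f: "test_fn f" "\<And>x. x \<in> space (Rd d) \<Longrightarrow> 0 \<le> f x \<and> f x \<le> 1"
    and x: "x \<in> space (Rd d)" "dev x + real n1 * rad \<le> \<alpha>" and y: "y \<in> space (Rd d)" "dev y + real n1 * rad \<le> \<alpha>"
  shows "Pit n0 f x - Pit n0 f y \<le> 1 - c\<^sup>2 / 16"
proof -
  have sq: "0 < sqrt d" "sqrt d * sqrt d = real d" using d_pos by auto
  define F where "F = Pit (n1 + 2) f"
  define Q where "Q = M / 2 * sqrt d"
  define I where "I = (\<lambda>x. if Q < dev x then 1 else 0 :: real)"
  define b where "b = c\<^sup>2 / 4"
  have b: "0 \<le> b" by (simp add: b_def)
  have Fe: "F = Pop d h kmax (Pit n1 (Pop d h kmax f))" by (simp add: F_def funpow_swap1)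
  have F: "test_fn F" unfolding F_def by (rule tf_Pit[OF f(1)])
  have F1: "0 \<le> F z \<and> F z \<le> 1" if "z \<in> space (Rd d)" for z unfolding F_def by (rule Pit_range[OF f(1) that f(2)])
  have I: "test_fn I" unfolding I_def by (rule tf_dev_gt)
  have "1 * F z + (- b) * I z \<le> (1 - b) + (1 * F w + b * I w)" if "z \<in> space (Rd d)" "w \<in> space (Rd d)" for z w
  proof (cases "dev z \<le> Q \<and> dev w \<le> Q")
    case True
    then have "F z - F w \<le> 1 - b" unfolding Fe b_def Q_def by (intro align f that) auto
    then show ?thesis using True by (auto simp: I_def)
  next
    case False
    have "F z \<le> 1" "0 \<le> F w" using F1 that by auto
    then show ?thesis using False b by (auto simp: I_def)
  qed
  then obtain \<kappa> where k: "\<And>z. z \<in> space (Rd d) \<Longrightarrow> 1 * F z + (- b) * I z \<le> \<kappa>" "\<And>z. z \<in> space (Rd d) \<Longrightarrow> \<kappa> \<le> (1 - b) + (1 * F z + b * I z)"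
    using separating_constant[of "space (Rd d)" "\<lambda>z. 1 * F z + (- b) * I z" "\<lambda>z. (1 - b) + (1 * F z + b * I z)"] by blast
  have "Pit n1 (\<lambda>z. 1 * F z + (- b) * I z) x \<le> \<kappa>"
    using Pit_mono[OF tf_lin[OF F I] tf_const x(1) k(1)] x(1) by (simp add: Pit_const)
  then have u: "Pit n1 F x \<le> \<kappa> + b * Pit n1 I x" unfolding Pit_lin[OF F I x(1)] by simp
  have "\<kappa> - (1 - b) \<le> Pit n1 (\<lambda>z. 1 * F z + b * I z) y"
    using Pit_mono[OF tf_const tf_lin[OF F I] y(1), of "\<kappa> - (1 - b)" 1 b n1] k(2) y(1) by (simp add: Pit_const algebra_simps)
  then have l: "\<kappa> - (1 - b) \<le> Pit n1 F y + b * Pit n1 I y" unfolding Pit_lin[OF F I y(1)] by simp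
  have J: "Pit n1 I z \<le> 3/8" if z: "z \<in> space (Rd d)" "dev z + real n1 * rad \<le> \<alpha>" for z
  proof -
    have Q0: "0 < Q" using M1 sq by (simp add: Q_def)
    have rk: "0 \<le> \<rho> ^ n1" "\<rho> ^ n1 \<le> 1" using \<rho> by (auto simp: power_le_one)
    have dz: "dev z \<le> real d" using z(2) \<alpha>d rad0 mult_nonneg_nonneg[of "real n1" rad] dev_nonneg[of z] by linarith
    have "Pit n1 I z \<le> \<rho> ^ n1 * dev z / Q + (1 - \<rho> ^ n1) * (98 * sqrt d / (k1 * Q)) + real n1 * \<eta>"
      unfolding I_def by (rule lyapunov[OF Q0 z])
    also have "\<dots> \<le> 1/8 + 1/8 + 1/8"
    proof (intro add_mono)
      have "dev z / Q \<le> (sqrt d * sqrt d) / (1 / 2 * sqrt d)" unfolding Q_def sq(2)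
        using dz M1 sq(1) by (intro frac_le mult_right_mono) auto
      also have "\<dots> = 2 * sqrt d"
      proof -
        have "a * a / (1 / 2 * a) = 2 * a" if "0 < a" for a :: real using that by simp
        then show ?thesis using sq(1) .
      qed
      finally have "\<rho> ^ n1 * (dev z / Q) \<le> \<rho> ^ n1 * (2 * sqrt d)" using rk by (intro mult_left_mono) auto
      moreover have "\<rho> ^ n1 * (4 * sqrt d) \<le> \<rho> ^ n1 * (4 * sqrt d + cW \<tau> M)" using rk cW M1 by (intro mult_left_mono) auto
      moreover have "\<rho> ^ n1 * (2 * sqrt d) = \<rho> ^ n1 * (4 * sqrt d) / 2" by simp
      ultimately have "\<rho> ^ n1 * (dev z / Q) \<le> 1/8" using rn1 by linarith
      then show "\<rho> ^ n1 * dev z / Q \<le> 1/8" by simp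
      have "98 * sqrt d / (k1 * Q) = 196 / (k1 * M)" using sq(1) k1 M1 by (simp add: Q_def field_simps)
      then show "(1 - \<rho> ^ n1) * (98 * sqrt d / (k1 * Q)) \<le> 1/8" using rk by (simp add: Mk)
      show "real n1 * \<eta> \<le> 1/8" using n1\<eta> c by linarith
    qed
    finally show ?thesis by simp
  qed
  have "b * (Pit n1 I x + Pit n1 I y) \<le> b * (3/4)" using J[OF x] J[OF y] b by (intro mult_left_mono) auto
  then have "Pit n1 F x - Pit n1 F y \<le> 1 - b / 4" using u l by (simp add: distrib_left)
  then have "Pit n1 F x - Pit n1 F y \<le> 1 - c\<^sup>2 / 16" by (simp add: b_def)
  moreover have "Pit n0 f = Pit n1 F" unfolding F_def by (metis comp_apply funpow_add)
  ultimately show ?thesis by (simp only:)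
qed

text \<open>
  The oscillation of the iterates over the admissible region contracts by a fixed factor in each
  epoch. Outside of the region the iterates are only known to lie between zero and one; they are
  clamped to the range of values inside, and \<open>exit_bound\<close> charges the difference.
\<close>

lemma epochs:
  assumes f: "test_fn f" "\<And>x. x \<in> space (Rd d) \<Longrightarrow> 0 \<le> f x \<and> f x \<le> 1"
    and x: "x \<in> space (Rd d)" "dev x + real (e * n0) * rad \<le> \<alpha>" and y: "y \<in> space (Rd d)" "dev y + real (e * n0) * rad \<le> \<alpha>"
  shows "Pit (e * n0) f x - Pit (e * n0) f y \<le> (1 - c\<^sup>2 / 16) ^ e + 2 * real (e * n0) * \<eta>"
  using x y
proof (induction e arbitrary: x y)
  case 0
  then show ?case using f(2)[of x] f(2)[of y] by simp
next
  case (Suc e)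
  define s where "s = (1 - c\<^sup>2 / 16) ^ e + 2 * real (e * n0) * \<eta>"
  define F where "F = Pit (e * n0) f"
  define A where "A = \<alpha> - real (e * n0) * rad"
  define I where "I = (\<lambda>x. if A < dev x then 1 else 0 :: real)"
  have "c\<^sup>2 \<le> 1" using c by (simp add: power_le_one)
  then have cp: "0 < 1 - c\<^sup>2 / 16" by simp
  have s0: "0 < s" unfolding s_def using cp \<eta>0 by (intro add_pos_nonneg) auto
  have F: "test_fn F" unfolding F_def by (rule tf_Pit[OF f(1)])
  have F1: "0 \<le> F z \<and> F z \<le> 1" if "z \<in> space (Rd d)" for z unfolding F_def by (rule Pit_range[OF f(1) that f(2)])
  have I: "test_fn I" unfolding I_def by (rule tf_dev_gt)
  have "F z - s \<le> F w" if "z \<in> {z \<in> space (Rd d). dev z \<le> A}" "w \<in> {z \<in> space (Rd d). dev z \<le> A}" for z w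
    using Suc.IH[of z w] that by (auto simp: A_def F_def s_def)
  then obtain m' where m': "\<And>z. z \<in> {z \<in> space (Rd d). dev z \<le> A} \<Longrightarrow> F z - s \<le> m'" "\<And>z. z \<in> {z \<in> space (Rd d). dev z \<le> A} \<Longrightarrow> m' \<le> F z"
    using separating_constant[of "{z \<in> space (Rd d). dev z \<le> A}" "\<lambda>z. F z - s" F] by blast
  have m'1: "m' \<le> 1" "- s \<le> m'"
  proof -
    have "0 \<le> real n0 * rad" using rad0 by simp
    then have "x \<in> {z \<in> space (Rd d). dev z \<le> A}" using Suc.prems by (simp add: A_def algebra_simps; linarith)
    then show "m' \<le> 1" "- s \<le> m'" using m'[of x] F1[of x] by auto
  qed
  define g where "g = (\<lambda>z. max 0 (min 1 ((F z - m') / s)))"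
  have g1: "0 \<le> g z \<and> g z \<le> 1" for z by (simp add: g_def)
  have [measurable]: "F \<in> borel_measurable (Rd d)" using F by (simp add: test_fn_def)
  have "g \<in> borel_measurable (Rd d)" unfolding g_def by measurable
  then have g: "test_fn g" unfolding test_fn_def using g1 by (intro conjI exI[of _ 1]) auto
  have gs: "m' + s * g z = max m' (min (m' + s) (F z))" for z
    using s0 by (auto simp: g_def max_def min_def field_simps)
  have cl: "F z \<le> m' + s * g z + I z" "m' + s * g z \<le> F z + I z" if "z \<in> space (Rd d)" for z
    using m'[of z] m'1 F1[OF that] that s0 unfolding gs I_def by (auto simp: max_def min_def)
  have room2: "dev z + real n0 * rad \<le> A" if "dev z + real (Suc e * n0) * rad \<le> \<alpha>" for z
    using that by (simp add: A_def algebra_simps)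
  have ex: "Pit n0 I z \<le> real n0 * \<eta>" if "z \<in> space (Rd d)" "dev z + real (Suc e * n0) * rad \<le> \<alpha>" for z
    unfolding I_def using rad0 by (intro exit_bound that(1) room2[OF that(2)]) (simp add: A_def)
  have P1: "Pit n0 (\<lambda>z. s * g z + 1 * I z) z = s * Pit n0 g z + Pit n0 I z" if "z \<in> space (Rd d)" for z
    unfolding Pit_lin[OF g I that] by simp
  have "Pit n0 (\<lambda>z. 1 * F z + (- m') * 1) x \<le> Pit n0 (\<lambda>z. s * g z + 1 * I z) x"
    using cl(1) by (intro Pit_mono tf_lin F g I tf_const Suc.prems) (simp add: algebra_simps)
  then have "Pit n0 F x - m' \<le> s * Pit n0 g x + Pit n0 I x"
    unfolding P1[OF Suc.prems(1)] Pit_lin[OF F tf_const Suc.prems(1)] Pit_const[OF Suc.prems(1)] by simp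
  moreover have "Pit n0 (\<lambda>z. s * g z + (- 1) * I z) y \<le> Pit n0 (\<lambda>z. 1 * F z + (- m') * 1) y"
    using cl(2) by (intro Pit_mono tf_lin F g I tf_const Suc.prems) (simp add: algebra_simps)
  then have "s * Pit n0 g y - Pit n0 I y \<le> Pit n0 F y - m'"
    unfolding Pit_lin[OF g I Suc.prems(3)] Pit_lin[OF F tf_const Suc.prems(3)] Pit_const[OF Suc.prems(3)] by simp
  moreover have "Pit n0 g x - Pit n0 g y \<le> 1 - c\<^sup>2 / 16"
  proof (rule epoch[OF g g1 Suc.prems(1) _ Suc.prems(3)])
    have "real n1 * rad \<le> real (Suc e * n0) * rad" using rad0 by (intro mult_right_mono) auto
    then show "dev x + real n1 * rad \<le> \<alpha>" "dev y + real n1 * rad \<le> \<alpha>" using Suc.prems by linarith+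
  qed
  then have "s * (Pit n0 g x - Pit n0 g y) \<le> s * (1 - c\<^sup>2 / 16)" using s0 by (intro mult_left_mono) auto
  ultimately have "Pit n0 F x - Pit n0 F y \<le> s * (1 - c\<^sup>2 / 16) + 2 * (real n0 * \<eta>)"
    using ex[OF Suc.prems(1,2)] ex[OF Suc.prems(3,4)] by (simp add: right_diff_distrib; linarith)
  also have "\<dots> \<le> (1 - c\<^sup>2 / 16) ^ Suc e + 2 * real (Suc e * n0) * \<eta>"
  proof -
    have "2 * real (e * n0) * \<eta> * (1 - c\<^sup>2 / 16) \<le> 2 * real (e * n0) * \<eta> * 1"
      using \<eta>0 cp by (intro mult_left_mono) auto
    then show ?thesis by (simp add: s_def algebra_simps)
  qed
  finally have "Pit n0 F x - Pit n0 F y \<le> (1 - c\<^sup>2 / 16) ^ Suc e + 2 * real (Suc e * n0) * \<eta>" .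
  moreover have "Pit (Suc e * n0) f = Pit n0 F"
    unfolding F_def by (metis comp_apply funpow_add mult_Suc)
  ultimately show ?case by (simp only:)
qed

end

section \<open>From test functions to total variation\<close>

context nuts_epoch begin

text \<open>
  Invariance turns the Gaussian measure of \<open>A\<close> into the integral of the iterated
  indicator function. Its values at points of the shell agree up to the bound of
  \<open>epochs\<close>, for the initial law as well as for the Gaussian measure.
\<close>

lemma TV_nuts_law:
  assumes \<nu>: "prob_space \<nu>" "sets \<nu> = sets (Rd d)"
    and e: "\<alpha>0 + real (e * n0) * rad \<le> \<alpha>"
    and out: "measure \<nu> (space (Rd d) - shell d \<alpha>0) \<le> p" "measure (gauss d) (space (Rd d) - shell d \<alpha>0) \<le> p"
  shows "TV (nuts_law d h kmax \<nu> (e * n0)) (gauss d) \<le> (1 - c\<^sup>2 / 16) ^ e + 2 * real (e * n0) * \<eta> + 2 * p"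
proof -
  define N where "N = e * n0"
  define s where "s = (1 - c\<^sup>2 / 16) ^ e + 2 * real N * \<eta>"
  let ?L = "nuts_law d h kmax \<nu> N"
  have "c\<^sup>2 \<le> 1" using c by (simp add: power_le_one)
  then have s0: "0 \<le> s" unfolding s_def using \<eta>0 by (intro add_nonneg_nonneg) auto
  note sL = sets_nuts_law[OF \<nu>(2), of N] and pL = prob_space_nuts_law[OF \<nu>(2,1), of N]
  interpret V: prob_space \<nu> by (rule \<nu>)
  interpret G: prob_space "gauss d" by (rule prob_space_gauss)
  have "measure ?L A - measure (gauss d) A \<le> s + 2 * p" if A: "A \<in> sets (Rd d)" for A
  proof -
    define f where "f = (indicator A :: _ \<Rightarrow> real)"
    define F where "F = Pit N f"
    define I where "I = (\<lambda>x. if \<alpha>0 < dev x then 1 else 0 :: real)"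
    have f: "test_fn f" unfolding test_fn_def f_def using A by (intro conjI exI[of _ 1]) auto
    have f1: "0 \<le> f z \<and> f z \<le> 1" for z by (simp add: f_def indicator_def)
    have F: "test_fn F" unfolding F_def by (rule tf_Pit[OF f])
    have F1: "0 \<le> F z \<and> F z \<le> 1" if "z \<in> space (Rd d)" for z unfolding F_def by (rule Pit_range[OF f that f1])
    have I: "test_fn I" unfolding I_def by (rule tf_dev_gt)
    have "F x - I x \<le> F y + s + I y" if "x \<in> space (Rd d)" "y \<in> space (Rd d)" for x y
    proof (cases "dev x \<le> \<alpha>0 \<and> dev y \<le> \<alpha>0")
      case True
      then have "F x - F y \<le> s" unfolding F_def s_def N_def using e that by (intro epochs f f1) auto
      then show ?thesis using True by (simp add: I_def)
    next
      case False
      then show ?thesis using F1[OF that(1)] F1[OF that(2)] s0 by (auto simp: I_def)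
    qed
    then obtain \<kappa> where k: "\<And>x. x \<in> space (Rd d) \<Longrightarrow> F x - I x \<le> \<kappa>" "\<And>x. x \<in> space (Rd d) \<Longrightarrow> \<kappa> \<le> F x + s + I x"
      using separating_constant[of "space (Rd d)" "\<lambda>x. F x - I x" "\<lambda>x. F x + s + I x"] by blast
    have int: "integrable Q g" if tg: "test_fn g" and pQ: "prob_space Q" and sQ: "sets Q = sets (Rd d)" for Q and g :: "_ \<Rightarrow> real"
    proof -
      interpret Q: prob_space Q by (rule pQ)
      obtain B where B: "\<And>x. x \<in> space (Rd d) \<Longrightarrow> \<bar>g x\<bar> \<le> B" using tg unfolding test_fn_def by blast
      have "g \<in> borel_measurable Q" using tg measurable_cong_sets[OF sQ refl] by (auto simp: test_fn_def)
      then show ?thesis using B sets_eq_imp_space_eq[OF sQ] by (intro Q.integrable_const_bound[of _ B]) auto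
    qed
    have I_out: "(\<integral>x. I x \<partial>Q) \<le> p" if "prob_space Q" "sets Q = sets (Rd d)" "measure Q (space (Rd d) - shell d \<alpha>0) \<le> p" for Q
    proof -
      have "(\<integral>x. I x \<partial>Q) = (\<integral>x. indicator (space (Rd d) - shell d \<alpha>0) x \<partial>Q)"
        using sets_eq_imp_space_eq[OF that(2)]
        by (intro Bochner_Integration.integral_cong) (auto simp: I_def shell_def dev_def enorm_sq)
      also have "\<dots> = measure Q (space (Rd d) - shell d \<alpha>0)"
        using sets_eq_imp_space_eq[OF that(2)] by (simp add: Int_absorb2 Diff_subset)
      finally show ?thesis using that(3) by simp
    qed
    have sp: "space \<nu> = space (Rd d)" by (rule sets_eq_imp_space_eq[OF \<nu>(2)])
    have "(\<integral>x. F x \<partial>\<nu>) \<le> (\<integral>x. \<kappa> + I x \<partial>\<nu>)"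
      using k(1) sp by (intro integral_mono int[OF F \<nu>] Bochner_Integration.integrable_add int[OF I \<nu>]) (auto simp: diff_le_eq)
    also have "\<dots> = \<kappa> + (\<integral>x. I x \<partial>\<nu>)" using int[OF I \<nu>] by (simp add: V.prob_space)
    finally have u: "(\<integral>x. F x \<partial>\<nu>) \<le> \<kappa> + p" using I_out[OF \<nu> out(1)] by simp
    have sg: "sets (gauss d) = sets (Rd d)" by simp
    note gI = int[OF I prob_space_gauss sg] and gF = int[OF F prob_space_gauss sg]
    have "(\<integral>x. \<kappa> \<partial>gauss d) \<le> (\<integral>x. (F x + s) + I x \<partial>gauss d)"
      using k(2) by (intro integral_mono Bochner_Integration.integrable_add gF gI) auto
    also have "\<dots> = (\<integral>x. F x + s \<partial>gauss d) + (\<integral>x. I x \<partial>gauss d)"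
      by (intro Bochner_Integration.integral_add Bochner_Integration.integrable_add gF gI) auto
    also have "(\<integral>x. F x + s \<partial>gauss d) = (\<integral>x. F x \<partial>gauss d) + s" using gF G.prob_space by simp
    finally have l: "\<kappa> \<le> (\<integral>x. F x \<partial>gauss d) + s + p" using I_out[OF prob_space_gauss sg out(2)] G.prob_space by simp
    have fA: "(\<integral>\<^sup>+x. ennreal (f x) \<partial>Q) = emeasure Q A" if "sets Q = sets (Rd d)" for Q
      using A that by (simp add: f_def ennreal_indicator)
    have "emeasure ?L A = (\<integral>\<^sup>+x. ennreal (F x) \<partial>\<nu>)"
      unfolding fA[OF sL, symmetric] F_def by (rule nn_integral_nuts_law[OF \<nu>(2) f]) (use f1 in auto)
    also have "\<dots> = ennreal (\<integral>x. F x \<partial>\<nu>)" using F1 sp by (intro nn_integral_eq_integral int[OF F \<nu>] AE_I2) auto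
    finally have 1: "measure ?L A = (\<integral>x. F x \<partial>\<nu>)"
      using Bochner_Integration.integral_nonneg[of \<nu> F] F1 sp by (simp add: measure_def)
    have "emeasure (gauss d) A = (\<integral>\<^sup>+x. ennreal (F x) \<partial>gauss d)"
      unfolding fA[OF sg, symmetric] F_def by (rule gauss_invariant_Pit[OF f, symmetric]) (use f1 in auto)
    also have "\<dots> = ennreal (\<integral>x. F x \<partial>gauss d)" using F1 by (intro nn_integral_eq_integral gF AE_I2) auto
    finally have 2: "measure (gauss d) A = (\<integral>x. F x \<partial>gauss d)"
      using Bochner_Integration.integral_nonneg[of "gauss d" F] F1 by (simp add: measure_def)
    show ?thesis using 1 2 u l by linarith
  qed
  then have "TV ?L (gauss d) \<le> s + 2 * p"
    by (intro TV_le pL prob_space_gauss diag_Rd[OF sL]) (auto simp: sL)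
  then show ?thesis by (simp add: s_def N_def)
qed

end

section \<open>Choice of the parameters\<close>

text \<open>
  In the order of the definitions: the number of steps in units of \<open>ln d * ln (1 /
  \<epsilon>)\<close>; the factor in \<open>t\<^sup>2\<close>; the room for the deviation over
  the whole run in units of \<open>sqrt d * ln d * ln (1 / \<epsilon>) powr (3/2) * Lam d
  \<epsilon>\<close>; and the final constant, which dominates everything that is required of
  \<open>d\<close>, \<open>h\<close> and the gap.
\<close>

definition cN :: "real \<Rightarrow> real" where "cN \<tau> = 3600 / (kap \<tau> * (shot \<tau> (cM \<tau>))\<^sup>2)"
definition cT :: "real \<Rightarrow> real" where "cT \<tau> = ln (32 * cN \<tau> / shot \<tau> (cM \<tau>)) + 3"
definition cR :: "real \<Rightarrow> real" where "cR \<tau> = (4 * cW \<tau> (cM \<tau>) + 8 + 7 * cN \<tau>) * sqrt (16 * cT \<tau>)"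
definition cMix :: "real \<Rightarrow> real" where
  "cMix \<tau> = 500 + cN \<tau> + 480 * cA \<tau> (cM \<tau>) + 16000 * (cG \<tau> (cM \<tau>))\<^sup>2 * (cM \<tau>)\<^sup>2 + 16 * cW \<tau> (cM \<tau>) + 48 * cR \<tau>"

lemma cM_ge: "0 < \<tau> \<Longrightarrow> 1 \<le> cM \<tau>"
  using kap_pos[of \<tau>] kap_le[of \<tau>] by (simp add: cM_def)

lemma const_signs:
  assumes "0 < \<tau>"
  shows "0 < shot \<tau> (cM \<tau>)" "shot \<tau> (cM \<tau>) \<le> 1" "3600 \<le> cN \<tau>" "3 \<le> cT \<tau>" "1 \<le> cW \<tau> (cM \<tau>)" "1 \<le> cA \<tau> (cM \<tau>)" "0 \<le> cR \<tau>"
    "1 \<le> cC \<tau> (cM \<tau>)" "cC \<tau> (cM \<tau>) \<le> cA \<tau> (cM \<tau>)"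
proof -
  note b = const_bounds[OF assms cM_ge[OF assms]] and k = kap_pos[OF assms] kap_le[of \<tau>]
  show s: "0 < shot \<tau> (cM \<tau>)" "shot \<tau> (cM \<tau>) \<le> 1" using b by auto
  have "(shot \<tau> (cM \<tau>))\<^sup>2 \<le> 1" using s by (simp add: power_le_one)
  then have "kap \<tau> * (shot \<tau> (cM \<tau>))\<^sup>2 \<le> 1 * 1" using k by (intro mult_mono) auto
  then show N: "3600 \<le> cN \<tau>" unfolding cN_def using k s by (simp add: le_divide_eq)
  have "1 \<le> 32 * cN \<tau> / shot \<tau> (cM \<tau>)" using N s by (simp add: le_divide_eq)
  then show T: "3 \<le> cT \<tau>" by (simp add: cT_def)
  show "1 \<le> cC \<tau> (cM \<tau>)" "1 \<le> cA \<tau> (cM \<tau>)" "cC \<tau> (cM \<tau>) \<le> cA \<tau> (cM \<tau>)" using b by (auto simp: cA_def)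
  then show W: "1 \<le> cW \<tau> (cM \<tau>)" using cM_ge[OF assms] by (simp add: cW_def)
  show "0 \<le> cR \<tau>" unfolding cR_def using W N T by (intro mult_nonneg_nonneg) auto
qed

lemma one_minus_power_le:
  fixes x :: real
  assumes "0 \<le> x" "x \<le> 1" shows "(1 - x) ^ n \<le> exp (- (x * real n))"
proof -
  have "(1 - x) ^ n \<le> exp (- x) ^ n" using assms exp_ge_add_one_self[of "- x"] by (intro power_mono) auto
  then show ?thesis by (simp add: exp_of_nat_mult[symmetric] mult.commute)
qed

text \<open>
  An epoch has to overcome a factor of order \<open>sqrt d\<close>, which takes \<open>O (ln
  d)\<close> steps, and \<open>O (ln (1 / \<epsilon>))\<close> epochs reduce the oscillation to
  \<open>\<epsilon> / 4\<close>.
\<close>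

lemma step_counts:
  fixes d :: nat and \<epsilon> \<tau> :: real
  assumes \<tau>: "0 < \<tau>" and d: "d \<ge> 2" and \<epsilon>: "0 < \<epsilon>" "\<epsilon> \<le> 1/2" and W: "cW \<tau> (cM \<tau>) \<le> sqrt d"
    and l: "1/2 \<le> ln (real d)" and E: "1/2 \<le> ln (1 / \<epsilon>)"
  obtains n1 e :: nat where "(1 - kap \<tau> / 6) ^ n1 * (4 * sqrt d + cW \<tau> (cM \<tau>)) \<le> 1/4"
    "(1 - (shot \<tau> (cM \<tau>))\<^sup>2 / 16) ^ e \<le> \<epsilon> / 4" "n1 \<le> e * (n1 + (n1 + 2))"
    "real (e * (n1 + (n1 + 2))) \<le> cN \<tau> * (ln (real d) * ln (1 / \<epsilon>))"
proof -
  define k c l E where "k = kap \<tau>" and "c = shot \<tau> (cM \<tau>)" and "l = ln (real d)" and "E = ln (1 / \<epsilon>)"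
  have k: "0 < k" "k \<le> 1/4" using kap_pos[OF \<tau>] kap_le[of \<tau>] by (simp_all add: k_def)
  have c: "0 < c" "c \<le> 1" using const_signs[OF \<tau>] by (simp_all add: c_def)
  have l: "1/2 \<le> l" "1/2 \<le> E" using l E by (simp_all add: l_def E_def)
  have c2: "0 < c\<^sup>2" "c\<^sup>2 \<le> 1" using c by (auto simp: power_le_one)
  define n1 where "n1 = nat \<lceil>33 * l / k\<rceil>"
  define e where "e = nat \<lceil>48 * E / c\<^sup>2\<rceil>"
  have p0: "0 < 33 * l / k" "0 < 48 * E / c\<^sup>2" using k c2 l by auto
  have n1: "33 * l / k \<le> real n1" "real n1 \<le> 33 * l / k + 1"
    using p0(1) unfolding n1_def by linarith+
  have e: "48 * E / c\<^sup>2 \<le> real e" "real e \<le> 48 * E / c\<^sup>2 + 1"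
    using p0(2) unfolding e_def by linarith+
  have "0 < real e" using e(1) p0(2) by linarith
  then have e1: "1 \<le> e" by linarith
  have sq: "0 < sqrt d" using d by simp
  have "(1 - k / 6) ^ n1 \<le> exp (- (k / 6 * real n1))" using k by (intro one_minus_power_le) auto
  also have "\<dots> \<le> exp (- (5 * l + l / 2))"
  proof -
    have "k / 6 * (33 * l / k) \<le> k / 6 * real n1" using n1(1) k by (intro mult_left_mono) auto
    then show ?thesis using k by simp
  qed
  also have "\<dots> = exp (- (5 * l)) * exp (- (l / 2))" by (simp flip: exp_add)
  also have "exp (- (l / 2)) = 1 / sqrt d"
  proof -
    have "exp (l / 2) = sqrt d" using d by (simp add: l_def ln_sqrt[symmetric] flip: ln_sqrt)
    then show ?thesis by (simp add: exp_minus inverse_eq_divide)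
  qed
  also have "exp (- (5 * l)) \<le> 1 / 32"
  proof -
    have "exp (5 * l) = real d ^ 5" using d by (simp add: l_def exp_of_nat_mult[of 5, simplified])
    also have "\<dots> \<ge> 2 ^ 5" using d by (intro power_mono) auto
    finally have "32 \<le> exp (5 * l)" by simp
    then show ?thesis by (simp add: exp_minus field_simps)
  qed
  finally have q: "(1 - k / 6) ^ n1 \<le> 1 / 32 * (1 / sqrt d)" using sq by (simp add: mult_right_mono divide_right_mono)
  have "(1 - k / 6) ^ n1 * (4 * sqrt d + cW \<tau> (cM \<tau>)) \<le> 1 / 32 * (1 / sqrt d) * (5 * sqrt d)"
    using q W sq k const_signs(5)[OF \<tau>] by (intro mult_mono) auto
  then have 1: "(1 - k / 6) ^ n1 * (4 * sqrt d + cW \<tau> (cM \<tau>)) \<le> 1 / 4" using sq by simp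
  have "(1 - c\<^sup>2 / 16) ^ e \<le> exp (- (c\<^sup>2 / 16 * real e))" using c2 by (intro one_minus_power_le) auto
  also have "\<dots> \<le> exp (- (3 * E))"
  proof -
    have "c\<^sup>2 / 16 * (48 * E / c\<^sup>2) \<le> c\<^sup>2 / 16 * real e" using e(1) c2 by (intro mult_left_mono) auto
    then show ?thesis using c2 by simp
  qed
  also have "\<dots> = \<epsilon> ^ 3" using \<epsilon> by (simp add: E_def ln_div exp_of_nat_mult[of 3, simplified])
  also have "\<dots> = \<epsilon> * (\<epsilon> * \<epsilon>)" by (simp add: power3_eq_cube)
  also have "\<dots> \<le> \<epsilon> * (1/2 * (1/2))" using \<epsilon> by (intro mult_left_mono mult_mono) auto
  finally have 2: "(1 - c\<^sup>2 / 16) ^ e \<le> \<epsilon> / 4" by simp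
  have 3: "n1 \<le> e * (n1 + (n1 + 2))" using e1 by (metis le_add1 mult_le_mono1 nat_mult_1 order_trans)
  have "real (n1 + (n1 + 2)) \<le> 72 * l / k"
  proof -
    have "1 / k \<ge> 4" using k by (simp add: le_divide_eq)
    then have "4 \<le> 8 * (l * (1 / k)) - 4 " using mult_mono[OF l(1), of 4 "1 / k"] l by simp
    then show ?thesis using n1(2) by simp
  qed
  moreover have "real e \<le> 50 * E / c\<^sup>2"
  proof -
    have "1 \<le> 1 / c\<^sup>2" using c2 by (simp add: le_divide_eq)
    then have "1/2 * 1 \<le> E * (1 / c\<^sup>2)" using l by (intro mult_mono) auto
    moreover have "50 * E / c\<^sup>2 = 48 * E / c\<^sup>2 + 2 * (E * (1 / c\<^sup>2))" by (simp add: field_simps)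
    ultimately show ?thesis using e(2) by linarith
  qed
  ultimately have "real e * real (n1 + (n1 + 2)) \<le> (50 * E / c\<^sup>2) * (72 * l / k)"
    using l k c2 by (intro mult_mono) auto
  also have "\<dots> = cN \<tau> * (l * E)" by (simp add: cN_def mult_ac flip: k_def c_def)
  finally have 4: "real (e * (n1 + (n1 + 2))) \<le> cN \<tau> * (l * E)" unfolding of_nat_mult .
  show ?thesis using that[of n1 e] 1 2 3 4 by (simp add: k_def c_def l_def E_def)
qed

text \<open>
  The two bounds on the step size in polynomial form. The quantity \<open>ln d * ln (1 /
  \<epsilon>) powr (3/2)\<close> is also the one that occurs in the gap.
\<close>

lemma step_bound_squares:
  assumes h: "0 < h" "h \<le> step_bound c1 d \<epsilon> \<alpha>0" and c1: "0 \<le> c1" and \<alpha>0: "0 < \<alpha>0" and d: "1 < real d" and \<epsilon>: "0 < \<epsilon>" "\<epsilon> < 1"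
  shows "h\<^sup>2 * \<alpha>0 * ln (real d) \<le> c1\<^sup>2"
    "h\<^sup>2 * sqrt d * ln (real d) * (ln (real d) * ln (1 / \<epsilon>) powr (3/2)) \<le> c1\<^sup>2"
proof -
  define l E where "l = ln (real d)" and "E = ln (1 / \<epsilon>)"
  have l: "0 < l" using d by (simp add: l_def)
  have E: "0 < E" using \<epsilon> by (simp add: E_def)
  have d0: "0 < real d" using d by simp
  have sq: "(x powr a)\<^sup>2 = x powr (2 * a)" if "0 < x" for x a :: real
    using that by (simp add: power2_eq_square flip: powr_add)
  have m: "h \<le> c1 * a * l powr (-1/2)" if "a \<in> {\<alpha>0 powr (-1/2), real d powr (-1/4) * l powr (-1/2) * E powr (-3/4)}" for a
  proof -
    have "h \<le> c1 * min (\<alpha>0 powr (-1/2)) (real d powr (-1/4) * l powr (-1/2) * E powr (-3/4)) * l powr (-1/2)"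
      using h(2) by (simp add: step_bound_def l_def E_def)
    also have "\<dots> \<le> c1 * a * l powr (-1/2)"
      using that c1 by (intro mult_right_mono mult_left_mono) auto
    finally show ?thesis .
  qed
  have "h\<^sup>2 \<le> (c1 * \<alpha>0 powr (-1/2) * l powr (-1/2))\<^sup>2" using m h(1) by (intro power_mono) auto
  also have "\<dots> = c1\<^sup>2 / (\<alpha>0 * l)"
    unfolding power_mult_distrib sq[OF \<alpha>0] sq[OF l] using \<alpha>0 l by (simp add: powr_minus_divide)
  finally show "h\<^sup>2 * \<alpha>0 * ln (real d) \<le> c1\<^sup>2" using \<alpha>0 l by (simp add: l_def le_divide_eq mult.assoc)
  have "h\<^sup>2 \<le> (c1 * (real d powr (-1/4) * l powr (-1/2) * E powr (-3/4)) * l powr (-1/2))\<^sup>2" using m h(1) by (intro power_mono) auto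
  also have "\<dots> = c1\<^sup>2 * (real d powr (- (1/2)) * l powr (- 1) * E powr (- (3/2))) * l powr (- 1)"
    unfolding power_mult_distrib sq[OF l] sq[OF E] sq[OF d0] by simp
  also have "\<dots> = c1\<^sup>2 / (sqrt d * l * (l * E powr (3/2)))"
    using d l E by (simp add: powr_minus_divide powr_half_sqrt)
  finally show "h\<^sup>2 * sqrt d * ln (real d) * (ln (real d) * ln (1 / \<epsilon>) powr (3/2)) \<le> c1\<^sup>2"
    using d l E by (simp add: l_def[symmetric] E_def[symmetric] le_divide_eq mult.assoc)
qed

lemma Lam_bounds:
  fixes d :: nat
  assumes "2 \<le> d" "0 < \<epsilon>" "\<epsilon> \<le> 1/2"
  shows "1/2 \<le> ln (real d)" "1/2 \<le> ln (1 / \<epsilon>)" "2 \<le> Lam d \<epsilon>" "ln (ln (real d)) + ln (ln (1 / \<epsilon>)) \<le> Lam d \<epsilon>"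
proof -
  have "ln 2 \<le> ln (real d)" "ln 2 \<le> ln (1 / \<epsilon>)" using assms by (simp_all add: le_divide_eq)
  then show l: "1/2 \<le> ln (real d)" "1/2 \<le> ln (1 / \<epsilon>)" using ln2_ge_two_thirds by linarith+
  have lp: "logp (logp x) = logp (ln x)" if "1 \<le> x" for x using that by (simp add: logp_def)
  have p: "0 \<le> logp x" "0 < x \<Longrightarrow> ln x \<le> logp x" for x by (simp_all add: logp_def)
  have e: "Lam d \<epsilon> = 2 + logp (ln (real d)) + logp (ln (1 / \<epsilon>))"
    using assms unfolding Lam_def by (subst (1 2) lp) (auto simp: le_divide_eq)
  show "2 \<le> Lam d \<epsilon>" unfolding e using p(1)[of "ln (real d)"] p(1)[of "ln (1 / \<epsilon>)"] by linarith
  show "ln (ln (real d)) + ln (ln (1 / \<epsilon>)) \<le> Lam d \<epsilon>"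
    unfolding e using p(2)[of "ln (real d)"] p(2)[of "ln (1 / \<epsilon>)"] l by linarith
qed

lemma powr_three_halves: "0 \<le> (x :: real) \<Longrightarrow> x powr (3/2) = x * sqrt x"
  using powr_add[of x 1 "1/2"] by (cases "x = 0") (auto simp: powr_half_sqrt)

text \<open>
  The chain runs for \<open>N\<close> steps, each of which moves the deviation by at most
  \<open>7 * t * sqrt d\<close>. As \<open>t\<close> is of order \<open>sqrt (L * ln (1 /
  \<epsilon>))\<close>, the total is \<open>sqrt d\<close> times the quantity that the step size
  condition and the gap control. This explains the exponent of \<open>ln (1 /
  \<epsilon>)\<close> there.
\<close>

lemma room_bound:
  fixes l E L t N \<tau> :: real
  assumes \<tau>: "0 < \<tau>" and l: "1/2 \<le> l" and E: "1/2 \<le> E" and L: "2 \<le> L" and t: "t = sqrt (16 * cT \<tau> * L * E)"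
    and N: "N \<le> cN \<tau> * (l * E)"
  shows "1 \<le> t" "cW \<tau> (cM \<tau>) + 2 * t + 7 * N * t \<le> cR \<tau> * (l * E powr (3/2)) * L"
proof -
  define W where "W = cW \<tau> (cM \<tau>)"
  note cs = const_signs[OF \<tau>]
  have W: "1 \<le> W" using cs by (simp add: W_def)
  have "16 * 3 * 2 * (1/2) \<le> 16 * cT \<tau> * L * E" using cs L E by (intro mult_mono) auto
  then have "1 \<le> 16 * cT \<tau> * L * E" by linarith
  then show t1: "1 \<le> t" by (simp add: t)
  have lE: "1/2 * (1/2) \<le> l * E" using l E by (intro mult_mono) auto
  have te: "t = sqrt (16 * cT \<tau>) * sqrt L * sqrt E" unfolding t by (simp add: real_sqrt_mult)
  have sL: "sqrt L \<le> L" using L by (simp add: real_le_lsqrt sqrt_le_D real_sqrt_le_iff power2_eq_square)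
  have "W + 2 * t + 7 * N * t \<le> (W + 2 + 7 * N) * t" using W t1 by (simp add: algebra_simps)
  also have "\<dots> \<le> ((4 * W + 8 + 7 * cN \<tau>) * (l * E)) * t"
  proof (rule mult_right_mono)
    have "W * 1 \<le> W * (4 * (l * E))" using lE W by (intro mult_left_mono) auto
    then show "W + 2 + 7 * N \<le> (4 * W + 8 + 7 * cN \<tau>) * (l * E)" using lE N by (simp add: distrib_right)
  qed (use t1 in simp)
  also have "\<dots> = cR \<tau> * (l * (E * sqrt E)) * sqrt L" by (simp add: te cR_def W_def)
  also have "\<dots> \<le> cR \<tau> * (l * (E * sqrt E)) * L" using cs l E sL by (intro mult_left_mono) auto
  finally show "cW \<tau> (cM \<tau>) + 2 * t + 7 * N * t \<le> cR \<tau> * (l * E powr (3/2)) * L"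
    using E by (simp add: powr_three_halves W_def)
qed

text \<open>
  The number of steps is of order \<open>l * E\<close>, so the failure probability per step has
  to be \<open>\<epsilon> / (l * E)\<close>. Its logarithm contains \<open>ln l\<close> and
  \<open>ln E\<close>, which is where the iterated logarithms in \<open>Lam\<close> come from.
\<close>

lemma tail_small:
  fixes l L \<epsilon> \<tau> :: real
  defines "E \<equiv> ln (1 / \<epsilon>)"
  assumes \<tau>: "0 < \<tau>" and \<epsilon>: "0 < \<epsilon>" and l: "1/2 \<le> l" and E: "1/2 \<le> E" and L: "2 \<le> L" "ln l + ln E \<le> L"
  shows "4 * exp (- (cT \<tau> * L * E)) \<le> \<epsilon> * shot \<tau> (cM \<tau>) / (8 * cN \<tau> * (l * E))"
proof -
  define c N b where "c = shot \<tau> (cM \<tau>)" and "N = cN \<tau>" and "b = ln (32 * N / c)"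
  note cs = const_signs[OF \<tau>]
  have c: "0 < c" "0 < N" using cs by (auto simp: c_def N_def)
  have b: "cT \<tau> = b + 3" "0 \<le> b" using cs by (simp_all add: cT_def b_def N_def c_def)
  have LE: "2 * (1/2) \<le> L * E" using L E by (intro mult_mono) auto
  have "b * 1 \<le> b * (L * E)" using b LE by (intro mult_left_mono) auto
  moreover have "L * (1/2) \<le> L * E" "2 * E \<le> L * E" using L E by (auto intro: mult_left_mono mult_right_mono)
  moreover have "cT \<tau> * L * E = b * (L * E) + 3 * (L * E)" unfolding b(1) by (simp add: algebra_simps)
  ultimately have "b + ln l + ln E + E \<le> cT \<tau> * L * E" using L E by linarith
  then have "exp (b + ln l + ln E + E) \<le> exp (cT \<tau> * L * E)" by simp
  moreover have "exp (b + ln l + ln E + E) = 32 * N / c * l * E * (1 / \<epsilon>)"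
  proof -
    have "exp E = 1 / \<epsilon>" using \<epsilon> by (simp add: E_def)
    then show ?thesis using c l E by (simp add: exp_add b_def)
  qed
  ultimately have "1 / exp (cT \<tau> * L * E) \<le> 1 / (32 * N / c * l * E * (1 / \<epsilon>))"
    using c l E \<epsilon> by (intro divide_left_mono) auto
  then show ?thesis using c l E \<epsilon> by (simp add: exp_minus inverse_eq_divide N_def c_def mult_ac)
qed

text \<open>
  The gap hypothesis is about \<open>h * (2 ^ n - 1)\<close>, but the arcs are multiples of
  \<open>theta h\<close>, which differs from \<open>h\<close> by at most \<open>h ^ 3\<close>.
  The arcs near \<open>pi\<close> therefore move by \<open>O (h\<^sup>2)\<close>, which is small
  compared to \<open>\<delta>\<close>. The cases \<open>n = 0\<close> and \<open>n = 1\<close>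
  of the hypothesis give \<open>\<delta> \<le> pi\<close> and \<open>\<delta> \<le> h\<close>.
\<close>

lemma escape_window:
  fixes d kmax :: nat and h \<delta> c w :: real
  assumes h: "0 < h" "h \<le> 1/20" and \<delta>: "0 < \<delta>" "16 * h\<^sup>2 \<le> \<delta>"
    and w: "0 < c" "c \<le> w" "20 * w \<le> \<delta>" "8 * h ^ 3 \<le> c"
    and window: "{h * (2 ^ n - 1) | n :: nat. True} \<inter> ({0<..<\<delta>} \<union> {pi - \<delta><..pi + \<delta>}) = {}"
  shows "\<exists>J\<le>kmax. (J = kmax \<or> (2 ^ J - 1) * theta h > pi / 2) \<and>
     ((\<forall>i<J. quiet c ((2 ^ i - 1) * theta h)) \<and> (J = kmax \<or> turns c ((2 ^ J - 1) * theta h)) \<or>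
      (\<forall>i<J. quiet w ((2 ^ i - 1) * theta h)) \<and> sin ((2 ^ J - 1) * theta h) \<le> c * (1 - cos ((2 ^ J - 1) * theta h)) \<and> 0 < 1 - cos ((2 ^ J - 1) * theta h))"
proof -
  have h1: "h \<le> 1" using h by simp
  note tb = theta_bounds[OF h(1) h1] theta_ge[OF h(1) h1] theta_pos[OF h(1) h1]
  have out: "h * (2 ^ n - 1) \<notin> {0<..<\<delta>}" "h * (2 ^ n - 1) \<le> pi - \<delta> \<or> pi + \<delta> < h * (2 ^ n - 1)" for n :: nat
  proof -
    have "h * (2 ^ n - 1) \<in> {h * (2 ^ n - 1) | n :: nat. True}" by blast
    then have "h * (2 ^ n - 1) \<notin> {0<..<\<delta>} \<union> {pi - \<delta><..pi + \<delta>}" using window by blast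
    then show "h * (2 ^ n - 1) \<notin> {0<..<\<delta>}" "h * (2 ^ n - 1) \<le> pi - \<delta> \<or> pi + \<delta> < h * (2 ^ n - 1)" by auto
  qed
  have dpi: "\<delta> \<le> pi" using out(2)[of 0] \<delta>(1) pi_gt_zero by auto
  have hd: "\<delta> \<le> h" using out(1)[of 1] h by auto
  have t2: "(theta h)\<^sup>2 \<le> \<delta> / 4"
  proof -
    have "(theta h)\<^sup>2 \<le> (2 * h)\<^sup>2" using tb by (intro power_mono) auto
    then show ?thesis using \<delta>(2) by (simp add: power_mult_distrib)
  qed
  have t3: "theta h ^ 3 \<le> c"
  proof -
    have "theta h ^ 3 \<le> (2 * h) ^ 3" using tb by (intro power_mono) auto
    then show ?thesis using w(4) by (simp add: power_mult_distrib)
  qed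
  have gap: "(2 ^ j - 1) * theta h \<le> pi - \<delta> / 4 \<or> pi + \<delta> / 4 < (2 ^ j - 1) * theta h" for j :: nat
    using out(2)[of j]
  proof
    assume a: "h * (2 ^ j - 1) \<le> pi - \<delta>"
    have "(2 ^ j - 1) * theta h \<le> (2 ^ j - 1) * (h + h ^ 3)" using tb by (intro mult_left_mono) auto
    also have "\<dots> = h * (2 ^ j - 1) * (1 + h\<^sup>2)" by (simp add: algebra_simps power2_eq_square power3_eq_cube)
    also have "\<dots> \<le> (pi - \<delta>) * (1 + h\<^sup>2)" using a by (intro mult_right_mono) auto
    also have "\<dots> = pi - \<delta> + (pi - \<delta>) * h\<^sup>2" by (simp add: algebra_simps)
    also have "(pi - \<delta>) * h\<^sup>2 \<le> 4 * h\<^sup>2" using \<delta>(1) pi_less_4 by (intro mult_right_mono) auto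
    finally show ?thesis using \<delta> by linarith
  next
    assume a: "pi + \<delta> < h * (2 ^ j - 1)"
    also have "\<dots> \<le> (2 ^ j - 1) * theta h" using tb by (subst mult.commute) (intro mult_left_mono, auto)
    finally show ?thesis using \<delta> by linarith
  qed
  show ?thesis
    by (rule escape[where \<delta> = "\<delta> / 4"]) (use tb h \<delta> w t2 t3 gap dpi hd pi_less_4 in auto)
qed

text \<open>
  The exponent of \<open>Lam\<close> can be taken to be one. The gap lies between the noise
  level \<open>1 / sqrt d\<close> and \<open>h\<close>; since it is at most \<open>pi\<close>,
  it forces \<open>d\<close> to be large compared to the square of \<open>ln d * ln (1 /
  \<epsilon>) powr (3/2)\<close> and also large compared to \<open>\<alpha>0\<close>. All
  requirements of \<open>nuts_epoch\<close> follow from this and from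
  \<open>step_bound_squares\<close>.
\<close>

lemma mixing:
  fixes d kmax :: nat and \<epsilon> \<alpha>0 h \<tau> :: real and \<nu> :: "(nat \<Rightarrow> real) measure"
  defines "\<kappa> \<equiv> cMix \<tau> * Lam d \<epsilon>"
  assumes \<tau>: "0 < \<tau>" "\<tau> \<le> pi / 2" and d: "2 \<le> d" and \<epsilon>: "0 < \<epsilon>" "\<epsilon> \<le> 1/2" and \<alpha>0: "0 < \<alpha>0"
    and \<nu>: "prob_space \<nu>" "sets \<nu> = sets (Rd d)"
    and out: "measure \<nu> (space (Rd d) - shell d \<alpha>0) \<le> \<epsilon> / 8" "measure (gauss d) (space (Rd d) - shell d \<alpha>0) \<le> \<epsilon> / 8"
    and h: "0 < h" "\<tau> < h * (2 ^ kmax - 1)" "h \<le> step_bound (inverse \<kappa>) d \<epsilon> \<alpha>0"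
    and window: "{h * (2 ^ n - 1) | n :: nat. True} \<inter> ({0<..<gap \<kappa> d \<epsilon> \<alpha>0} \<union> {pi - gap \<kappa> d \<epsilon> \<alpha>0<..pi + gap \<kappa> d \<epsilon> \<alpha>0}) = {}"
  shows "\<exists>N. TV (nuts_law d h kmax \<nu> N) (gauss d) \<le> \<epsilon> \<and> real N \<le> \<kappa> * (ln (real d) * ln (1 / \<epsilon>))"
proof -
  define M where "M = cM \<tau>"
  define K L l E s u \<delta> where "K = cMix \<tau>" and "L = Lam d \<epsilon>" and "l = ln (real d)" and "E = ln (1 / \<epsilon>)" and "s = sqrt (real d)"
    and "u = l * E powr (3/2)" and "\<delta> = gap \<kappa> d \<epsilon> \<alpha>0"
  note cs = const_signs[OF \<tau>(1), folded M_def]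
  have g0: "0 \<le> (cG \<tau> M)\<^sup>2 * M\<^sup>2" by simp
  have K: "500 \<le> K" "cN \<tau> \<le> K" "480 * cA \<tau> M \<le> K" "16000 * (cG \<tau> M)\<^sup>2 * M\<^sup>2 \<le> K" "16 * cW \<tau> M \<le> K" "48 * cR \<tau> \<le> K"
    using cs g0 unfolding K_def cMix_def M_def[symmetric] by linarith+
  note Lb = Lam_bounds[OF d \<epsilon>]
  have l: "1/2 \<le> l" and E: "1/2 \<le> E" and L: "2 \<le> L" using Lb by (simp_all add: l_def E_def L_def)
  have \<kappa>: "\<kappa> = K * L" by (simp add: \<kappa>_def K_def L_def)
  have \<kappa>2: "2 * K \<le> \<kappa>" unfolding \<kappa> using L K by (simp add: mult.commute mult_left_mono)
  have \<kappa>0: "0 < \<kappa>" "1000 \<le> \<kappa>" using \<kappa>2 K by auto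
  have s: "1 \<le> s" "s * s = real d" using d by (simp_all add: s_def)
  have "sqrt (1/4) \<le> sqrt E" using E by (intro real_sqrt_le_mono) auto
  then have "1/2 \<le> sqrt E" by (simp add: real_sqrt_divide)
  then have "1/2 * (1/2 * (1/2)) \<le> l * (E * sqrt E)" using l E by (intro mult_mono) auto
  then have u: "1/8 \<le> u" using E by (simp add: u_def powr_three_halves)
  have \<delta>e: "\<delta> = \<kappa> * max (\<alpha>0 / real d) (u / s)"
    using d by (simp add: \<delta>_def gap_def u_def s_def l_def E_def powr_minus_divide powr_half_sqrt)
  have \<delta>1: "\<kappa> * \<alpha>0 \<le> \<delta> * real d" "\<kappa> * u \<le> \<delta> * s"
  proof -
    have "\<kappa> * (\<alpha>0 / real d) \<le> \<delta>" "\<kappa> * (u / s) \<le> \<delta>"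
      unfolding \<delta>e by (rule mult_left_mono; use \<kappa>0 in simp)+
    then show "\<kappa> * \<alpha>0 \<le> \<delta> * real d" "\<kappa> * u \<le> \<delta> * s" using d s by (simp_all add: pos_divide_le_eq)
  qed
  have ku: "K / 4 \<le> \<kappa> * u"
  proof -
    have "(2 * K) * (1/8) \<le> \<kappa> * u" using \<kappa>2 u K by (intro mult_mono) auto
    then show ?thesis by simp
  qed
  have \<delta>s: "K / 4 \<le> \<delta> * s" using ku \<delta>1(2) by linarith
  have \<delta>0: "0 < \<delta>"
  proof (rule ccontr)
    assume "\<not> 0 < \<delta>"
    then have "\<delta> * s \<le> 0" using s by (simp add: mult_nonpos_nonneg)
    then show False using \<delta>s K by linarith
  qed
  have "0 \<in> {h * (2 ^ n - 1) | n :: nat. True}" by (rule CollectI, rule exI[of _ 0]) simp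
  then have "0 \<notin> {pi - \<delta><..pi + \<delta>}" using window unfolding \<delta>_def by blast
  then have "\<delta> \<le> 4" using \<delta>0 pi_gt_zero pi_less_4 by auto
  then have sb: "\<kappa> * \<alpha>0 \<le> 4 * real d" "\<kappa> * u \<le> 4 * s"
    using \<delta>1 mult_right_mono[of \<delta> 4 "real d"] mult_right_mono[of \<delta> 4 s] s(1) by (simp; linarith)+
  have sK: "K \<le> 16 * s" using sb(2) ku by linarith
  \<comment> \<open>everything about h is derived from a bound on h^2 * sqrt d; l and E are only known to be at least 1/2, and u to be at least 1/8\<close>
  have hq: "h\<^sup>2 * \<alpha>0 * l \<le> (inverse \<kappa>)\<^sup>2" "h\<^sup>2 * s * l * u \<le> (inverse \<kappa>)\<^sup>2"
    using step_bound_squares[OF h(1,3) _ \<alpha>0] \<kappa>0 d \<epsilon> by (simp_all add: l_def s_def u_def E_def)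
  have ik: "(inverse \<kappa>)\<^sup>2 \<le> inverse \<kappa> * (1/1000)" "inverse \<kappa> \<le> 1 / (2 * K)" "0 < inverse \<kappa>"
  proof -
    have "inverse \<kappa> \<le> inverse 1000" using \<kappa>0 by (intro le_imp_inverse_le) auto
    then show "(inverse \<kappa>)\<^sup>2 \<le> inverse \<kappa> * (1/1000)" unfolding power2_eq_square using \<kappa>0 by (intro mult_left_mono) auto
    have "inverse \<kappa> \<le> inverse (2 * K)" using \<kappa>2 K by (intro le_imp_inverse_le) auto
    then show "inverse \<kappa> \<le> 1 / (2 * K)" by (simp add: inverse_eq_divide)
  qed (use \<kappa>0 in simp)
  have nn: "0 \<le> h\<^sup>2 * \<alpha>0" "0 \<le> h\<^sup>2 * s" "0 \<le> h\<^sup>2 * s * u" using \<alpha>0 s u by auto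
  have ha: "h\<^sup>2 * \<alpha>0 \<le> 2 * (inverse \<kappa>)\<^sup>2" using mult_left_mono[OF l nn(1)] hq(1) by linarith
  have hu: "h\<^sup>2 * s * u \<le> 2 * (inverse \<kappa>)\<^sup>2"
    using mult_left_mono[OF l nn(3)] hq(2) by (simp add: mult_ac)
  have hs: "h\<^sup>2 * s \<le> 16 * (inverse \<kappa>)\<^sup>2" using mult_left_mono[OF u nn(2)] hu by linarith
  have hsK: "h\<^sup>2 * s \<le> 1 / (2 * K)" using hs ik by linarith
  have hs1: "h\<^sup>2 * s \<le> 1 / 1000"
  proof -
    have "1 / (2 * K) \<le> 1 / 1000" using K by (intro divide_left_mono) auto
    then show ?thesis using hsK by linarith
  qed
  have h2: "h\<^sup>2 \<le> 1 / 1000" using mult_left_mono[OF s(1), of "h\<^sup>2"] hs1 by simp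
  have h20: "h \<le> 1/20"
  proof (rule power2_le_imp_le)
    show "h\<^sup>2 \<le> (1/20)\<^sup>2" using h2 by (simp add: power2_eq_square)
  qed simp
  have kmax: "kmax \<ge> 1" using h(2) \<tau>(1) by (cases kmax) auto
  interpret N: nuts d h kmax by unfold_locales (use h h20 kmax d in auto)
  have h1: "h \<le> 1" using h20 by simp
  note tb = theta_bounds[OF h(1) h1] theta_ge[OF h(1) h1] theta_pos[OF h(1) h1]
  have arc: "\<tau> \<le> N.arcl kmax"
  proof -
    have "h * (2 ^ kmax - 1) \<le> theta h * (2 ^ kmax - 1)" using tb by (intro mult_right_mono) auto
    then show ?thesis using h(2) by (simp add: N.arcl_def mult.commute)
  qed
  have hA: "h\<^sup>2 * (cA \<tau> M * s) \<le> 1/2"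
  proof -
    have "cA \<tau> M * (h\<^sup>2 * s) \<le> (K / 480) * (1 / (2 * K))" using K cs hsK nn by (intro mult_mono) auto
    then show ?thesis using K by (simp add: mult_ac)
  qed
  have esc: "\<exists>J\<le>kmax. (J = kmax \<or> N.arcl J > pi / 2) \<and>
      ((\<forall>i<J. quiet (6 * cC \<tau> M / s) (N.arcl i)) \<and> (J = kmax \<or> turns (6 * cC \<tau> M / s) (N.arcl J)) \<or>
       (\<forall>i<J. quiet (6 * cA \<tau> M / s) (N.arcl i)) \<and> sin (N.arcl J) \<le> 6 * cC \<tau> M / s * (1 - cos (N.arcl J)) \<and> 0 < 1 - cos (N.arcl J))"
    unfolding N.arcl_def
  proof (rule escape_window[OF h(1) h20 \<delta>0])
    have "16 * (h\<^sup>2 * s) \<le> \<delta> * s" using hs1 \<delta>s K by linarith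
    then have "(16 * h\<^sup>2) * s \<le> \<delta> * s" by simp
    then show "16 * h\<^sup>2 \<le> \<delta>" using s by (simp add: mult_le_cancel_right)
    show "0 < 6 * cC \<tau> M / s" "6 * cC \<tau> M / s \<le> 6 * cA \<tau> M / s" using cs s by (auto intro!: divide_right_mono)
    have "120 * cA \<tau> M \<le> \<delta> * s" using \<delta>s K by linarith
    then show "20 * (6 * cA \<tau> M / s) \<le> \<delta>" using s by (simp add: pos_divide_le_eq)
    have "h * (h\<^sup>2 * s) \<le> 1 * (1/1000)" using h h1 hs1 nn by (intro mult_mono) auto
    then have "8 * h ^ 3 * s \<le> 6 * cC \<tau> M" using cs by (simp add: power2_eq_square power3_eq_cube mult_ac)
    then show "8 * h ^ 3 \<le> 6 * cC \<tau> M / s" using s by (simp add: pos_le_divide_eq)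
  qed (use window in \<open>simp add: \<delta>_def\<close>)
  obtain n1 e :: nat where n1: "(1 - kap \<tau> / 6) ^ n1 * (4 * s + cW \<tau> M) \<le> 1/4"
    and e: "(1 - (shot \<tau> M)\<^sup>2 / 16) ^ e \<le> \<epsilon> / 4" and n1e: "n1 \<le> e * (n1 + (n1 + 2))"
    and Ne: "real (e * (n1 + (n1 + 2))) \<le> cN \<tau> * (l * E)"
    using step_counts[OF \<tau>(1) d \<epsilon> _ Lb(1,2)] K sK by (auto simp: s_def M_def l_def E_def)
  define N where "N = real (e * (n1 + (n1 + 2)))"
  have N0: "0 \<le> N" "real n1 \<le> N" using n1e by (simp_all only: N_def of_nat_0_le_iff of_nat_le_iff)
  define t where "t = sqrt (16 * cT \<tau> * L * E)"
  define \<eta> where "\<eta> = \<epsilon> * shot \<tau> M / (8 * cN \<tau> * (l * E))"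
  define B where "B = cW \<tau> M + 2 * t + 7 * N * t"
  define \<alpha> where "\<alpha> = \<alpha>0 + B * s"
  have t1: "1 \<le> t" and Bu: "B \<le> cR \<tau> * u * L"
    using room_bound[OF \<tau>(1) l E L t_def, of N] Ne by (simp_all add: N_def B_def u_def M_def)
  have eta: "4 * exp (- t\<^sup>2 / 16) \<le> \<eta>"
  proof -
    have "0 \<le> 16 * cT \<tau> * L * E" using cs L E by simp
    then have "t\<^sup>2 = 16 * (cT \<tau> * L * E)" by (simp add: t_def)
    then show ?thesis using tail_small[of \<tau> \<epsilon> l L] \<tau> \<epsilon> l E L Lb(4) by (simp add: \<eta>_def E_def M_def l_def L_def)
  qed
  have N\<eta>: "N * \<eta> \<le> \<epsilon> * shot \<tau> M / 8"
  proof -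
    have "N * \<eta> \<le> cN \<tau> * (l * E) * \<eta>" using Ne eta exp_gt_zero[of "- t\<^sup>2 / 16"] unfolding N_def by (intro mult_right_mono) linarith+
    also have "\<dots> = \<epsilon> * shot \<tau> M / 8" using l E cs(3) by (simp add: \<eta>_def)
    finally show ?thesis .
  qed
  have \<eta>0: "0 \<le> \<eta>" using eta exp_gt_zero[of "- t\<^sup>2 / 16"] by linarith
  have B0: "0 \<le> B" "2 * t \<le> B" "cW \<tau> M + 7 * real n1 * t \<le> B" "7 * N * t \<le> B"
  proof -
    have "0 \<le> 7 * N * t" "7 * real n1 * t \<le> 7 * N * t" using N0 t1 by (auto intro!: mult_right_mono)
    then show "0 \<le> B" "2 * t \<le> B" "cW \<tau> M + 7 * real n1 * t \<le> B" "7 * N * t \<le> B" using t1 cs(5) unfolding B_def by linarith+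
  qed
  have B\<kappa>: "B \<le> \<kappa> * u / 48"
  proof -
    have "48 * cR \<tau> * (u * L) \<le> K * (u * L)" using K u L by (intro mult_right_mono) auto
    then show ?thesis using Bu by (simp add: \<kappa> mult_ac)
  qed
  have \<alpha>d: "6 * \<alpha> \<le> real d"
  proof -
    have "1000 * \<alpha>0 \<le> \<kappa> * \<alpha>0" using \<kappa>0 \<alpha>0 by (intro mult_right_mono) auto
    then have 1: "6 * \<alpha>0 \<le> real d / 4" using sb(1) by linarith
    have "B * s \<le> (s / 12) * s" using B\<kappa> sb(2) s by (intro mult_right_mono) auto
    then show ?thesis using 1 s(2) unfolding \<alpha>_def by simp
  qed
  have h\<alpha>: "h\<^sup>2 * \<alpha> \<le> 1/2"
  proof -
    have "h\<^sup>2 * s * B \<le> h\<^sup>2 * s * (\<kappa> * u / 48)" using B\<kappa> nn by (intro mult_left_mono) auto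
    also have "\<dots> = \<kappa> / 48 * (h\<^sup>2 * s * u)" by simp
    also have "\<dots> \<le> \<kappa> / 48 * (2 * (inverse \<kappa>)\<^sup>2)" using hu \<kappa>0 by (intro mult_left_mono) auto
    also have "\<dots> = inverse \<kappa> / 24" using \<kappa>0 by (simp add: power2_eq_square)
    finally have "h\<^sup>2 * s * B \<le> inverse \<kappa> / 24" .
    moreover have "inverse \<kappa> \<le> inverse 1" using \<kappa>0 by (intro le_imp_inverse_le) auto
    moreover have "h\<^sup>2 * \<alpha> = h\<^sup>2 * \<alpha>0 + h\<^sup>2 * s * B" by (simp add: \<alpha>_def algebra_simps)
    ultimately show ?thesis using ha ik by simp
  qed
  have Bs: "X * s \<le> \<alpha>" if "X \<le> B" for X
    using mult_right_mono[OF that, of s] s(1) \<alpha>0 unfolding \<alpha>_def by linarith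
  interpret nuts_epoch d h kmax \<alpha> t \<tau> \<eta> n1
  proof unfold_locales
    have "h\<^sup>2 * s \<le> 1" using hs1 by linarith
    then have "h\<^sup>2 * s * s \<le> 1 * s" using s by (intro mult_right_mono) auto
    then show "h\<^sup>2 * real d \<le> sqrt (real d)" by (simp add: s_def mult.assoc)
    show "1 \<le> t" by (rule t1)
    show "2 * t * sqrt (real d) \<le> \<alpha>" using Bs[OF B0(2)] by (simp add: s_def)
    show "6 * \<alpha> \<le> real d" "h\<^sup>2 * \<alpha> \<le> 1/2" by fact+
    show "0 < \<tau>" "\<tau> \<le> pi / 2" "\<tau> \<le> N.arcl kmax" by fact+
    show "4 * exp (- t\<^sup>2 / 16) \<le> \<eta>" by fact
    show "theta h \<le> pi / 4" using tb h20 pi_gt3 by linarith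
    show "1000 * (cG \<tau> (cM \<tau>))\<^sup>2 * (cM \<tau>)\<^sup>2 \<le> sqrt (real d)" using K(4) sK unfolding M_def s_def by linarith
    show "h\<^sup>2 * (cA \<tau> (cM \<tau>) * sqrt (real d)) \<le> 1/2" using hA by (simp add: M_def s_def)
    show "(1 - kap \<tau> / 6) ^ n1 * (4 * sqrt (real d) + cW \<tau> (cM \<tau>)) \<le> 1/4" using n1 by (simp add: M_def s_def)
    have "real n1 * \<eta> \<le> N * \<eta>" using N0 \<eta>0 by (intro mult_right_mono) auto
    moreover have "\<epsilon> * shot \<tau> M \<le> 1 * shot \<tau> M" using \<epsilon> cs by (intro mult_right_mono) auto
    ultimately have "real n1 * \<eta> \<le> shot \<tau> M / 4" using N\<eta> cs(1) by linarith
    then show "real n1 * \<eta> \<le> shot \<tau> (cM \<tau>) / 4" by (simp add: M_def)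
    show "cW \<tau> (cM \<tau>) * sqrt (real d) + real n1 * (7 * t * sqrt (real d)) \<le> \<alpha>"
      using Bs[OF B0(3)] by (simp add: M_def s_def algebra_simps)
  qed (use esc in \<open>simp add: M_def s_def\<close>)
  have "7 * N * t * s \<le> B * s" using B0(4) s by (intro mult_right_mono) auto
  then have r: "\<alpha>0 + real (e * n0) * rad \<le> \<alpha>" by (simp add: rad_def \<alpha>_def N_def s_def mult_ac)
  have "TV (nuts_law d h kmax \<nu> (e * n0)) (gauss d) \<le> (1 - (shot \<tau> (cM \<tau>))\<^sup>2 / 16) ^ e + 2 * real (e * n0) * \<eta> + 2 * (\<epsilon> / 8)"
    by (rule TV_nuts_law[OF \<nu> r out])
  moreover have "\<epsilon> * shot \<tau> M \<le> \<epsilon> * 1" using \<epsilon> cs by (intro mult_left_mono) auto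
  ultimately have tv: "TV (nuts_law d h kmax \<nu> (e * n0)) (gauss d) \<le> \<epsilon>"
    using e N\<eta> \<epsilon> unfolding M_def N_def by linarith
  have "N \<le> \<kappa> * (l * E)"
  proof -
    have "cN \<tau> \<le> \<kappa>" using K \<kappa>2 by linarith
    then have "cN \<tau> * (l * E) \<le> \<kappa> * (l * E)" using l E by (intro mult_right_mono) auto
    then show ?thesis using Ne by (simp add: N_def)
  qed
  then show ?thesis using tv unfolding N_def l_def E_def by blast
qed

theorem theorem2:
  fixes C1 :: real
  assumes "C1 > 0"
  shows "\<exists>K p :: real. K \<ge> 1 \<and> p \<ge> 0 \<and>
    (\<forall>(d :: nat) (\<epsilon> :: real) (c1 :: real) (C2 :: real) (C3 :: real)
      (\<alpha>0 :: real) (\<nu> :: (nat \<Rightarrow> real) measure) (kmax :: nat) (h :: real) (\<delta> :: real).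
        d \<ge> 2 \<longrightarrow> 0 < \<epsilon> \<longrightarrow> \<epsilon> \<le> 1/2 \<longrightarrow>
        c1 = inverse (K * Lam d \<epsilon> powr p) \<longrightarrow>
        C2 = K * Lam d \<epsilon> powr p \<longrightarrow>
        C3 = K * Lam d \<epsilon> powr p \<longrightarrow>
        \<alpha>0 > 0 \<longrightarrow>
        prob_space \<nu> \<longrightarrow> sets \<nu> = sets (Rd d) \<longrightarrow>
        max (measure \<nu> (space (Rd d) - shell d \<alpha>0)) (measure (gauss d) (space (Rd d) - shell d \<alpha>0)) \<le> \<epsilon> / 8 \<longrightarrow>
        h > 0 \<longrightarrow>
        h * (2 ^ kmax - 1) > C1 \<longrightarrow>
        h \<le> step_bound c1 d \<epsilon> \<alpha>0 \<longrightarrow>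
        \<delta> = gap C2 d \<epsilon> \<alpha>0 \<longrightarrow>
        {h * (2 ^ n - 1) | n :: nat. True} \<inter> ({0<..<\<delta>} \<union> {pi - \<delta><..pi + \<delta>}) = {} \<longrightarrow>
        ereal_of_enat (nuts_mixing_time d h kmax \<nu> \<epsilon>) \<le> ereal (C3 * ln (real d) * ln (1 / \<epsilon>)))"
proof -
  define \<tau> where "\<tau> = min (pi / 2) C1"
  have \<tau>: "0 < \<tau>" "\<tau> \<le> pi / 2" "\<tau> \<le> C1" using assms by (auto simp: \<tau>_def)
  note cs = const_signs[OF \<tau>(1)]
  have g0: "0 \<le> (cG \<tau> (cM \<tau>))\<^sup>2 * (cM \<tau>)\<^sup>2" by simp
  have "1 \<le> cMix \<tau>" using cs g0 unfolding cMix_def by linarith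
  moreover have "ereal_of_enat (nuts_mixing_time d h kmax \<nu> \<epsilon>) \<le> ereal (cMix \<tau> * Lam d \<epsilon> powr 1 * ln (real d) * ln (1 / \<epsilon>))"
    if H: "d \<ge> 2" "0 < \<epsilon>" "\<epsilon> \<le> 1/2" "\<alpha>0 > 0" "prob_space \<nu>" "sets \<nu> = sets (Rd d)"
      "max (measure \<nu> (space (Rd d) - shell d \<alpha>0)) (measure (gauss d) (space (Rd d) - shell d \<alpha>0)) \<le> \<epsilon> / 8"
      "h > 0" "h * (2 ^ kmax - 1) > C1" "h \<le> step_bound (inverse (cMix \<tau> * Lam d \<epsilon> powr 1)) d \<epsilon> \<alpha>0"
      "{h * (2 ^ n - 1) | n :: nat. True} \<inter> ({0<..<gap (cMix \<tau> * Lam d \<epsilon> powr 1) d \<epsilon> \<alpha>0} \<union>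
        {pi - gap (cMix \<tau> * Lam d \<epsilon> powr 1) d \<epsilon> \<alpha>0<..pi + gap (cMix \<tau> * Lam d \<epsilon> powr 1) d \<epsilon> \<alpha>0}) = {}"
    for d kmax :: nat and \<epsilon> \<alpha>0 h :: real and \<nu> :: "(nat \<Rightarrow> real) measure"
  proof -
    have L1: "Lam d \<epsilon> powr 1 = Lam d \<epsilon>" using Lam_bounds(3)[OF H(1-3)] by simp
    have out: "measure \<nu> (space (Rd d) - shell d \<alpha>0) \<le> \<epsilon> / 8" "measure (gauss d) (space (Rd d) - shell d \<alpha>0) \<le> \<epsilon> / 8" using H(7) by auto
    have "\<tau> < h * (2 ^ kmax - 1)" using H(9) \<tau>(3) by linarith
    from mixing[OF \<tau>(1,2) H(1-6) out H(8) this H(10,11)[unfolded L1]]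
    obtain N where N: "TV (nuts_law d h kmax \<nu> N) (gauss d) \<le> \<epsilon>" "real N \<le> cMix \<tau> * Lam d \<epsilon> * (ln (real d) * ln (1 / \<epsilon>))" by blast
    have "nuts_mixing_time d h kmax \<nu> \<epsilon> \<le> enat N" unfolding nuts_mixing_time_def using N(1) by (intro Inf_lower) auto
    then have "ereal_of_enat (nuts_mixing_time d h kmax \<nu> \<epsilon>) \<le> ereal (real N)" by (metis ereal_of_enat_le_iff ereal_of_enat_simps(1))
    also have "\<dots> \<le> ereal (cMix \<tau> * Lam d \<epsilon> powr 1 * ln (real d) * ln (1 / \<epsilon>))" unfolding L1 using N(2) by (simp add: mult.assoc)
    finally show ?thesis .
  qed
  ultimately show ?thesis by (intro exI[of _ "cMix \<tau>"] exI[of _ "1::real"]) (simp only: zero_le_one simp_thms imp_conjL all_simps, blast)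
qed

end
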